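(* Let $\Omega\subset\mathbb{C}$ be a bounded star-shaped domain with respect to $z=0$, let $1<p<\infty$, and let $f\in W^{1,\infty}(\Omega)$ be a non-vanishing complex-valued function with $\frac1f\in L_\infty(\Omega)$. Given $u\in\widehat{\operatorname{Sol}}_f^p(\Omega)$, $$v=\frac1f I_fu\in\widehat{\operatorname{Sol}}_{\frac1f}^p(\Omega)\quad\text{and}\quad W=u+\mathbf{j}v\in\mathcal{A}_f^p(\Omega;\mathbb{B})\cap W^{1,p}(\Omega;\mathbb{B}).$$ If $v_2\in W^{1,p}(\Omega)$ is another function such that $u+\mathbf{j}v_2\in\mathcal{A}_f^p(\Omega;\mathbb{B})\cap W^{1,p}(\Omega;\mathbb{B})$, then $v_2=\frac1f I_fu+\frac cf$ for some $c\in\mathbb{C}$.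
   Context: $\mathbb{B}=\{u+\mathbf{j}v : u,v\in\mathbb{C}\}$ is the commutative $\mathbb{C}$-algebra of bicomplex numbers, with $\mathbf{j}^2=-1$ and $i\mathbf{j}=\mathbf{j}i$. For $W=u+\mathbf{j}v$: $\operatorname{Sc}W=u$, $\operatorname{Vec}W=v$, $\overline{W}=u-\mathbf{j}v$. A function $F:\Omega\to\mathbb{B}$ belongs to $\mathscr{F}(\Omega;\mathbb{B})$ (for a space $\mathscr{F}(\Omega)$ of complex-valued functions) iff $\operatorname{Sc}F,\operatorname{Vec}F\in\mathscr{F}(\Omega)$. With $z=x+iy$, $\overline{\boldsymbol{\partial}}=\frac12\left(\frac{\partial}{\partial x}+\mathbf{j}\frac{\partial}{\partial y}\right)$. A function $V\in L_{1,loc}(\Omega;\mathbb{B})$ is the weak $\overline{\boldsymbol{\partial}}$-derivative of $W\in L_p(\Omega;\mathbb{B})$ if $\iint_\Omega W\,\overline{\boldsymbol{\partial}}\phi\,dA=-\iint_\Omega V\phi\,dA$ for all $\phi\in C_0^\infty(\Omega;\mathbb{B})$. $\mathcal{A}_f^p(\Omega;\mathbb{B})$ is the set of all weak solutions $W\in L_p(\Omega;\mathbb{B})$ of $\overline{\boldsymbol{\partial}}W=\frac{\overline{\boldsymbol{\partial}}f}{f}\,\overline{W}$ in $\Omega$. For $\sigma\in W^{1,\infty}(\Omega)$ (complex-valued) with $1/\sigma\in L_\infty(\Omega)$, $\operatorname{Sol}_\sigma^p(\Omega)=\{U\in W^{1,p}(\Omega): \iint_\Omega\sigma\nabla U\cdot\nabla\varphi\,dA=0\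 \forall\varphi\in C_0^\infty(\Omega)\}$. Define $\widehat{\operatorname{Sol}}_f^p(\Omega)=\{u\in W^{1,p}(\Omega): \frac uf\in\operatorname{Sol}_{f^2}^p(\Omega)\}$ and $\widehat{\operatorname{Sol}}_{\frac1f}^p(\Omega)=\{v\in W^{1,p}(\Omega): fv\in\operatorname{Sol}_{1/f^2}^p(\Omega)\}$. $\Omega$ star-shaped with respect to $0$ means $0\in\Omega$ and $tz\in\Omega$ for all $z\in\Omega$, $t\in[0,1]$. For a continuous $\Phi:\Omega\to\mathbb{B}$ let $\overline{A}\Phi(z)=2\int_\gamma(\operatorname{Sc}\Phi\,dx+\operatorname{Vec}\Phi\,dy)$, with $\gamma$ the line segment from $0$ to $z$. For $u\in\widehat{\operatorname{Sol}}_f^p(\Omega)$ and $U=\frac uf$ (which has a $C^1(\Omega)$ representative), $$I_fu(z):=\overline{A}\left[\mathbf{j}f^2\,\overline{\boldsymbol{\partial}}U\right](z)=\int_0^1 f^2(tz)\left(yU_x(tz)-xU_y(tz)\right)dt,\quad z=x+iy\in\Omega.$$ *)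

theory Defs
  imports "HOL-Analysis.Analysis"
begin

section \<open>Bicomplex numbers\<close>

datatype bicomplex = Bicomplex (Sc: complex) (Vec: complex)

lemma bicomplex_eq_iff: "Z = W \<longleftrightarrow> Sc Z = Sc W \<and> Vec Z = Vec W"
  by (cases Z; cases W) simp

instantiation bicomplex :: comm_ring_1
begin

definition zero_bicomplex :: bicomplex where "0 = Bicomplex 0 0"
definition one_bicomplex :: bicomplex where "1 = Bicomplex 1 0"
definition plus_bicomplex :: "bicomplex \<Rightarrow> bicomplex \<Rightarrow> bicomplex"
  where "Z + W = Bicomplex (Sc Z + Sc W) (Vec Z + Vec W)"
definition minus_bicomplex :: "bicomplex \<Rightarrow> bicomplex \<Rightarrow> bicomplex"
  where "Z - W = Bicomplex (Sc Z - Sc W) (Vec Z - Vec W)"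
definition uminus_bicomplex :: "bicomplex \<Rightarrow> bicomplex"
  where "- Z = Bicomplex (- Sc Z) (- Vec Z)"
definition times_bicomplex :: "bicomplex \<Rightarrow> bicomplex \<Rightarrow> bicomplex"
  where "Z * W = Bicomplex (Sc Z * Sc W - Vec Z * Vec W) (Sc Z * Vec W + Vec Z * Sc W)"

instance
  by standard
    (auto simp: zero_bicomplex_def one_bicomplex_def plus_bicomplex_def minus_bicomplex_def
      uminus_bicomplex_def times_bicomplex_def algebra_simps)

end

definition bc :: "complex \<Rightarrow> bicomplex"
  where "bc u = Bicomplex u 0"

definition jj :: bicomplex (\<open>\<j>\<close>)
  where "\<j> = Bicomplex 0 1"

definition bcnj :: "bicomplex \<Rightarrow> bicomplex"
  where "bcnj W = bc (Sc W) - \<j> * bc (Vec W)"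

lemma bicomplex_sel [simp]:
  "Sc 0 = 0" "Vec 0 = 0" "Sc 1 = 1" "Vec 1 = 0"
  "Sc (Z + W) = Sc Z + Sc W" "Vec (Z + W) = Vec Z + Vec W"
  "Sc (Z - W) = Sc Z - Sc W" "Vec (Z - W) = Vec Z - Vec W"
  "Sc (- Z) = - Sc Z" "Vec (- Z) = - Vec Z"
  "Sc (Z * W) = Sc Z * Sc W - Vec Z * Vec W"
  "Vec (Z * W) = Sc Z * Vec W + Vec Z * Sc W"
  "Sc (bc u) = u" "Vec (bc u) = 0" "Sc \<j> = 0" "Vec \<j> = 1"
  "Sc (bcnj W) = Sc W" "Vec (bcnj W) = - Vec W"
  by (simp_all add: zero_bicomplex_def one_bicomplex_def plus_bicomplex_def minus_bicomplex_def
      uminus_bicomplex_def times_bicomplex_def bc_def jj_def bcnj_def)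

lemma jj_squared: "\<j> * \<j> = - 1"
  by (simp add: bicomplex_eq_iff)

lemma bicomplex_decomp: "W = bc (Sc W) + \<j> * bc (Vec W)"
  by (simp add: bicomplex_eq_iff)

definition bc_valued :: "(complex \<Rightarrow> complex) set \<Rightarrow> (complex \<Rightarrow> bicomplex) set"
  where "bc_valued X = {F. (\<lambda>z. Sc (F z)) \<in> X \<and> (\<lambda>z. Vec (F z)) \<in> X}"

definition bc_integral :: "complex set \<Rightarrow> (complex \<Rightarrow> bicomplex) \<Rightarrow> bicomplex"
  where "bc_integral \<Omega> F =
    bc (\<integral>z. Sc (F z) \<partial>lebesgue_on \<Omega>) + \<j> * bc (\<integral>z. Vec (F z) \<partial>lebesgue_on \<Omega>)"

section \<open>Classical derivatives and test functions\<close>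

definition pdx :: "(complex \<Rightarrow> complex) \<Rightarrow> complex \<Rightarrow> complex"
  where "pdx g z = vector_derivative (\<lambda>t. g (z + complex_of_real t)) (at 0)"

definition pdy :: "(complex \<Rightarrow> complex) \<Rightarrow> complex \<Rightarrow> complex"
  where "pdy g z = vector_derivative (\<lambda>t. g (z + \<i> * complex_of_real t)) (at 0)"

text \<open>Real \<open>C\<^sup>k\<close> regularity; \<open>differentiable\<close> below is real differentiability on the
  plane.  Intended for open \<open>S\<close> only.\<close>

primrec Ck_on :: "nat \<Rightarrow> complex set \<Rightarrow> (complex \<Rightarrow> complex) \<Rightarrow> bool" where
  "Ck_on 0 S g \<longleftrightarrow> continuous_on S g"
| "Ck_on (Suc k) S g \<longleftrightarrow>
     (\<forall>z\<in>S. g differentiable (at z)) \<and> Ck_on k S (pdx g) \<and> Ck_on k S (pdy g)"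

text \<open>\<open>C\<^sub>0\<^sup>\<infinity>(\<Omega>)\<close>, its elements being extended by zero to the whole plane.\<close>

definition test_fun :: "complex set \<Rightarrow> (complex \<Rightarrow> complex) set"
  where "test_fun \<Omega> = {\<phi>. (\<forall>k. Ck_on k UNIV \<phi>) \<and>
    compact (closure {z. \<phi> z \<noteq> 0}) \<and> closure {z. \<phi> z \<noteq> 0} \<subseteq> \<Omega>}"

definition dbar :: "(complex \<Rightarrow> bicomplex) \<Rightarrow> complex \<Rightarrow> bicomplex"
  where "dbar F z = bc (1/2) *
    ((bc (pdx (\<lambda>w. Sc (F w)) z) + \<j> * bc (pdx (\<lambda>w. Vec (F w)) z)) +
     \<j> * (bc (pdy (\<lambda>w. Sc (F w)) z) + \<j> * bc (pdy (\<lambda>w. Vec (F w)) z)))"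

section \<open>Lebesgue and Sobolev spaces\<close>

text \<open>Elements of these spaces are functions rather than classes; every notion below depends on its
  Lebesgue- and Sobolev-space arguments only up to null sets of \<open>\<Omega>\<close>.\<close>

definition Lp :: "ennreal \<Rightarrow> complex set \<Rightarrow> (complex \<Rightarrow> complex) set"
  where "Lp p \<Omega> = {g \<in> borel_measurable (lebesgue_on \<Omega>).
    if p = \<infinity> then \<exists>C. AE z in lebesgue_on \<Omega>. cmod (g z) \<le> C
    else integrable (lebesgue_on \<Omega>) (\<lambda>z. cmod (g z) powr enn2real p)}"

definition L1loc :: "complex set \<Rightarrow> (complex \<Rightarrow> complex) set"
  where "L1loc \<Omega> = {g \<in> borel_measurable (lebesgue_on \<Omega>).
    \<forall>K. compact K \<and> K \<subseteq> \<Omega> \<longrightarrow> integrable (lebesgue_on K) g}"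

text \<open>\<open>D\<close> is one of the classical operators \<^const>\<open>pdx\<close>, \<^const>\<open>pdy\<close>.\<close>

definition weak_pd ::
  "((complex \<Rightarrow> complex) \<Rightarrow> complex \<Rightarrow> complex) \<Rightarrow> complex set \<Rightarrow>
   (complex \<Rightarrow> complex) \<Rightarrow> (complex \<Rightarrow> complex) \<Rightarrow> bool"
  where "weak_pd D \<Omega> g h \<longleftrightarrow> g \<in> L1loc \<Omega> \<and> h \<in> L1loc \<Omega> \<and>
    (\<forall>\<phi>\<in>test_fun \<Omega>. (\<integral>z. g z * D \<phi> z \<partial>lebesgue_on \<Omega>) = - (\<integral>z. h z * \<phi> z \<partial>lebesgue_on \<Omega>))"

text \<open>Weak partial derivatives are unique up to null sets; the operators below select one version.\<close>

definition wdx :: "complex set \<Rightarrow> (complex \<Rightarrow> complex) \<Rightarrow> complex \<Rightarrow> complex"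
  where "wdx \<Omega> g = (SOME h. weak_pd pdx \<Omega> g h)"

definition wdy :: "complex set \<Rightarrow> (complex \<Rightarrow> complex) \<Rightarrow> complex \<Rightarrow> complex"
  where "wdy \<Omega> g = (SOME h. weak_pd pdy \<Omega> g h)"

definition W1 :: "ennreal \<Rightarrow> complex set \<Rightarrow> (complex \<Rightarrow> complex) set"
  where "W1 p \<Omega> = {g \<in> Lp p \<Omega>.
    (\<exists>h\<in>Lp p \<Omega>. weak_pd pdx \<Omega> g h) \<and> (\<exists>h\<in>Lp p \<Omega>. weak_pd pdy \<Omega> g h)}"

section \<open>Weak solutions\<close>

definition weak_dbar ::
  "ennreal \<Rightarrow> complex set \<Rightarrow> (complex \<Rightarrow> bicomplex) \<Rightarrow> (complex \<Rightarrow> bicomplex) \<Rightarrow> bool"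
  where "weak_dbar p \<Omega> W V \<longleftrightarrow> W \<in> bc_valued (Lp p \<Omega>) \<and> V \<in> bc_valued (L1loc \<Omega>) \<and>
    (\<forall>\<phi>\<in>bc_valued (test_fun \<Omega>).
       bc_integral \<Omega> (\<lambda>z. W z * dbar \<phi> z) = - bc_integral \<Omega> (\<lambda>z. V z * \<phi> z))"

definition sobolev_dbar :: "complex set \<Rightarrow> (complex \<Rightarrow> complex) \<Rightarrow> complex \<Rightarrow> bicomplex"
  where "sobolev_dbar \<Omega> f z = bc (1/2) * (bc (wdx \<Omega> f z) + \<j> * bc (wdy \<Omega> f z))"

definition vekua_space ::
  "(complex \<Rightarrow> complex) \<Rightarrow> ennreal \<Rightarrow> complex set \<Rightarrow> (complex \<Rightarrow> bicomplex) set"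
  where "vekua_space f p \<Omega> = {W \<in> bc_valued (Lp p \<Omega>).
    weak_dbar p \<Omega> W (\<lambda>z. bc (1 / f z) * sobolev_dbar \<Omega> f z * bcnj (W z))}"

definition Sol ::
  "(complex \<Rightarrow> complex) \<Rightarrow> ennreal \<Rightarrow> complex set \<Rightarrow> (complex \<Rightarrow> complex) set"
  where "Sol \<sigma> p \<Omega> = {U \<in> W1 p \<Omega>. \<forall>\<phi>\<in>test_fun \<Omega>.
    (\<integral>z. \<sigma> z * (wdx \<Omega> U z * pdx \<phi> z + wdy \<Omega> U z * pdy \<phi> z) \<partial>lebesgue_on \<Omega>) = 0}"

text \<open>The space for the index \<open>1/f\<close> is the same definition applied to \<open>\<lambda>z. 1 / f z\<close>.\<close>

definition Sol_hat ::
  "(complex \<Rightarrow> complex) \<Rightarrow> ennreal \<Rightarrow> complex set \<Rightarrow> (complex \<Rightarrow> complex) set"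
  where "Sol_hat f p \<Omega> = {u \<in> W1 p \<Omega>. (\<lambda>z. u z / f z) \<in> Sol (\<lambda>z. (f z)\<^sup>2) p \<Omega>}"

lemma Sol_hat_inverse:
  "Sol_hat (\<lambda>z. 1 / f z) p \<Omega> =
    {v \<in> W1 p \<Omega>. (\<lambda>z. f z * v z) \<in> Sol (\<lambda>z. 1 / (f z)\<^sup>2) p \<Omega>}"
  by (simp add: Sol_hat_def power_divide mult.commute)

section \<open>The operator \<open>I\<^sub>f\<close>\<close>

definition star_shaped0 :: "complex set \<Rightarrow> bool"
  where "star_shaped0 \<Omega> \<longleftrightarrow> 0 \<in> \<Omega> \<and> (\<forall>z\<in>\<Omega>. \<forall>t\<in>{0..1}. complex_of_real t * z \<in> \<Omega>)"

text \<open>The line integral along the segment, parametrised by \<open>t \<mapsto> t z\<close>, so that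
  \<open>dx = Re z dt\<close> and \<open>dy = Im z dt\<close>.\<close>

definition Abar :: "(complex \<Rightarrow> bicomplex) \<Rightarrow> complex \<Rightarrow> complex"
  where "Abar \<Phi> z = 2 * integral {0..1} (\<lambda>t::real.
    Sc (\<Phi> (complex_of_real t * z)) * complex_of_real (Re z) +
    Vec (\<Phi> (complex_of_real t * z)) * complex_of_real (Im z))"

text \<open>A line integral is not determined by functions given up to null sets, so \<open>I\<^sub>f\<close> uses the
  \<open>C\<^sup>0\<close> representative of \<open>f\<close> and the \<open>C\<^sup>1\<close> representative of \<open>u / f\<close>.  On an open \<open>\<Omega>\<close> such a
  representative is unique on \<open>\<Omega>\<close>.\<close>

definition Ck_rep :: "nat \<Rightarrow> complex set \<Rightarrow> (complex \<Rightarrow> complex) \<Rightarrow> complex \<Rightarrow> complex"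
  where "Ck_rep k \<Omega> g = (SOME h. Ck_on k \<Omega> h \<and> (AE z in lebesgue_on \<Omega>. h z = g z))"

definition I_op ::
  "complex set \<Rightarrow> (complex \<Rightarrow> complex) \<Rightarrow> (complex \<Rightarrow> complex) \<Rightarrow> complex \<Rightarrow> complex"
  where "I_op \<Omega> f u =
    Abar (\<lambda>z. \<j> * bc ((Ck_rep 0 \<Omega> f z)\<^sup>2) *
      dbar (\<lambda>w. bc (Ck_rep 1 \<Omega> (\<lambda>w. u w / f w) w)) z)"

lemma I_op_explicit:
  fixes \<Omega> f u
  defines "F \<equiv> Ck_rep 0 \<Omega> f" and "U \<equiv> Ck_rep 1 \<Omega> (\<lambda>w. u w / f w)"
  shows "I_op \<Omega> f u z = integral {0..1} (\<lambda>t::real. (F (complex_of_real t * z))\<^sup>2 *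
    (complex_of_real (Im z) * pdx U (complex_of_real t * z) -
     complex_of_real (Re z) * pdy U (complex_of_real t * z)))"
proof -
  have "pdx (\<lambda>w. 0) = (\<lambda>z. 0)" "pdy (\<lambda>w. 0) = (\<lambda>z. 0)"
    by (auto simp: pdx_def pdy_def)
  then show ?thesis
    unfolding I_op_def Abar_def dbar_def F_def U_def integral_mult_right [symmetric]
    by (intro integral_cong) (simp add: algebra_simps)
qed

end

theory Submission
  imports Defs
begin

text \<open>
  Write \<open>U = u/f\<close>, so that \<open>div (f\<^sup>2 \<nabla>U) = 0\<close>. Multiplying by \<open>1/f\<^sup>2\<close> gives
  \<open>\<Delta>U = g\<close> with \<open>g\<close> a combination of \<open>U\<^sub>x, U\<^sub>y\<close> with bounded coefficients, a first-order
  Cauchy--Riemann system for the gradient; iterating the Cauchy kernel shows that \<open>\<nabla>U\<close> is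
  continuous. The field \<open>(-f\<^sup>2 U\<^sub>y, f\<^sup>2 U\<^sub>x)\<close> is weakly closed, so on the star-shaped domain
  (after mollification) its integrals along rays from \<open>0\<close> define a \<open>C\<^sup>1\<close> potential \<open>V = I\<^sub>f u\<close>.
  Since \<open>\<nabla>V\<close> is \<open>f\<^sup>2\<close> times the rotated gradient of \<open>U\<close>, the equation
  \<open>div (f\<^sup>-\<^sup>2 \<nabla>V) = 0\<close> is the symmetry of weak second derivatives of \<open>U\<close>, and the product rule
  turns \<open>u = f U\<close>, \<open>v = V/f\<close> into the two scalar components of the Vekua equation. The difference
  \<open>D\<close> of two admissible \<open>v\<close> satisfies \<open>\<nabla>(f D) = 0\<close>, hence \<open>f D\<close> is constant.
\<close>

section \<open>Directional derivatives and smooth functions\<close>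

text \<open>Two obstacles shape the argument. The coefficient \<open>f\<close> and the solution are
  complex-valued, so positivity and maximum principles do not apply to \<sigma> = f^2; and p may be
  close to 1, so a single Cauchy transform of the gradient need not be bounded. Regularity is
  therefore derived from local integrability of the gradient alone: composing the kernel 1/|z| twice
  leaves a pole of order at most 1/2, composing it three times leaves none, and these facts follow
  from elementary inequalities between products of poles. Since U is complex, U_x + i U_y is not the
  conjugate of U_x - i U_y, which is why a coupled pair of Cauchy-Riemann equations appears. As
  \<open>f\<close> has only bounded weak derivatives, products such as f \<phi> are not test
  functions; each product rule replaces the factor by mollifications and passes to the limit by
  dominated convergence. The notions of the theorem live on \<open>lebesgue_on \<Omega>\<close> and
  contain choices by \<open>SOME\<close>. The analysis is done for Borel functions on the whole
  plane, and \<open>rep\<close> links the two settings.\<close>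

definition pd :: "complex \<Rightarrow> (complex \<Rightarrow> complex) \<Rightarrow> complex \<Rightarrow> complex"
  where "pd e g z = vector_derivative (\<lambda>t. g (z + of_real t * e)) (at 0)"

lemma pdx_eq_pd: "pdx = pd 1" and pdy_eq_pd: "pdy = pd \<i>"
  by (auto simp: fun_eq_iff pdx_def pdy_def pd_def mult.commute)

lemma pd_eqI:
  assumes "(g has_derivative g') (at z)"
  shows "pd e g z = g' e"
proof -
  have lin: "bounded_linear g'" using assms by (rule has_derivative_bounded_linear)
  have "((\<lambda>t. z + of_real t * e) has_derivative (\<lambda>t. of_real t * e)) (at (0::real))"
    by (auto intro!: derivative_eq_intros)
  moreover have "(g has_derivative g') (at (z + of_real 0 * e))"
    using assms by simp
  ultimately have "(g \<circ> (\<lambda>t. z + of_real t * e) has_derivative g' \<circ> (\<lambda>t. of_real t * e)) (at 0)"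
    by (rule diff_chain_at)
  moreover have "g' \<circ> (\<lambda>t. of_real t * e) = (\<lambda>t. t *\<^sub>R g' e)"
    using linear_cmul[OF bounded_linear.linear[OF lin]]
    by (auto simp: fun_eq_iff scaleR_conv_of_real[symmetric])
  ultimately show ?thesis
    unfolding pd_def by (intro vector_derivative_at) (simp add: has_vector_derivative_def o_def)
qed

text \<open>As the direction in \<open>pd\<close> is an arbitrary complex number, h |->
  \<open>pd h g z\<close> is the Frechet derivative itself; the calculus rules below are read off
  from rules for \<open>has_derivative\<close>.\<close>

lemma has_derivative_pd:
  assumes "g differentiable (at z)"
  shows "(g has_derivative (\<lambda>h. pd h g z)) (at z)"
proof -
  obtain g' where g': "(g has_derivative g') (at z)"
    using assms by (auto simp: differentiable_def)
  then have "(\<lambda>h. pd h g z) = g'" by (auto simp: pd_eqI)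
  with g' show ?thesis by simp
qed

lemma pd_expand:
  assumes "g differentiable (at z)"
  shows "pd h g z = of_real (Re h) * pd 1 g z + of_real (Im h) * pd \<i> g z"
proof -
  have lin: "linear (\<lambda>h. pd h g z)"
    using has_derivative_pd[OF assms] has_derivative_bounded_linear bounded_linear.linear by blast
  have "h = Re h *\<^sub>R 1 + Im h *\<^sub>R \<i>" by (simp add: complex_eq_iff)
  then have "pd h g z = pd (Re h *\<^sub>R 1 + Im h *\<^sub>R \<i>) g z" by (rule arg_cong)
  also have "\<dots> = Re h *\<^sub>R pd 1 g z + Im h *\<^sub>R pd \<i> g z"
    using linear_add[OF lin] linear_cmul[OF lin] by simp
  finally show ?thesis by (simp add: scaleR_conv_of_real)
qed

lemma pd_add:
  assumes "f differentiable (at z)" "g differentiable (at z)"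
  shows "pd e (\<lambda>z. f z + g z) z = pd e f z + pd e g z"
  using has_derivative_add[OF assms[THEN has_derivative_pd]] by (simp add: pd_eqI)

lemma pd_mult:
  assumes "f differentiable (at z)" "g differentiable (at z)"
  shows "pd e (\<lambda>z. f z * g z) z = f z * pd e g z + pd e f z * g z"
  using has_derivative_mult[OF assms[THEN has_derivative_pd]] by (simp add: pd_eqI)

lemma pd_cong_ev:
  assumes "eventually (\<lambda>w. f w = g w) (nhds z)"
  shows "pd e f z = pd e g z"
proof -
  have "((\<lambda>t. z + of_real t * e) \<longlongrightarrow> z) (at (0::real))"
    by (auto intro!: tendsto_eq_intros)
  then have "filterlim (\<lambda>t. z + of_real t * e) (nhds z) (at (0::real))" .
  then have ev: "\<forall>\<^sub>F t in at (0::real). f (z + of_real t * e) = g (z + of_real t * e)"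
    using assms by (auto simp: filterlim_iff)
  moreover have "f z = g z" using eventually_nhds_x_imp_x[OF assms] by simp
  ultimately have "\<forall>\<^sub>F t in nhds (0::real). t \<in> UNIV \<longrightarrow> f (z + of_real t * e) = g (z + of_real t * e)"
    by (auto simp: eventually_at_filter elim!: eventually_mono)
  then show ?thesis unfolding pd_def
    by (intro vector_derivative_cong_eq) auto
qed

lemma pd_const [simp]: "pd e (\<lambda>z. c) = (\<lambda>z. 0)"
  by (auto simp: pd_def)

definition smooth :: "(complex \<Rightarrow> complex) \<Rightarrow> bool"
  where "smooth g \<longleftrightarrow> (\<forall>k. Ck_on k UNIV g)"

lemma Ck_Suc: "Ck_on (Suc k) S g \<longleftrightarrow>
    (\<forall>z\<in>S. g differentiable (at z)) \<and> Ck_on k S (pd 1 g) \<and> Ck_on k S (pd \<i> g)"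
  by (simp add: pdx_eq_pd pdy_eq_pd)

lemma Ck_on_imp_continuous: "Ck_on k S g \<Longrightarrow> continuous_on S g"
  by (cases k) (auto intro!: continuous_at_imp_continuous_on differentiable_imp_continuous_within)

lemma Ck_on_Suc_imp: "Ck_on (Suc k) S g \<Longrightarrow> Ck_on k S g"
proof (induction k arbitrary: g)
  case 0 then show ?case using Ck_on_imp_continuous[OF 0] by simp
next
  case (Suc k)
  have "(\<forall>z\<in>S. g differentiable (at z)) \<and> Ck_on (Suc k) S (pdx g) \<and> Ck_on (Suc k) S (pdy g)"
    using Suc.prems unfolding Ck_on.simps(2)[of "Suc k" S g] .
  then show ?case unfolding Ck_on.simps(2)[of k S g]
    by (elim conjE) (intro conjI Suc.IH)
qed

lemma Ck_on_add: "Ck_on k UNIV f \<Longrightarrow> Ck_on k UNIV g \<Longrightarrow> Ck_on k UNIV (\<lambda>z. f z + g z)"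
proof (induction k arbitrary: f g)
  case 0 then show ?case by (auto intro: continuous_intros)
next
  case (Suc k)
  have d: "\<And>z. f differentiable (at z)" "\<And>z. g differentiable (at z)" using Suc.prems by auto
  have "pd e (\<lambda>z. f z + g z) = (\<lambda>z. pd e f z + pd e g z)" for e
    using d by (auto simp: pd_add)
  then show ?case using Suc.prems d unfolding Ck_Suc
    by (simp only:) (intro conjI ballI Suc.IH differentiable_add, simp_all)
qed

lemma Ck_on_mult: "Ck_on k UNIV f \<Longrightarrow> Ck_on k UNIV g \<Longrightarrow> Ck_on k UNIV (\<lambda>z. f z * g z)"
proof (induction k arbitrary: f g)
  case 0 then show ?case by (auto intro: continuous_intros)
next
  case (Suc k)
  have d: "\<And>z. f differentiable (at z)" "\<And>z. g differentiable (at z)" using Suc.prems by auto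
  have "pd e (\<lambda>z. f z * g z) = (\<lambda>z. f z * pd e g z + pd e f z * g z)" for e
    using d by (auto simp: pd_mult)
  moreover have "Ck_on k UNIV f" "Ck_on k UNIV g" using Suc.prems Ck_on_Suc_imp by blast+
  ultimately show ?case
    using Suc d unfolding Ck_Suc by (auto intro!: differentiable_mult Ck_on_add)
qed

lemma Ck_on_const [simp]: "Ck_on k S (\<lambda>z. c)"
  by (induction k arbitrary: c) (auto simp: pdx_eq_pd pdy_eq_pd)

lemma smooth_const [simp]: "smooth (\<lambda>z. c)" by (simp add: smooth_def)
lemma smooth_add: "smooth f \<Longrightarrow> smooth g \<Longrightarrow> smooth (\<lambda>z. f z + g z)"
  by (simp add: smooth_def Ck_on_add)
lemma smooth_mult: "smooth f \<Longrightarrow> smooth g \<Longrightarrow> smooth (\<lambda>z. f z * g z)"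
  by (simp add: smooth_def Ck_on_mult)
lemma smooth_diff: "smooth f \<Longrightarrow> smooth g \<Longrightarrow> smooth (\<lambda>z. f z - g z)"
  using smooth_add[of f "\<lambda>z. (-1) * g z"] smooth_mult[of "\<lambda>z. -1" g] by simp

lemma smooth_differentiable: "smooth g \<Longrightarrow> g differentiable (at z)"
  unfolding smooth_def by (drule spec[of _ "Suc 0"]) auto
lemma smooth_continuous: "smooth g \<Longrightarrow> continuous_on S g"
  unfolding smooth_def using Ck_on_imp_continuous continuous_on_subset by blast
lemma smooth_pd: 
  assumes "smooth g" shows "smooth (pd e g)"
proof -
  have 1: "smooth (pd 1 g)" "smooth (pd \<i> g)"
    using assms unfolding smooth_def Ck_Suc[symmetric] by (metis Ck_Suc)+
  have "pd e g = (\<lambda>z. of_real (Re e) * pd 1 g z + of_real (Im e) * pd \<i> g z)"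
    by (intro ext pd_expand smooth_differentiable[OF assms])
  then show ?thesis using 1 by (simp add: smooth_add smooth_mult)
qed

text \<open>Smoothness by coinduction: membership in \<open>S\<close> passes to both partial
  derivatives, so the induction on the order of differentiability is done here once for all members
  of \<open>S\<close>. This suits families such as the convolutions with a fixed kernel.\<close>

lemma smooth_coinduct:
  assumes "g \<in> S"
    and "\<And>g z. g \<in> S \<Longrightarrow> g differentiable (at z)"
    and "\<And>g. g \<in> S \<Longrightarrow> pd 1 g \<in> S" "\<And>g. g \<in> S \<Longrightarrow> pd \<i> g \<in> S"
  shows "smooth g"
proof -
  have "Ck_on k UNIV g" if "g \<in> S" for k g
    using that
  proof (induction k arbitrary: g)
    case 0 then show ?case using assms(2)
      by (auto intro!: continuous_at_imp_continuous_on differentiable_imp_continuous_within)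
  next
    case (Suc k) then show ?case unfolding Ck_Suc using assms by auto
  qed
  then show ?thesis using assms(1) by (auto simp: smooth_def)
qed

lemma smooth_pd_imp:
  assumes "\<And>z. g differentiable (at z)" "smooth (pd 1 g)" "smooth (pd \<i> g)"
  shows "smooth g"
  by (rule smooth_coinduct[of g "insert g (Collect smooth)"])
     (use assms in \<open>auto simp: smooth_differentiable smooth_pd\<close>)

lemma smooth_linear:
  assumes "bounded_linear L" shows "smooth L"
proof (rule smooth_pd_imp)
  have d: "(L has_derivative L) (at z)" for z by (rule bounded_linear_imp_has_derivative[OF assms])
  then have "pd e L = (\<lambda>z. L e)" for e by (auto simp: pd_eqI)
  then show "smooth (pd 1 L)" "smooth (pd \<i> L)" by auto
  show "L differentiable at z" for z using d by (auto simp: differentiable_def)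
qed

lemma has_derivative_compose_affine:
  assumes "g differentiable (at (a + of_real c * z))"
  shows "((\<lambda>z. g (a + of_real c * z)) has_derivative (\<lambda>h. pd (of_real c * h) g (a + of_real c * z))) (at z)"
proof -
  have "((\<lambda>z. a + of_real c * z) has_derivative (\<lambda>h. of_real c * h)) (at z)"
    by (auto intro!: derivative_eq_intros)
  from diff_chain_at[OF this has_derivative_pd[OF assms]] show ?thesis by (simp add: o_def)
qed

lemma pd_scale: 
  assumes "g differentiable (at z)"
  shows "pd (of_real c * h) g z = of_real c * pd h g z"
  unfolding pd_expand[OF assms, of "of_real c * h"] pd_expand[OF assms, of h] by (simp add: algebra_simps)

lemma pd_compose_affine:
  assumes "g differentiable (at (a + of_real c * z))"
  shows "pd e (\<lambda>z. g (a + of_real c * z)) z = of_real c * pd e g (a + of_real c * z)"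
  by (subst pd_eqI[OF has_derivative_compose_affine[OF assms]]) (rule pd_scale[OF assms])

lemma smooth_compose_affine:
  assumes "smooth g" shows "smooth (\<lambda>z. g (a + of_real c * z))"
proof -
  have "Ck_on k UNIV g \<Longrightarrow> Ck_on k UNIV (\<lambda>z. g (a + of_real c * z))" for k
  proof (induction k arbitrary: g)
    case 0
    then show ?case by (auto intro!: continuous_intros continuous_on_compose2[of UNIV g])
  next
    case (Suc k)
    have d: "\<And>z. g differentiable (at z)" using Suc.prems by auto
    have "pd e (\<lambda>z. g (a + of_real c * z)) = (\<lambda>z. of_real c * pd e g (a + of_real c * z))" for e
      by (intro ext pd_compose_affine d)
    moreover have "(\<lambda>z. g (a + of_real c * z)) differentiable (at z)" for z
      using has_derivative_compose_affine[OF d] by (auto simp: differentiable_def)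
    ultimately show ?case using Suc.prems unfolding Ck_Suc
      by (simp only:) (intro conjI ballI Ck_on_mult Ck_on_const Suc.IH, simp_all)
  qed
  then show ?thesis using assms by (auto simp: smooth_def)
qed

lemma smooth_reflect: "smooth g \<Longrightarrow> smooth (\<lambda>w. g (z - w))"
  using smooth_compose_affine[of g z "-1"] by simp

lemma pd_reflect: "smooth g \<Longrightarrow> pd e (\<lambda>w. g (z - w)) w = - pd e g (z - w)"
  using pd_compose_affine[of g z "-1" w e] smooth_differentiable[of g] by simp

lemma has_derivative_cnj: "(g has_derivative g') (at z) \<Longrightarrow> ((\<lambda>z. cnj (g z)) has_derivative (\<lambda>h. cnj (g' h))) (at z)"
  using bounded_linear.has_derivative[OF bounded_linear_cnj] by blast

lemma pd_cnj:
  assumes "g differentiable (at z)" shows "pd e (\<lambda>z. cnj (g z)) z = cnj (pd e g z)"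
  using pd_eqI[OF has_derivative_cnj[OF has_derivative_pd[OF assms]]] .

lemma smooth_cnj: 
  assumes "smooth g" shows "smooth (\<lambda>z. cnj (g z))"
proof -
  have "Ck_on k UNIV g \<Longrightarrow> Ck_on k UNIV (\<lambda>z. cnj (g z))" for k
  proof (induction k arbitrary: g)
    case 0 then show ?case by (auto intro!: continuous_intros)
  next
    case (Suc k)
    have d: "\<And>z. g differentiable (at z)" using Suc.prems by auto
    have "pd e (\<lambda>z. cnj (g z)) = (\<lambda>z. cnj (pd e g z))" for e
      by (intro ext pd_cnj d)
    moreover have "(\<lambda>z. cnj (g z)) differentiable (at z)" for z
      using has_derivative_cnj[OF has_derivative_pd[OF d]] by (auto simp: differentiable_def)
    ultimately show ?case using Suc.prems unfolding Ck_Suc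
      by (simp only:) (intro conjI ballI Suc.IH, simp_all)
  qed
  then show ?thesis using assms by (auto simp: smooth_def)
qed

lemma pd_closed_support:
  assumes "closed S" "\<And>z. z \<notin> S \<Longrightarrow> g z = 0" "z \<notin> S"
  shows "pd e g z = 0"
proof -
  have "eventually (\<lambda>w. w \<in> - S) (nhds z)"
    using assms by (intro eventually_nhds_in_open) auto
  then have "eventually (\<lambda>w. g w = (\<lambda>w. 0) w) (nhds z)"
    by eventually_elim (use assms in auto)
  from pd_cong_ev[OF this, of e] show ?thesis by simp
qed

text \<open>\<open>t\<^sup>-\<^sup>m exp (-1/t)\<close> for \<open>t > 0\<close>: the derivative of the \<open>m\<close>-th function is a combination
  of the functions with index \<open>m + 1\<close> and \<open>m + 2\<close>.\<close>

definition flat :: "nat \<Rightarrow> real \<Rightarrow> real"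
  where "flat m t = (if t > 0 then (1/t)^m * exp (- (1/t)) else 0)"

text \<open>With s = 1/t, a single term of the exponential series gives s^(m+2) <= (m+2)! exp s. The
  two extra powers of s become the factor t^2, which makes the difference quotient at 0 tend to
  0.\<close>

lemma flat_le: "\<bar>flat m t\<bar> \<le> fact (m+2) * t\<^sup>2"
proof (cases "t > 0")
  case True
  define s where "s = 1/t"
  have s: "s > 0" using True by (simp add: s_def)
  define n where "n = m + 2"
  have "(\<Sum>k\<in>{n}. s^k /\<^sub>R fact k) \<le> (\<Sum>k. s^k /\<^sub>R fact k)"
    using s summable_exp_generic[of s] by (intro sum_le_suminf) auto
  then have "s^n / fact n \<le> exp s"
    by (simp add: exp_def divide_inverse mult.commute)
  then have "s^n \<le> fact n * exp s"
    by (simp add: divide_le_eq mult.commute)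
  then have "s^n * exp (-s) \<le> fact n * exp s * exp (-s)"
    by (intro mult_right_mono) auto
  also have "\<dots> = fact n" by (simp add: exp_minus)
  finally have "s^(m+2) * exp (-s) \<le> fact (m+2)" unfolding n_def .
  then have "t\<^sup>2 * (s^(m+2) * exp (-s)) \<le> t\<^sup>2 * fact (m+2)"
    by (intro mult_left_mono) auto
  also have "t\<^sup>2 * (s^(m+2) * exp (-s)) = s^m * exp (-s)"
    using True by (simp add: s_def power_add field_simps power2_eq_square)
  finally show ?thesis using True s by (simp add: flat_def s_def[symmetric] mult.commute)
qed (simp add: flat_def)

lemma flat_deriv: "(flat m has_field_derivative (- real m * flat (m+1) t + flat (m+2) t)) (at t)"
proof (cases t "0::real" rule: linorder_cases)
  case less
  have "((\<lambda>t. 0) has_field_derivative 0) (at t)" by simp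
  moreover have "\<forall>\<^sub>F x in nhds t. flat m x = 0"
    using eventually_nhds_in_open[of "{..<0}" t] less
    by (auto simp: flat_def elim!: eventually_mono)
  ultimately have "(flat m has_field_derivative 0) (at t)"
    by (subst DERIV_cong_ev[OF refl _ refl]) auto
  with less show ?thesis by (simp add: flat_def)
next
  case greater
  have "((\<lambda>t. (1/t)^m * exp (- (1/t))) has_field_derivative (- real m * flat (m+1) t + flat (m+2) t)) (at t)"
  proof -
    have inv: "((\<lambda>t. 1/t) has_field_derivative - ((1/t)\<^sup>2)) (at t)"
      using greater by (auto intro!: derivative_eq_intros simp: power2_eq_square)
    show ?thesis
      by (rule DERIV_cong[OF DERIV_mult[OF DERIV_power[OF inv, of m] DERIV_fun_exp[OF DERIV_minus[OF inv]]]])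
         (use greater in \<open>cases m; simp add: flat_def power2_eq_square algebra_simps add_divide_distrib diff_divide_distrib\<close>)
  qed
  moreover have "\<forall>\<^sub>F x in nhds t. flat m x = (1/x)^m * exp (- (1/x))"
    using eventually_nhds_in_open[of "{0<..}" t] greater
    by (auto simp: flat_def elim!: eventually_mono)
  ultimately show ?thesis
    by (subst DERIV_cong_ev[OF refl _ refl]) auto
next
  case equal
  \<comment> \<open>The quadratic bound \<open>flat_le\<close> squeezes the quotient below a
    multiple of |h|.\<close>
  have "((\<lambda>h. (flat m (0 + h) - flat m 0) / h) \<longlongrightarrow> 0) (at 0)"
  proof (rule tendsto_0_le[where K=1 and f="\<lambda>h. fact (m+2) * h"])
    show "((\<lambda>h::real. fact (m+2) * h) \<longlongrightarrow> 0) (at 0)" by (auto intro!: tendsto_eq_intros)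
    show "\<forall>\<^sub>F x in at 0. norm ((flat m (0 + x) - flat m 0) / x) \<le> norm (fact (m + 2) * x) * 1"
    proof (rule eventually_mono[OF eventually_neq_at_within[of 0 0 UNIV]])
      fix x :: real assume "x \<noteq> 0"
      have "\<bar>flat m x\<bar> / \<bar>x\<bar> \<le> fact (m+2) * x\<^sup>2 / \<bar>x\<bar>"
        by (intro divide_right_mono flat_le) auto
      also have "\<dots> = fact (m+2) * \<bar>x\<bar>" using \<open>x \<noteq> 0\<close> by (simp add: power2_eq_square abs_if)
      finally show "norm ((flat m (0 + x) - flat m 0) / x) \<le> norm (fact (m + 2) * x) * 1"
        by (simp add: abs_mult flat_def[of m 0])
    qed
  qed
  then have "(flat m has_field_derivative 0) (at 0)" by (simp add: DERIV_def)
  then show ?thesis using equal by (simp add: flat_def)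
qed

text \<open>Differentiating \<open>flat m\<close> raises the index m, so the induction on the order
  of differentiability has to treat all m together. The inner function L is real but smoothness is a
  notion for complex functions, hence the embeddings \<open>of_real\<close>.\<close>

lemma smooth_flat:
  assumes L: "smooth (\<lambda>z. of_real (L z))"
  shows "smooth (\<lambda>z. of_real (flat m (L z)))"
proof -
  have dL: "(L has_derivative (\<lambda>h. Re (pd h (\<lambda>z. of_real (L z)) z))) (at z)" for z
    using bounded_linear.has_derivative[OF bounded_linear_Re has_derivative_pd[OF smooth_differentiable[OF L]], of z]
    by simp
  \<comment> \<open>The derivative of a real-valued function is real, so taking the real part in
    \<open>dL\<close> loses nothing.\<close>
  have im: "of_real (Re (pd h (\<lambda>z. of_real (L z)) z)) = pd h (\<lambda>z. of_real (L z)) z" for h z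
    using pd_eqI[OF bounded_linear.has_derivative[OF bounded_linear_of_real dL[of z]], of h] by simp
  have d: "((\<lambda>z. complex_of_real (flat m (L z))) has_derivative
     (\<lambda>h. of_real (- real m * flat (m+1) (L z) + flat (m+2) (L z)) * pd h (\<lambda>z. of_real (L z)) z)) (at z)" for m z
  proof -
    have "(flat m \<circ> L has_derivative (*) (- real m * flat (m+1) (L z) + flat (m+2) (L z)) \<circ> (\<lambda>h. Re (pd h (\<lambda>z. of_real (L z)) z))) (at z)"
      by (rule diff_chain_at[OF dL]) (rule flat_deriv[unfolded has_field_derivative_def])
    from has_derivative_of_real[OF this, where 'a=complex]
    show ?thesis by (simp add: o_def im)
  qed
  have "Ck_on k UNIV (\<lambda>z. complex_of_real (flat m (L z)))" for k m
  proof (induction k arbitrary: m)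
    case 0
    have "continuous (at z) (\<lambda>z. complex_of_real (flat m (L z)))" for z
      using d has_derivative_continuous by blast
    then show ?case by (simp only: Ck_on.simps) (rule continuous_at_imp_continuous_on, blast)
  next
    case (Suc k)
    have P: "pd e (\<lambda>z. complex_of_real (flat m (L z))) =
       (\<lambda>z. ((- of_nat m) * of_real (flat (m+1) (L z)) + of_real (flat (m+2) (L z))) * pd e (\<lambda>z. of_real (L z)) z)" for e
      by (auto simp: fun_eq_iff pd_eqI[OF d])
    have "Ck_on k UNIV (pd e (\<lambda>z. of_real (L z)))" for e
      using smooth_pd[OF L] by (auto simp: smooth_def)
    moreover have "(\<lambda>z. complex_of_real (flat m (L z))) differentiable (at z)" for z
      using d[of m z] unfolding differentiable_def by blast
    ultimately show ?case unfolding Ck_Suc P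
      by (intro conjI ballI Ck_on_mult Ck_on_add Ck_on_const Suc.IH)
  qed
  then show ?thesis by (simp add: smooth_def)
qed

text \<open>The values are those of an unnormalised bump function supported in the disc of radius \<open>e\<close>.\<close>

lemma exists_bump:
  assumes "e > 0"
  obtains b :: "complex \<Rightarrow> real" where "smooth (\<lambda>z. of_real (b z))" "\<And>z. b z \<ge> 0"
    "\<And>z. cmod z < e \<Longrightarrow> b z > 0" "\<And>z. cmod z \<ge> e \<Longrightarrow> b z = 0"
proof -
  have "smooth (\<lambda>z. z)" by (rule smooth_linear) (rule bounded_linear_ident)
  \<comment> \<open>Writing e^2 - |z|^2 with z and its conjugate avoids differentiating the norm,
    which is not smooth at 0.\<close>
  then have "smooth (\<lambda>z. of_real (e\<^sup>2) - z * cnj z)"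
    by (intro smooth_diff smooth_mult smooth_cnj smooth_const)
  then have "smooth (\<lambda>z. of_real (e\<^sup>2 - (cmod z)\<^sup>2))"
    by (simp add: complex_norm_square[symmetric])
  note sm = smooth_flat[OF this, of 0]
  show ?thesis
  proof (rule that[OF sm])
    fix z :: complex
    show "flat 0 (e\<^sup>2 - (cmod z)\<^sup>2) \<ge> 0" by (simp add: flat_def)
    show "flat 0 (e\<^sup>2 - (cmod z)\<^sup>2) > 0" if "cmod z < e"
      using power_strict_mono[OF that, of 2] by (simp add: flat_def)
    show "flat 0 (e\<^sup>2 - (cmod z)\<^sup>2) = 0" if "cmod z \<ge> e"
      using power_mono[OF that, of 2] assms by (simp add: flat_def linorder_not_less)
  qed
qed

section \<open>Test functions\<close>

lemma test_funI:
  assumes "smooth \<phi>" "compact K" "K \<subseteq> \<Omega>" "\<And>z. z \<notin> K \<Longrightarrow> \<phi> z = 0"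
  shows "\<phi> \<in> test_fun \<Omega>"
proof -
  have "closure {z. \<phi> z \<noteq> 0} \<subseteq> K"
    using assms(2,4) by (intro closure_minimal compact_imp_closed) auto
  moreover then have "compact (closure {z. \<phi> z \<noteq> 0})"
    using assms(2) by (metis closed_closure compact_Int_closed inf.absorb_iff2 inf_commute)
  ultimately show ?thesis using assms by (auto simp: test_fun_def smooth_def)
qed

lemma test_funD:
  assumes "\<phi> \<in> test_fun \<Omega>"
  shows "\<exists>K. smooth \<phi> \<and> compact K \<and> K \<subseteq> \<Omega> \<and> (\<forall>z. z \<notin> K \<longrightarrow> \<phi> z = 0)"
  using assms closure_subset[of "{z. \<phi> z \<noteq> 0}"]
  by (intro exI[of _ "closure {z. \<phi> z \<noteq> 0}"]) (auto simp: test_fun_def smooth_def)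

lemma test_fun_smooth: "\<phi> \<in> test_fun \<Omega> \<Longrightarrow> smooth \<phi>"
  using test_funD by blast

lemma test_fun_zero: "\<phi> \<in> test_fun \<Omega> \<Longrightarrow> z \<notin> \<Omega> \<Longrightarrow> \<phi> z = 0"
  using test_funD by blast

lemma test_fun_pd: assumes "\<phi> \<in> test_fun \<Omega>" shows "pd e \<phi> \<in> test_fun \<Omega>"
proof -
  obtain K where K: "smooth \<phi>" "compact K" "K \<subseteq> \<Omega>" "\<And>z. z \<notin> K \<Longrightarrow> \<phi> z = 0"
    using test_funD[OF assms] by blast
  show ?thesis
    by (rule test_funI[OF smooth_pd[OF K(1)] K(2,3) pd_closed_support[OF compact_imp_closed[OF K(2)] K(4)]])
qed

lemma test_fun_mult:
  assumes "\<phi> \<in> test_fun \<Omega>" "smooth g" shows "(\<lambda>z. g z * \<phi> z) \<in> test_fun \<Omega>"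
proof -
  obtain K where K: "smooth \<phi>" "compact K" "K \<subseteq> \<Omega>" "\<And>z. z \<notin> K \<Longrightarrow> \<phi> z = 0"
    using test_funD[OF assms(1)] by blast
  show ?thesis
    by (rule test_funI[OF smooth_mult[OF assms(2) K(1)] K(2,3)]) (simp add: K)
qed

lemma test_fun_mult2: "\<phi> \<in> test_fun \<Omega> \<Longrightarrow> smooth g \<Longrightarrow> (\<lambda>z. \<phi> z * g z) \<in> test_fun \<Omega>"
  using test_fun_mult by (simp add: mult.commute)

lemma test_fun_add:
  assumes "\<phi> \<in> test_fun \<Omega>" "\<psi> \<in> test_fun \<Omega>" shows "(\<lambda>z. \<phi> z + \<psi> z) \<in> test_fun \<Omega>"
proof -
  obtain K where K: "smooth \<phi>" "compact K" "K \<subseteq> \<Omega>" "\<And>z. z \<notin> K \<Longrightarrow> \<phi> z = 0"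
    using test_funD[OF assms(1)] by blast
  obtain L where L: "smooth \<psi>" "compact L" "L \<subseteq> \<Omega>" "\<And>z. z \<notin> L \<Longrightarrow> \<psi> z = 0"
    using test_funD[OF assms(2)] by blast
  show ?thesis using K L by (intro test_funI[of _ "K \<union> L"]) (auto intro: smooth_add)
qed

lemma test_fun_cnj: assumes "\<phi> \<in> test_fun \<Omega>" shows "(\<lambda>z. cnj (\<phi> z)) \<in> test_fun \<Omega>"
proof -
  obtain K where K: "smooth \<phi>" "compact K" "K \<subseteq> \<Omega>" "\<And>z. z \<notin> K \<Longrightarrow> \<phi> z = 0"
    using test_funD[OF assms] by blast
  show ?thesis by (rule test_funI[OF smooth_cnj[OF K(1)] K(2,3)]) (simp add: K)
qed

lemma test_fun_mono: "\<phi> \<in> test_fun S \<Longrightarrow> S \<subseteq> T \<Longrightarrow> \<phi> \<in> test_fun T"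
  by (auto simp: test_fun_def)

lemma compact_subset_cball0:
  fixes K :: "complex set" assumes "compact K" obtains R where "R > 0" "K \<subseteq> cball 0 R"
  using bounded_subset_ballD[OF compact_imp_bounded[OF assms], of 0] ball_subset_cball that by blast

lemma test_fun_bdd_support:
  assumes "\<phi> \<in> test_fun \<Omega>" obtains R where "R > 0" "\<And>z. cmod z > R \<Longrightarrow> \<phi> z = 0"
proof -
  obtain K where K: "compact K" "\<And>z. z \<notin> K \<Longrightarrow> \<phi> z = 0"
    using test_funD[OF assms] by blast
  obtain R where "R > 0" "K \<subseteq> cball 0 R" using compact_subset_cball0[OF K(1)] .
  then have "z \<notin> K" if "cmod z > R" for z using that by auto
  then show ?thesis using K \<open>R > 0\<close> that by blast
qed

section \<open>Invariance of Lebesgue measure and functions of bounded support\<close>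

lemma lborel_reflect: "distr lborel borel (\<lambda>x. z - x) = (lborel :: 'a::euclidean_space measure)"
proof -
  show ?thesis using lborel_affine[of "-1" z] by (simp add: density_1)
qed

lemma nn_integral_reflect:
  fixes f :: "'a::euclidean_space \<Rightarrow> ennreal"
  assumes "f \<in> borel_measurable borel"
  shows "(\<integral>\<^sup>+w. f (z - w) \<partial>lborel) = (\<integral>\<^sup>+w. f w \<partial>lborel)"
  by (subst (2) lborel_reflect[symmetric, of z], subst nn_integral_distr) (use assms in auto)

lemma integral_reflect:
  fixes f :: "'a::euclidean_space \<Rightarrow> 'b::{banach, second_countable_topology}"
  assumes "f \<in> borel_measurable borel"
  shows "(\<integral>w. f (z - w) \<partial>lborel) = (\<integral>w. f w \<partial>lborel)"
  by (subst (2) lborel_reflect[symmetric, of z], subst integral_distr) (use assms in auto)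

lemma integral_shift:
  fixes f :: "'a::euclidean_space \<Rightarrow> 'b::{banach, second_countable_topology}"
  assumes "f \<in> borel_measurable borel"
  shows "(\<integral>w. f (w + z) \<partial>lborel) = (\<integral>w. f w \<partial>lborel)"
  by (subst (2) lborel_distr_plus[symmetric, of z], subst integral_distr)
     (use assms in \<open>auto simp: add.commute\<close>)

lemma integrable_reflect:
  fixes f :: "'a::euclidean_space \<Rightarrow> 'b::{banach, second_countable_topology}"
  assumes "integrable lborel f"
  shows "integrable lborel (\<lambda>w. f (z - w))"
  using assms by (subst (asm) lborel_reflect[symmetric, of z], subst (asm) integrable_distr_eq) auto

lemma integrable_shift:
  fixes f :: "'a::euclidean_space \<Rightarrow> 'b::{banach, second_countable_topology}"
  assumes "integrable lborel f"
  shows "integrable lborel (\<lambda>w. f (w + z))"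
  using assms by (subst (asm) lborel_distr_plus[symmetric, of z], subst (asm) integrable_distr_eq)
    (auto simp: add.commute)

lemma integrable_bdd_support:
  fixes f :: "complex \<Rightarrow> 'b::{banach, second_countable_topology}"
  assumes "f \<in> borel_measurable borel" "\<And>z. norm (f z) \<le> B" "\<And>z. cmod z > R \<Longrightarrow> f z = 0"
  shows "integrable lborel f"
proof (rule Bochner_Integration.integrable_bound)
  show "integrable lborel (\<lambda>z::complex. B * indicator (cball 0 R) z :: real)"
    using emeasure_lborel_cball_finite[of "0::complex" R]
    by (intro integrable_mult_right integrable_real_indicator) (auto simp: less_top)
  have "norm (f z) \<le> norm (B * indicator (cball 0 R) z :: real)" for z :: complex
    using assms(2)[of z] assms(3)[of z] order_trans[OF norm_ge_zero assms(2)[of z]]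
    by (auto simp: indicator_def)
  then show "AE z in lborel. norm (f z) \<le> norm (B * indicator (cball 0 R) z :: real)" by simp
qed (use assms in auto)

lemma norm_integral_le:
  fixes f :: "'a \<Rightarrow> 'b::{banach, second_countable_topology}"
  assumes "integrable M f" "integrable M g" "\<And>x. norm (f x) \<le> g x"
  shows "norm (\<integral>x. f x \<partial>M) \<le> (\<integral>x. g x \<partial>M)"
  using assms by (intro order_trans[OF integral_norm_bound] integral_mono) auto

lemma continuous_bdd_support_bounded:
  fixes f :: "complex \<Rightarrow> 'b::real_normed_vector"
  assumes "continuous_on UNIV f" "\<And>z. cmod z > R \<Longrightarrow> f z = 0"
  obtains B where "B > 0" "\<And>z. norm (f z) \<le> B"
proof -
  have "compact (f ` cball 0 R)"
    using assms(1) by (intro compact_continuous_image) (auto intro: continuous_on_subset)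
  then obtain B where B: "B > 0" "\<And>x. x \<in> f ` cball 0 R \<Longrightarrow> norm x \<le> B"
    using compact_imp_bounded bounded_pos by metis
  have "norm (f z) \<le> B" for z
    using B assms(2)[of z] by (cases "cmod z \<le> R") auto
  then show ?thesis using that B(1) by blast
qed

lemma integrable_continuous_support:
  fixes f :: "complex \<Rightarrow> 'b::{banach, second_countable_topology}"
  assumes "continuous_on UNIV f" "\<And>z. cmod z > R \<Longrightarrow> f z = 0"
  shows "integrable lborel f"
proof -
  obtain B where "\<And>z. norm (f z) \<le> B" using continuous_bdd_support_bounded[OF assms] by metis
  then show ?thesis using assms borel_measurable_continuous_onI
    by (intro integrable_bdd_support[of f B R]) auto
qed

lemma uniformly_continuous_support:
  fixes f :: "complex \<Rightarrow> 'b::real_normed_vector"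
  assumes "continuous_on UNIV f" "\<And>z. cmod z > R \<Longrightarrow> f z = 0" "e > 0"
  obtains d where "d > 0" "\<And>z w. cmod (z - w) < d \<Longrightarrow> norm (f z - f w) < e"
proof -
  have "uniformly_continuous_on (cball 0 (R+1)) f"
    using assms(1) by (intro compact_uniformly_continuous) (auto intro: continuous_on_subset)
  then obtain d where d: "d > 0"
    "\<And>z w. z \<in> cball 0 (R+1) \<Longrightarrow> w \<in> cball 0 (R+1) \<Longrightarrow> dist w z < d \<Longrightarrow> dist (f w) (f z) < e"
    using assms(3) unfolding uniformly_continuous_on_def by metis
  show ?thesis
  proof (rule that[of "min d 1"])
    fix z w assume zw: "cmod (z - w) < min d 1"
    show "norm (f z - f w) < e"
    proof (cases "z \<in> cball 0 (R+1) \<and> w \<in> cball 0 (R+1)")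
      case True then show ?thesis using d(2)[of w z] zw by (auto simp: dist_norm)
    next
      case False
      have "cmod z \<le> cmod w + cmod (z - w)" "cmod w \<le> cmod z + cmod (z - w)"
        using norm_triangle_ineq[of w "z - w"] norm_triangle_ineq[of z "w - z"]
        by (auto simp: norm_minus_commute)
      then have "cmod z > R" "cmod w > R" using False zw by auto
      then show ?thesis using assms by simp
    qed
  qed (use d in auto)
qed

section \<open>Continuously differentiable functions and integration by parts\<close>

abbreviation "C1 \<equiv> Ck_on (Suc 0) UNIV"

lemma C1D:
  assumes "C1 g"
  shows "g differentiable (at z)" "continuous_on UNIV (pd e g)" "continuous_on UNIV g"
proof -
  show d: "g differentiable (at z)" for z using assms by auto
  have "pd e g = (\<lambda>z. of_real (Re e) * pd 1 g z + of_real (Im e) * pd \<i> g z)"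
    by (intro ext pd_expand d)
  then show "continuous_on UNIV (pd e g)" using assms
    by (auto simp: pdx_eq_pd pdy_eq_pd intro!: continuous_intros)
  show "continuous_on UNIV g" using assms by (rule Ck_on_imp_continuous)
qed

lemma smooth_C1: "smooth g \<Longrightarrow> C1 g" by (simp add: smooth_def del: Ck_on.simps)

lemma pd_support:
  assumes "\<And>z. cmod z > R \<Longrightarrow> g z = 0" "cmod z > R" shows "pd e g z = 0"
  by (rule pd_closed_support[of "cball 0 R"]) (use assms in auto)

lemma pd_diff_le:
  assumes "g differentiable (at z)" "g differentiable (at w)"
    "cmod (pd 1 g z - pd 1 g w) \<le> e" "cmod (pd \<i> g z - pd \<i> g w) \<le> e"
  shows "cmod (pd h g z - pd h g w) \<le> 2 * e * cmod h"
proof -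
  have "pd h g z - pd h g w = of_real (Re h) * (pd 1 g z - pd 1 g w) + of_real (Im h) * (pd \<i> g z - pd \<i> g w)"
    unfolding pd_expand[OF assms(1), of h] pd_expand[OF assms(2), of h] by (simp add: algebra_simps)
  also have "cmod \<dots> \<le> \<bar>Re h\<bar> * cmod (pd 1 g z - pd 1 g w) + \<bar>Im h\<bar> * cmod (pd \<i> g z - pd \<i> g w)"
    by (intro norm_triangle_le) (simp add: norm_mult)
  also have "\<dots> \<le> cmod h * e + cmod h * e"
    using assms by (intro add_mono mult_mono abs_Re_le_cmod abs_Im_le_cmod) auto
  finally show ?thesis by (simp add: algebra_simps)
qed

text \<open>Bounded support makes both partial derivatives uniformly continuous. The mean value
  inequality on discs of one fixed radius then bounds the linearisation error uniformly in z, which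
  is what allows a difference quotient to be taken under an integral.\<close>

lemma uniform_differentiable:
  assumes C1: "C1 g" and R: "\<And>z. cmod z > R \<Longrightarrow> g z = 0" and "e > 0"
  obtains d where "d > 0" "\<And>z h. cmod h < d \<Longrightarrow> cmod (g (z + h) - g z - pd h g z) \<le> e * cmod h"
proof -
  note c = C1D[OF C1]
  have S: "pd e g z = 0" if "cmod z > R" for e z using pd_support[of R g z e] R that by blast
  obtain d1 where d1: "d1 > 0" "\<And>z w. cmod (z - w) < d1 \<Longrightarrow> cmod (pd 1 g z - pd 1 g w) < e/2"
    using uniformly_continuous_support[of "pd 1 g" R "e/2", OF c(2) S] \<open>e > 0\<close> by auto
  obtain d2 where d2: "d2 > 0" "\<And>z w. cmod (z - w) < d2 \<Longrightarrow> cmod (pd \<i> g z - pd \<i> g w) < e/2"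
    using uniformly_continuous_support[of "pd \<i> g" R "e/2", OF c(2) S] \<open>e > 0\<close> by auto
  show ?thesis
  proof (rule that[of "min d1 d2"])
    fix z h :: complex assume h: "cmod h < min d1 d2"
    have "norm (g (z + h) - g z - pd (z + h - z) g z) \<le> norm (z + h - z) * e"
    proof (rule differentiable_bound_linearization[where S="ball z (min d1 d2)" and f'="\<lambda>x h. pd h g x" and ?x0.0=z])
      fix t :: real assume t: "t \<in> {0..1}"
      have "t * cmod h \<le> 1 * cmod h" using t by (intro mult_right_mono) auto
      then show "z + t *\<^sub>R (z + h - z) \<in> ball z (min d1 d2)" using h t by (auto simp: dist_norm)
    next
      fix x assume x: "x \<in> ball z (min d1 d2)"
      show "(g has_derivative (\<lambda>h. pd h g x)) (at x within ball z (min d1 d2))"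
        using has_derivative_pd[OF c(1)] has_derivative_at_withinI by blast
      have "cmod (x - z) < min d1 d2" using x by (auto simp: dist_norm norm_minus_commute)
      then have "cmod (pd k g x - pd k g z) \<le> e * cmod k" for k
        using pd_diff_le[OF c(1) c(1), of x z "e/2" k] d1(2)[of x z] d2(2)[of x z] by auto
      then show "onorm ((\<lambda>h. pd h g x) - (\<lambda>h. pd h g z)) \<le> e"
        using \<open>e > 0\<close> by (intro onorm_bound) auto
    qed (use d1 d2 in auto)
    then show "cmod (g (z + h) - g z - pd h g z) \<le> e * cmod h" by (simp add: mult.commute)
  qed (use d1 d2 in auto)
qed

text \<open>Translation invariance replaces iterated integration: the integral of g(z + te) - g(z)
  vanishes, so t times the integral of the derivative equals, up to sign, the integral of the
  linearisation error. That error is at most a small multiple of t and lives in a fixed disc;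
  dividing by t finishes.\<close>

lemma integral_pd_zero:
  assumes C1: "C1 g" and R: "\<And>z. cmod z > R \<Longrightarrow> g z = 0"
  shows "(\<integral>z. pd e g z \<partial>lborel) = 0"
proof -
  note c = C1D[OF C1]
  have S: "pd e g z = 0" if "cmod z > R" for e z using pd_support[of R g z e] R that by blast
  define M where "M = measure lborel (cball (0::complex) (R+1))"
  have M: "M \<ge> 0" by (simp add: M_def)
  have intpd: "integrable lborel (pd e g)"
    by (rule integrable_continuous_support[OF c(2) S])
  have intg: "integrable lborel g"
    by (rule integrable_continuous_support[OF c(3) R])
  have "cmod (\<integral>z. pd e g z \<partial>lborel) \<le> \<epsilon> * (cmod e * M)" if \<epsilon>: "\<epsilon> > 0" for \<epsilon>
  proof -
    obtain d where d: "d > 0" "\<And>z h. cmod h < d \<Longrightarrow> cmod (g (z + h) - g z - pd h g z) \<le> \<epsilon> * cmod h"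
      using uniform_differentiable[OF C1 R \<epsilon>] by metis
    \<comment> \<open>The step |te| must stay below d for the error estimate and below 1 so that the
      error is supported in the disc of radius R + 1; adding 1 to |e| covers e = 0.\<close>
    define t where "t = min (d/2) (1/2) / (cmod e + 1)"
    have pos: "cmod e + 1 > 0" by (simp add: add_nonneg_pos)
    have t: "t > 0" using d pos by (simp add: t_def)
    have "t * cmod e \<le> t * (cmod e + 1)" using t by auto
    also have "\<dots> = min (d/2) (1/2)" unfolding t_def using pos by auto
    finally have te: "t * cmod e < d" "t * cmod e < 1" using d by auto
    let ?r = "\<lambda>z. g (z + of_real t * e) - g z - of_real t * pd e g z"
    have r: "cmod (?r z) \<le> \<epsilon> * (t * cmod e) * indicator (cball 0 (R+1)) z" for z
    proof (cases "z \<in> cball 0 (R+1)")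
      case True
      then show ?thesis using d(2)[of "of_real t * e" z] te t pd_scale[OF c(1), of t e z] 
        by (auto simp: norm_mult)
    next
      case False
      have "cmod z \<le> cmod (z + of_real t * e) + cmod (of_real t * e)"
        using norm_triangle_ineq4[of "z + of_real t * e" "of_real t * e"] by simp
      then have "cmod (z + of_real t * e) > R" "cmod z > R" using False te t by (auto simp: norm_mult)
      then show ?thesis using False R S by auto
    qed
    have int1: "integrable lborel (\<lambda>z. g (z + of_real t * e))" by (rule integrable_shift[OF intg])
    have "of_real t * (\<integral>z. pd e g z \<partial>lborel) = - (\<integral>z. ?r z \<partial>lborel)"
      using int1 intg intpd integral_shift[of g "of_real t * e"] intg
      by (simp add: Bochner_Integration.integral_diff borel_measurable_continuous_onI[OF c(3)])
    then have "t * cmod (\<integral>z. pd e g z \<partial>lborel) = cmod (\<integral>z. ?r z \<partial>lborel)"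
      using t by (metis norm_minus_cancel norm_mult norm_of_real abs_of_pos)
    also have "\<dots> \<le> integral\<^sup>L lborel (\<lambda>z::complex. \<epsilon> * (t * cmod e) * indicator (cball 0 (R+1)) z)"
    proof (rule norm_integral_le)
      show "integrable lborel ?r"
        using int1 intg intpd by (intro Bochner_Integration.integrable_diff integrable_mult_right)
      show "integrable lborel (\<lambda>z::complex. \<epsilon> * (t * cmod e) * indicator (cball 0 (R+1)) z :: real)"
        using emeasure_lborel_cball_finite[of "0::complex" "R+1"]
        by (intro integrable_mult_right integrable_real_indicator) (auto simp: less_top)
    qed (use r in auto)
    also have "\<dots> = t * (\<epsilon> * (cmod e * M))" by (simp add: M_def)
    finally show ?thesis using t by simp
  qed
  then have "cmod (\<integral>z. pd e g z \<partial>lborel) \<le> \<epsilon>" if "\<epsilon> > 0" for \<epsilon>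
  proof -
    have pos: "cmod e * M + 1 > 0" using M by (simp add: add_nonneg_pos)
    have "cmod (\<integral>z. pd e g z \<partial>lborel) \<le> \<epsilon> / (cmod e * M + 1) * (cmod e * M)"
      using \<open>\<epsilon> > 0\<close> pos by (intro \<open>\<And>\<epsilon>. \<epsilon> > 0 \<Longrightarrow> _\<close>) auto
    also have "\<dots> \<le> \<epsilon> / (cmod e * M + 1) * (cmod e * M + 1)"
      using \<open>\<epsilon> > 0\<close> pos by (intro mult_left_mono) auto
    finally show ?thesis using pos by simp
  qed
  then show ?thesis by (metis dense norm_le_zero_iff not_le)
qed

lemma continuous_on_mult_support:
  fixes a b :: "complex \<Rightarrow> complex"
  assumes "open \<Omega>" "continuous_on \<Omega> a" "continuous_on UNIV b" "compact K" "K \<subseteq> \<Omega>" "\<And>z. z \<notin> K \<Longrightarrow> b z = 0"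
  shows "continuous_on UNIV (\<lambda>z. a z * b z)"
proof -
  have "continuous_on (\<Omega> \<union> - K) (\<lambda>z. a z * b z)"
  proof (rule continuous_on_open_Un)
    show "continuous_on \<Omega> (\<lambda>z. a z * b z)"
      using assms by (intro continuous_intros) (auto intro: continuous_on_subset)
    show "continuous_on (- K) (\<lambda>z. a z * b z)"
      by (rule continuous_on_eq[of _ "\<lambda>z. 0"]) (use assms in auto)
  qed (use assms compact_imp_closed in auto)
  moreover have "\<Omega> \<union> - K = UNIV" using assms by auto
  ultimately show ?thesis by simp
qed

text \<open>Nothing is known about g outside \<Omega>. The product is nevertheless differentiable
  everywhere, because it vanishes identically near every point off the compact set K carrying
  \<phi>; \<Omega> and the complement of K form an open cover of the plane.\<close>

lemma C1_mult_test:
  assumes "open \<Omega>" "Ck_on (Suc 0) \<Omega> g" "\<phi> \<in> test_fun \<Omega>"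
  shows "C1 (\<lambda>z. g z * \<phi> z)" "pd e (\<lambda>z. g z * \<phi> z) z = g z * pd e \<phi> z + pd e g z * \<phi> z"
proof -
  obtain K where K: "smooth \<phi>" "compact K" "K \<subseteq> \<Omega>" "\<And>z. z \<notin> K \<Longrightarrow> \<phi> z = 0"
    using test_funD[OF assms(3)] by blast
  have pdK: "pd e \<phi> z = 0" if "z \<notin> K" for e z
    by (rule pd_closed_support[of K]) (use K that compact_imp_closed in auto)
  have D: "((\<lambda>z. g z * \<phi> z) has_derivative (\<lambda>h. g z * pd h \<phi> z + pd h g z * \<phi> z)) (at z)" for z
  proof (cases "z \<in> \<Omega>")
    case True
    then have "g differentiable (at z)" using assms by auto
    from has_derivative_mult[OF has_derivative_pd[OF this] has_derivative_pd[OF smooth_differentiable[OF K(1)]]]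
    show ?thesis .
  next
    case False
    have "\<forall>\<^sub>F w in nhds z. w \<in> - K" using K False compact_imp_closed
      by (intro eventually_nhds_in_open) auto
    then have ev: "\<forall>\<^sub>F w in nhds z. g w * \<phi> w = 0" by eventually_elim (use K in auto)
    have "((\<lambda>z. 0) has_derivative (\<lambda>h. 0)) (at z)" by simp
    then have "((\<lambda>z. g z * \<phi> z) has_derivative (\<lambda>h. 0)) (at z)"
    proof (rule has_derivative_transform_eventually)
      show "\<forall>\<^sub>F w in at z. 0 = g w * \<phi> w"
        unfolding eventually_at_filter by (rule eventually_mono[OF ev]) simp
      show "0 = g z * \<phi> z" using eventually_nhds_x_imp_x[OF ev] by simp
    qed simp
    moreover have "z \<notin> K" using False K by auto
    ultimately show ?thesis using K pdK by simp
  qed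
  show P: "pd e (\<lambda>z. g z * \<phi> z) z = g z * pd e \<phi> z + pd e g z * \<phi> z" for e z
    by (rule pd_eqI[OF D])
  have Pf: "pd e (\<lambda>z. g z * \<phi> z) = (\<lambda>z. g z * pd e \<phi> z + pd e g z * \<phi> z)" for e
    using P by auto
  have cg: "continuous_on \<Omega> g" using assms(2) Ck_on_imp_continuous by blast
  have cpg: "continuous_on \<Omega> (pd 1 g)" "continuous_on \<Omega> (pd \<i> g)"
    using assms(2) by (auto simp: pdx_eq_pd pdy_eq_pd)
  have "continuous_on UNIV (\<lambda>z. g z * pd e \<phi> z + pd e g z * \<phi> z)" if "e \<in> {1, \<i>}" for e
    using that cpg smooth_continuous[OF K(1), of UNIV] smooth_continuous[OF smooth_pd[OF K(1), of e], of UNIV]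
    by (intro continuous_on_add continuous_on_mult_support[OF assms(1) cg _ K(2,3)]
          continuous_on_mult_support[OF assms(1) _ _ K(2,3)] K pdK) auto
  then show "C1 (\<lambda>z. g z * \<phi> z)"
    using D unfolding Ck_Suc Pf by (auto simp: differentiable_def)
qed

lemma C1_by_parts:
  assumes "open \<Omega>" "Ck_on (Suc 0) \<Omega> g" "\<phi> \<in> test_fun \<Omega>" "e \<in> {1, \<i>}"
  shows "(\<integral>z. g z * pd e \<phi> z \<partial>lborel) = - (\<integral>z. pd e g z * \<phi> z \<partial>lborel)"
proof -
  obtain K where K: "smooth \<phi>" "compact K" "K \<subseteq> \<Omega>" "\<And>z. z \<notin> K \<Longrightarrow> \<phi> z = 0"
    using test_funD[OF assms(3)] by blast
  have pdK: "pd e \<phi> z = 0" if "z \<notin> K" for e z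
    by (rule pd_closed_support[of K]) (use K that compact_imp_closed in auto)
  obtain R where R: "R > 0" "K \<subseteq> cball 0 R" using compact_subset_cball0[OF K(2)] .
  have cg: "continuous_on \<Omega> g" using assms(2) Ck_on_imp_continuous by blast
  have cpg: "continuous_on \<Omega> (pd e g)"
    using assms(2,4) by (auto simp: pdx_eq_pd pdy_eq_pd)
  have out: "z \<notin> K" if "cmod z > R" for z using that R by auto
  have i1: "integrable lborel (\<lambda>z. g z * pd e \<phi> z)"
    by (rule integrable_continuous_support[of _ R])
       (use continuous_on_mult_support[OF assms(1) cg _ K(2,3) pdK] smooth_continuous[OF smooth_pd[OF K(1)]] pdK out in auto)
  have i2: "integrable lborel (\<lambda>z. pd e g z * \<phi> z)"
    by (rule integrable_continuous_support[of _ R])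
       (use continuous_on_mult_support[OF assms(1) cpg _ K(2,3) K(4)] smooth_continuous[OF K(1)] K out in auto)
  have "(\<integral>z. pd e (\<lambda>z. g z * \<phi> z) z \<partial>lborel) = 0"
    by (rule integral_pd_zero[OF C1_mult_test(1)[OF assms(1-3)], of R]) (use out K in auto)
  then have "(\<integral>z. g z * pd e \<phi> z + pd e g z * \<phi> z \<partial>lborel) = 0"
    by (simp add: C1_mult_test(2)[OF assms(1-3)])
  then show ?thesis using i1 i2 by (simp add: add_eq_0_iff)
qed

section \<open>Local integrability and convolutions\<close>

text \<open>Borel measurability on the whole plane replaces Lebesgue measurability on \<Omega>, so
  that translations, products and Fubini can be used for \<open>lborel\<close> without leaving the
  Borel setting. No integrability is asked outside \<Omega>.\<close>

definition locint :: "complex set \<Rightarrow> (complex \<Rightarrow> complex) \<Rightarrow> bool"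
  where "locint \<Omega> g \<longleftrightarrow> g \<in> borel_measurable borel \<and>
    (\<forall>K. compact K \<longrightarrow> K \<subseteq> \<Omega> \<longrightarrow> integrable lborel (\<lambda>z. indicator K z * g z))"

lemma locint_measurable [measurable_dest]: "locint \<Omega> g \<Longrightarrow> g \<in> borel_measurable borel"
  by (simp add: locint_def)

lemma locint_integrable: "locint \<Omega> g \<Longrightarrow> compact K \<Longrightarrow> K \<subseteq> \<Omega> \<Longrightarrow> integrable lborel (\<lambda>z. indicator K z * g z)"
  by (simp add: locint_def)

lemma locint_mono: "locint \<Omega> g \<Longrightarrow> S \<subseteq> \<Omega> \<Longrightarrow> locint S g"
  by (auto simp: locint_def)

lemma integrable_imp_locint: "integrable lborel g \<Longrightarrow> locint UNIV g"
  unfolding locint_def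
proof (intro conjI allI impI)
  assume g: "integrable lborel g"
  then show m: "g \<in> borel_measurable borel" by auto
  fix K :: "complex set" assume "compact K"
  then have "K \<in> sets borel" by (simp add: compact_imp_closed borel_closed)
  then show "integrable lborel (\<lambda>z. indicator K z * g z)"
    using m by (intro Bochner_Integration.integrable_bound[OF g]) (auto simp: norm_mult indicator_def)
qed

lemma locint_mult_integrable:
  assumes g: "locint \<Omega> g" and K: "compact K" "K \<subseteq> \<Omega>" "\<And>z. z \<notin> K \<Longrightarrow> b z = 0"
    and b: "b \<in> borel_measurable borel" "\<And>z. cmod (b z) \<le> B"
  shows "integrable lborel (\<lambda>z. g z * b z)"
proof (rule Bochner_Integration.integrable_bound)
  show "integrable lborel (\<lambda>z. B * cmod (indicator K z * g z))"
    using locint_integrable[OF g K(1,2)] by auto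
  have "B \<ge> 0" using b(2) norm_ge_zero order_trans by blast
  have "cmod (g z * b z) \<le> norm (B * cmod (indicator K z * g z))" for z
    using b(2)[of z] K(3)[of z] \<open>B \<ge> 0\<close>
    by (auto simp: indicator_def norm_mult mult.commute[of B] intro!: mult_left_mono)
  then show "AE z in lborel. cmod (g z * b z) \<le> norm (B * cmod (indicator K z * g z))" by simp
qed (use locint_measurable[OF g] b(1) in simp)

lemma locint_mult_continuous:
  assumes g: "locint \<Omega> g" and K: "compact K" "K \<subseteq> \<Omega>" "\<And>z. z \<notin> K \<Longrightarrow> b z = 0"
    and b: "continuous_on UNIV b"
  shows "integrable lborel (\<lambda>z. g z * b z)"
proof -
  obtain R where R: "K \<subseteq> cball 0 R" using compact_subset_cball0[OF K(1)] by blast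
  have "b z = 0" if "cmod z > R" for z
  proof -
    have "z \<notin> K" using R that by auto
    then show ?thesis by (rule K(3))
  qed
  then obtain B where "\<And>z. cmod (b z) \<le> B" using continuous_bdd_support_bounded[OF b] by metis
  then show ?thesis using locint_mult_integrable[OF g K borel_measurable_continuous_onI[OF b]] by blast
qed

lemma locint_mult_test:
  assumes "locint \<Omega> g" "\<phi> \<in> test_fun \<Omega>" shows "integrable lborel (\<lambda>z. g z * \<phi> z)"
proof -
  obtain K where K: "smooth \<phi>" "compact K" "K \<subseteq> \<Omega>" "\<And>z. z \<notin> K \<Longrightarrow> \<phi> z = 0"
    using test_funD[OF assms(2)] by blast
  show ?thesis by (rule locint_mult_continuous[OF assms(1) K(2,3) K(4) smooth_continuous[OF K(1)]])
qed

section \<open>Convolution of a locally integrable kernel with a function of bounded support\<close>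

definition conv :: "(complex \<Rightarrow> complex) \<Rightarrow> (complex \<Rightarrow> complex) \<Rightarrow> complex \<Rightarrow> complex"
  where "conv k \<phi> z = (\<integral>w. k w * \<phi> (z - w) \<partial>lborel)"

lemma conv_integrable:
  assumes "locint UNIV k" "continuous_on UNIV \<phi>" "\<And>z. cmod z > R \<Longrightarrow> \<phi> z = 0"
  shows "integrable lborel (\<lambda>w. k w * \<phi> (z - w))"
proof (rule locint_mult_continuous[OF assms(1), of "cball z R"])
  show "continuous_on UNIV (\<lambda>w. \<phi> (z - w))"
    by (intro continuous_on_compose2[OF assms(2)] continuous_intros) auto
qed (use assms(3) in \<open>auto simp: dist_norm\<close>)

text \<open>The derivative always falls on \<phi>, whose linearisation error is uniformly small by
  \<open>uniform_differentiable\<close>; the kernel enters only through its mass on a fixed disc.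
  This covers the singular kernel 1/w as well as the functions to be mollified.\<close>

lemma conv_has_derivative:
  assumes k: "locint UNIV k" and C1: "C1 \<phi>" and R: "\<And>z. cmod z > R \<Longrightarrow> \<phi> z = 0"
  shows "(conv k \<phi> has_derivative (\<lambda>h. conv k (pd h \<phi>) z)) (at z)"
  unfolding has_derivative_at_alt
proof (intro conjI allI impI)
  note c = C1D[OF C1]
  have S: "pd e \<phi> z = 0" if "cmod z > R" for e z using pd_support[of R \<phi> z e] R that by blast
  have i0: "integrable lborel (\<lambda>w. k w * \<phi> (z - w))" for z by (rule conv_integrable[OF k c(3) R])
  have ie: "integrable lborel (\<lambda>w. k w * pd e \<phi> (z - w))" for e z by (rule conv_integrable[OF k c(2) S])
  have lin: "conv k (pd h \<phi>) z = of_real (Re h) * conv k (pd 1 \<phi>) z + of_real (Im h) * conv k (pd \<i> \<phi>) z" for h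
  proof -
    have "conv k (pd h \<phi>) z = (\<integral>w. of_real (Re h) * (k w * pd 1 \<phi> (z - w)) + of_real (Im h) * (k w * pd \<i> \<phi> (z - w)) \<partial>lborel)"
      unfolding conv_def by (rule Bochner_Integration.integral_cong[OF refl], subst pd_expand[OF c(1), of h]) (simp add: algebra_simps)
    then show ?thesis using ie[of 1 z] ie[of \<i> z] by (simp add: conv_def)
  qed
  have "bounded_linear (\<lambda>h. of_real (Re h) * a + of_real (Im h) * b)" for a b :: complex
    by (intro bounded_linear_add bounded_linear_compose[OF bounded_linear_mult_left]
          bounded_linear_compose[OF bounded_linear_of_real] bounded_linear_Re bounded_linear_Im)
  moreover have "(\<lambda>h. conv k (pd h \<phi>) z) = (\<lambda>h. of_real (Re h) * conv k (pd 1 \<phi>) z + of_real (Im h) * conv k (pd \<i> \<phi>) z)"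
    by (rule ext lin)+
  ultimately show "bounded_linear (\<lambda>h. conv k (pd h \<phi>) z)" by simp
  fix e :: real assume "e > 0"
  \<comment> \<open>For |h| < 1 every w at which the error term does not vanish lies in this disc.
    Dividing by N + 1 below avoids the case N = 0.\<close>
  define N where "N = (\<integral>w. cmod (indicator (cball z (R+1)) w * k w) \<partial>lborel)"
  have N: "N \<ge> 0" unfolding N_def by simp
  then have "e / (N + 1) > 0" using \<open>e > 0\<close> by simp
  then obtain d where d: "d > 0" "\<And>z h. cmod h < d \<Longrightarrow> cmod (\<phi> (z + h) - \<phi> z - pd h \<phi> z) \<le> e / (N + 1) * cmod h"
    using uniform_differentiable[OF C1 R] by metis
  show "\<exists>d>0. \<forall>y. cmod (y - z) < d \<longrightarrow> cmod (conv k \<phi> y - conv k \<phi> z - conv k (pd (y - z) \<phi>) z) \<le> e * cmod (y - z)"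
  proof (intro exI[of _ "min d 1"] conjI allI impI)
    fix y assume y: "cmod (y - z) < min d 1"
    define h where "h = y - z"
    let ?r = "\<lambda>w. k w * (\<phi> (z - w + h) - \<phi> (z - w) - pd h \<phi> (z - w))"
    have yh: "y - w = z - w + h" for w by (simp add: h_def)
    have int: "integrable lborel (\<lambda>w. k w * \<phi> (z - w + h))" using i0[of y] by (simp add: yh)
    have "conv k \<phi> y - conv k \<phi> z - conv k (pd h \<phi>) z = (\<integral>w. ?r w \<partial>lborel)"
      unfolding conv_def yh using int i0 ie
      by (simp add: right_diff_distrib Bochner_Integration.integral_diff)
    also have "cmod \<dots> \<le> (\<integral>w. e / (N + 1) * cmod h * cmod (indicator (cball z (R+1)) w * k w) \<partial>lborel)"
    proof (rule norm_integral_le)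
      show "integrable lborel ?r" using int i0 ie by (simp add: right_diff_distrib)
      show "integrable lborel (\<lambda>w. e / (N + 1) * cmod h * cmod (indicator (cball z (R+1)) w * k w))"
        using locint_integrable[OF k, of "cball z (R+1)"] by auto
      fix w
      show "cmod (?r w) \<le> e / (N + 1) * cmod h * cmod (indicator (cball z (R+1)) w * k w)"
      proof (cases "w \<in> cball z (R+1)")
        case True
        have "cmod (?r w) \<le> cmod (k w) * (e / (N + 1) * cmod h)"
          unfolding norm_mult using d(2)[of h "z - w"] y by (intro mult_left_mono) (auto simp: h_def)
        then show ?thesis using True by (simp add: mult.commute)
      next
        case False
        then have "cmod (z - w) > R + 1" by (simp add: dist_norm)
        moreover have "cmod (z - w) \<le> cmod (z - w + h) + cmod h"
          using norm_triangle_ineq4[of "z - w + h" h] by simp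
        ultimately have "cmod (z - w) > R" "cmod (z - w + h) > R" using y by (auto simp: h_def)
        then show ?thesis using R S \<open>e > 0\<close> N by simp
      qed
    qed
    also have "\<dots> = (N / (N + 1)) * e * cmod h" by (simp add: N_def)
    also have "\<dots> \<le> 1 * e * cmod h" using N \<open>e > 0\<close> by (intro mult_right_mono) auto
    finally show "cmod (conv k \<phi> y - conv k \<phi> z - conv k (pd (y - z) \<phi>) z) \<le> e * cmod (y - z)"
      by (simp add: h_def)
  qed (use d in auto)
qed

text \<open>Convolutions of the fixed kernel with smooth functions supported in one fixed disc are
  closed under differentiation, so \<open>smooth_coinduct\<close> applies to this family.\<close>

lemma
  assumes k: "locint UNIV k" and \<phi>: "smooth \<phi>" and R: "\<And>z. cmod z > R \<Longrightarrow> \<phi> z = 0"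
  shows pd_conv: "pd e (conv k \<phi>) = conv k (pd e \<phi>)" and smooth_conv: "smooth (conv k \<phi>)"
proof -
  have P: "pd e (conv k \<phi>) = conv k (pd e \<phi>)" if "smooth \<phi>" "\<And>z. cmod z > R \<Longrightarrow> \<phi> z = 0" for \<phi> e
    by (rule ext pd_eqI)+ (rule conv_has_derivative[OF k smooth_C1], use that in auto)
  then show "pd e (conv k \<phi>) = conv k (pd e \<phi>)" using \<phi> R by blast
  show "smooth (conv k \<phi>)"
  proof (rule smooth_coinduct[of _ "{conv k \<phi> |\<phi>. smooth \<phi> \<and> (\<forall>z. cmod z > R \<longrightarrow> \<phi> z = 0)}"], goal_cases)
    case 1 then show ?case using \<phi> R by auto
  next
    case (2 g z)
    then obtain \<psi> where "g = conv k \<psi>" "smooth \<psi>" "\<And>z. cmod z > R \<Longrightarrow> \<psi> z = 0" by auto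
    then show ?case using conv_has_derivative[OF k smooth_C1] unfolding differentiable_def by blast
  next
    case (3 g)
    then obtain \<psi> where "g = conv k \<psi>" "smooth \<psi>" "\<And>z. cmod z > R \<Longrightarrow> \<psi> z = 0" by auto
    then show ?case using P[of \<psi> 1] smooth_pd[of \<psi> 1] pd_support[of R \<psi> _ 1] by auto
  next
    case (4 g)
    then obtain \<psi> where "g = conv k \<psi>" "smooth \<psi>" "\<And>z. cmod z > R \<Longrightarrow> \<psi> z = 0" by auto
    then show ?case using P[of \<psi> \<i>] smooth_pd[of \<psi> \<i>] pd_support[of R \<psi> _ \<i>] by auto
  qed
qed

section \<open>Continuity of translations in the mean\<close>

definition L1_continuous :: "(complex \<Rightarrow> complex) \<Rightarrow> bool"
  where "L1_continuous g \<longleftrightarrow> (\<forall>\<epsilon>>0. \<exists>d>0. \<forall>h. cmod h < d \<longrightarrow> (\<integral>w. cmod (g (w + h) - g w) \<partial>lborel) \<le> \<epsilon>)"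

lemma L1_continuous_approx:
  assumes f: "integrable lborel f"
    and ex: "\<And>\<epsilon>. \<epsilon> > 0 \<Longrightarrow> \<exists>s. integrable lborel s \<and> L1_continuous s \<and> (\<integral>w. cmod (s w - f w) \<partial>lborel) \<le> \<epsilon>"
  shows "L1_continuous f"
  unfolding L1_continuous_def
proof (intro allI impI)
  fix \<epsilon> :: real assume "\<epsilon> > 0"
  then obtain s where s: "integrable lborel s" "L1_continuous s" "(\<integral>w. cmod (s w - f w) \<partial>lborel) \<le> \<epsilon>/3"
    using ex[of "\<epsilon>/3"] by auto
  then obtain d where d: "d > 0" "\<And>h. cmod h < d \<Longrightarrow> (\<integral>w. cmod (s (w + h) - s w) \<partial>lborel) \<le> \<epsilon>/3"
    unfolding L1_continuous_def using \<open>\<epsilon> > 0\<close> by (metis divide_pos_pos zero_less_numeral)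
  have [measurable]: "s \<in> borel_measurable borel" "f \<in> borel_measurable borel"
    using s(1) f by auto
  have "(\<integral>w. cmod (f (w + h) - f w) \<partial>lborel) \<le> \<epsilon>" if h: "cmod h < d" for h
  proof -
    have i: "integrable lborel (\<lambda>w. f (w + h))" "integrable lborel (\<lambda>w. s (w + h))"
      using integrable_shift f s by auto
    have "(\<integral>w. cmod (f (w + h) - f w) \<partial>lborel) \<le>
      (\<integral>w. cmod (s (w + h) - f (w + h)) + cmod (s (w + h) - s w) + cmod (s w - f w) \<partial>lborel)"
    proof (rule integral_mono)
      fix w
      have "f (w + h) - f w = - (s (w + h) - f (w + h)) + (s (w + h) - s w) + (s w - f w)" by simp
      also have "cmod \<dots> \<le> cmod (s (w + h) - f (w + h)) + cmod (s (w + h) - s w) + cmod (s w - f w)"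
        by (intro norm_triangle_le add_mono) (auto simp: norm_minus_commute intro!: norm_triangle_ineq2 order_trans[OF norm_triangle_ineq])
      finally show "cmod (f (w + h) - f w) \<le> cmod (s (w + h) - f (w + h)) + cmod (s (w + h) - s w) + cmod (s w - f w)" .
    qed (use i f s in auto)
    also have "\<dots> = (\<integral>w. cmod (s (w + h) - f (w + h)) \<partial>lborel) + (\<integral>w. cmod (s (w + h) - s w) \<partial>lborel) + (\<integral>w. cmod (s w - f w) \<partial>lborel)"
      using i f s by simp
    also have "(\<integral>w. cmod (s (w + h) - f (w + h)) \<partial>lborel) = (\<integral>w. cmod (s w - f w) \<partial>lborel)"
      by (rule integral_shift[of "\<lambda>w. cmod (s w - f w)"]) measurable
    finally show ?thesis using s(3) d(2)[OF h] by simp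
  qed
  then show "\<exists>d>0. \<forall>h. cmod h < d \<longrightarrow> (\<integral>w. cmod (f (w + h) - f w) \<partial>lborel) \<le> \<epsilon>"
    using d(1) by blast
qed

lemma L1_continuous_lim:
  assumes s: "\<And>i::nat. integrable lborel (s i)" "\<And>i. L1_continuous (s i)"
    and lim: "\<And>x. (\<lambda>i. s i x) \<longlonglongrightarrow> f x" and G: "integrable lborel G" "\<And>i x. cmod (s i x) \<le> G x"
    and f: "integrable lborel f"
  shows "L1_continuous f"
proof (rule L1_continuous_approx[OF f])
  fix \<epsilon> :: real assume "\<epsilon> > 0"
  have "(\<lambda>i. \<integral>w. cmod (s i w - f w) \<partial>lborel) \<longlonglongrightarrow> (\<integral>w. 0 \<partial>(lborel :: complex measure))"
  proof (rule integral_dominated_convergence[where w="\<lambda>w. G w + cmod (f w)"])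
    show "AE x in lborel. (\<lambda>i. cmod (s i x - f x)) \<longlonglongrightarrow> 0"
      using lim by (auto intro!: tendsto_norm_zero LIM_zero)
    show "AE x in lborel. norm (cmod (s i x - f x)) \<le> G x + cmod (f x)" for i
      using G(2) by (auto intro!: order_trans[OF norm_triangle_ineq4] add_mono)
  qed (use s f G in auto)
  then have "\<forall>\<^sub>F i in sequentially. (\<integral>w. cmod (s i w - f w) \<partial>lborel) < \<epsilon>"
    using \<open>\<epsilon> > 0\<close> by (intro order_tendstoD) auto
  then obtain i where "(\<integral>w. cmod (s i w - f w) \<partial>lborel) < \<epsilon>" by (auto simp: eventually_sequentially)
  then show "\<exists>s. integrable lborel s \<and> L1_continuous s \<and> (\<integral>w. cmod (s w - f w) \<partial>lborel) \<le> \<epsilon>"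
    using s by (intro exI[of _ "s i"]) auto
qed

lemma L1_continuous_continuous:
  assumes g: "continuous_on UNIV g" "\<And>z. cmod z > R \<Longrightarrow> g z = 0"
  shows "L1_continuous g"
  unfolding L1_continuous_def
proof (intro allI impI)
  fix \<epsilon> :: real assume "\<epsilon> > 0"
  define M where "M = measure lborel (cball (0::complex) (R+1))"
  have "M \<ge> 0" by (simp add: M_def)
  then have "\<epsilon> / (M + 1) > 0" using \<open>\<epsilon> > 0\<close> by simp
  from uniformly_continuous_support[OF g this]
  obtain d where d: "d > 0" "\<And>z w. cmod (z - w) < d \<Longrightarrow> norm (g z - g w) < \<epsilon> / (M + 1)" by blast
  have int: "integrable lborel g" by (rule integrable_continuous_support[OF g])
  have ind: "integrable lborel (\<lambda>w::complex. \<epsilon> / (M + 1) * indicator (cball 0 (R+1)) w :: real)"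
    using emeasure_lborel_cball_finite[of "0::complex" "R+1"]
    by (intro integrable_mult_right integrable_real_indicator) (auto simp: less_top)
  have "(\<integral>w. cmod (g (w + h) - g w) \<partial>lborel) \<le> \<epsilon>" if h: "cmod h < min d 1" for h
  proof -
    have "(\<integral>w. cmod (g (w + h) - g w) \<partial>lborel) \<le> integral\<^sup>L lborel (\<lambda>w::complex. \<epsilon> / (M + 1) * indicator (cball 0 (R+1)) w)"
    proof (rule integral_mono)
      fix w
      show "cmod (g (w + h) - g w) \<le> \<epsilon> / (M + 1) * indicator (cball 0 (R+1)) w"
      proof (cases "w \<in> cball 0 (R+1)")
        case True then show ?thesis using d(2)[of "w + h" w] h by auto
      next
        case False
        then have "cmod w > R + 1" by simp
        moreover have "cmod w \<le> cmod (w + h) + cmod h" using norm_triangle_ineq4[of "w + h" h] by simp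
        ultimately have "cmod w > R" "cmod (w + h) > R" using h by auto
        then show ?thesis using g(2) False by simp
      qed
    qed (use int integrable_shift[OF int] ind in auto)
    also have "\<dots> = M / (M + 1) * \<epsilon>" by (simp add: M_def)
    also have "\<dots> \<le> 1 * \<epsilon>" using \<open>M \<ge> 0\<close> \<open>\<epsilon> > 0\<close> by (intro mult_right_mono) auto
    finally show ?thesis by simp
  qed
  then show "\<exists>d>0. \<forall>h. cmod h < d \<longrightarrow> (\<integral>w. cmod (g (w + h) - g w) \<partial>lborel) \<le> \<epsilon>"
    using d(1) by (intro exI[of _ "min d 1"]) auto
qed

text \<open>The indicator of a compact set is the pointwise limit of the continuous tents 1 - n
  dist(x, K), cut off at 0. They have bounded support and are dominated by one multiple of the
  indicator of a disc.\<close>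

lemma L1_continuous_compact:
  assumes K: "compact K" shows "L1_continuous (\<lambda>x. indicator K x *\<^sub>R c)"
proof (cases "K = {}")
  case True
  then show ?thesis by (auto simp: L1_continuous_def intro: exI[of _ 1])
next
  case False
  obtain R where R: "K \<subseteq> cball 0 R" using compact_subset_cball0[OF K] by blast
  define s where "s n x = max 0 (1 - real n * infdist x K) *\<^sub>R c" for n x
  \<comment> \<open>The index starts at 1 because \<open>s 0\<close> is the constant c and has no
    bounded support.\<close>
  have s0: "s (Suc n) x = 0" if "cmod x > R + 1" for n x
  proof -
    have "1 \<le> infdist x K"
    proof (rule cINF_greatest[of K 1 "\<lambda>a. dist x a", folded infdist_notempty[OF False]])
      fix a assume "a \<in> K"
      then have "cmod a \<le> R" using R by auto
      then show "1 \<le> dist x a" using that norm_triangle_ineq2[of x a] by (auto simp: dist_norm)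
    qed (use False in auto)
    then have "1 * 1 \<le> real (Suc n) * infdist x K" by (intro mult_mono) auto
    then show ?thesis by (simp add: s_def)
  qed
  have sc: "continuous_on UNIV (s n)" for n unfolding s_def by (intro continuous_intros)
  have sb: "cmod (s n x) \<le> cmod c" for n x
  proof -
    have "max 0 (1 - real n * infdist x K) \<le> 1" by (simp add: infdist_nonneg)
    then have "max 0 (1 - real n * infdist x K) * cmod c \<le> 1 * cmod c" by (intro mult_right_mono) auto
    then show ?thesis by (simp add: s_def)
  qed
  show ?thesis
  proof (rule L1_continuous_lim[where s="\<lambda>n. s (Suc n)" and G="\<lambda>x. cmod c * indicator (cball 0 (R+1)) x"])
    show "integrable lborel (s (Suc n))" "L1_continuous (s (Suc n))" for n
      using integrable_continuous_support[OF sc s0] L1_continuous_continuous[OF sc s0] by blast+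
    show "integrable lborel (\<lambda>x. cmod c * indicator (cball (0::complex) (R+1)) x)"
      using emeasure_lborel_cball_finite[of "0::complex" "R+1"]
      by (intro integrable_mult_right integrable_real_indicator) (auto simp: less_top)
    show "cmod (s (Suc i) x) \<le> cmod c * indicator (cball 0 (R+1)) x" for i x
      using sb s0 by (auto simp: indicator_def)
    show "integrable lborel (\<lambda>x. indicator K x *\<^sub>R c)"
      using K by (auto simp: compact_imp_closed borel_closed less_top intro!: integrable_scaleR_left integrable_real_indicator emeasure_compact_finite)
    fix x
    show "(\<lambda>i. s (Suc i) x) \<longlonglongrightarrow> indicator K x *\<^sub>R c"
    proof (cases "x \<in> K")
      case True then show ?thesis by (simp add: s_def)
    next
      case False
      then have pos: "infdist x K > 0"
        using K \<open>K \<noteq> {}\<close> by (simp add: infdist_pos_not_in_closed compact_imp_closed)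
      obtain N where N: "1 / infdist x K < real N" using reals_Archimedean2 by blast
      have "s (Suc i) x = 0" if "i \<ge> N" for i
      proof -
        have "1 / infdist x K \<le> real (Suc i)" using N that by simp
        then have "1 \<le> real (Suc i) * infdist x K" using pos by (simp add: divide_le_eq)
        then show ?thesis by (simp add: s_def)
      qed
      then have "\<forall>\<^sub>F i in sequentially. s (Suc i) x = 0" by (auto simp: eventually_sequentially)
      then show ?thesis using False by (simp add: tendsto_eventually)
    qed
  qed
qed

text \<open>Inner regularity replaces A by a closed subset T up to small measure, and T is the
  increasing limit of its intersections with discs, which are compact.\<close>

lemma L1_continuous_indicator:
  assumes A: "A \<in> sets borel" "emeasure lborel A < \<infinity>"
  shows "L1_continuous (\<lambda>x. indicator A x *\<^sub>R c)"
proof (rule L1_continuous_approx)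
  have fin: "integrable lborel (\<lambda>x. indicator B x *\<^sub>R c)" if "B \<subseteq> A" "B \<in> sets borel" for B
    using that A emeasure_mono[of B A lborel] 
    by (intro integrable_scaleR_left integrable_real_indicator) auto
  show "integrable lborel (\<lambda>x. indicator A x *\<^sub>R c)" using fin A by auto
  fix \<epsilon> :: real assume "\<epsilon> > 0"
  then have "\<epsilon> / (cmod c + 1) > 0" by (simp add: add_nonneg_pos)
  moreover have "A \<in> sets lebesgue" using A by (simp add: sets_completionI_sets)
  ultimately obtain T where T: "closed T" "T \<subseteq> A" "emeasure lebesgue (A - T) < ennreal (\<epsilon> / (cmod c + 1))"
    using sets_lebesgue_inner_closed by metis
  have Tm: "T \<in> sets borel" using T by auto
  have m: "emeasure lborel (A - T) < ennreal (\<epsilon> / (cmod c + 1))"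
    using T(3) A Tm by simp
  have L: "L1_continuous (\<lambda>x. indicator T x *\<^sub>R c)"
  proof (rule L1_continuous_lim[where s="\<lambda>n x. indicator (T \<inter> cball 0 (real n)) x *\<^sub>R c" and G="\<lambda>x. cmod (indicator T x *\<^sub>R c)"])
    show "integrable lborel (\<lambda>x. indicator (T \<inter> cball 0 (real i)) x *\<^sub>R c)" for i
      using fin[of "T \<inter> cball 0 (real i)"] T(2) Tm by auto
    show "L1_continuous (\<lambda>x. indicator (T \<inter> cball 0 (real i)) x *\<^sub>R c)" for i
      using T(1) by (intro L1_continuous_compact closed_Int_compact) auto
    fix x
    obtain N where N: "cmod x < real N" using reals_Archimedean2 by blast
    have "\<forall>\<^sub>F i in sequentially. indicator (T \<inter> cball 0 (real i)) x *\<^sub>R c = indicator T x *\<^sub>R c"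
      using N by (auto simp: eventually_sequentially indicator_def intro!: exI[of _ N])
    then show "(\<lambda>i. indicator (T \<inter> cball 0 (real i)) x *\<^sub>R c) \<longlonglongrightarrow> indicator T x *\<^sub>R c"
      by (rule tendsto_eventually)
    show "cmod (indicator (T \<inter> cball 0 (real i)) x *\<^sub>R c) \<le> cmod (indicator T x *\<^sub>R c)" for i x
      by (auto simp: indicator_def)
    show "integrable lborel (\<lambda>x. cmod (indicator T x *\<^sub>R c))"
      by (rule integrable_norm[OF fin[OF T(2) Tm]])
  qed (rule fin[OF T(2) Tm])
  have eq: "cmod (indicator T x *\<^sub>R c - indicator A x *\<^sub>R c) = indicator (A - T) x * cmod c" for x
    using T(2) by (auto simp: indicator_def)
  have "measure lborel (A - T) \<le> \<epsilon> / (cmod c + 1)"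
    using m \<open>\<epsilon> / (cmod c + 1) > 0\<close> unfolding measure_def
    by (intro enn2real_leI) auto
  then have "measure lborel (A - T) * cmod c \<le> \<epsilon> / (cmod c + 1) * cmod c" by (intro mult_right_mono) auto
  also have "\<dots> \<le> \<epsilon> / (cmod c + 1) * (cmod c + 1)" using \<open>\<epsilon> > 0\<close> by (intro mult_left_mono) auto
  also have "\<dots> = \<epsilon>" by (simp add: add_nonneg_eq_0_iff)
  finally have "(\<integral>w. cmod (indicator T w *\<^sub>R c - indicator A w *\<^sub>R c) \<partial>lborel) \<le> \<epsilon>"
    unfolding eq by simp
  then show "\<exists>s. integrable lborel s \<and> L1_continuous s \<and> (\<integral>w. cmod (s w - indicator A w *\<^sub>R c) \<partial>lborel) \<le> \<epsilon>"
    using L fin[OF T(2) Tm] by blast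
qed

lemma L1_continuous_integrable:
  assumes "integrable lborel g" shows "L1_continuous g"
  using assms
proof (induction rule: integrable_induct)
  case (base A c) then show ?case by (intro L1_continuous_indicator) auto
next
  case (add f g)
  show ?case unfolding L1_continuous_def
  proof (intro allI impI)
    fix \<epsilon> :: real assume "\<epsilon> > 0"
    then have e2: "\<epsilon>/2 > 0" by simp
    obtain d1 where d1: "d1 > 0" "\<And>h. cmod h < d1 \<Longrightarrow> (\<integral>w. cmod (f (w + h) - f w) \<partial>lborel) \<le> \<epsilon>/2"
      using add.IH(1)[unfolded L1_continuous_def, rule_format, OF e2] by blast
    obtain d2 where d2: "d2 > 0" "\<And>h. cmod h < d2 \<Longrightarrow> (\<integral>w. cmod (g (w + h) - g w) \<partial>lborel) \<le> \<epsilon>/2"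
      using add.IH(2)[unfolded L1_continuous_def, rule_format, OF e2] by blast
    have "(\<integral>w. cmod (f (w + h) + g (w + h) - (f w + g w)) \<partial>lborel) \<le> \<epsilon>" if "cmod h < min d1 d2" for h
    proof -
      have "(\<integral>w. cmod (f (w + h) + g (w + h) - (f w + g w)) \<partial>lborel)
         \<le> (\<integral>w. cmod (f (w + h) - f w) + cmod (g (w + h) - g w) \<partial>lborel)"
        using add.hyps integrable_shift[OF add.hyps(1), of h] integrable_shift[OF add.hyps(2), of h]
        by (intro integral_mono) (auto intro: norm_diff_triangle_ineq)
      also have "\<dots> = (\<integral>w. cmod (f (w + h) - f w) \<partial>lborel) + (\<integral>w. cmod (g (w + h) - g w) \<partial>lborel)"
        using add.hyps integrable_shift[OF add.hyps(1), of h] integrable_shift[OF add.hyps(2), of h] by simp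
      finally show ?thesis using d1(2)[of h] d2(2)[of h] that by simp
    qed
    then show "\<exists>d>0. \<forall>h. cmod h < d \<longrightarrow> (\<integral>w. cmod (f (w + h) + g (w + h) - (f w + g w)) \<partial>lborel) \<le> \<epsilon>"
      using d1(1) d2(1) by (intro exI[of _ "min d1 d2"]) auto
  qed
next
  case (lim f s)
  show ?case
    by (rule L1_continuous_lim[where s=s and G="\<lambda>x. 2 * cmod (f x)"]) (use lim in auto)
qed

section \<open>Mollification\<close>

lemma exists_mollifier:
  assumes "e > 0"
  shows "\<exists>\<eta> :: complex \<Rightarrow> real. smooth (\<lambda>z. of_real (\<eta> z)) \<and> (\<forall>z. \<eta> z \<ge> 0) \<and>
    (\<forall>z. cmod z \<ge> e \<longrightarrow> \<eta> z = 0) \<and> (\<integral>z. \<eta> z \<partial>lborel) = 1"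
proof -
  obtain b :: "complex \<Rightarrow> real" where b: "smooth (\<lambda>z. of_real (b z))" "\<And>z. b z \<ge> 0"
    "\<And>z. cmod z < e \<Longrightarrow> b z > 0" "\<And>z. cmod z \<ge> e \<Longrightarrow> b z = 0"
    using exists_bump[OF assms] by metis
  have "continuous_on UNIV (\<lambda>z. Re (of_real (b z)))"
    by (intro continuous_on_Re smooth_continuous[OF b(1)])
  then have cb: "continuous_on UNIV b" by simp
  have int: "integrable lborel b"
    by (rule integrable_continuous_support[OF cb, of e]) (use b in auto)
  define M where "M = (\<integral>z. b z \<partial>lborel)"
  have "M \<noteq> 0"
  proof
    assume "M = 0"
    then have "AE z in lborel. b z = 0"
      using integral_nonneg_eq_0_iff_AE[OF int] b(2) by (simp add: M_def)
    then have "AE z::complex in lborel. z \<notin> ball 0 e"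
    proof eventually_elim
      case (elim z) then show ?case using b(3)[of z] by (auto simp: dist_norm)
    qed
    then have "ball (0::complex) e \<in> null_sets lborel"
      by (subst AE_iff_null_sets) auto
    then have "negligible (ball (0::complex) e)"
      by (simp add: negligible_iff_null_sets null_sets_completionI)
    then show False using open_not_negligible[of "ball (0::complex) e"] assms by simp
  qed
  moreover have "M \<ge> 0" unfolding M_def by (simp add: b)
  ultimately have M: "M > 0" by simp
  show ?thesis
  proof (intro exI[of _ "\<lambda>z. b z / M"] conjI)
    show "smooth (\<lambda>z. of_real (b z / M))"
      using smooth_mult[OF smooth_const[of "of_real (1/M)"] b(1)] by (simp add: field_simps)
    show "(\<integral>z. b z / M \<partial>lborel) = 1" using M by (simp add: M_def)
  qed (use b M in auto)
qed

definition mollifier :: "real \<Rightarrow> complex \<Rightarrow> real"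
  where "mollifier e = (SOME \<eta>. smooth (\<lambda>z. of_real (\<eta> z)) \<and> (\<forall>z. \<eta> z \<ge> 0) \<and>
    (\<forall>z. cmod z \<ge> e \<longrightarrow> \<eta> z = 0) \<and> (\<integral>z. \<eta> z \<partial>lborel) = 1)"

lemma mollifier:
  assumes "e > 0"
  shows "smooth (\<lambda>z. of_real (mollifier e z))" "mollifier e z \<ge> 0"
    "cmod z \<ge> e \<Longrightarrow> mollifier e z = 0" "(\<integral>z. mollifier e z \<partial>lborel) = 1"
  using someI_ex[OF exists_mollifier[OF assms]] unfolding mollifier_def[symmetric] by blast+

lemma mollifier_continuous:
  assumes "e > 0" shows "continuous_on UNIV (mollifier e)"
proof -
  have "continuous_on UNIV (\<lambda>z. Re (of_real (mollifier e z)))"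
    by (intro continuous_on_Re smooth_continuous mollifier assms)
  then show ?thesis by simp
qed

lemma mollifier_integrable: "e > 0 \<Longrightarrow> integrable lborel (mollifier e)"
  by (rule integrable_continuous_support[OF mollifier_continuous, of e e]) (auto simp: mollifier)

definition mol :: "real \<Rightarrow> (complex \<Rightarrow> complex) \<Rightarrow> complex \<Rightarrow> complex"
  where "mol e g = conv g (\<lambda>z. of_real (mollifier e z))"

lemma mol_zero_support: "e > 0 \<Longrightarrow> cmod z > e \<Longrightarrow> complex_of_real (mollifier e z) = 0"
  by (simp add: mollifier)

lemma smooth_mol: "locint UNIV g \<Longrightarrow> e > 0 \<Longrightarrow> smooth (mol e g)"
  unfolding mol_def by (rule smooth_conv[of g _ e]) (auto simp: mollifier)

lemma pd_mol: "locint UNIV g \<Longrightarrow> e > 0 \<Longrightarrow> pd h (mol e g) = conv g (pd h (\<lambda>z. of_real (mollifier e z)))"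
  unfolding mol_def by (rule pd_conv[of g _ e]) (auto simp: mollifier)

lemma mollifier_reflect_test:
  assumes "e > 0" "cball z e \<subseteq> \<Omega>"
  shows "(\<lambda>w. of_real (mollifier e (z - w))) \<in> test_fun \<Omega>"
  by (rule test_funI[of _ "cball z e"])
     (use assms in \<open>auto simp: mollifier dist_norm intro: smooth_reflect[OF mollifier(1)]\<close>)

lemma locint_reflect_integrable:
  assumes "locint UNIV g" "continuous_on UNIV \<phi>" "\<And>z. cmod z > R \<Longrightarrow> \<phi> z = 0"
  shows "integrable lborel (\<lambda>w. g (z - w) * \<phi> w)"
proof -
  have "integrable lborel (\<lambda>w. g w * \<phi> (z - w))" by (rule conv_integrable[OF assms])
  from integrable_reflect[OF this, of z] show ?thesis by simp
qed

lemma conv_commute: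
  assumes "locint UNIV g" "continuous_on UNIV \<phi>"
  shows "conv g \<phi> z = (\<integral>w. g (z - w) * \<phi> w \<partial>lborel)"
proof -
  have [measurable]: "g \<in> borel_measurable borel" "\<phi> \<in> borel_measurable borel"
    using assms by (auto intro: borel_measurable_continuous_onI locint_measurable)
  have "conv g \<phi> z = (\<integral>w. (\<lambda>w. g (z - w) * \<phi> w) (z - w) \<partial>lborel)" by (simp add: conv_def)
  also have "\<dots> = (\<integral>w. g (z - w) * \<phi> w \<partial>lborel)" by (rule integral_reflect) measurable
  finally show ?thesis .
qed

lemma mol_diff:
  assumes "locint UNIV g" "e > 0"
  shows "mol e g z - c = (\<integral>w. (g (z - w) - c) * of_real (mollifier e w) \<partial>lborel)"
    and "integrable lborel (\<lambda>w. (g (z - w) - c) * of_real (mollifier e w))"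
proof -
  have c: "continuous_on UNIV (\<lambda>w. complex_of_real (mollifier e w))"
    by (intro smooth_continuous mollifier assms)
  have i: "integrable lborel (\<lambda>w. g (z - w) * of_real (mollifier e w))"
    by (rule locint_reflect_integrable[OF assms(1) c mol_zero_support[OF assms(2)]])
  have i2: "integrable lborel (\<lambda>w. c * complex_of_real (mollifier e w))"
    using mollifier_integrable[OF assms(2)] by (intro integrable_mult_right integrable_of_real)
  have "(\<integral>w. complex_of_real (mollifier e w) \<partial>lborel) = of_real (\<integral>w. mollifier e w \<partial>lborel)"
    by (rule integral_complex_of_real)
  then have "(\<integral>w. c * complex_of_real (mollifier e w) \<partial>lborel) = c" using mollifier(4)[OF assms(2)] by simp
  then show "mol e g z - c = (\<integral>w. (g (z - w) - c) * of_real (mollifier e w) \<partial>lborel)"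
    unfolding mol_def conv_commute[OF assms(1) c] left_diff_distrib using i i2 by simp
  show "integrable lborel (\<lambda>w. (g (z - w) - c) * of_real (mollifier e w))"
    unfolding left_diff_distrib using i i2 by simp
qed

text \<open>As the mollifier has mass 1, the mollified value minus c is an average of g(z - w) - c
  over |w| < e. The free constant gives the lemma several uses: c = g z for convergence, c = 0 for
  bounds and for vanishing, c = 1 for the plateau of a cut-off.\<close>

lemma mol_diff_le:
  assumes "locint UNIV g" "e > 0" "\<And>w. cmod w < e \<Longrightarrow> cmod (g (z - w) - c) \<le> B"
  shows "cmod (mol e g z - c) \<le> B"
proof -
  have "cmod (mol e g z - c) \<le> (\<integral>w. B * mollifier e w \<partial>lborel)"
    unfolding mol_diff(1)[OF assms(1,2)]
  proof (rule norm_integral_le[OF mol_diff(2)[OF assms(1,2)]])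
    show "integrable lborel (\<lambda>w. B * mollifier e w)" using mollifier_integrable[OF assms(2)] by simp
    fix w show "cmod ((g (z - w) - c) * of_real (mollifier e w)) \<le> B * mollifier e w"
      using assms(3)[of w] mollifier(2,3)[OF assms(2), of w]
      by (cases "cmod w < e") (auto simp: norm_mult intro: mult_right_mono)
  qed
  then show ?thesis by (simp add: mollifier(4)[OF assms(2)])
qed

lemma mol_bounded:
  assumes "locint UNIV g" "e > 0" "\<And>w. cmod (g w) \<le> B"
  shows "cmod (mol e g z) \<le> B"
  using mol_diff_le[where c = 0 and z = z and B = B, OF assms(1,2)] assms(3) by simp

text \<open>Minkowski's integral inequality by Tonelli: the mean error of the mollification is an
  average, with weight \<open>mollifier e w\<close>, of the translation errors by -w, and only |w| <
  e contributes.\<close>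

lemma mol_L1_le:
  assumes g: "integrable lborel g" and e: "e > 0"
    and d: "\<And>h. cmod h < e \<Longrightarrow> (\<integral>w. cmod (g (w + h) - g w) \<partial>lborel) \<le> \<epsilon>"
  shows "integrable lborel (mol e g)" "(\<integral>z. cmod (mol e g z - g z) \<partial>lborel) \<le> \<epsilon>"
proof -
  have loc: "locint UNIV g" by (rule integrable_imp_locint[OF g])
  have gm [measurable]: "g \<in> borel_measurable borel" using g by auto
  have mm [measurable]: "mollifier e \<in> borel_measurable borel"
    by (intro borel_measurable_continuous_onI mollifier_continuous e)
  have \<epsilon>: "\<epsilon> \<ge> 0" using d[of 0] e by simp
  have [measurable]: "mol e g \<in> borel_measurable borel"
    by (intro borel_measurable_continuous_onI smooth_continuous smooth_mol loc e)
  have "(\<integral>\<^sup>+z. ennreal (cmod (mol e g z - g z)) \<partial>lborel) \<le>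
     (\<integral>\<^sup>+z. \<integral>\<^sup>+w. ennreal (cmod ((g (z - w) - g z) * of_real (mollifier e w))) \<partial>lborel \<partial>lborel)"
    unfolding mol_diff(1)[OF loc e]
    by (intro nn_integral_mono order_trans[OF ennreal_leI[OF integral_norm_bound]])
       (simp add: nn_integral_eq_integral[symmetric] mol_diff(2)[OF loc e] integrable_norm)
  also have "\<dots> = (\<integral>\<^sup>+w. \<integral>\<^sup>+z. ennreal (cmod ((g (z - w) - g z) * of_real (mollifier e w))) \<partial>lborel \<partial>lborel)"
    by (rule lborel_pair.Fubini') measurable
  also have "\<dots> \<le> (\<integral>\<^sup>+w. ennreal (\<epsilon> * mollifier e w) \<partial>lborel)"
  proof (rule nn_integral_mono)
    fix w
    have i: "integrable lborel (\<lambda>z. cmod (g (z + - w) - g z))"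
      using g integrable_shift[OF g, of "- w"] by auto
    have "(\<integral>\<^sup>+z. ennreal (cmod ((g (z - w) - g z) * of_real (mollifier e w))) \<partial>lborel)
       = (\<integral>\<^sup>+z. ennreal (mollifier e w) * ennreal (cmod (g (z + - w) - g z)) \<partial>lborel)"
      using mollifier(2)[OF e] by (simp add: norm_mult ennreal_mult'[symmetric] mult.commute)
    also have "\<dots> = ennreal (mollifier e w) * (\<integral>\<^sup>+z. ennreal (cmod (g (z + - w) - g z)) \<partial>lborel)"
      by (rule nn_integral_cmult) measurable
    also have "(\<integral>\<^sup>+z. ennreal (cmod (g (z + - w) - g z)) \<partial>lborel) = ennreal (\<integral>z. cmod (g (z + - w) - g z) \<partial>lborel)"
      by (rule nn_integral_eq_integral[OF i]) simp
    also have "ennreal (mollifier e w) * \<dots> \<le> ennreal (\<epsilon> * mollifier e w)"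
    proof (cases "cmod w < e")
      case True
      then have "(\<integral>z. cmod (g (z + - w) - g z) \<partial>lborel) \<le> \<epsilon>" by (intro d) simp
      then show ?thesis using mollifier(2)[OF e, of w] \<epsilon>
        by (auto simp: ennreal_mult'[symmetric] mult.commute[of \<epsilon>] intro!: ennreal_leI mult_left_mono)
    next
      case False then show ?thesis using mollifier(3)[OF e, of w] by simp
    qed
    finally show "(\<integral>\<^sup>+z. ennreal (cmod ((g (z - w) - g z) * of_real (mollifier e w))) \<partial>lborel) \<le> ennreal (\<epsilon> * mollifier e w)" .
  qed
  also have "\<dots> = ennreal (\<integral>w. \<epsilon> * mollifier e w \<partial>lborel)"
    using mollifier_integrable[OF e] mollifier(2)[OF e] \<epsilon> by (intro nn_integral_eq_integral) auto
  also have "\<dots> = ennreal \<epsilon>" by (simp add: mollifier(4)[OF e])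
  finally have le: "(\<integral>\<^sup>+z. ennreal (cmod (mol e g z - g z)) \<partial>lborel) \<le> ennreal \<epsilon>" .
  then have int: "integrable lborel (\<lambda>z. mol e g z - g z)"
    by (intro integrableI_bounded) (auto simp: less_top top.not_eq_extremum intro: le_less_trans)
  from Bochner_Integration.integrable_add[OF this g] show "integrable lborel (mol e g)" by simp
  have "ennreal (\<integral>z. cmod (mol e g z - g z) \<partial>lborel) \<le> ennreal \<epsilon>"
    using le int by (simp add: nn_integral_eq_integral integrable_norm)
  then show "(\<integral>z. cmod (mol e g z - g z) \<partial>lborel) \<le> \<epsilon>" using \<epsilon> by simp
qed

text \<open>Integrability of the mollification is stated only from some N on, since
  \<open>mol_L1_le\<close> provides it together with an error bound once the radius is below the
  modulus of continuity of translations.\<close>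

lemma mol_L1:
  assumes g: "integrable lborel g"
  shows "(\<lambda>n. \<integral>z. cmod (mol (1 / real (Suc n)) g z - g z) \<partial>lborel) \<longlonglongrightarrow> 0"
    and "\<exists>N. \<forall>n\<ge>N. integrable lborel (mol (1 / real (Suc n)) g)"
proof -
  have ev: "\<exists>N. \<forall>n\<ge>N. integrable lborel (mol (1 / real (Suc n)) g) \<and> (\<integral>z. cmod (mol (1 / real (Suc n)) g z - g z) \<partial>lborel) \<le> \<epsilon>"
    if "\<epsilon> > 0" for \<epsilon> :: real
  proof -
    obtain d where d: "d > 0" "\<And>h. cmod h < d \<Longrightarrow> (\<integral>w. cmod (g (w + h) - g w) \<partial>lborel) \<le> \<epsilon>"
      using L1_continuous_integrable[OF g] \<open>\<epsilon> > 0\<close> unfolding L1_continuous_def by blast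
    obtain N where N: "inverse (real (Suc N)) < d" using reals_Archimedean[OF d(1)] by blast
    have "1 / real (Suc n) < d" if "n \<ge> N" for n
    proof -
      have "1 / real (Suc n) \<le> 1 / real (Suc N)" using that by (intro divide_left_mono) auto
      then show ?thesis using N by (simp add: inverse_eq_divide)
    qed
    then have "cmod h < d" if "n \<ge> N" "cmod h < 1 / real (Suc n)" for n and h :: complex
      using that less_trans by blast
    then show ?thesis
      using mol_L1_le[OF g, of "1 / real (Suc n)" \<epsilon> for n] d(2) by (intro exI[of _ N]) simp
  qed
  then show "\<exists>N. \<forall>n\<ge>N. integrable lborel (mol (1 / real (Suc n)) g)"
    using zero_less_one by blast
  show "(\<lambda>n. \<integral>z. cmod (mol (1 / real (Suc n)) g z - g z) \<partial>lborel) \<longlonglongrightarrow> 0"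
    unfolding LIMSEQ_iff
  proof (intro allI impI)
    fix r :: real assume "r > 0"
    then obtain N where "\<forall>n\<ge>N. (\<integral>z. cmod (mol (1 / real (Suc n)) g z - g z) \<partial>lborel) \<le> r/2"
      using ev[of "r/2"] by auto
    then show "\<exists>N. \<forall>n\<ge>N. norm ((\<integral>z. cmod (mol (1 / real (Suc n)) g z - g z) \<partial>lborel) - 0) < r"
      using \<open>r > 0\<close> by (intro exI[of _ N]) (fastforce simp: abs_of_nonneg)
  qed
qed

section \<open>The fundamental lemma and cut-off functions\<close>

lemma compact_nbhd:
  fixes K :: "complex set"
  assumes "compact K" "open \<Omega>" "K \<subseteq> \<Omega>"
  obtains d K' where "d > 0" "compact K'" "K' \<subseteq> \<Omega>" "\<And>z. z \<in> K \<Longrightarrow> cball z d \<subseteq> K'"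
proof -
  obtain e where e: "e > 0" "(\<Union>x\<in>K. ball x e) \<subseteq> \<Omega>"
    using compact_subset_open_imp_ball_epsilon_subset[OF assms] by blast
  let ?K' = "{x + y |x y. x \<in> K \<and> y \<in> cball 0 (e/2)}"
  show ?thesis
  proof (rule that[of "e/2" ?K'])
    show "compact ?K'" by (intro compact_sums assms) auto
    show "?K' \<subseteq> \<Omega>"
    proof safe
      fix x y assume "x \<in> K" "y \<in> cball (0::complex) (e/2)"
      then have "x + y \<in> ball x e" using e by (auto simp: dist_norm)
      then show "x + y \<in> \<Omega>" using e \<open>x \<in> K\<close> by blast
    qed
    fix z assume "z \<in> K"
    show "cball z (e/2) \<subseteq> ?K'"
    proof
      fix w assume "w \<in> cball z (e/2)"
      then have "w = z + (w - z)" "w - z \<in> cball 0 (e/2)" by (auto simp: dist_norm norm_minus_commute)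
      then show "w \<in> ?K'" using \<open>z \<in> K\<close> by blast
    qed
  qed (use e in auto)
qed

text \<open>Testing with reflected mollifiers says that the mollifications of g, cut off to a
  neighbourhood K' of K, vanish on K for all small radii. They also converge in the mean, so g has
  mean 0 in absolute value over K; countably many compact sets exhaust \<Omega>.\<close>

lemma fundamental_lemma:
  assumes "open \<Omega>" and g: "locint \<Omega> g" and z: "\<And>\<phi>. \<phi> \<in> test_fun \<Omega> \<Longrightarrow> (\<integral>z. g z * \<phi> z \<partial>lborel) = 0"
  shows "AE z in lborel. z \<in> \<Omega> \<longrightarrow> g z = 0"
proof -
  have *: "AE z in lborel. z \<in> K \<longrightarrow> g z = 0" if K: "compact K" "K \<subseteq> \<Omega>" for K
  proof -
    obtain d K' where d: "d > 0" "compact K'" "K' \<subseteq> \<Omega>" "\<And>z. z \<in> K \<Longrightarrow> cball z d \<subseteq> K'"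
      using compact_nbhd[OF K(1) assms(1) K(2)] by metis
    define h where "h z = indicator K' z * g z" for z
    have h: "integrable lborel h" unfolding h_def by (rule locint_integrable[OF g d(2,3)])
    have loc: "locint UNIV h" by (rule integrable_imp_locint[OF h])
    have m0: "mol e h z = 0" if "e > 0" "e \<le> d" "z \<in> K" for e z
    proof -
      have sub: "cball z e \<subseteq> K'" using d(4)[OF that(3)] that(2) by auto
      have "(\<integral>w. g w * of_real (mollifier e (z - w)) \<partial>lborel) = 0"
        by (rule z[OF mollifier_reflect_test]) (use that sub d in auto)
      moreover have "h w * of_real (mollifier e (z - w)) = g w * of_real (mollifier e (z - w))" for w
        using sub mollifier(3)[OF that(1), of "z - w"]
        by (cases "w \<in> cball z e") (auto simp: h_def dist_norm)
      ultimately show ?thesis by (simp only: mol_def conv_def)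
    qed
    have hK: "integrable lborel (\<lambda>z. indicator K z * h z)"
      by (rule locint_integrable[OF loc K(1)]) simp
    obtain N where N: "\<And>n. n \<ge> N \<Longrightarrow> integrable lborel (mol (1 / real (Suc n)) h)"
      using mol_L1(2)[OF h] by blast
    obtain N2 where N2: "inverse (real (Suc N2)) < d" using reals_Archimedean[OF d(1)] by blast
    have le: "(\<integral>z. cmod (indicator K z * h z) \<partial>lborel) \<le> (\<integral>z. cmod (mol (1 / real (Suc n)) h z - h z) \<partial>lborel)"
      if "n \<ge> max N N2" for n
    proof (rule integral_mono)
      show "integrable lborel (\<lambda>z. cmod (indicator K z * h z))" using hK by simp
      show "integrable lborel (\<lambda>z. cmod (mol (1 / real (Suc n)) h z - h z))" using N[of n] h that by auto
      have "1 / real (Suc n) \<le> 1 / real (Suc N2)" using that by (intro divide_left_mono) auto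
      then have "1 / real (Suc n) \<le> d" using N2 by (simp add: inverse_eq_divide)
      then show "cmod (indicator K z * h z) \<le> cmod (mol (1 / real (Suc n)) h z - h z)" for z
        using m0[of "1 / real (Suc n)" z] by (cases "z \<in> K") auto
    qed
    have "(\<integral>z. cmod (indicator K z * h z) \<partial>lborel) \<le> 0"
      by (rule LIMSEQ_le_const[OF mol_L1(1)[OF h]]) (use le in blast)
    then have "(\<integral>z. cmod (indicator K z * h z) \<partial>lborel) = 0" by (simp add: antisym)
    then have "AE z in lborel. cmod (indicator K z * h z) = 0"
      using integral_nonneg_eq_0_iff_AE[of lborel "\<lambda>z. cmod (indicator K z * h z)"] hK by auto
    moreover have "K \<subseteq> K'" using d(1,4) by force
    ultimately show ?thesis by (auto simp: h_def indicator_def elim!: eventually_mono)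
  qed
  obtain C :: "nat \<Rightarrow> complex set" where C: "\<And>n. compact (C n)" "\<And>n. C n \<subseteq> \<Omega>" "\<Union>(range C) = \<Omega>"
    using open_Union_compact_subsets[OF assms(1)] by metis
  have "AE z in lborel. \<forall>n. z \<in> C n \<longrightarrow> g z = 0"
    unfolding AE_all_countable using *[OF C(1,2)] by blast
  then show ?thesis by (rule eventually_mono) (use C(3) in blast)
qed

text \<open>The indicator of a middle set K' is mollified. A margin d between K and K' makes the
  result 1 on K, a margin e between K' and K2 keeps its support in K2, and the radius is the smaller
  of the two margins.\<close>

lemma cutoff:
  assumes "compact K" "open \<Omega>" "K \<subseteq> \<Omega>"
  obtains \<kappa> where "\<kappa> \<in> test_fun \<Omega>" "\<And>z. z \<in> K \<Longrightarrow> \<kappa> z = 1" "\<And>z. cmod (\<kappa> z) \<le> 1"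
proof -
  obtain d K' where d: "d > 0" "compact K'" "K' \<subseteq> \<Omega>" "\<And>z. z \<in> K \<Longrightarrow> cball z d \<subseteq> K'"
    using compact_nbhd[OF assms] by metis
  obtain e K2 where e: "e > 0" "compact K2" "K2 \<subseteq> \<Omega>" "\<And>z. z \<in> K' \<Longrightarrow> cball z e \<subseteq> K2"
    using compact_nbhd[OF d(2) assms(2) d(3)] by metis
  define r where "r = min d e"
  have r: "r > 0" using d e by (simp add: r_def)
  define k where "k z = complex_of_real (indicator K' z)" for z
  have "integrable lborel k" unfolding k_def
    using d(2) by (intro integrable_of_real integrable_real_indicator)
      (use emeasure_compact_finite[OF d(2)] in \<open>auto simp: compact_imp_closed borel_closed\<close>)
  then have k: "locint UNIV k" by (rule integrable_imp_locint)
  show ?thesis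
  proof (rule that[of "mol r k"])
    show "mol r k \<in> test_fun \<Omega>"
    proof (rule test_funI[OF smooth_mol[OF k r] e(2,3)])
      fix z assume z: "z \<notin> K2"
      have "cmod (mol r k z - 0) \<le> 0"
      proof (rule mol_diff_le[OF k r])
        fix w assume "cmod w < r"
        then have "z \<in> cball (z - w) e" by (auto simp: dist_norm r_def)
        then have "z - w \<notin> K'" using e(4)[of "z - w"] z by blast
        then show "cmod (k (z - w) - 0) \<le> 0" by (simp add: k_def)
      qed
      then show "mol r k z = 0" by simp
    qed
    show "cmod (mol r k z) \<le> 1" for z
      by (rule mol_bounded[OF k r]) (auto simp: k_def indicator_def)
    fix z assume z: "z \<in> K"
    have "cmod (mol r k z - 1) \<le> 0"
    proof (rule mol_diff_le[OF k r])
      fix w assume "cmod w < r"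
      then have "z - w \<in> cball z d" by (auto simp: dist_norm r_def)
      then have "z - w \<in> K'" using d(4)[OF z] by auto
      then show "cmod (k (z - w) - 1) \<le> 0" by (simp add: k_def)
    qed
    then show "mol r k z = 1" by simp
  qed
qed

section \<open>Weak derivatives\<close>

text \<open>The Borel counterpart of \<open>weak_pd\<close>. The integrals may run over the whole
  plane because a test function and its derivatives vanish off \<Omega>, so values of g and h
  outside \<Omega> do not matter.\<close>

definition wd :: "complex \<Rightarrow> complex set \<Rightarrow> (complex \<Rightarrow> complex) \<Rightarrow> (complex \<Rightarrow> complex) \<Rightarrow> bool"
  where "wd e \<Omega> g h \<longleftrightarrow> locint \<Omega> g \<and> locint \<Omega> h \<and>
    (\<forall>\<phi>\<in>test_fun \<Omega>. (\<integral>z. g z * pd e \<phi> z \<partial>lborel) = - (\<integral>z. h z * \<phi> z \<partial>lborel))"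

lemma wdD:
  assumes "wd e \<Omega> g h"
  shows "locint \<Omega> g" "locint \<Omega> h"
    "\<phi> \<in> test_fun \<Omega> \<Longrightarrow> (\<integral>z. g z * pd e \<phi> z \<partial>lborel) = - (\<integral>z. h z * \<phi> z \<partial>lborel)"
  using assms by (auto simp: wd_def)

lemma locint_add: "locint \<Omega> g \<Longrightarrow> locint \<Omega> h \<Longrightarrow> locint \<Omega> (\<lambda>z. g z + h z)"
  by (auto simp: locint_def distrib_left)
lemma locint_diff: "locint \<Omega> g \<Longrightarrow> locint \<Omega> h \<Longrightarrow> locint \<Omega> (\<lambda>z. g z - h z)"
  by (auto simp: locint_def right_diff_distrib)
lemma locint_cmult: "locint \<Omega> g \<Longrightarrow> locint \<Omega> (\<lambda>z. c * g z)"
proof -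
  assume "locint \<Omega> g"
  moreover have "(\<lambda>z. indicator K z * (c * g z)) = (\<lambda>z. c * (indicator K z * g z))" for K
    by (auto simp: mult_ac)
  ultimately show ?thesis by (auto simp: locint_def)
qed

lemma locint_mult_bdd:
  assumes "locint \<Omega> g" "b \<in> borel_measurable borel" "\<And>z. cmod (b z) \<le> B"
  shows "locint \<Omega> (\<lambda>z. b z * g z)"
  unfolding locint_def
proof (intro conjI allI impI)
  show "(\<lambda>z. b z * g z) \<in> borel_measurable borel"
    using assms(2) locint_measurable[OF assms(1)] by simp
  fix K assume K: "compact K" "K \<subseteq> \<Omega>"
  then have Kb: "K \<in> sets borel" by (simp add: compact_imp_closed borel_closed)
  have "B \<ge> 0" using assms(3) norm_ge_zero order_trans by blast
  have "integrable lborel (\<lambda>z. g z * (indicator K z * b z))"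
    by (rule locint_mult_integrable[OF assms(1) K, of _ B])
       (use assms(2,3) Kb \<open>B \<ge> 0\<close> in \<open>auto simp: norm_mult indicator_def\<close>)
  then show "integrable lborel (\<lambda>z. indicator K z * (b z * g z))" by (simp add: mult_ac)
qed

lemma locint_bdd:
  assumes "b \<in> borel_measurable borel" "\<And>z. cmod (b z) \<le> B" shows "locint \<Omega> b"
  unfolding locint_def
proof (intro conjI allI impI)
  fix K assume K: "compact K" "K \<subseteq> \<Omega>"
  then have Kb: "K \<in> sets borel" by (simp add: compact_imp_closed borel_closed)
  obtain R where R: "K \<subseteq> cball 0 R" using compact_subset_cball0[OF K(1)] by blast
  have "B \<ge> 0" using assms(2) norm_ge_zero order_trans by blast
  show "integrable lborel (\<lambda>z. indicator K z * b z)"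
  proof (rule integrable_bdd_support[of _ B R])
    show "norm (indicator K z * b z) \<le> B" for z
      using assms(2)[of z] \<open>B \<ge> 0\<close> by (auto simp: norm_mult indicator_def)
    show "indicator K z * b z = 0" if "cmod z > R" for z
    proof -
      have "z \<notin> K" using R that by auto
      then show ?thesis by simp
    qed
  qed (use assms Kb in simp)
qed (rule assms)

lemma locint_continuous:
  assumes "continuous_on \<Omega> b" "b \<in> borel_measurable borel" shows "locint \<Omega> b"
  unfolding locint_def
proof (intro conjI allI impI)
  fix K assume K: "compact K" "K \<subseteq> \<Omega>"
  have "integrable lborel (\<lambda>x. indicator K x *\<^sub>R b x)"
    by (rule borel_integrable_compact[OF K(1)]) (use assms(1) K(2) continuous_on_subset in blast)
  then show "integrable lborel (\<lambda>z. indicator K z * b z)"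
    by (rule Bochner_Integration.integrable_cong[THEN iffD1, rotated 2]) (auto simp: indicator_def)
qed (rule assms)

lemma continuous_on_open_borel:
  fixes g :: "complex \<Rightarrow> complex"
  assumes "open \<Omega>" "continuous_on \<Omega> g" shows "(\<lambda>z. if z \<in> \<Omega> then g z else 0) \<in> borel_measurable borel"
proof -
  have "(\<lambda>z. indicator \<Omega> z *\<^sub>R g z) \<in> borel_measurable borel"
    using assms by (intro borel_measurable_continuous_on_indicator) auto
  moreover have "(\<lambda>z. indicator \<Omega> z *\<^sub>R g z) = (\<lambda>z. if z \<in> \<Omega> then g z else 0)"
    by (auto simp: indicator_def)
  ultimately show ?thesis by simp
qed

lemma wd_unique:
  assumes "open \<Omega>" "wd e \<Omega> g h" "wd e \<Omega> g h'"
  shows "AE z in lborel. z \<in> \<Omega> \<longrightarrow> h z = h' z"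
proof -
  note w = wdD[OF assms(2)] wdD[OF assms(3)]
  have "AE z in lborel. z \<in> \<Omega> \<longrightarrow> h z - h' z = 0"
  proof (rule fundamental_lemma[OF assms(1) locint_diff[OF w(2,5)]])
    fix \<phi> assume \<phi>: "\<phi> \<in> test_fun \<Omega>"
    show "(\<integral>z. (h z - h' z) * \<phi> z \<partial>lborel) = 0"
      using w(3,6)[OF \<phi>] locint_mult_test[OF w(2) \<phi>] locint_mult_test[OF w(5) \<phi>]
      by (simp add: left_diff_distrib)
  qed
  then show ?thesis by simp
qed

lemma wd_cong_AE:
  assumes "wd e \<Omega> g h" "AE z in lborel. z \<in> \<Omega> \<longrightarrow> g z = g' z" "AE z in lborel. z \<in> \<Omega> \<longrightarrow> h z = h' z"
    "g' \<in> borel_measurable borel" "h' \<in> borel_measurable borel"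
  shows "wd e \<Omega> g' h'"
proof -
  have loc: "locint \<Omega> b'" if "locint \<Omega> b" "AE z in lborel. z \<in> \<Omega> \<longrightarrow> b z = b' z" "b' \<in> borel_measurable borel" for b b'
    unfolding locint_def
  proof (intro conjI allI impI)
    fix K assume K: "compact K" "K \<subseteq> \<Omega>"
    then have Kb: "K \<in> sets borel" by (simp add: compact_imp_closed borel_closed)
    show "integrable lborel (\<lambda>z. indicator K z * b' z)"
    proof (rule integrable_cong_AE_imp[OF locint_integrable[OF that(1) K]])
      show "AE x in lborel. indicator K x * b x = indicator K x * b' x"
        using that(2) by eventually_elim (use K in \<open>auto simp: indicator_def\<close>)
    qed (use Kb that in simp)
  qed (rule that)
  have cong: "(\<integral>z. b z * \<phi> z \<partial>lborel) = (\<integral>z. b' z * \<phi> z \<partial>lborel)"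
    if "locint \<Omega> b" "AE z in lborel. z \<in> \<Omega> \<longrightarrow> b z = b' z" "b' \<in> borel_measurable borel" "\<phi> \<in> test_fun \<Omega>" for b b' \<phi>
  proof (rule integral_cong_AE)
    have [measurable]: "\<phi> \<in> borel_measurable borel"
      by (intro borel_measurable_continuous_onI smooth_continuous test_fun_smooth[OF that(4)])
    show "(\<lambda>z. b z * \<phi> z) \<in> borel_measurable lborel" "(\<lambda>z. b' z * \<phi> z) \<in> borel_measurable lborel"
      using locint_measurable[OF that(1)] that(3) by simp_all
    show "AE z in lborel. b z * \<phi> z = b' z * \<phi> z"
      using that(2) by eventually_elim (use test_fun_zero[OF that(4)] in auto)
  qed
  note w = wdD[OF assms(1)]
  show ?thesis unfolding wd_def
    using loc[OF w(1) assms(2,4)] loc[OF w(2) assms(3,5)] w(3)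
      cong[OF w(1) assms(2,4) test_fun_pd] cong[OF w(2) assms(3,5)] by auto
qed

text \<open>Expresses a derivative of a mollification as a weak pairing of g with a test function of
  \<Omega>, without assuming that g has a weak derivative. In this form it also serves fields about
  which only a weak relation between two components is known.\<close>

lemma pd_mol_test:
  assumes g: "locint \<Omega> g" and K': "compact K'" "K' \<subseteq> \<Omega>" and r: "r > 0" "cball z r \<subseteq> K'"
  shows "pd e (mol r (\<lambda>w. indicator K' w * g w)) z =
    - (\<integral>w. g w * pd e (\<lambda>w. of_real (mollifier r (z - w))) w \<partial>lborel)"
proof -
  let ?\<eta> = "\<lambda>w. complex_of_real (mollifier r w)"
  have sm: "smooth ?\<eta>" by (rule mollifier(1)[OF r(1)])
  have p0: "pd e ?\<eta> w = 0" if "cmod w > r" for w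
    by (rule pd_support[of r]) (use that mollifier(3)[OF r(1)] in auto)
  have "pd e (mol r (\<lambda>w. indicator K' w * g w)) z = (\<integral>w. (indicator K' w * g w) * pd e ?\<eta> (z - w) \<partial>lborel)"
    using pd_mol[OF integrable_imp_locint[OF locint_integrable[OF g K']] r(1), of e] by (simp add: conv_def)
  also have "\<dots> = (\<integral>w. - (g w * pd e (\<lambda>w. ?\<eta> (z - w)) w) \<partial>lborel)"
  proof (rule Bochner_Integration.integral_cong[OF refl])
    fix w
    show "(indicator K' w * g w) * pd e ?\<eta> (z - w) = - (g w * pd e (\<lambda>w. ?\<eta> (z - w)) w)"
      using r(2) p0[of "z - w"] unfolding pd_reflect[OF sm]
      by (cases "w \<in> cball z r") (auto simp: dist_norm indicator_def)
  qed
  finally show ?thesis by simp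
qed

text \<open>Cutting g off at K' destroys its weak derivative along the boundary of K', but the disc
  of radius r about z lies inside K' and the mollification at z sees nothing else.\<close>

lemma pd_mol_cut:
  assumes w: "wd e \<Omega> g h" and K': "compact K'" "K' \<subseteq> \<Omega>" and r: "r > 0" "cball z r \<subseteq> K'"
  shows "pd e (mol r (\<lambda>w. indicator K' w * g w)) z = mol r (\<lambda>w. indicator K' w * h w) z"
proof -
  let ?\<eta> = "\<lambda>w. complex_of_real (mollifier r w)"
  note l = wdD[OF w]
  have "pd e (mol r (\<lambda>w. indicator K' w * g w)) z = (\<integral>w. h w * ?\<eta> (z - w) \<partial>lborel)"
  proof -
    have "(\<lambda>w. ?\<eta> (z - w)) \<in> test_fun \<Omega>"
      by (rule mollifier_reflect_test[OF r(1) order_trans[OF r(2) K'(2)]])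
    then show ?thesis by (simp only: pd_mol_test[OF l(1) K' r] l(3) minus_minus)
  qed
  also have "\<dots> = (\<integral>w. (indicator K' w * h w) * ?\<eta> (z - w) \<partial>lborel)"
  proof (rule Bochner_Integration.integral_cong[OF refl])
    fix w
    show "h w * ?\<eta> (z - w) = (indicator K' w * h w) * ?\<eta> (z - w)"
      using r(2) mollifier(3)[OF r(1), of "z - w"]
      by (cases "w \<in> cball z r") (auto simp: dist_norm indicator_def)
  qed
  finally show ?thesis by (simp add: mol_def conv_def)
qed

text \<open>Mean convergence yields convergence almost everywhere only along a subsequence. A
  function and its two weak derivatives need one common subsequence, which is obtained by refining
  once for each member of the finite set.\<close>

lemma mol_AE_subseq:
  assumes "finite H" "\<And>h. h \<in> H \<Longrightarrow> integrable lborel h"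
  shows "\<exists>r. strict_mono r \<and> (\<forall>h\<in>H. AE z in lborel. (\<lambda>n. mol (1 / real (Suc (r n))) h z) \<longlonglongrightarrow> h z)"
  using assms
proof (induction rule: finite_induct)
  case empty show ?case by (auto intro: strict_mono_id)
next
  case (insert h H)
  then obtain r where r: "strict_mono r"
    "\<And>h. h \<in> H \<Longrightarrow> AE z in lborel. (\<lambda>n. mol (1 / real (Suc (r n))) h z) \<longlonglongrightarrow> h z" by auto
  have h: "integrable lborel h" using insert by auto
  obtain N where N: "\<And>n. n \<ge> N \<Longrightarrow> integrable lborel (mol (1 / real (Suc n)) h)"
    using mol_L1(2)[OF h] by blast
  \<comment> \<open>The shift by N discards the radii for which integrability of the mollification
    is not yet known.\<close>
  have r1: "strict_mono (\<lambda>n. r (n + N))" using r(1) by (simp add: strict_mono_def)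
  let ?u = "\<lambda>n z. mol (1 / real (Suc (r (n + N)))) h z - h z"
  have "r (n + N) \<ge> N" for n using strict_mono_imp_increasing[OF r(1), of "n + N"] by linarith
  then have "integrable lborel (?u n)" for n using N h by auto
  moreover have "(\<lambda>n. \<integral>z. cmod (?u n z) \<partial>lborel) \<longlonglongrightarrow> 0"
    using LIMSEQ_subseq_LIMSEQ[OF mol_L1(1)[OF h] r1] by (simp add: o_def)
  ultimately obtain s where s: "strict_mono s" "AE z in lborel. (\<lambda>n. ?u (s n) z) \<longlonglongrightarrow> 0"
    using tendsto_L1_AE_subseq[of lborel ?u] by blast
  let ?q = "\<lambda>n. r (s n + N)"
  have q: "strict_mono ?q" using r(1) s(1) by (simp add: strict_mono_def)
  have "AE z in lborel. (\<lambda>n. mol (1 / real (Suc (?q n))) h z) \<longlonglongrightarrow> h z"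
    using s(2) by eventually_elim (rule LIM_zero_cancel)
  moreover have "AE z in lborel. (\<lambda>n. mol (1 / real (Suc (?q n))) h' z) \<longlonglongrightarrow> h' z" if "h' \<in> H" for h'
    using r(2)[OF that]
  proof eventually_elim
    case (elim z)
    have "strict_mono (\<lambda>n. s n + N)" using s(1) by (simp add: strict_mono_def)
    from LIMSEQ_subseq_LIMSEQ[OF elim this] show ?case by (simp add: o_def)
  qed
  ultimately show ?case using q by (intro exI[of _ ?q]) auto
qed

text \<open>The tool for replacing a bounded factor with bounded weak derivatives by smooth ones:
  averages respect the bound B, so dominated convergence applies to the function and to both
  derivatives. The last clause adds uniform closeness for continuous f; it keeps approximants of a
  non-vanishing function away from 0.\<close>

lemma wd_approx:
  assumes "open \<Omega>" "compact K" "K \<subseteq> \<Omega>" and w1: "wd 1 \<Omega> f fx" and w2: "wd \<i> \<Omega> f fy"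
    and bd: "\<And>z. cmod (f z) \<le> B" "\<And>z. cmod (fx z) \<le> B" "\<And>z. cmod (fy z) \<le> B"
  obtains F :: "nat \<Rightarrow> complex \<Rightarrow> complex" where "\<And>n. smooth (F n)" "\<And>n z. cmod (F n z) \<le> B"
    "\<And>n z. z \<in> K \<Longrightarrow> cmod (pd 1 (F n) z) \<le> B" "\<And>n z. z \<in> K \<Longrightarrow> cmod (pd \<i> (F n) z) \<le> B"
    "AE z in lborel. z \<in> K \<longrightarrow> (\<lambda>n. F n z) \<longlonglongrightarrow> f z"
    "AE z in lborel. z \<in> K \<longrightarrow> (\<lambda>n. pd 1 (F n) z) \<longlonglongrightarrow> fx z"
    "AE z in lborel. z \<in> K \<longrightarrow> (\<lambda>n. pd \<i> (F n) z) \<longlonglongrightarrow> fy z"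
    "\<And>\<epsilon>. continuous_on \<Omega> f \<Longrightarrow> \<epsilon> > 0 \<Longrightarrow> \<forall>\<^sub>F n in sequentially. \<forall>z\<in>K. cmod (F n z - f z) \<le> \<epsilon>"
proof -
  obtain d K' where d: "d > 0" "compact K'" "K' \<subseteq> \<Omega>" "\<And>z. z \<in> K \<Longrightarrow> cball z d \<subseteq> K'"
    using compact_nbhd[OF assms(2,1,3)] by metis
  define c where "c g = (\<lambda>w. indicator K' w * g w :: complex)" for g
  have B: "B \<ge> 0" using bd(1) norm_ge_zero order_trans by blast
  have KK': "K \<subseteq> K'" using d(1,4) by force
  have int: "integrable lborel (c f)" "integrable lborel (c fx)" "integrable lborel (c fy)"
    unfolding c_def using locint_integrable[OF _ d(2,3)] wdD[OF w1] wdD[OF w2] by auto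
  note loc = int[THEN integrable_imp_locint]
  have cb: "cmod (c f z) \<le> B" "cmod (c fx z) \<le> B" "cmod (c fy z) \<le> B" for z
    using bd[of z] B by (auto simp: c_def norm_mult indicator_def)
  obtain r0 where r0: "strict_mono r0"
    "\<forall>h\<in>{c f, c fx, c fy}. AE z in lborel. (\<lambda>n. mol (1 / real (Suc (r0 n))) h z) \<longlonglongrightarrow> h z"
    using mol_AE_subseq[of "{c f, c fx, c fy}"] int by auto
  obtain N where N: "inverse (real (Suc N)) < d" using reals_Archimedean[OF d(1)] by blast
  \<comment> \<open>The shift by N makes all radii at most d, so that the derivative formula
    \<open>pd_mol_cut\<close> holds on K for every n.\<close>
  define r where "r n = 1 / real (Suc (r0 (n + N)))" for n
  have rpos: "r n > 0" for n by (simp add: r_def)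
  have rle: "r n \<le> 1 / real (Suc n)" "r n \<le> d" for n
  proof -
    have "n + N \<le> r0 (n + N)" by (rule strict_mono_imp_increasing[OF r0(1)])
    then show "r n \<le> 1 / real (Suc n)" unfolding r_def by (intro divide_left_mono) auto
    have "r n \<le> 1 / real (Suc N)" using \<open>n + N \<le> r0 (n + N)\<close> unfolding r_def by (intro divide_left_mono) auto
    then show "r n \<le> d" using N by (simp add: inverse_eq_divide)
  qed
  have ae: "AE z in lborel. (\<lambda>n. mol (r n) h z) \<longlonglongrightarrow> h z" if "h \<in> {c f, c fx, c fy}" for h
    using r0(2)[rule_format, OF that]
    by eventually_elim (auto simp: r_def intro: LIMSEQ_ignore_initial_segment[where k=N, unfolded])
  have sub: "cball z (r n) \<subseteq> K'" if "z \<in> K" for z n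
    using d(4)[OF that] rle(2)[of n] by auto
  have p: "pd 1 (mol (r n) (c f)) z = mol (r n) (c fx) z" "pd \<i> (mol (r n) (c f)) z = mol (r n) (c fy) z"
    if "z \<in> K" for n z
    unfolding c_def using pd_mol_cut[OF w1 d(2,3) rpos sub[OF that]] pd_mol_cut[OF w2 d(2,3) rpos sub[OF that]] by auto
  show ?thesis
  proof (rule that[of "\<lambda>n. mol (r n) (c f)"])
    show "smooth (mol (r n) (c f))" for n by (rule smooth_mol[OF loc(1) rpos])
    show "cmod (mol (r n) (c f) z) \<le> B" for n z by (rule mol_bounded[OF loc(1) rpos cb(1)])
    show "cmod (pd 1 (mol (r n) (c f)) z) \<le> B" if "z \<in> K" for n z
      unfolding p[OF that] by (rule mol_bounded[OF loc(2) rpos cb(2)])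
    show "cmod (pd \<i> (mol (r n) (c f)) z) \<le> B" if "z \<in> K" for n z
      unfolding p[OF that] by (rule mol_bounded[OF loc(3) rpos cb(3)])
    have ind: "c g z = g z" if "z \<in> K" for g z using that KK' by (auto simp: c_def)
    show "AE z in lborel. z \<in> K \<longrightarrow> (\<lambda>n. mol (r n) (c f) z) \<longlonglongrightarrow> f z"
      using ae[of "c f"] by (auto elim!: eventually_mono simp: ind)
    show "AE z in lborel. z \<in> K \<longrightarrow> (\<lambda>n. pd 1 (mol (r n) (c f)) z) \<longlonglongrightarrow> fx z"
      using ae[of "c fx"] by (auto elim!: eventually_mono simp: ind p)
    show "AE z in lborel. z \<in> K \<longrightarrow> (\<lambda>n. pd \<i> (mol (r n) (c f)) z) \<longlonglongrightarrow> fy z"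
      using ae[of "c fy"] by (auto elim!: eventually_mono simp: ind p)
    fix \<epsilon> :: real assume cf: "continuous_on \<Omega> f" and "\<epsilon> > 0"
    have "uniformly_continuous_on K' f"
      using cf d(2,3) by (intro compact_uniformly_continuous) (auto intro: continuous_on_subset)
    then obtain \<delta> where \<delta>: "\<delta> > 0" "\<And>z w. z \<in> K' \<Longrightarrow> w \<in> K' \<Longrightarrow> dist w z < \<delta> \<Longrightarrow> dist (f w) (f z) < \<epsilon>"
      using \<open>\<epsilon> > 0\<close> unfolding uniformly_continuous_on_def by metis
    obtain M where M: "inverse (real (Suc M)) < \<delta>" using reals_Archimedean[OF \<delta>(1)] by blast
    have "cmod (mol (r n) (c f) z - f z) \<le> \<epsilon>" if "n \<ge> M" "z \<in> K" for n z
    proof (rule mol_diff_le[OF loc(1) rpos])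
      fix w assume w: "cmod w < r n"
      have "1 / real (Suc n) \<le> 1 / real (Suc M)" using that by (intro divide_left_mono) auto
      then have "r n < \<delta>" using M rle(1)[of n] by (simp add: inverse_eq_divide)
      moreover have "z - w \<in> cball z (r n)" using w by (simp add: dist_norm)
      ultimately have "z - w \<in> K'" "z \<in> K'" "dist (z - w) z < \<delta>"
        using w sub[OF that(2), of n] that(2) KK' by (auto simp: dist_norm)
      then show "cmod (c f (z - w) - f z) \<le> \<epsilon>"
        using \<delta>(2)[of z "z - w"] by (simp add: c_def dist_norm)
    qed
    then show "\<forall>\<^sub>F n in sequentially. \<forall>z\<in>K. cmod (mol (r n) (c f) z - f z) \<le> \<epsilon>"
      by (auto simp: eventually_sequentially)
  qed
qed

section \<open>Products and reciprocals of weakly differentiable functions\<close>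

lemma integral_lim_bdd:
  fixes w :: "complex \<Rightarrow> complex" and a :: "nat \<Rightarrow> complex \<Rightarrow> complex"
  assumes w: "integrable lborel w" "\<And>z. z \<notin> K \<Longrightarrow> w z = 0"
    and a: "\<And>n. a n \<in> borel_measurable borel" "a' \<in> borel_measurable borel"
      "\<And>n z. z \<in> K \<Longrightarrow> cmod (a n z) \<le> B"
    and lim: "AE z in lborel. z \<in> K \<longrightarrow> (\<lambda>n. a n z) \<longlonglongrightarrow> a' z"
  shows "(\<lambda>n. \<integral>z. w z * a n z \<partial>lborel) \<longlonglongrightarrow> (\<integral>z. w z * a' z \<partial>lborel)"
proof (rule integral_dominated_convergence[where w="\<lambda>z. B * cmod (w z)"])
  show "AE x in lborel. (\<lambda>i. w x * a i x) \<longlonglongrightarrow> w x * a' x"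
    using lim
  proof eventually_elim
    case (elim z)
    then show ?case using w(2)[of z] by (cases "z \<in> K") (simp_all add: tendsto_mult_left)
  qed
  have "norm (w x * a i x) \<le> B * cmod (w x)" for i x
    using a(3)[of x i] w(2)[of x] by (cases "x \<in> K") (auto simp: norm_mult mult.commute[of B] intro: mult_left_mono)
  then show "AE x in lborel. norm (w x * a i x) \<le> B * cmod (w x)" for i by simp
qed (use w a in auto)

lemma smooth_borel: "smooth g \<Longrightarrow> g \<in> borel_measurable borel"
  by (intro borel_measurable_continuous_onI smooth_continuous)

text \<open>With F n smooth, F n \<phi> is an admissible test function for g, which gives the
  product rule for F n. All three integrals converge when F n is replaced by f, since g, g' paired
  with \<phi> or its derivative are integrable and the F n and their derivatives are bounded by B on
  the support.\<close>

lemma wd_mult: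
  assumes "open \<Omega>" and w1: "wd 1 \<Omega> f fx" and w2: "wd \<i> \<Omega> f fy"
    and bd: "\<And>z. cmod (f z) \<le> B" "\<And>z. cmod (fx z) \<le> B" "\<And>z. cmod (fy z) \<le> B"
    and g: "wd e \<Omega> g g'" and e: "e = 1 \<and> fe = fx \<or> e = \<i> \<and> fe = fy"
  shows "wd e \<Omega> (\<lambda>z. f z * g z) (\<lambda>z. fe z * g z + f z * g' z)"
  unfolding wd_def
proof (intro conjI ballI)
  have we: "wd e \<Omega> f fe" and bde: "\<And>z. cmod (fe z) \<le> B" using e w1 w2 bd by auto
  note lf = wdD[OF we] and lg = wdD[OF g]
  have m: "f \<in> borel_measurable borel" "fe \<in> borel_measurable borel" using lf locint_measurable by auto
  show "locint \<Omega> (\<lambda>z. f z * g z)" by (rule locint_mult_bdd[OF lg(1) m(1) bd(1)])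
  show "locint \<Omega> (\<lambda>z. fe z * g z + f z * g' z)"
    by (intro locint_add locint_mult_bdd[OF lg(1) m(2) bde] locint_mult_bdd[OF lg(2) m(1) bd(1)])
  fix \<phi> assume \<phi>: "\<phi> \<in> test_fun \<Omega>"
  obtain K where K: "smooth \<phi>" "compact K" "K \<subseteq> \<Omega>" "\<And>z. z \<notin> K \<Longrightarrow> \<phi> z = 0"
    using test_funD[OF \<phi>] by blast
  have pK: "pd e \<phi> z = 0" if "z \<notin> K" for z
    by (rule pd_closed_support[OF compact_imp_closed[OF K(2)] K(4) that])
  obtain F :: "nat \<Rightarrow> complex \<Rightarrow> complex" where F: "\<And>n. smooth (F n)" "\<And>n z. cmod (F n z) \<le> B"
    "\<And>n z. z \<in> K \<Longrightarrow> cmod (pd 1 (F n) z) \<le> B" "\<And>n z. z \<in> K \<Longrightarrow> cmod (pd \<i> (F n) z) \<le> B"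
    "AE z in lborel. z \<in> K \<longrightarrow> (\<lambda>n. F n z) \<longlonglongrightarrow> f z"
    "AE z in lborel. z \<in> K \<longrightarrow> (\<lambda>n. pd 1 (F n) z) \<longlonglongrightarrow> fx z"
    "AE z in lborel. z \<in> K \<longrightarrow> (\<lambda>n. pd \<i> (F n) z) \<longlonglongrightarrow> fy z"
  proof (rule wd_approx[OF assms(1) K(2,3) w1 w2 bd], goal_cases)
    case (1 F) show ?case by (rule 1(1)[OF 1(2-8)])
  qed
  have Fe: "\<And>n z. z \<in> K \<Longrightarrow> cmod (pd e (F n) z) \<le> B" "AE z in lborel. z \<in> K \<longrightarrow> (\<lambda>n. pd e (F n) z) \<longlonglongrightarrow> fe z"
    using F e by auto
  have i: "integrable lborel (\<lambda>z. g z * pd e \<phi> z)" "integrable lborel (\<lambda>z. g z * \<phi> z)" "integrable lborel (\<lambda>z. g' z * \<phi> z)"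
    using locint_mult_test lg \<phi> test_fun_pd by auto
  have bdi: "integrable lborel (\<lambda>z. w z * b z)" if "integrable lborel w" "b \<in> borel_measurable borel" "\<And>z. z \<in> K \<Longrightarrow> cmod (b z) \<le> B"
     "\<And>z. z \<notin> K \<Longrightarrow> w z = 0" for w b
  proof (rule Bochner_Integration.integrable_bound)
    show "integrable lborel (\<lambda>z. B * cmod (w z))" using that by auto
    have "B \<ge> 0" using bd(1) norm_ge_zero order_trans by blast
    then have "norm (w z * b z) \<le> norm (B * cmod (w z))" for z
      using that(3)[of z] that(4)[of z] by (cases "z \<in> K") (auto simp: norm_mult mult.commute[of B] intro!: mult_left_mono)
    then show "AE z in lborel. norm (w z * b z) \<le> norm (B * cmod (w z))" by simp
  qed (use that in auto)
  have eq: "(\<integral>z. g z * pd e \<phi> z * F n z \<partial>lborel) + (\<integral>z. g z * \<phi> z * pd e (F n) z \<partial>lborel) = - (\<integral>z. g' z * \<phi> z * F n z \<partial>lborel)" for n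
  proof -
    have "(\<integral>z. g z * pd e (\<lambda>z. F n z * \<phi> z) z \<partial>lborel) = - (\<integral>z. g' z * (F n z * \<phi> z) \<partial>lborel)"
      by (rule lg(3)[OF test_fun_mult[OF \<phi> F(1)]])
    moreover have "pd e (\<lambda>z. F n z * \<phi> z) z = F n z * pd e \<phi> z + pd e (F n) z * \<phi> z" for z
      by (rule pd_mult) (auto intro: smooth_differentiable F K)
    ultimately have "(\<integral>z. g z * pd e \<phi> z * F n z + g z * \<phi> z * pd e (F n) z \<partial>lborel) = - (\<integral>z. g' z * \<phi> z * F n z \<partial>lborel)"
      by (simp add: algebra_simps)
    moreover have "integrable lborel (\<lambda>z. g z * pd e \<phi> z * F n z)" "integrable lborel (\<lambda>z. g z * \<phi> z * pd e (F n) z)"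
      using bdi[OF i(1) smooth_borel[OF F(1)]] bdi[OF i(2) smooth_borel[OF smooth_pd[OF F(1)]]] F(2) Fe(1) pK K(4) by auto
    ultimately show ?thesis by simp
  qed
  have "(\<lambda>n. \<integral>z. g z * pd e \<phi> z * F n z \<partial>lborel) \<longlonglongrightarrow> (\<integral>z. g z * pd e \<phi> z * f z \<partial>lborel)"
    by (rule integral_lim_bdd[OF i(1) _ smooth_borel[OF F(1)] m(1) F(2) F(5)]) (simp add: pK)
  moreover have "(\<lambda>n. \<integral>z. g z * \<phi> z * pd e (F n) z \<partial>lborel) \<longlonglongrightarrow> (\<integral>z. g z * \<phi> z * fe z \<partial>lborel)"
    by (rule integral_lim_bdd[OF i(2) _ smooth_borel[OF smooth_pd[OF F(1)]] m(2) Fe(1) Fe(2)]) (simp_all add: K)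
  ultimately have l1: "(\<lambda>n. - (\<integral>z. g' z * \<phi> z * F n z \<partial>lborel)) \<longlonglongrightarrow> (\<integral>z. g z * pd e \<phi> z * f z \<partial>lborel) + (\<integral>z. g z * \<phi> z * fe z \<partial>lborel)"
    unfolding eq[symmetric] by (rule tendsto_add)
  have "(\<lambda>n. - (\<integral>z. g' z * \<phi> z * F n z \<partial>lborel)) \<longlonglongrightarrow> - (\<integral>z. g' z * \<phi> z * f z \<partial>lborel)"
    by (intro tendsto_minus integral_lim_bdd[OF i(3) _ smooth_borel[OF F(1)] m(1) F(2) F(5)]) (simp add: K)
  from LIMSEQ_unique[OF l1 this]
  have "(\<integral>z. g z * pd e \<phi> z * f z \<partial>lborel) = - ((\<integral>z. g z * \<phi> z * fe z \<partial>lborel) + (\<integral>z. g' z * \<phi> z * f z \<partial>lborel))"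
    by (simp add: algebra_simps)
  also have "\<dots> = - (\<integral>z. g z * \<phi> z * fe z + g' z * \<phi> z * f z \<partial>lborel)"
    using bdi[OF i(2) m(2)] bdi[OF i(3) m(1)] bde bd(1) K(4) by simp
  finally show "(\<integral>z. f z * g z * pd e \<phi> z \<partial>lborel) = - (\<integral>z. (fe z * g z + f z * g' z) * \<phi> z \<partial>lborel)"
    by (simp add: algebra_simps)
qed

lemma Ck1_reciprocal:
  assumes "smooth F"
  shows "Ck_on (Suc 0) {z. F z \<noteq> 0} (\<lambda>z. 1 / F z)"
    "F z \<noteq> 0 \<Longrightarrow> pd e (\<lambda>z. 1 / F z) z = - pd e F z / (F z)\<^sup>2"
proof -
  have D: "((\<lambda>z. 1 / F z) has_derivative (\<lambda>h. - pd h F z / (F z)\<^sup>2)) (at z)" if "F z \<noteq> 0" for z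
  proof -
    have "((\<lambda>z. inverse (F z)) has_derivative (\<lambda>h. - (inverse (F z) * pd h F z * inverse (F z)))) (at z)"
      by (rule Deriv.has_derivative_inverse[OF that has_derivative_pd[OF smooth_differentiable[OF assms]]])
    then show ?thesis by (simp add: inverse_eq_divide power2_eq_square)
  qed
  show P: "F z \<noteq> 0 \<Longrightarrow> pd e (\<lambda>z. 1 / F z) z = - pd e F z / (F z)\<^sup>2" for z e
    by (rule pd_eqI[OF D])
  have "continuous_on {z. F z \<noteq> 0} (\<lambda>z. - pd e F z / (F z)\<^sup>2)" for e
    by (intro continuous_intros smooth_continuous smooth_pd assms) auto
  then have "continuous_on {z. F z \<noteq> 0} (pd e (\<lambda>z. 1 / F z))" for e
    by (rule continuous_on_eq) (simp add: P)
  then show "Ck_on (Suc 0) {z. F z \<noteq> 0} (\<lambda>z. 1 / F z)"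
    using D unfolding Ck_Suc by (auto simp: differentiable_def)
qed

text \<open>Continuity of f lets the approximants F n be within c/2 of f on the support K of \<phi>.
  Their modulus is then at least c/2 there, so 1/F n is continuously differentiable on an open set
  containing K, where classical integration by parts applies; the bounds needed for the limit depend
  only on B and c.\<close>

lemma wd_reciprocal:
  assumes "open \<Omega>" and w1: "wd 1 \<Omega> f fx" and w2: "wd \<i> \<Omega> f fy"
    and bd: "\<And>z. cmod (f z) \<le> B" "\<And>z. cmod (fx z) \<le> B" "\<And>z. cmod (fy z) \<le> B"
    and cf: "continuous_on \<Omega> f" and c: "c > 0" "\<And>z. z \<in> \<Omega> \<Longrightarrow> cmod (f z) \<ge> c" "\<And>z. z \<notin> \<Omega> \<Longrightarrow> f z = 0"
    and e: "e = 1 \<and> fe = fx \<or> e = \<i> \<and> fe = fy"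
  shows "wd e \<Omega> (\<lambda>z. 1 / f z) (\<lambda>z. - fe z / (f z)\<^sup>2)"
  unfolding wd_def
proof (intro conjI ballI)
  have we: "wd e \<Omega> f fe" and bde: "\<And>z. cmod (fe z) \<le> B" using e w1 w2 bd by auto
  note lf = wdD[OF we]
  have B: "B \<ge> 0" using bd(1) norm_ge_zero order_trans by blast
  have m [measurable]: "f \<in> borel_measurable borel" "fe \<in> borel_measurable borel" using lf locint_measurable by auto
  \<comment> \<open>Off \<Omega> the function f is 0 and so is its reciprocal, by the convention for
    division by 0; the bound therefore holds on the whole plane.\<close>
  have cle: "cmod (1 / f z) \<le> 1 / c" for z
  proof (cases "z \<in> \<Omega>")
    case True then show ?thesis using c(1) c(2)[OF True] frac_le[of 1 1 c "cmod (f z)"] by (simp add: norm_divide)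
  qed (use c in auto)
  show "locint \<Omega> (\<lambda>z. 1 / f z)" by (rule locint_bdd[OF _ cle]) simp
  have "cmod (- fe z / (f z)\<^sup>2) \<le> B * (1 / c * (1 / c))" for z
  proof -
    have "cmod (- fe z / (f z)\<^sup>2) = cmod (fe z) * (cmod (1 / f z) * cmod (1 / f z))"
      by (simp add: norm_divide norm_mult power2_eq_square)
    also have "\<dots> \<le> B * (1 / c * (1 / c))"
      using bde cle B c by (intro mult_mono) auto
    finally show ?thesis .
  qed
  then show "locint \<Omega> (\<lambda>z. - fe z / (f z)\<^sup>2)" by (rule locint_bdd[rotated]) simp
  fix \<phi> assume \<phi>: "\<phi> \<in> test_fun \<Omega>"
  obtain K where K: "smooth \<phi>" "compact K" "K \<subseteq> \<Omega>" "\<And>z. z \<notin> K \<Longrightarrow> \<phi> z = 0"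
    using test_funD[OF \<phi>] by blast
  have pK: "pd e \<phi> z = 0" if "z \<notin> K" for z
    by (rule pd_closed_support[OF compact_imp_closed[OF K(2)] K(4) that])
  obtain F :: "nat \<Rightarrow> complex \<Rightarrow> complex" where F: "\<And>n. smooth (F n)" "\<And>n z. cmod (F n z) \<le> B"
    "\<And>n z. z \<in> K \<Longrightarrow> cmod (pd 1 (F n) z) \<le> B" "\<And>n z. z \<in> K \<Longrightarrow> cmod (pd \<i> (F n) z) \<le> B"
    "AE z in lborel. z \<in> K \<longrightarrow> (\<lambda>n. F n z) \<longlonglongrightarrow> f z"
    "AE z in lborel. z \<in> K \<longrightarrow> (\<lambda>n. pd 1 (F n) z) \<longlonglongrightarrow> fx z"
    "AE z in lborel. z \<in> K \<longrightarrow> (\<lambda>n. pd \<i> (F n) z) \<longlonglongrightarrow> fy z"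
    "\<forall>\<^sub>F n in sequentially. \<forall>z\<in>K. cmod (F n z - f z) \<le> c/2"
  proof (rule wd_approx[OF assms(1) K(2,3) w1 w2 bd], goal_cases)
    case (1 F) show ?case by (rule 1(1)[OF 1(2-8) 1(9)[OF cf half_gt_zero[OF c(1)]]])
  qed
  obtain N where N: "\<And>n z. n \<ge> N \<Longrightarrow> z \<in> K \<Longrightarrow> cmod (F n z - f z) \<le> c/2"
    using F(8) unfolding eventually_sequentially by blast
  define G where "G n = F (n + N)" for n
  have Gs: "smooth (G n)" for n by (simp add: G_def F)
  have Gm [measurable]: "G n \<in> borel_measurable borel" "pd e (G n) \<in> borel_measurable borel" for n
    by (auto intro: smooth_borel smooth_pd Gs)
  have Gc: "cmod (G n z) \<ge> c/2" if "z \<in> K" for n z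
  proof -
    have "cmod (f z) \<le> cmod (f z - G n z) + cmod (G n z)" using norm_triangle_ineq[of "f z - G n z" "G n z"] by simp
    moreover have "cmod (f z - G n z) \<le> c/2" using N[of "n + N" z] that by (simp add: G_def norm_minus_commute)
    moreover have "cmod (f z) \<ge> c" using c(2) that K(3) by auto
    ultimately show ?thesis by simp
  qed
  have Gi: "cmod (1 / G n z) \<le> 2 / c" if "z \<in> K" for n z
    using Gc[OF that, of n] c(1) frac_le[of 1 1 "c/2" "cmod (G n z)"]
    by (simp add: norm_divide)
  have Ge: "cmod (pd e (G n) z) \<le> B" if "z \<in> K" for n z
    using F(3,4) that e by (auto simp: G_def)
  have limG: "AE z in lborel. z \<in> K \<longrightarrow> (\<lambda>n. G n z) \<longlonglongrightarrow> f z"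
    using F(5) unfolding G_def by (auto elim!: eventually_mono intro: LIMSEQ_ignore_initial_segment)
  have limGe: "AE z in lborel. z \<in> K \<longrightarrow> (\<lambda>n. pd e (G n) z) \<longlonglongrightarrow> fe z"
  proof -
    have "AE z in lborel. z \<in> K \<longrightarrow> (\<lambda>n. pd e (F n) z) \<longlonglongrightarrow> fe z" using F(6,7) e by auto
    then show ?thesis unfolding G_def
      by eventually_elim (auto intro: LIMSEQ_ignore_initial_segment[where f="\<lambda>n. pd e (F n) z" for z])
  qed
  have fK: "f z \<noteq> 0" if "z \<in> K" for z using c(1) c(2)[of z] K(3) that by auto
  have eq: "(\<integral>z. pd e \<phi> z * (1 / G n z) \<partial>lborel) = (\<integral>z. \<phi> z * (pd e (G n) z * ((1 / G n z) * (1 / G n z))) \<partial>lborel)" for n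
  proof -
    let ?O = "{z. G n z \<noteq> 0}"
    have op: "open ?O" using smooth_continuous[OF Gs, of UNIV n] by (intro open_Collect_neq) auto
    have sub: "K \<subseteq> ?O" using Gc[of _ n] c(1) by force
    have t: "\<phi> \<in> test_fun ?O" by (rule test_funI[OF K(1,2) sub K(4)])
    have "(\<integral>z. 1 / G n z * pd e \<phi> z \<partial>lborel) = - (\<integral>z. pd e (\<lambda>z. 1 / G n z) z * \<phi> z \<partial>lborel)"
      by (rule C1_by_parts[OF op Ck1_reciprocal(1)[OF Gs] t]) (use e in auto)
    also have "(\<integral>z. pd e (\<lambda>z. 1 / G n z) z * \<phi> z \<partial>lborel) = (\<integral>z. - (\<phi> z * (pd e (G n) z * ((1 / G n z) * (1 / G n z)))) \<partial>lborel)"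
    proof (rule Bochner_Integration.integral_cong[OF refl])
      fix z show "pd e (\<lambda>z. 1 / G n z) z * \<phi> z = - (\<phi> z * (pd e (G n) z * ((1 / G n z) * (1 / G n z))))"
      proof (cases "z \<in> K")
        case True
        then have "G n z \<noteq> 0" using sub by auto
        from Ck1_reciprocal(2)[OF Gs this] show ?thesis by (simp add: power2_eq_square)
      qed (simp add: K)
    qed
    finally show ?thesis by (simp add: mult.commute)
  qed
  have one: "locint \<Omega> (\<lambda>z. 1)" by (rule locint_bdd[of _ 1]) auto
  have i: "integrable lborel (pd e \<phi>)" "integrable lborel \<phi>"
    using locint_mult_test[OF one \<phi>] locint_mult_test[OF one test_fun_pd[OF \<phi>, of e]] by simp_all
  have "(\<lambda>n. \<integral>z. pd e \<phi> z * (1 / G n z) \<partial>lborel) \<longlonglongrightarrow> (\<integral>z. pd e \<phi> z * (1 / f z) \<partial>lborel)"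
  proof (rule integral_lim_bdd[OF i(1) pK _ _ Gi])
    show "AE z in lborel. z \<in> K \<longrightarrow> (\<lambda>n. 1 / G n z) \<longlonglongrightarrow> 1 / f z"
      using limG
    proof eventually_elim
      case (elim z)
      then show ?case using tendsto_divide[OF tendsto_const, of "\<lambda>n. G n z" "f z" sequentially 1] fK[of z] by simp
    qed
  qed auto
  moreover have "(\<lambda>n. \<integral>z. \<phi> z * (pd e (G n) z * ((1 / G n z) * (1 / G n z))) \<partial>lborel) \<longlonglongrightarrow>
     (\<integral>z. \<phi> z * (fe z * ((1 / f z) * (1 / f z))) \<partial>lborel)"
  proof (rule integral_lim_bdd[OF i(2) K(4), where B="B * (2/c * (2/c))"])
    show "cmod (pd e (G n) z * (1 / G n z * (1 / G n z))) \<le> B * (2/c * (2/c))" if "z \<in> K" for n z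
      unfolding norm_mult using Ge[OF that] Gi[OF that] B c by (intro mult_mono) auto
    show "AE z in lborel. z \<in> K \<longrightarrow> (\<lambda>n. pd e (G n) z * (1 / G n z * (1 / G n z))) \<longlonglongrightarrow> fe z * (1 / f z * (1 / f z))"
      using limG limGe
    proof eventually_elim
      case (elim z)
      show ?case
      proof
        assume z: "z \<in> K"
        then have "(\<lambda>n. 1 / G n z) \<longlonglongrightarrow> 1 / f z"
          using elim fK[OF z] tendsto_divide[OF tendsto_const, of "\<lambda>n. G n z" "f z" sequentially 1] by simp
        then show "(\<lambda>n. pd e (G n) z * (1 / G n z * (1 / G n z))) \<longlonglongrightarrow> fe z * (1 / f z * (1 / f z))"
          using elim z by (intro tendsto_mult) auto
      qed
    qed
  qed auto
  ultimately have "(\<integral>z. pd e \<phi> z * (1 / f z) \<partial>lborel) = (\<integral>z. \<phi> z * (fe z * ((1 / f z) * (1 / f z))) \<partial>lborel)"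
    unfolding eq by (rule LIMSEQ_unique)
  then show "(\<integral>z. 1 / f z * pd e \<phi> z \<partial>lborel) = - (\<integral>z. - fe z / (f z)\<^sup>2 * \<phi> z \<partial>lborel)"
    by (simp add: power2_eq_square mult_ac)
qed

lemma mol_continuous_lim:
  assumes "continuous_on UNIV g"
  shows "(\<lambda>n. mol (1 / real (Suc n)) g z) \<longlonglongrightarrow> g z"
  unfolding LIMSEQ_iff
proof (intro allI impI)
  have loc: "locint UNIV g" by (rule locint_continuous[OF assms borel_measurable_continuous_onI[OF assms]])
  fix r :: real assume "r > 0"
  then obtain d where d: "d > 0" "\<And>w. dist w z < d \<Longrightarrow> dist (g w) (g z) < r/2"
    using assms unfolding continuous_on_iff by (metis UNIV_I half_gt_zero)
  obtain N where N: "inverse (real (Suc N)) < d" using reals_Archimedean[OF d(1)] by blast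
  have "cmod (mol (1 / real (Suc n)) g z - g z) \<le> r/2" if "n \<ge> N" for n
  proof (rule mol_diff_le[OF loc])
    fix w assume w: "cmod w < 1 / real (Suc n)"
    have "1 / real (Suc n) \<le> 1 / real (Suc N)" using that by (intro divide_left_mono) auto
    then have "dist (z - w) z < d" using w N by (simp add: dist_norm inverse_eq_divide)
    from d(2)[OF this] show "cmod (g (z - w) - g z) \<le> r/2" by (simp add: dist_norm)
  qed simp
  then show "\<exists>N. \<forall>n\<ge>N. norm (mol (1 / real (Suc n)) g z - g z) < r"
    using \<open>r > 0\<close> by (intro exI[of _ N]) (fastforce intro: le_less_trans)
qed

lemma smooth_locint: "smooth g \<Longrightarrow> locint UNIV g"
  by (intro locint_continuous smooth_continuous smooth_borel)

text \<open>Symmetry of second derivatives, by transferring both derivatives of \<open>\<phi> * \<eta>\<close> onto \<open>\<phi>\<close>.\<close>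

lemma pd_commute:
  assumes "smooth \<phi>" "\<And>z. cmod z > R \<Longrightarrow> \<phi> z = 0"
  shows "pd a (pd b \<phi>) = pd b (pd a \<phi>)"
proof
  fix z
  have sc: "conv g \<psi> = conv \<psi> g" if "smooth g" "smooth \<psi>" for g \<psi>
    using conv_commute[OF smooth_locint[OF that(1)] smooth_continuous[OF that(2)]]
    by (auto simp: conv_def mult.commute)
  have S: "pd e \<phi> z = 0" if "cmod z > R" for e z
    by (rule pd_support[of R]) (use assms that in auto)
  have S2: "pd e (pd e' \<phi>) z = 0" if "cmod z > R" for e e' z
    by (rule pd_support[of R]) (use S that in auto)
  have eq: "conv (pd a (pd b \<phi>)) \<eta> = conv (pd b (pd a \<phi>)) \<eta>" if \<eta>: "smooth \<eta>" "\<And>z. cmod z > r \<Longrightarrow> \<eta> z = 0" for \<eta> r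
  proof -
    have S': "pd e \<eta> z = 0" if "cmod z > r" for e z
      by (rule pd_support[of r]) (use \<eta> that in auto)
    note l = smooth_locint
    note sp = smooth_pd
    have "conv (pd a (pd b \<phi>)) \<eta> = conv \<eta> (pd a (pd b \<phi>))" by (intro sc sp assms \<eta>)
    also have "\<dots> = pd a (conv \<eta> (pd b \<phi>))" by (rule pd_conv[symmetric, OF l[OF \<eta>(1)] sp[OF assms(1)] S])
    also have "conv \<eta> (pd b \<phi>) = pd b (conv \<eta> \<phi>)" by (rule pd_conv[symmetric, OF l[OF \<eta>(1)] assms])
    also have "conv \<eta> \<phi> = conv \<phi> \<eta>" by (intro sc assms \<eta>)
    also have "pd b (conv \<phi> \<eta>) = conv \<phi> (pd b \<eta>)" by (rule pd_conv[OF l[OF assms(1)] \<eta>])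
    also have "conv \<phi> (pd b \<eta>) = conv (pd b \<eta>) \<phi>" by (intro sc sp assms \<eta>)
    also have "pd a (conv (pd b \<eta>) \<phi>) = conv (pd b \<eta>) (pd a \<phi>)" by (rule pd_conv[OF l[OF sp[OF \<eta>(1)]] assms])
    also have "\<dots> = conv (pd a \<phi>) (pd b \<eta>)" by (intro sc sp assms \<eta>)
    also have "\<dots> = pd b (conv (pd a \<phi>) \<eta>)" by (rule pd_conv[symmetric, OF l[OF sp[OF assms(1)]] \<eta>])
    also have "conv (pd a \<phi>) \<eta> = conv \<eta> (pd a \<phi>)" by (intro sc sp assms \<eta>)
    also have "pd b (conv \<eta> (pd a \<phi>)) = conv \<eta> (pd b (pd a \<phi>))" by (rule pd_conv[OF l[OF \<eta>(1)] sp[OF assms(1)] S])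
    also have "\<dots> = conv (pd b (pd a \<phi>)) \<eta>" by (intro sc sp assms \<eta>)
    finally show ?thesis .
  qed
  \<comment> \<open>The two mixed derivatives agree after mollification at every radius, and both
    mollifications converge pointwise to the continuous functions they came from.\<close>
  have "mol (1 / real (Suc n)) (pd a (pd b \<phi>)) = mol (1 / real (Suc n)) (pd b (pd a \<phi>))" for n
    unfolding mol_def by (rule eq[of _ "1 / real (Suc n)"]) (auto simp: mollifier)
  then have "(\<lambda>n. mol (1 / real (Suc n)) (pd a (pd b \<phi>)) z) \<longlonglongrightarrow> pd b (pd a \<phi>) z"
    using mol_continuous_lim[OF smooth_continuous[OF smooth_pd[OF smooth_pd[OF assms(1)]]], of b a z] by simp
  then show "pd a (pd b \<phi>) z = pd b (pd a \<phi>) z"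
    using mol_continuous_lim[OF smooth_continuous[OF smooth_pd[OF smooth_pd[OF assms(1)]]], of a b z] LIMSEQ_unique by blast
qed

section \<open>Weakly singular kernels\<close>

lemma indicator_ball_borel [measurable (raw)]:
  fixes f :: "'a \<Rightarrow> complex"
  shows "f \<in> borel_measurable M \<Longrightarrow> (\<lambda>x. indicator (ball a R) (f x) :: ennreal) \<in> borel_measurable M"
  by (rule measurable_compose[of f M borel "indicator (ball a R)"]) (auto intro!: borel_measurable_indicator)

lemma ennreal_le_suminf:
  fixes g :: "nat \<Rightarrow> ennreal" shows "g k \<le> suminf g"
  using sum_le_suminf[of g "{k}"] by simp

text \<open>Stands in for polar coordinates: a radial function is dominated by a series of constants
  on concentric discs, whose areas are proportional to the squared radii. It serves both for a pole
  at 0 and for decay at infinity.\<close>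

lemma nn_integral_ball_series:
  fixes f :: "complex \<Rightarrow> ennreal"
  assumes le: "\<And>z. f z \<le> (\<Sum>k. ennreal (a k) * indicator (ball 0 (r k)) z)"
    and a: "\<And>k. a k \<ge> 0" "\<And>k. r k \<ge> 0" and s: "summable (\<lambda>k. a k * (r k)\<^sup>2)"
  shows "(\<integral>\<^sup>+z. f z \<partial>lborel) < \<infinity>"
proof -
  have "(\<integral>\<^sup>+z. f z \<partial>lborel) \<le> (\<integral>\<^sup>+z. (\<Sum>k. ennreal (a k) * indicator (ball 0 (r k)) (z::complex)) \<partial>lborel)"
    by (rule nn_integral_mono) (rule le)
  also have "\<dots> = (\<Sum>k. \<integral>\<^sup>+z. ennreal (a k) * indicator (ball (0::complex) (r k)) z \<partial>lborel)"
    by (rule nn_integral_suminf) measurable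
  also have "\<dots> = (\<Sum>k. ennreal (a k * (unit_ball_vol 2 * (r k)\<^sup>2)))"
    by (intro arg_cong[of _ _ suminf] ext, subst nn_integral_cmult_indicator)
       (use a in \<open>simp_all add: emeasure_ball ennreal_mult\<close>)
  also have "\<dots> = ennreal (\<Sum>k. unit_ball_vol 2 * (a k * (r k)\<^sup>2))"
    using a s summable_mult[OF s, of "unit_ball_vol 2"]
    by (subst suminf_ennreal2) (auto simp: mult_ac intro!: mult_nonneg_nonneg)
  also have "\<dots> < \<infinity>" by simp
  finally show ?thesis .
qed

text \<open>Dyadic radii r_k = R/2^k: on the k-th annulus the pole of order 3/2 is at most its value
  at the inner radius, and times r_k^2 this is a multiple of sqrt(r_k), a geometric sequence of
  ratio 1/sqrt 2.\<close>

lemma nn_integral_singular_ball: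
  assumes "R > 0"
  shows "(\<integral>\<^sup>+z. ennreal (1 / (cmod z * sqrt (cmod z))) * indicator (ball 0 R) z \<partial>lborel) < \<infinity>"
proof (rule nn_integral_ball_series)
  define r where "r k = R / 2 ^ k" for k :: nat
  define a where "a k = 1 / (r (Suc k) * sqrt (r (Suc k)))" for k
  have rpos: "r k > 0" for k using assms by (simp add: r_def)
  show "a k \<ge> 0" "r k \<ge> 0" for k using rpos[of k] rpos[of "Suc k"] by (auto simp: a_def)
  have "a k * (r k)\<^sup>2 = (2 * sqrt 2 * sqrt R) * (1 / sqrt 2) ^ k" for k
  proof -
    have r2: "r (Suc k) = r k / 2" by (simp add: r_def)
    have sq: "r k = sqrt (r k) * sqrt (r k)" using rpos[of k] by simp
    have "a k * (r k)\<^sup>2 = 2 * sqrt 2 * (r k)\<^sup>2 / (r k * sqrt (r k))"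
      by (simp add: a_def r2 real_sqrt_divide)
    also have "\<dots> = 2 * sqrt 2 * (r k / sqrt (r k))" using rpos[of k] by (simp add: power2_eq_square)
    also have "r k / sqrt (r k) = sqrt (r k)" using rpos[of k] by (simp add: real_div_sqrt)
    also have "sqrt (r k) = sqrt R * (1 / sqrt 2) ^ k"
      by (simp add: r_def real_sqrt_divide real_sqrt_power power_one_over)
    finally show ?thesis by simp
  qed
  moreover have "summable (\<lambda>k. (2 * sqrt 2 * sqrt R) * (1 / sqrt 2) ^ k)"
    by (intro summable_mult summable_geometric) (simp add: real_less_lsqrt)
  ultimately show "summable (\<lambda>k. a k * (r k)\<^sup>2)" by simp
  fix z :: complex
  show "ennreal (1 / (cmod z * sqrt (cmod z))) * indicator (ball 0 R) z \<le> (\<Sum>k. ennreal (a k) * indicator (ball 0 (r k)) z)"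
  proof (cases "z \<in> ball 0 R \<and> z \<noteq> 0")
    case True
    then have z: "0 < cmod z" "cmod z < R" by auto
    obtain n where n: "R / cmod z < 2 ^ n" using real_arch_pow[of 2 "R / cmod z"] by auto
    then have "r n < cmod z" using z by (simp add: r_def field_simps)
    then have ex: "\<exists>n. r (Suc n) \<le> cmod z"
    proof -
      have "r (Suc n) \<le> r n" using assms by (simp add: r_def field_simps)
      then show ?thesis using \<open>r n < cmod z\<close> by (intro exI[of _ n]) simp
    qed
    \<comment> \<open>The least such index puts z into the annulus r (Suc k) <= |z| < r k.\<close>
    define k where "k = (LEAST n. r (Suc n) \<le> cmod z)"
    have k1: "r (Suc k) \<le> cmod z" unfolding k_def by (rule LeastI_ex[OF ex])
    have k2: "cmod z < r k"
    proof (cases k)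
      case 0 then show ?thesis using z by (simp add: r_def)
    next
      case (Suc m)
      then have "\<not> r (Suc m) \<le> cmod z" unfolding k_def by (intro not_less_Least) simp
      then show ?thesis using Suc by simp
    qed
    have "1 / (cmod z * sqrt (cmod z)) \<le> a k"
      unfolding a_def using k1 rpos[of "Suc k"] z
      by (intro divide_left_mono mult_mono mult_pos_pos) auto
    then have "ennreal (1 / (cmod z * sqrt (cmod z))) * indicator (ball 0 R) z \<le> ennreal (a k) * indicator (ball 0 (r k)) z"
      using k2 z by (simp add: ennreal_leI)
    also have "\<dots> \<le> (\<Sum>j. ennreal (a j) * indicator (ball 0 (r j)) z)"
      by (rule ennreal_le_suminf)
    finally show ?thesis .
  qed (auto simp: indicator_def)
qed

text \<open>The integral of this function normalises the Cauchy kernel in \<open>pomp\<close>. On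
  the annulus 2^(k-1) <= |z| < 2^k the function is at most 16 / 16^k; the factor 16 accounts for the
  inner radius being half the outer one. The area 4^k leaves a geometric series of ratio
  1/4.\<close>

lemma integrable_inverse_quartic:
  "integrable lborel (\<lambda>z::complex. 1 / (1 + (cmod z)\<^sup>2)\<^sup>2)"
proof (rule integrableI_bounded)
  have "(\<integral>\<^sup>+z. ennreal (1 / (1 + (cmod z)\<^sup>2)\<^sup>2) \<partial>lborel) < \<infinity>"
  proof (rule nn_integral_ball_series[where a="\<lambda>k. 16 * (1/16) ^ k" and r="\<lambda>k. 2 ^ k"])
    have "16 * (1/16) ^ k * (2 ^ k)\<^sup>2 = 16 * (1/4 :: real) ^ k" for k :: nat
    proof -
      have "(2 ^ k)\<^sup>2 = (4::real) ^ k" by (simp add: power_mult[symmetric] mult.commute power2_eq_square power_mult_distrib[symmetric])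
      then have "(1/16) ^ k * (2 ^ k)\<^sup>2 = ((1/16) * 4 :: real) ^ k" by (simp only: power_mult_distrib)
      then show ?thesis by simp
    qed
    then show "summable (\<lambda>k. 16 * (1/16) ^ k * ((2::real) ^ k)\<^sup>2)"
      by (simp only:) (intro summable_mult summable_geometric, simp)
    fix z :: complex
    obtain n where n: "cmod z < 2 ^ n" using real_arch_pow[of 2 "cmod z"] by auto
    define k where "k = (LEAST n. cmod z < 2 ^ n)"
    have k1: "cmod z < 2 ^ k" unfolding k_def by (rule LeastI[of _ n]) (rule n)
    have "1 / (1 + (cmod z)\<^sup>2)\<^sup>2 \<le> 16 * (1/16) ^ k"
    proof (cases k)
      case 0
      have "1 \<le> (1 + (cmod z)\<^sup>2)\<^sup>2" by (simp add: one_le_power)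
      from frac_le[OF _ _ _ this, of 1 1] have "1 / (1 + (cmod z)\<^sup>2)\<^sup>2 \<le> 1" by simp
      then show ?thesis using 0 by simp
    next
      case (Suc m)
      then have "\<not> cmod z < 2 ^ m" unfolding k_def by (intro not_less_Least) simp
      then have "(2 ^ m)\<^sup>2 \<le> (cmod z)\<^sup>2" by (intro power_mono) auto
      also have "\<dots> \<le> 1 + (cmod z)\<^sup>2" by simp
      finally have "((2 ^ m)\<^sup>2)\<^sup>2 \<le> (1 + (cmod z)\<^sup>2)\<^sup>2" by (intro power_mono) auto
      moreover have "((2 ^ m)\<^sup>2)\<^sup>2 = ((2::real) ^ 4) ^ m"
        unfolding power_mult[symmetric] by (simp add: mult.commute)
      ultimately have "(16::real) ^ m \<le> (1 + (cmod z)\<^sup>2)\<^sup>2" by simp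
      from frac_le[OF _ _ _ this, of 1 1] have "1 / (1 + (cmod z)\<^sup>2)\<^sup>2 \<le> 1 / 16 ^ m" by simp
      then show ?thesis using Suc by (simp add: power_one_over)
    qed
    then have "ennreal (1 / (1 + (cmod z)\<^sup>2)\<^sup>2) \<le> ennreal (16 * (1/16) ^ k) * indicator (ball 0 (2 ^ k)) z"
      using k1 by (simp add: ennreal_leI)
    also have "\<dots> \<le> (\<Sum>j. ennreal (16 * (1/16) ^ j) * indicator (ball 0 (2 ^ j)) z)"
      by (rule ennreal_le_suminf)
    finally show "ennreal (1 / (1 + (cmod z)\<^sup>2)\<^sup>2) \<le> (\<Sum>j. ennreal (16 * (1/16) ^ j) * indicator (ball 0 (2 ^ j)) z)" .
  qed auto
  then show "(\<integral>\<^sup>+z. ennreal (norm (1 / (1 + (cmod (z::complex))\<^sup>2)\<^sup>2)) \<partial>lborel) < \<infinity>" by simp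
qed simp

text \<open>A bound, uniform in the pole \<open>z\<close>, for the integral of \<open>\<bar>z - w\<bar>\<close> to the power \<open>-3/2\<close> over a disc.\<close>

definition sing_bound :: "real \<Rightarrow> real"
  where "sing_bound R = enn2real ((\<integral>\<^sup>+z. ennreal (1 / (cmod z * sqrt (cmod z))) * indicator (ball 0 1) z \<partial>lborel)
     + emeasure lborel (ball (0::complex) R))"

lemma sing_bound_nonneg [simp]: "sing_bound R \<ge> 0" by (simp add: sing_bound_def)

lemma singular_kernel_borel [measurable]: "(\<lambda>w. 1 / (cmod (z - w) * sqrt (cmod (z - w)))) \<in> borel_measurable borel"
  by measurable

text \<open>Within distance 1 of the pole the integrand is a reflected translate of one fixed
  integrable function; further away it is at most 1 and contributes no more than the area of the
  disc. Neither part depends on z.\<close>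

lemma singular_le:
  "(\<integral>\<^sup>+w. ennreal (1 / (cmod (z - w) * sqrt (cmod (z - w)))) * indicator (ball 0 R) w \<partial>lborel) \<le> ennreal (sing_bound R)"
proof -
  let ?s = "\<lambda>w. ennreal (1 / (cmod w * sqrt (cmod w)))"
  have [measurable]: "?s \<in> borel_measurable borel" by measurable
  have "ennreal (1 / (cmod (z - w) * sqrt (cmod (z - w)))) * indicator (ball 0 R) w
      \<le> ?s (z - w) * indicator (ball 0 1) (z - w) + indicator (ball 0 R) w" for w
  proof (cases "cmod (z - w) < 1")
    case True then show ?thesis by (simp add: indicator_def)
  next
    case False
    then have "1 * 1 \<le> cmod (z - w) * sqrt (cmod (z - w))" by (intro mult_mono) auto
    then have "1 / (cmod (z - w) * sqrt (cmod (z - w))) \<le> 1" by simp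
    then have "?s (z - w) \<le> 1" by (metis ennreal_1 ennreal_leI)
    then show ?thesis by (simp add: indicator_def)
  qed
  then have "(\<integral>\<^sup>+w. ?s (z - w) * indicator (ball 0 R) w \<partial>lborel)
     \<le> (\<integral>\<^sup>+w. ?s (z - w) * indicator (ball 0 1) (z - w) + indicator (ball 0 R) w \<partial>lborel)"
    by (rule nn_integral_mono)
  also have "\<dots> = (\<integral>\<^sup>+w. ?s (z - w) * indicator (ball 0 1) (z - w) \<partial>lborel) + (\<integral>\<^sup>+w. indicator (ball 0 R) (w::complex) \<partial>lborel)"
    by (rule nn_integral_add) measurable
  also have "(\<integral>\<^sup>+w. ?s (z - w) * indicator (ball 0 1) (z - w) \<partial>lborel) = (\<integral>\<^sup>+w. ?s w * indicator (ball 0 1) w \<partial>lborel)"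
    by (rule nn_integral_reflect[of "\<lambda>w. ?s w * indicator (ball 0 1) w"]) measurable
  also have "(\<integral>\<^sup>+w. ?s w * indicator (ball 0 1) w \<partial>lborel) + (\<integral>\<^sup>+w. indicator (ball (0::complex) R) w \<partial>lborel) = ennreal (sing_bound R)"
    using nn_integral_singular_ball[of 1] emeasure_bounded_finite[of "ball (0::complex) R"]
    unfolding sing_bound_def by (subst ennreal_enn2real) (auto simp: ennreal_add_less_top)
  finally show ?thesis .
qed

lemma mult_sq_le_cubes:
  fixes a b :: real assumes "a \<ge> 0" "b \<ge> 0" shows "a * b\<^sup>2 \<le> a ^ 3 + b ^ 3"
proof (cases "a \<le> b")
  case True
  then have "a * b\<^sup>2 \<le> b * b\<^sup>2" by (intro mult_right_mono) auto
  also have "\<dots> = b ^ 3" by (simp add: power2_eq_square power3_eq_cube)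
  finally show ?thesis using zero_le_power[OF assms(1), of 3] by linarith
next
  case False
  then have "b\<^sup>2 \<le> a\<^sup>2" using assms by (intro power_mono) auto
  then have "a * b\<^sup>2 \<le> a * a\<^sup>2" using assms by (intro mult_left_mono) auto
  also have "\<dots> = a ^ 3" by (simp add: power2_eq_square power3_eq_cube)
  finally show ?thesis using zero_le_power[OF assms(2), of 3] by linarith
qed

text \<open>Young's inequality in the form a b^2 <= a^3 + b^3, with a and b the inverse square roots
  of x and y. It splits a product of two poles of total order 3/2 into single poles of order 3/2,
  which are still integrable in the plane.\<close>

lemma kernel_young:
  fixes x y :: real assumes "x \<ge> 0" "y \<ge> 0"
  shows "1 / (sqrt x * y) \<le> 1 / (x * sqrt x) + 1 / (y * sqrt y)"
proof -
  have eq: "1 / (x * sqrt x) = (1 / sqrt x) ^ 3" if "x \<ge> 0" for x :: real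
    using that by (simp add: power_divide power3_eq_cube)
  have "1 / (sqrt x * y) = (1 / sqrt x) * (1 / sqrt y)\<^sup>2" using assms by (simp add: power_divide)
  also have "\<dots> \<le> (1 / sqrt x) ^ 3 + (1 / sqrt y) ^ 3" by (rule mult_sq_le_cubes) (use assms in auto)
  finally show ?thesis using assms by (simp only: eq)
qed

lemma nn_kernel_half_one:
  "(\<integral>\<^sup>+w. ennreal (1 / (sqrt (cmod (z - w)) * cmod (z' - w))) * indicator (ball 0 R) w \<partial>lborel) \<le> ennreal (2 * sing_bound R)"
proof -
  have "(\<integral>\<^sup>+w. ennreal (1 / (sqrt (cmod (z - w)) * cmod (z' - w))) * indicator (ball 0 R) w \<partial>lborel)
    \<le> (\<integral>\<^sup>+w. ennreal (1 / (cmod (z - w) * sqrt (cmod (z - w)))) * indicator (ball 0 R) w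
       + ennreal (1 / (cmod (z' - w) * sqrt (cmod (z' - w)))) * indicator (ball 0 R) w \<partial>lborel)"
  proof (rule nn_integral_mono)
    fix w
    have "ennreal (1 / (sqrt (cmod (z - w)) * cmod (z' - w))) \<le> 
      ennreal (1 / (cmod (z - w) * sqrt (cmod (z - w)))) + ennreal (1 / (cmod (z' - w) * sqrt (cmod (z' - w))))"
      by (simp add: ennreal_plus[symmetric] ennreal_leI kernel_young del: ennreal_plus)
    then show "ennreal (1 / (sqrt (cmod (z - w)) * cmod (z' - w))) * indicator (ball 0 R) w
      \<le> ennreal (1 / (cmod (z - w) * sqrt (cmod (z - w)))) * indicator (ball 0 R) w
       + ennreal (1 / (cmod (z' - w) * sqrt (cmod (z' - w)))) * indicator (ball 0 R) w"
      by (simp add: indicator_def)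
  qed
  also have "\<dots> \<le> ennreal (sing_bound R) + ennreal (sing_bound R)"
    by (subst nn_integral_add) (measurable, intro add_mono singular_le)
  also have "\<dots> = ennreal (2 * sing_bound R)" by (simp add: ennreal_plus[symmetric] del: ennreal_plus)
  finally show ?thesis .
qed

text \<open>Two poles of order 1 have total order 2, the borderline at which the integral diverges
  as z' tends to z. From sqrt|z - z'| <= sqrt|z - w| + sqrt|z' - w|, half an order is traded for the
  factor |z - z'|^(-1/2), leaving two products of total order 3/2.\<close>

lemma nn_kernel_one_one:
  assumes "z \<noteq> z'"
  shows "(\<integral>\<^sup>+w. ennreal (1 / (cmod (z - w) * cmod (z' - w))) * indicator (ball 0 R) w \<partial>lborel)
     \<le> ennreal (4 * sing_bound R / sqrt (cmod (z - z')))"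
proof -
  let ?q = "sqrt (cmod (z - z'))"
  have q: "?q > 0" using assms by simp
  have "ennreal (1 / (cmod (z - w) * cmod (z' - w))) * indicator (ball 0 R) w
     \<le> ennreal (1 / ?q) * (ennreal (1 / (sqrt (cmod (z - w)) * cmod (z' - w))) * indicator (ball 0 R) w
      + ennreal (1 / (sqrt (cmod (z' - w)) * cmod (z - w))) * indicator (ball 0 R) w)" for w
  \<comment> \<open>At the poles themselves the left-hand side is 0 by the convention for division
    by 0.\<close>
  proof (cases "w = z \<or> w = z'")
    case False
    have "?q \<le> sqrt (cmod (z - w) + cmod (z' - w))"
      using norm_triangle_ineq4[of "z - w" "z' - w"] by simp
    also have "\<dots> \<le> sqrt (cmod (z - w)) + sqrt (cmod (z' - w))" by (rule sqrt_add_le_add_sqrt) auto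
    finally have "1 \<le> (sqrt (cmod (z - w)) + sqrt (cmod (z' - w))) / ?q" using q by (simp add: le_divide_eq)
    then have "1 / (cmod (z - w) * cmod (z' - w)) * 1 \<le>
        1 / (cmod (z - w) * cmod (z' - w)) * ((sqrt (cmod (z - w)) + sqrt (cmod (z' - w))) / ?q)"
      by (intro mult_left_mono) auto
    then have "1 / (cmod (z - w) * cmod (z' - w)) \<le> 1 / ?q * ((sqrt (cmod (z - w)) + sqrt (cmod (z' - w))) / (cmod (z - w) * cmod (z' - w)))"
      by (simp add: mult.commute)
    also have "(sqrt (cmod (z - w)) + sqrt (cmod (z' - w))) / (cmod (z - w) * cmod (z' - w))
       = 1 / (sqrt (cmod (z - w)) * cmod (z' - w)) + 1 / (sqrt (cmod (z' - w)) * cmod (z - w))"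
    proof -
      have "sqrt x / (x * y) = 1 / (sqrt x * y)" if "x > 0" for x y :: real
      proof -
        have "x = sqrt x * sqrt x" "sqrt x > 0" using that by simp_all
        then obtain s where "sqrt x = s" "x = s * s" "s > 0" by blast
        then show ?thesis by simp
      qed
      moreover have "cmod (z - w) > 0" "cmod (z' - w) > 0" using False by auto
      ultimately have "sqrt (cmod (z - w)) / (cmod (z - w) * cmod (z' - w)) = 1 / (sqrt (cmod (z - w)) * cmod (z' - w))"
        "sqrt (cmod (z' - w)) / (cmod (z' - w) * cmod (z - w)) = 1 / (sqrt (cmod (z' - w)) * cmod (z - w))" by blast+
      then show ?thesis by (simp add: add_divide_distrib mult.commute)
    qed
    finally have "ennreal (1 / (cmod (z - w) * cmod (z' - w))) \<le>
      ennreal (1 / ?q) * (ennreal (1 / (sqrt (cmod (z - w)) * cmod (z' - w))) + ennreal (1 / (sqrt (cmod (z' - w)) * cmod (z - w))))"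
      by (subst ennreal_plus[symmetric], simp, simp, subst ennreal_mult[symmetric]) (auto intro!: ennreal_leI)
    then show ?thesis by (simp add: indicator_def)
  qed auto
  then have "(\<integral>\<^sup>+w. ennreal (1 / (cmod (z - w) * cmod (z' - w))) * indicator (ball 0 R) w \<partial>lborel)
     \<le> (\<integral>\<^sup>+w. ennreal (1 / ?q) * (ennreal (1 / (sqrt (cmod (z - w)) * cmod (z' - w))) * indicator (ball 0 R) w
      + ennreal (1 / (sqrt (cmod (z' - w)) * cmod (z - w))) * indicator (ball 0 R) w) \<partial>lborel)"
    by (rule nn_integral_mono)
  also have "\<dots> = ennreal (1 / ?q) * ((\<integral>\<^sup>+w. ennreal (1 / (sqrt (cmod (z - w)) * cmod (z' - w))) * indicator (ball 0 R) w \<partial>lborel)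
      + (\<integral>\<^sup>+w. ennreal (1 / (sqrt (cmod (z' - w)) * cmod (z - w))) * indicator (ball 0 R) w \<partial>lborel))"
    by (subst nn_integral_cmult, measurable, subst nn_integral_add) measurable
  also have "\<dots> \<le> ennreal (1 / ?q) * (ennreal (2 * sing_bound R) + ennreal (2 * sing_bound R))"
    by (intro mult_left_mono add_mono nn_kernel_half_one) auto
  also have "\<dots> = ennreal (4 * sing_bound R / ?q)"
    using q by (subst ennreal_plus[symmetric], simp, simp, subst ennreal_mult[symmetric]) auto
  finally show ?thesis .
qed

definition kernel_bound :: "real \<Rightarrow> real"
  where "kernel_bound R = sing_bound R + measure lborel (ball (0::complex) R)"

lemma kernel_bound_nonneg [simp]: "kernel_bound R \<ge> 0" by (simp add: kernel_bound_def)

lemma nn_kernel_one: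
  "(\<integral>\<^sup>+w. ennreal (1 / cmod (z - w)) * indicator (ball 0 R) w \<partial>lborel) \<le> ennreal (kernel_bound R)"
proof -
  have "ennreal (1 / cmod (z - w)) \<le> ennreal (1 / (cmod (z - w) * sqrt (cmod (z - w)))) + 1" for w
  proof (cases "cmod (z - w) \<le> 1")
    case True
    have "1 / cmod (z - w) \<le> 1 / (cmod (z - w) * sqrt (cmod (z - w)))"
    proof (cases "z = w")
      case False
      then show ?thesis using True by (intro divide_left_mono) (auto simp: mult_le_cancel_left1)
    qed simp
    from ennreal_leI[OF this] show ?thesis by (intro add_increasing2) simp_all
  next
    case False
    then have "ennreal (1 / cmod (z - w)) \<le> ennreal 1"
      using frac_le[of 1 1 1 "cmod (z - w)"] by (intro ennreal_leI) simp
    then show ?thesis by (intro add_increasing) simp_all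
  qed
  then have "(\<integral>\<^sup>+w. ennreal (1 / cmod (z - w)) * indicator (ball 0 R) w \<partial>lborel)
     \<le> (\<integral>\<^sup>+w. ennreal (1 / (cmod (z - w) * sqrt (cmod (z - w)))) * indicator (ball 0 R) w + indicator (ball 0 R) w \<partial>lborel)"
    by (intro nn_integral_mono) (simp add: indicator_def)
  also have "\<dots> = (\<integral>\<^sup>+w. ennreal (1 / (cmod (z - w) * sqrt (cmod (z - w)))) * indicator (ball 0 R) w \<partial>lborel) + emeasure lborel (ball (0::complex) R)"
    by (subst nn_integral_add) (measurable, auto intro!: borel_measurable_indicator)
  also have "\<dots> \<le> ennreal (sing_bound R) + emeasure lborel (ball (0::complex) R)" by (intro add_mono singular_le) auto
  also have "\<dots> = ennreal (kernel_bound R)"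
    using emeasure_bounded_finite[of "ball (0::complex) R"] by (simp add: kernel_bound_def emeasure_eq_ennreal_measure)
  finally show ?thesis .
qed

section \<open>The Cauchy transform\<close>

text \<open>Twice the usual derivative with respect to the conjugate of z, built with the complex
  unit i. It acts on complex-valued functions and differs from the bicomplex \<open>dbar\<close> of
  the theorem, whose unit is \<open>\<j>\<close>.\<close>

definition dz :: "(complex \<Rightarrow> complex) \<Rightarrow> complex \<Rightarrow> complex"
  where "dz \<phi> z = pd 1 \<phi> z + \<i> * pd \<i> \<phi> z"

text \<open>The constant in Pompeiu's formula for \<open>dz\<close> and the kernel 1/w, numerically
  2 pi. It is kept as the integral in which it arises, since the argument uses only that it is
  positive.\<close>

definition pomp :: real where "pomp = 2 * (\<integral>z. 1 / (1 + (cmod z)\<^sup>2)\<^sup>2 \<partial>lborel)"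

lemma smooth_dz: "smooth \<phi> \<Longrightarrow> smooth (dz \<phi>)"
  unfolding dz_def by (intro smooth_add smooth_mult smooth_const smooth_pd)

lemma test_fun_dz: "\<phi> \<in> test_fun \<Omega> \<Longrightarrow> dz \<phi> \<in> test_fun \<Omega>"
  unfolding dz_def by (intro test_fun_add test_fun_mult test_fun_pd smooth_const)

lemma dz_mult:
  assumes "smooth f" "smooth g" shows "dz (\<lambda>z. f z * g z) z = f z * dz g z + dz f z * g z"
  unfolding dz_def by (simp add: pd_mult smooth_differentiable assms algebra_simps)

lemma pomp_pos: "pomp > 0"
proof -
  let ?I = "\<integral>z. 1 / (1 + (cmod z)\<^sup>2)\<^sup>2 \<partial>lborel"
  have pos: "1 / (1 + (cmod z)\<^sup>2)\<^sup>2 > 0" for z :: complex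
  proof -
    have "1 + (cmod z)\<^sup>2 > 0" by (simp add: add_pos_nonneg)
    from zero_less_power[OF this, of 2] show ?thesis by simp
  qed
  have "?I \<noteq> 0"
  proof
    assume "?I = 0"
    then have "AE z::complex in lborel. 1 / (1 + (cmod z)\<^sup>2)\<^sup>2 = 0"
      using integral_nonneg_eq_0_iff_AE[OF integrable_inverse_quartic] by simp
    then have "AE z::complex in lborel. False"
      by (rule eventually_mono) (use pos in \<open>metis less_irrefl\<close>)
    then show False by (simp add: AE_iff_null UNIV_I null_sets_def)
  qed
  moreover have "?I \<ge> 0" by simp
  ultimately have "?I > 0" by linarith
  then show ?thesis by (simp add: pomp_def)
qed

lemma integral_scale:
  fixes f :: "complex \<Rightarrow> 'b::{banach, second_countable_topology}"
  assumes "c > 0" and [measurable]: "f \<in> borel_measurable borel"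
  shows "(\<integral>w. f w \<partial>lborel) = c\<^sup>2 *\<^sub>R (\<integral>w. f (c *\<^sub>R w) \<partial>lborel)"
proof -
  have eq: "(lborel :: complex measure) = density (distr lborel borel (\<lambda>x. 0 + c *\<^sub>R x)) (\<lambda>_. ennreal (c\<^sup>2))"
    using lborel_affine[of c "0::complex"] assms(1) by simp
  have "(\<integral>w. f w \<partial>lborel) = (\<integral>w. c\<^sup>2 *\<^sub>R f w \<partial>distr lborel borel (\<lambda>x. 0 + c *\<^sub>R x))"
    by (subst eq, subst integral_density) auto
  also have "\<dots> = (\<integral>w. c\<^sup>2 *\<^sub>R f (c *\<^sub>R w) \<partial>lborel)"
    by (subst integral_distr) auto
  finally show ?thesis by simp
qed

lemma pd_cnj_id: "pd e cnj z = cnj e"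
  by (rule pd_eqI) (rule bounded_linear_imp_has_derivative[OF bounded_linear_cnj])

lemma pd_id: "pd e (\<lambda>z. z) z = e"
  by (rule pd_eqI) (rule has_derivative_ident)

lemma smooth_id: "smooth (\<lambda>z. z)" by (rule smooth_linear) (rule bounded_linear_ident)

lemma kernel_integrable:
  fixes h :: "complex \<Rightarrow> complex"
  assumes [measurable]: "h \<in> borel_measurable borel" and b: "AE w in lborel. cmod (h w) \<le> B * indicator (ball 0 R) w"
  shows "integrable lborel (\<lambda>w. h w * (1 / (z - w)))"
proof (rule integrableI_bounded)
  have "(\<integral>\<^sup>+w. ennreal (norm (h w * (1 / (z - w)))) \<partial>lborel) \<le>
    (\<integral>\<^sup>+w. ennreal \<bar>B\<bar> * (ennreal (1 / cmod (z - w)) * indicator (ball 0 R) w) \<partial>lborel)"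
  proof (rule nn_integral_mono_AE, use b in eventually_elim)
    fix w assume "cmod (h w) \<le> B * indicator (ball 0 R) w"
    also have "\<dots> \<le> \<bar>B\<bar> * indicator (ball 0 R) w" by (intro mult_right_mono) auto
    finally have "norm (h w * (1 / (z - w))) \<le> \<bar>B\<bar> * (1 / cmod (z - w) * indicator (ball 0 R) w)"
      unfolding norm_mult norm_divide by (auto simp: indicator_def divide_right_mono)
    then have "ennreal (norm (h w * (1 / (z - w)))) \<le> ennreal (\<bar>B\<bar> * (1 / cmod (z - w) * indicator (ball 0 R) w))"
      by (rule ennreal_leI)
    also have "\<dots> = ennreal \<bar>B\<bar> * (ennreal (1 / cmod (z - w)) * indicator (ball 0 R) w)"
      by (simp add: indicator_def ennreal_mult'[symmetric])
    finally show "ennreal (norm (h w * (1 / (z - w)))) \<le> ennreal \<bar>B\<bar> * (ennreal (1 / cmod (z - w)) * indicator (ball 0 R) w)" .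
  qed
  also have "\<dots> = ennreal \<bar>B\<bar> * (\<integral>\<^sup>+w. (ennreal (1 / cmod (z - w)) * indicator (ball 0 R) w) \<partial>lborel)"
    by (rule nn_integral_cmult) measurable
  also have "\<dots> \<le> ennreal \<bar>B\<bar> * ennreal (kernel_bound R)" by (intro mult_left_mono nn_kernel_one) auto
  also have "\<dots> < \<infinity>" by (simp add: ennreal_mult_less_top)
  finally show "(\<integral>\<^sup>+w. ennreal (norm (h w * (1 / (z - w)))) \<partial>lborel) < \<infinity>" .
qed measurable

text \<open>Instead of cutting out a small disc around the pole, the kernel is regularised to cnj w
  / (d^2 + |w|^2). This is smooth, so integration by parts produces no boundary term; what remains
  is an approximate identity of mass \<open>pomp\<close>, and d tends to 0.\<close>

lemma pompeiu0:
  assumes \<phi>: "smooth \<phi>" and R: "\<And>z. cmod z > R \<Longrightarrow> \<phi> z = 0"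
  shows "(\<integral>w. dz \<phi> w * (1 / w) \<partial>lborel) = - (of_real pomp * \<phi> 0)"
proof -
  have S: "pd e \<phi> z = 0" if "cmod z > R" for e z by (rule pd_support[of R]) (use R that in auto)
  have Sd: "dz \<phi> z = 0" if "cmod z > R" for z using S[OF that] by (simp add: dz_def)
  have cd: "continuous_on UNIV (dz \<phi>)" by (intro smooth_continuous smooth_dz \<phi>)
  have [measurable]: "dz \<phi> \<in> borel_measurable borel" "\<phi> \<in> borel_measurable borel"
    using \<phi> smooth_dz smooth_borel by auto
  have [measurable]: "cnj \<in> borel_measurable borel"
    by (intro borel_measurable_continuous_onI continuous_on_cnj continuous_on_id)
  obtain B where B: "B > 0" "\<And>z. cmod (dz \<phi> z) \<le> B"
    using continuous_bdd_support_bounded[OF cd Sd] by metis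
  obtain B' where B': "B' > 0" "\<And>z. cmod (\<phi> z) \<le> B'"
    using continuous_bdd_support_bounded[OF smooth_continuous[OF \<phi>] R] by metis
  have key: "(\<integral>w. dz \<phi> w * (cnj w / (of_real (d\<^sup>2) + w * cnj w)) \<partial>lborel) =
      (\<integral>v. - 2 * (\<phi> (d *\<^sub>R v) * of_real (1 / (1 + (cmod v)\<^sup>2)\<^sup>2)) \<partial>lborel)" if d: "d > 0" for d :: real
  proof -
    define D where "D z = of_real (d\<^sup>2) + z * cnj z" for z :: complex
    have Dr: "D z = of_real (d\<^sup>2 + (cmod z)\<^sup>2)" for z by (simp add: D_def complex_norm_square[symmetric])
    have D0: "D z \<noteq> 0" for z
    proof -
      have "d\<^sup>2 + (cmod z)\<^sup>2 > 0" using d by (simp add: add_pos_nonneg)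
      then show ?thesis unfolding Dr of_real_eq_0_iff by linarith
    qed
    have sD: "smooth D" unfolding D_def by (intro smooth_add smooth_mult smooth_const smooth_cnj smooth_id)
    have pD: "pd e D z = e * cnj z + z * cnj e" for e z
    proof -
      have "pd e D z = pd e (\<lambda>z. of_real (d\<^sup>2)) z + pd e (\<lambda>z. z * cnj z) z"
        unfolding D_def by (rule pd_add[OF smooth_differentiable smooth_differentiable])
          (intro smooth_const smooth_mult smooth_cnj smooth_id)+
      also have "pd e (\<lambda>z. z * cnj z) z = z * pd e cnj z + pd e (\<lambda>z. z) z * cnj z"
        by (rule pd_mult[OF smooth_differentiable smooth_differentiable]) (intro smooth_cnj smooth_id)+
      finally show ?thesis by (simp add: pd_cnj_id pd_id)
    qed
    \<comment> \<open>Since \<open>dz\<close> of the conjugate is 2, cnj z times dz \<phi> equals dz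
      \<psi> - 2 \<phi>; only the derivative of 1/D is then needed.\<close>
    define \<psi> where "\<psi> z = cnj z * \<phi> z" for z
    have s\<psi>: "smooth \<psi>" unfolding \<psi>_def by (intro smooth_mult smooth_cnj smooth_id \<phi>)
    have t\<psi>: "\<psi> \<in> test_fun UNIV" by (rule test_funI[OF s\<psi>, of "cball 0 R"]) (use R in \<open>auto simp: \<psi>_def\<close>)
    have p\<psi>: "pd e \<psi> z = cnj z * pd e \<phi> z + cnj e * \<phi> z" for e z
      unfolding \<psi>_def using pd_mult[of cnj z \<phi> e] by (simp add: pd_cnj_id smooth_differentiable \<phi> smooth_cnj[OF smooth_id])
    have bp: "(\<integral>z. 1 / D z * pd e \<psi> z \<partial>lborel) = (\<integral>z. pd e D z / (D z)\<^sup>2 * \<psi> z \<partial>lborel)" if "e \<in> {1, \<i>}" for e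
    proof -
      have "Ck_on (Suc 0) UNIV (\<lambda>z. 1 / D z)" using Ck1_reciprocal(1)[OF sD] D0 by simp
      from C1_by_parts[OF open_UNIV this t\<psi> that]
      have "(\<integral>z. 1 / D z * pd e \<psi> z \<partial>lborel) = - (\<integral>z. pd e (\<lambda>z. 1 / D z) z * \<psi> z \<partial>lborel)" .
      also have "\<dots> = - (\<integral>z. - (pd e D z / (D z)\<^sup>2 * \<psi> z) \<partial>lborel)"
        by (simp add: Ck1_reciprocal(2)[OF sD D0])
      finally show ?thesis by simp
    qed
    have c1D: "continuous_on UNIV (\<lambda>z. 1 / D z)" by (intro continuous_intros smooth_continuous sD) (use D0 in auto)
    have int: "integrable lborel (\<lambda>z. a z * b z)" if "continuous_on UNIV a" "continuous_on UNIV b" "\<And>z. cmod z > R \<Longrightarrow> b z = 0" for a b :: "complex \<Rightarrow> complex"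
      by (rule integrable_continuous_support[of _ R]) (use that in \<open>auto intro: continuous_intros\<close>)
    have R\<psi>: "\<psi> z = 0" "pd e \<psi> z = 0" if "cmod z > R" for e z using R[OF that] S[OF that] by (auto simp: \<psi>_def p\<psi>)
    have cont\<psi>: "continuous_on UNIV \<psi>" "continuous_on UNIV (pd e \<psi>)" for e by (intro smooth_continuous smooth_pd s\<psi>)+
    have cpD: "continuous_on UNIV (\<lambda>z. pd e D z / (D z)\<^sup>2)" for e
      by (intro continuous_intros smooth_continuous smooth_pd sD) (use D0 in auto)
    have c\<phi>: "continuous_on UNIV \<phi>" by (rule smooth_continuous[OF \<phi>])
    have "(\<integral>z. 1 / D z * (pd 1 \<psi> z + \<i> * pd \<i> \<psi> z) \<partial>lborel) = (\<integral>z. 1 / D z * pd 1 \<psi> z \<partial>lborel) + \<i> * (\<integral>z. 1 / D z * pd \<i> \<psi> z \<partial>lborel)"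
    proof -
      have j: "integrable lborel (\<lambda>z. 1 / D z * pd e \<psi> z)" for e by (rule int[OF c1D cont\<psi>(2) R\<psi>(2)])
      have "1 / D z * (pd 1 \<psi> z + \<i> * pd \<i> \<psi> z) = 1 / D z * pd 1 \<psi> z + \<i> * (1 / D z * pd \<i> \<psi> z)" for z
        by (simp add: algebra_simps)
      then show ?thesis
        by (simp only: Bochner_Integration.integral_add[OF j integrable_mult_right[OF j]] integral_mult_right_zero)
    qed
    also have "\<dots> = (\<integral>z. pd 1 D z / (D z)\<^sup>2 * \<psi> z \<partial>lborel) + \<i> * (\<integral>z. pd \<i> D z / (D z)\<^sup>2 * \<psi> z \<partial>lborel)"
      by (simp only: bp insert_iff simp_thms)
    also have "\<dots> = (\<integral>z. pd 1 D z / (D z)\<^sup>2 * \<psi> z + \<i> * (pd \<i> D z / (D z)\<^sup>2 * \<psi> z) \<partial>lborel)"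
    proof -
      have j: "integrable lborel (\<lambda>z. pd e D z / (D z)\<^sup>2 * \<psi> z)" for e by (rule int[OF cpD cont\<psi>(1) R\<psi>(1)])
      show ?thesis
        by (simp only: Bochner_Integration.integral_add[OF j integrable_mult_right[OF j]] integral_mult_right_zero)
    qed
    also have "\<dots> = (\<integral>z. 2 * z / (D z)\<^sup>2 * \<psi> z \<partial>lborel)"
    proof (rule Bochner_Integration.integral_cong[OF refl])
      fix z
      have "pd 1 D z / (D z)\<^sup>2 * \<psi> z + \<i> * (pd \<i> D z / (D z)\<^sup>2 * \<psi> z) = (pd 1 D z + \<i> * pd \<i> D z) / (D z)\<^sup>2 * \<psi> z"
        by (simp add: add_divide_distrib algebra_simps)
      moreover have "pd 1 D z + \<i> * pd \<i> D z = 2 * z" by (simp add: pD algebra_simps)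
      ultimately show "pd 1 D z / (D z)\<^sup>2 * \<psi> z + \<i> * (pd \<i> D z / (D z)\<^sup>2 * \<psi> z) = 2 * z / (D z)\<^sup>2 * \<psi> z" by simp
    qed
    finally have e1: "(\<integral>z. 1 / D z * (pd 1 \<psi> z + \<i> * pd \<i> \<psi> z) \<partial>lborel) = (\<integral>z. 2 * z / (D z)\<^sup>2 * \<psi> z \<partial>lborel)" .
    have i1: "integrable lborel (\<lambda>z. 1 / D z * (pd 1 \<psi> z + \<i> * pd \<i> \<psi> z))"
      by (rule int[OF c1D]) (use cont\<psi> R\<psi> in \<open>auto intro!: continuous_intros\<close>)
    have i2: "integrable lborel (\<lambda>z. 1 / D z * (2 * \<phi> z))"
      by (rule int[OF c1D]) (use c\<phi> R in \<open>auto intro!: continuous_intros\<close>)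
    have i3: "integrable lborel (\<lambda>z. 2 * z / (D z)\<^sup>2 * \<psi> z)"
      by (rule int[OF _ cont\<psi>(1) R\<psi>(1)], intro continuous_intros smooth_continuous sD) (use D0 in auto)
    have "dz \<phi> w * (cnj w / D w) = 1 / D w * (pd 1 \<psi> w + \<i> * pd \<i> \<psi> w) - 1 / D w * (2 * \<phi> w)" for w
      by (simp add: p\<psi> dz_def algebra_simps add_divide_distrib diff_divide_distrib)
    then have "(\<integral>w. dz \<phi> w * (cnj w / D w) \<partial>lborel) = (\<integral>z. 1 / D z * (pd 1 \<psi> z + \<i> * pd \<i> \<psi> z) \<partial>lborel) - (\<integral>z. 1 / D z * (2 * \<phi> z) \<partial>lborel)"
      by (simp only: Bochner_Integration.integral_diff[OF i1 i2])
    also have "\<dots> = (\<integral>z. 2 * z / (D z)\<^sup>2 * \<psi> z - 1 / D z * (2 * \<phi> z) \<partial>lborel)"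
      by (simp only: e1 Bochner_Integration.integral_diff[OF i3 i2])
    also have "\<dots> = (\<integral>z. - 2 * of_real (d\<^sup>2) * \<phi> z / (D z)\<^sup>2 \<partial>lborel)"
    proof (rule Bochner_Integration.integral_cong[OF refl])
      fix z
      have "1 / D z = D z / (D z)\<^sup>2" using D0 by (simp add: power2_eq_square)
      then have "2 * z / (D z)\<^sup>2 * \<psi> z - 1 / D z * (2 * \<phi> z) = (2 * z * cnj z - 2 * D z) * \<phi> z / (D z)\<^sup>2"
        by (simp add: \<psi>_def algebra_simps diff_divide_distrib)
      then show "2 * z / (D z)\<^sup>2 * \<psi> z - 1 / D z * (2 * \<phi> z) = - 2 * of_real (d\<^sup>2) * \<phi> z / (D z)\<^sup>2"
        by (simp add: D_def algebra_simps)
    qed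
    \<comment> \<open>The substitution w = d v makes the powers of d cancel: D scales by d^2, and d
      remains only in the argument of \<phi>.\<close>
    also have "\<dots> = d\<^sup>2 *\<^sub>R (\<integral>v. - 2 * of_real (d\<^sup>2) * \<phi> (d *\<^sub>R v) / (D (d *\<^sub>R v))\<^sup>2 \<partial>lborel)"
      by (rule integral_scale[OF d]) (use smooth_borel[OF sD] in measurable)
    also have "\<dots> = (\<integral>v. d\<^sup>2 *\<^sub>R (- 2 * of_real (d\<^sup>2) * \<phi> (d *\<^sub>R v) / (D (d *\<^sub>R v))\<^sup>2) \<partial>lborel)" by simp
    also have "\<dots> = (\<integral>v. - 2 * (\<phi> (d *\<^sub>R v) * of_real (1 / (1 + (cmod v)\<^sup>2)\<^sup>2)) \<partial>lborel)"
    proof (rule Bochner_Integration.integral_cong[OF refl])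
      fix v
      have "D (d *\<^sub>R v) = of_real (d\<^sup>2 * (1 + (cmod v)\<^sup>2))"
        unfolding Dr by (simp add: algebra_simps power_mult_distrib)
      moreover have "1 + (cmod v)\<^sup>2 \<noteq> 0" by (smt (verit) zero_le_power2)
      ultimately show "d\<^sup>2 *\<^sub>R (- 2 * of_real (d\<^sup>2) * \<phi> (d *\<^sub>R v) / (D (d *\<^sub>R v))\<^sup>2) = - 2 * (\<phi> (d *\<^sub>R v) * of_real (1 / (1 + (cmod v)\<^sup>2)\<^sup>2))"
        using d by (simp add: scaleR_conv_of_real power_mult_distrib power2_eq_square)
    qed
    finally show ?thesis by (simp add: D_def)
  qed
  let ?d = "\<lambda>n::nat. 1 / real (Suc n)"
  have dlim: "?d \<longlonglongrightarrow> 0" by (rule LIMSEQ_Suc[OF lim_1_over_n])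
  have L: "(\<lambda>n. \<integral>w. dz \<phi> w * (cnj w / (of_real ((?d n)\<^sup>2) + w * cnj w)) \<partial>lborel) \<longlonglongrightarrow> (\<integral>w. dz \<phi> w * (1 / w) \<partial>lborel)"
  proof (rule integral_dominated_convergence[where w="\<lambda>w. cmod (dz \<phi> w * (1 / (0 - w)))"])
    have "integrable lborel (\<lambda>w. dz \<phi> w * (1 / (0 - w)))"
      by (rule kernel_integrable[of _ B "R + 1"]) (use B Sd in \<open>auto simp: indicator_def\<close>)
    then show "integrable lborel (\<lambda>w. cmod (dz \<phi> w * (1 / (0 - w))))" by (rule integrable_norm)
    have "(\<lambda>n. dz \<phi> w * (cnj w / (of_real ((?d n)\<^sup>2) + w * cnj w))) \<longlonglongrightarrow> dz \<phi> w * (1 / w)" for w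
    proof (cases "w = 0")
      case False
      have "(\<lambda>n. dz \<phi> w * (cnj w / (of_real ((?d n)\<^sup>2) + w * cnj w))) \<longlonglongrightarrow> dz \<phi> w * (cnj w / (of_real (0\<^sup>2) + w * cnj w))"
        using False by (intro tendsto_intros dlim) auto
      then show ?thesis using False by simp
    qed simp
    then show "AE w in lborel. (\<lambda>n. dz \<phi> w * (cnj w / (of_real ((?d n)\<^sup>2) + w * cnj w))) \<longlonglongrightarrow> dz \<phi> w * (1 / w)" by simp
    \<comment> \<open>The regularised kernels are dominated by the Cauchy kernel itself, which is
      integrable against the bounded, compactly supported \<open>dz \<phi>\<close>.\<close>
    have "cmod (cnj w / (of_real ((?d n)\<^sup>2) + w * cnj w)) \<le> cmod (1 / (0 - w))" for n w
    proof (cases "w = 0")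
      case False
      have eq: "of_real ((?d n)\<^sup>2) + w * cnj w = of_real ((?d n)\<^sup>2 + (cmod w)\<^sup>2)"
        by (simp only: of_real_add complex_norm_square)
      have "cmod (cnj w / (of_real ((?d n)\<^sup>2) + w * cnj w)) = cmod w / ((?d n)\<^sup>2 + (cmod w)\<^sup>2)"
        unfolding eq norm_divide norm_of_real by simp
      also have "\<dots> \<le> cmod w / (cmod w)\<^sup>2" using False by (intro divide_left_mono mult_pos_pos) (auto simp: add_nonneg_pos)
      also have "\<dots> = cmod (1 / (0 - w))" using False by (simp add: norm_divide power2_eq_square)
      finally show ?thesis .
    qed simp
    then have "norm (dz \<phi> w * (cnj w / (of_real ((?d n)\<^sup>2) + w * cnj w))) \<le> cmod (dz \<phi> w * (1 / (0 - w)))" for n w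
      unfolding norm_mult by (intro mult_left_mono) auto
    then show "AE w in lborel. norm (dz \<phi> w * (cnj w / (of_real ((?d n)\<^sup>2) + w * cnj w))) \<le> cmod (dz \<phi> w * (1 / (0 - w)))" for n by simp
  qed measurable
  have "(\<lambda>n. \<integral>v. - 2 * (\<phi> (?d n *\<^sub>R v) * of_real (1 / (1 + (cmod v)\<^sup>2)\<^sup>2)) \<partial>lborel) \<longlonglongrightarrow>
     (\<integral>v. - 2 * (\<phi> 0 * of_real (1 / (1 + (cmod v)\<^sup>2)\<^sup>2)) \<partial>(lborel :: complex measure))"
  proof (rule integral_dominated_convergence[where w="\<lambda>v. 2 * B' * (1 / (1 + (cmod v)\<^sup>2)\<^sup>2)"])
    show "integrable lborel (\<lambda>v::complex. 2 * B' * (1 / (1 + (cmod v)\<^sup>2)\<^sup>2))"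
      by (intro integrable_mult_right integrable_inverse_quartic)
    have "(\<lambda>n. \<phi> (?d n *\<^sub>R v)) \<longlonglongrightarrow> \<phi> 0" for v
    proof -
      have "(\<lambda>n. ?d n *\<^sub>R v) \<longlonglongrightarrow> 0 *\<^sub>R v" by (intro tendsto_intros dlim)
      moreover have "isCont \<phi> (0 *\<^sub>R v)" using smooth_continuous[OF \<phi>, of UNIV] by (simp add: continuous_on_eq_continuous_at)
      ultimately show ?thesis using isCont_tendsto_compose by fastforce
    qed
    then show "AE v in lborel. (\<lambda>n. - 2 * (\<phi> (?d n *\<^sub>R v) * of_real (1 / (1 + (cmod v)\<^sup>2)\<^sup>2))) \<longlonglongrightarrow> - 2 * (\<phi> 0 * of_real (1 / (1 + (cmod v)\<^sup>2)\<^sup>2))"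
      by (intro AE_I2 tendsto_mult tendsto_const)
    have "norm (- 2 * (\<phi> (?d n *\<^sub>R v) * of_real (1 / (1 + (cmod v)\<^sup>2)\<^sup>2))) \<le> 2 * B' * (1 / (1 + (cmod v)\<^sup>2)\<^sup>2)" for n and v :: complex
      unfolding norm_mult norm_of_real using B'(2)[of "?d n *\<^sub>R v"] by (simp add: mult_right_mono divide_right_mono)
    then show "AE v in lborel. norm (- 2 * (\<phi> (?d n *\<^sub>R v) * of_real (1 / (1 + (cmod v)\<^sup>2)\<^sup>2))) \<le> 2 * B' * (1 / (1 + (cmod v)\<^sup>2)\<^sup>2)" for n by simp
  qed measurable
  moreover have "(\<integral>v. - 2 * (\<phi> 0 * of_real (1 / (1 + (cmod v)\<^sup>2)\<^sup>2)) \<partial>(lborel :: complex measure)) = - (of_real pomp * \<phi> 0)"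
  proof -
    have "(\<integral>v. complex_of_real (1 / (1 + (cmod v)\<^sup>2)\<^sup>2) \<partial>(lborel :: complex measure)) = of_real (\<integral>v. 1 / (1 + (cmod v)\<^sup>2)\<^sup>2 \<partial>lborel)"
      by (rule integral_complex_of_real)
    then show ?thesis by (simp add: pomp_def del: of_real_divide)
  qed
  ultimately show ?thesis using L key[of "?d n" for n] LIMSEQ_unique by simp
qed

lemma ennreal_mult3:
  "a \<ge> 0 \<Longrightarrow> b \<ge> 0 \<Longrightarrow> c \<ge> 0 \<Longrightarrow> ennreal (a * (b * c)) = ennreal a * ennreal b * ennreal c"
  by (simp add: ennreal_mult mult.assoc)

lemma pompeiu:
  assumes \<phi>: "smooth \<phi>" and R: "\<And>z. cmod z > R \<Longrightarrow> \<phi> z = 0"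
  shows "conv (\<lambda>w. 1 / w) (dz \<phi>) z = of_real pomp * \<phi> z"
proof -
  have "(\<integral>w. dz (\<lambda>w. \<phi> (z - w)) w * (1 / w) \<partial>lborel) = - (of_real pomp * \<phi> (z - 0))"
  proof (rule pompeiu0[OF smooth_reflect[OF \<phi>], of "R + cmod z"])
    fix w assume "cmod w > R + cmod z"
    then have "cmod (z - w) > R" using norm_triangle_ineq2[of w z] by (simp add: norm_minus_commute)
    then show "\<phi> (z - w) = 0" by (rule R)
  qed
  moreover have "dz (\<lambda>w. \<phi> (z - w)) w * (1 / w) = - (1 / w * dz \<phi> (z - w))" for w
    by (simp add: dz_def pd_reflect[OF \<phi>] algebra_simps)
  ultimately show ?thesis by (simp add: conv_def)
qed

lemma cauchy_kernel_locint: "locint UNIV (\<lambda>w. 1 / w)"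
  unfolding locint_def
proof (intro conjI allI impI)
  show [measurable]: "(\<lambda>w::complex. 1 / w) \<in> borel_measurable borel" by simp
  fix K :: "complex set" assume K: "compact K"
  obtain R where R: "K \<subseteq> ball 0 R"
    using bounded_subset_ballD[OF compact_imp_bounded[OF K]] by blast
  have "K \<in> sets borel" using K by (simp add: compact_imp_closed borel_closed)
  moreover have "cmod (indicator K w) \<le> 1 * indicator (ball 0 R) w" for w
    using R by (cases "w \<in> K") auto
  ultimately have "integrable lborel (\<lambda>w. indicator K w * (1 / (0 - w)) :: complex)"
    by (intro kernel_integrable[of _ 1 R]) auto
  then have "integrable lborel (\<lambda>w. - (indicator K w * (1 / (0 - w))) :: complex)" by (rule Bochner_Integration.integrable_minus)
  then show "integrable lborel (\<lambda>w. indicator K w * (1 / w) :: complex)" by simp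
qed

definition cau :: "(complex \<Rightarrow> complex) \<Rightarrow> complex \<Rightarrow> complex"
  where "cau h z = (\<integral>w. h w * (1 / (z - w)) \<partial>lborel)"

lemma cau_measurable:
  assumes [measurable]: "h \<in> borel_measurable borel" shows "cau h \<in> borel_measurable borel"
proof -
  have "(\<lambda>z. \<integral>w. h w * (1 / (z - w)) \<partial>lborel) \<in> borel_measurable borel" by measurable
  then show ?thesis by (simp add: cau_def[abs_def])
qed

text \<open>The bound needs no integrability: where the defining integral does not exist,
  \<open>cau h z\<close> is 0. It can therefore be applied at every point before anything is known
  about h beyond measurability.\<close>

lemma nn_cau_le:
  assumes "h \<in> borel_measurable borel"
  shows "ennreal (cmod (cau h z)) \<le> (\<integral>\<^sup>+w. ennreal (cmod (h w)) * ennreal (1 / cmod (z - w)) \<partial>lborel)"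
proof (cases "integrable lborel (\<lambda>w. h w * (1 / (z - w)))")
  case True
  have "ennreal (cmod (cau h z)) \<le> (\<integral>\<^sup>+w. ennreal (cmod (h w * (1 / (z - w)))) \<partial>lborel)"
    unfolding cau_def using integral_norm_bound_ennreal[OF True] by simp
  also have "\<dots> = (\<integral>\<^sup>+w. ennreal (cmod (h w)) * ennreal (1 / cmod (z - w)) \<partial>lborel)"
    by (simp add: norm_mult norm_divide ennreal_mult'[symmetric])
  finally show ?thesis .
next
  case False
  then show ?thesis by (simp add: cau_def not_integrable_integral_eq)
qed

lemma cau_locint:
  assumes h: "integrable lborel h" shows "locint UNIV (cau h)"
  unfolding locint_def
proof (intro conjI allI impI)
  have [measurable]: "h \<in> borel_measurable borel" using h by auto
  show cm [measurable]: "cau h \<in> borel_measurable borel" by (rule cau_measurable) simp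
  fix K :: "complex set" assume K: "compact K"
  obtain R where R: "K \<subseteq> ball 0 R"
    using bounded_subset_ballD[OF compact_imp_bounded[OF K]] by blast
  have [measurable]: "K \<in> sets borel" using K by (simp add: compact_imp_closed borel_closed)
  show "integrable lborel (\<lambda>z. indicator K z * cau h z)"
  proof (rule integrableI_bounded)
    have "(\<integral>\<^sup>+z. ennreal (norm (indicator K z * cau h z)) \<partial>lborel) \<le>
      (\<integral>\<^sup>+z. \<integral>\<^sup>+w. ennreal (cmod (h w)) * (ennreal (1 / cmod (w - z)) * indicator (ball 0 R) z) \<partial>lborel \<partial>lborel)"
    proof (rule nn_integral_mono)
      fix z
      show "ennreal (norm (indicator K z * cau h z)) \<le> (\<integral>\<^sup>+w. ennreal (cmod (h w)) * (ennreal (1 / cmod (w - z)) * indicator (ball 0 R) z) \<partial>lborel)"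
      proof (cases "z \<in> K")
        case True
        then have "z \<in> ball 0 R" using R by auto
        then show ?thesis using True nn_cau_le[of h z] by (simp add: norm_minus_commute)
      qed simp
    qed
    also have "\<dots> = (\<integral>\<^sup>+w. \<integral>\<^sup>+z. ennreal (cmod (h w)) * (ennreal (1 / cmod (w - z)) * indicator (ball 0 R) z) \<partial>lborel \<partial>lborel)"
      by (rule lborel_pair.Fubini') measurable
    also have "\<dots> = (\<integral>\<^sup>+w. ennreal (cmod (h w)) * (\<integral>\<^sup>+z. (ennreal (1 / cmod (w - z)) * indicator (ball 0 R) z) \<partial>lborel) \<partial>lborel)"
      by (intro nn_integral_cong nn_integral_cmult) measurable
    also have "\<dots> \<le> (\<integral>\<^sup>+w. ennreal (cmod (h w)) * ennreal (kernel_bound R) \<partial>lborel)"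
      by (intro nn_integral_mono mult_left_mono nn_kernel_one) auto
    also have "\<dots> = (\<integral>\<^sup>+w. ennreal (cmod (h w)) \<partial>lborel) * ennreal (kernel_bound R)"
      by (rule nn_integral_multc) measurable
    also have "\<dots> < \<infinity>" using h by (simp add: integrable_iff_bounded ennreal_mult_less_top)
    finally show "(\<integral>\<^sup>+z. ennreal (norm (indicator K z * cau h z)) \<partial>lborel) < \<infinity>" .
  qed measurable
qed

text \<open>The difference of the two kernels is (z' - z) / ((z - w)(z' - w)). The two-pole bound
  loses |z - z'|^(-1/2) against the factor |z - z'|, which leaves Hoelder exponent 1/2, enough for
  continuity.\<close>

lemma cau_holder:
  assumes [measurable]: "h \<in> borel_measurable borel" and b: "AE w in lborel. cmod (h w) \<le> B * indicator (ball 0 R) w" and "B \<ge> 0"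
  shows "cmod (cau h z - cau h z') \<le> B * (4 * sing_bound R) * sqrt (cmod (z - z'))"
proof (cases "z = z'")
  case False
  have i: "integrable lborel (\<lambda>w. h w * (1 / (z - w)))" for z by (rule kernel_integrable[OF assms(1,2)])
  have "cau h z - cau h z' = (\<integral>w. h w * (1 / (z - w)) - h w * (1 / (z' - w)) \<partial>lborel)"
    unfolding cau_def by (rule Bochner_Integration.integral_diff[OF i i, symmetric])
  then have "ennreal (cmod (cau h z - cau h z')) \<le> (\<integral>\<^sup>+w. ennreal (cmod (h w * (1 / (z - w)) - h w * (1 / (z' - w)))) \<partial>lborel)"
    using integral_norm_bound_ennreal[OF Bochner_Integration.integrable_diff[OF i i, of z z']] by simp
  also have "\<dots> \<le> (\<integral>\<^sup>+w. ennreal (B * cmod (z - z')) * (ennreal (1 / (cmod (z - w) * cmod (z' - w))) * indicator (ball 0 R) w) \<partial>lborel)"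
  proof (rule nn_integral_mono_AE, use b AE_lborel_singleton[of z] AE_lborel_singleton[of z'] in eventually_elim)
    fix w assume w: "cmod (h w) \<le> B * indicator (ball 0 R) w" "w \<noteq> z" "w \<noteq> z'"
    have "h w * (1 / (z - w)) - h w * (1 / (z' - w)) = h w * ((z' - z) / ((z - w) * (z' - w)))"
      using w by (simp add: field_simps)
    then have "cmod (h w * (1 / (z - w)) - h w * (1 / (z' - w))) = cmod (h w) * (cmod (z - z') / (cmod (z - w) * cmod (z' - w)))"
      by (simp add: norm_mult norm_divide norm_minus_commute)
    also have "\<dots> \<le> (B * indicator (ball 0 R) w) * (cmod (z - z') / (cmod (z - w) * cmod (z' - w)))"
      using w(1) by (intro mult_right_mono) auto
    also have "\<dots> = B * cmod (z - z') * (1 / (cmod (z - w) * cmod (z' - w)) * indicator (ball 0 R) w)" by simp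
    finally have "ennreal (cmod (h w * (1 / (z - w)) - h w * (1 / (z' - w)))) \<le> ennreal (B * cmod (z - z') * (1 / (cmod (z - w) * cmod (z' - w)) * indicator (ball 0 R) w))"
      by (rule ennreal_leI)
    also have "\<dots> = ennreal (B * cmod (z - z')) * (ennreal (1 / (cmod (z - w) * cmod (z' - w))) * indicator (ball 0 R) w)"
      using \<open>B \<ge> 0\<close> by (simp add: indicator_def ennreal_mult''[symmetric])
    finally show "ennreal (cmod (h w * (1 / (z - w)) - h w * (1 / (z' - w)))) \<le> ennreal (B * cmod (z - z')) * (ennreal (1 / (cmod (z - w) * cmod (z' - w))) * indicator (ball 0 R) w)" .
  qed
  also have "\<dots> = ennreal (B * cmod (z - z')) * (\<integral>\<^sup>+w. (ennreal (1 / (cmod (z - w) * cmod (z' - w))) * indicator (ball 0 R) w) \<partial>lborel)"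
    by (rule nn_integral_cmult) measurable
  also have "\<dots> \<le> ennreal (B * cmod (z - z')) * ennreal (4 * sing_bound R / sqrt (cmod (z - z')))"
    by (intro mult_left_mono nn_kernel_one_one[OF False]) auto
  also have "\<dots> = ennreal (B * cmod (z - z') * (4 * sing_bound R / sqrt (cmod (z - z'))))"
    using \<open>B \<ge> 0\<close> by (intro ennreal_mult[symmetric]) auto
  also have "B * cmod (z - z') * (4 * sing_bound R / sqrt (cmod (z - z'))) = B * (4 * sing_bound R) * (cmod (z - z') / sqrt (cmod (z - z')))" by simp
  also have "cmod (z - z') / sqrt (cmod (z - z')) = sqrt (cmod (z - z'))" by (rule real_div_sqrt) simp
  finally show ?thesis using \<open>B \<ge> 0\<close> by (subst (asm) ennreal_le_iff) auto
qed simp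

lemma cau_continuous:
  assumes "h \<in> borel_measurable borel" "AE w in lborel. cmod (h w) \<le> B * indicator (ball 0 R) w" "B \<ge> 0"
  shows "continuous_on UNIV (cau h)"
proof -
  have "(cau h \<longlongrightarrow> cau h z) (at z)" for z
  proof (rule Lim_transform_bound[of _ "\<lambda>w. B * (4 * sing_bound R) * sqrt (cmod (w - z))" "at z", THEN Lim_null[THEN iffD2]])
    show "\<forall>\<^sub>F w in at z. norm (cau h w - cau h z) \<le> norm (B * (4 * sing_bound R) * sqrt (cmod (w - z)))"
      using cau_holder[OF assms] by (intro always_eventually allI) (auto intro: order_trans[OF _ abs_ge_self])
    have "((\<lambda>w. B * (4 * sing_bound R) * sqrt (cmod (w - z))) \<longlongrightarrow> B * (4 * sing_bound R) * sqrt (cmod (z - z))) (at z)"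
      by (intro tendsto_intros)
    then show "((\<lambda>w. B * (4 * sing_bound R) * sqrt (cmod (w - z))) \<longlongrightarrow> 0) (at z)" by simp
  qed
  then show ?thesis by (simp add: continuous_on_def)
qed

definition wdz :: "complex set \<Rightarrow> (complex \<Rightarrow> complex) \<Rightarrow> (complex \<Rightarrow> complex) \<Rightarrow> bool"
  where "wdz \<Omega> q g \<longleftrightarrow> locint \<Omega> q \<and> locint \<Omega> g \<and>
    (\<forall>\<psi>\<in>test_fun \<Omega>. (\<integral>z. q z * dz \<psi> z \<partial>lborel) = - (\<integral>z. g z * \<psi> z \<partial>lborel))"

text \<open>By duality: the test
  function \<open>\<kappa> C\<phi>\<close>, with \<open>C\<phi>\<close> the Cauchy transform of \<open>\<phi>\<close>, is inserted into the weak equation.\<close>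

lemma cauchy_rep:
  assumes "open \<Omega>" and q: "wdz \<Omega> q g" and \<kappa>: "\<kappa> \<in> test_fun \<Omega>"
  defines "h \<equiv> \<lambda>z. g z * \<kappa> z + q z * dz \<kappa> z"
  shows "integrable lborel h" "AE z in lborel. z \<in> \<Omega> \<longrightarrow> of_real pomp * (q z * \<kappa> z) = cau h z"
proof -
  have lq: "locint \<Omega> q" and lg: "locint \<Omega> g" using q by (auto simp: wdz_def)
  have s\<kappa>: "smooth \<kappa>" by (rule test_fun_smooth[OF \<kappa>])
  have i: "integrable lborel (\<lambda>z. g z * \<kappa> z)" "integrable lborel (\<lambda>z. q z * dz \<kappa> z)"
    by (intro locint_mult_test[OF lg \<kappa>] locint_mult_test[OF lq test_fun_dz[OF \<kappa>]])+
  then show h: "integrable lborel h" unfolding h_def by simp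
  have [measurable]: "h \<in> borel_measurable borel" using h by auto
  have lq\<kappa>: "locint \<Omega> (\<lambda>z. of_real pomp * (q z * \<kappa> z))"
    by (intro locint_cmult locint_mono[OF integrable_imp_locint[OF locint_mult_test[OF lq \<kappa>]]]) simp
  have lcau: "locint \<Omega> (cau h)" by (rule locint_mono[OF cau_locint[OF h]]) simp
  have "AE z in lborel. z \<in> \<Omega> \<longrightarrow> of_real pomp * (q z * \<kappa> z) - cau h z = 0"
  proof (rule fundamental_lemma[OF assms(1) locint_diff[OF lq\<kappa> lcau]])
    fix \<phi> assume \<phi>: "\<phi> \<in> test_fun \<Omega>"
    have s\<phi>: "smooth \<phi>" by (rule test_fun_smooth[OF \<phi>])
    obtain R where R: "R > 0" "\<And>z. cmod z > R \<Longrightarrow> \<phi> z = 0" using test_fun_bdd_support[OF \<phi>] by metis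
    have S: "pd e \<phi> z = 0" if "cmod z > R" for e z by (rule pd_support[of R]) (use R that in auto)
    have c\<phi>: "continuous_on UNIV \<phi>" by (rule smooth_continuous[OF s\<phi>])
    have [measurable]: "\<phi> \<in> borel_measurable borel" by (rule smooth_borel[OF s\<phi>])
    let ?k = "\<lambda>w::complex. 1 / w"
    let ?C = "conv ?k \<phi>"
    have sC: "smooth ?C" by (rule smooth_conv[OF cauchy_kernel_locint s\<phi> R(2)])
    have pC: "pd e ?C = conv ?k (pd e \<phi>)" for e by (rule pd_conv[OF cauchy_kernel_locint s\<phi> R(2)])
    have dzC: "dz ?C z = of_real pomp * \<phi> z" for z
    proof -
      have j: "integrable lborel (\<lambda>w. ?k w * pd e \<phi> (z - w))" for e
        by (rule conv_integrable[OF cauchy_kernel_locint smooth_continuous[OF smooth_pd[OF s\<phi>]] S])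
      have "conv ?k (dz \<phi>) z = (\<integral>w. ?k w * pd 1 \<phi> (z - w) + \<i> * (?k w * pd \<i> \<phi> (z - w)) \<partial>lborel)"
        unfolding conv_def dz_def by (intro Bochner_Integration.integral_cong refl) (simp add: algebra_simps)
      also have "\<dots> = dz ?C z"
        unfolding dz_def pC
        by (simp only: Bochner_Integration.integral_add[OF j integrable_mult_right[OF j]] integral_mult_right_zero conv_def)
      finally show ?thesis using pompeiu[OF s\<phi> R(2)] by simp
    qed
    \<comment> \<open>C\<phi> is smooth but not compactly supported, so the cut-off \<kappa> makes
      it admissible; the derivative of \<kappa> is the origin of the second term of h.\<close>
    have "(\<integral>z. q z * dz (\<lambda>z. ?C z * \<kappa> z) z \<partial>lborel) = - (\<integral>z. g z * (?C z * \<kappa> z) \<partial>lborel)"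
      using q test_fun_mult[OF \<kappa> sC] unfolding wdz_def by blast
    moreover have "q z * dz (\<lambda>z. ?C z * \<kappa> z) z = q z * dz \<kappa> z * ?C z + of_real pomp * (q z * \<kappa> z) * \<phi> z" for z
      unfolding dz_mult[OF sC s\<kappa>] dzC by (simp add: algebra_simps)
    moreover have j1: "integrable lborel (\<lambda>z. q z * dz \<kappa> z * ?C z)"
      using locint_mult_test[OF lq test_fun_mult2[OF test_fun_dz[OF \<kappa>] sC]] by (simp add: mult.assoc)
    moreover have j2: "integrable lborel (\<lambda>z. of_real pomp * (q z * \<kappa> z) * \<phi> z)"
      by (rule locint_mult_test[OF lq\<kappa> \<phi>])
    ultimately have e1: "(\<integral>z. q z * dz \<kappa> z * ?C z \<partial>lborel) + (\<integral>z. of_real pomp * (q z * \<kappa> z) * \<phi> z \<partial>lborel) = - (\<integral>z. g z * (?C z * \<kappa> z) \<partial>lborel)"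
      by simp
    have j3: "integrable lborel (\<lambda>z. g z * (?C z * \<kappa> z))"
      by (rule locint_mult_test[OF lg test_fun_mult[OF \<kappa> sC]])
    have "(\<integral>z. h z * ?C z \<partial>lborel) = (\<integral>z. g z * (?C z * \<kappa> z) + q z * dz \<kappa> z * ?C z \<partial>lborel)"
      unfolding h_def by (intro Bochner_Integration.integral_cong refl) (simp add: algebra_simps)
    also have "\<dots> = (\<integral>z. g z * (?C z * \<kappa> z) \<partial>lborel) + (\<integral>z. q z * dz \<kappa> z * ?C z \<partial>lborel)"
      by (rule Bochner_Integration.integral_add[OF j3 j1])
    finally have e2: "(\<integral>z. of_real pomp * (q z * \<kappa> z) * \<phi> z \<partial>lborel) = - (\<integral>z. h z * ?C z \<partial>lborel)"
      using e1 by (simp add: algebra_simps eq_neg_iff_add_eq_0)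
    obtain B where B: "B > 0" "\<And>z. cmod (\<phi> z) \<le> B" using continuous_bdd_support_bounded[OF c\<phi> R(2)] by metis
    have \<phi>le: "cmod (\<phi> w) \<le> B * indicator (ball 0 (R+1)) w" for w using B(2)[of w] R(2)[of w] by (auto simp: indicator_def)
    let ?f = "\<lambda>z w. h z * (\<phi> w * (1 / (z - w)))"
    \<comment> \<open>For fixed z the kernel is integrated over the support of the bounded function
      \<phi>, with a bound independent of z; what remains is the mean of |h|. This justifies moving
      the transform from \<phi> to h.\<close>
    have int2: "integrable (lborel \<Otimes>\<^sub>M lborel) (case_prod ?f)"
    proof (rule integrableI_bounded)
      have "(\<integral>\<^sup>+x. ennreal (norm (case_prod ?f x)) \<partial>(lborel \<Otimes>\<^sub>M lborel)) = (\<integral>\<^sup>+z. \<integral>\<^sup>+w. ennreal (norm (?f z w)) \<partial>lborel \<partial>lborel)"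
        using lborel.nn_integral_fst[of "\<lambda>x. ennreal (norm (case_prod ?f x))" "lborel :: complex measure"] by simp
      also have "\<dots> \<le> (\<integral>\<^sup>+z. ennreal (cmod (h z)) * ennreal (B * kernel_bound (R+1)) \<partial>lborel)"
      proof (rule nn_integral_mono)
        fix z
        have "(\<integral>\<^sup>+w. ennreal (norm (?f z w)) \<partial>lborel) \<le> (\<integral>\<^sup>+w. (ennreal (cmod (h z)) * ennreal B) * (ennreal (1 / cmod (z - w)) * indicator (ball 0 (R+1)) w) \<partial>lborel)"
        proof (rule nn_integral_mono)
          fix w
          have "norm (?f z w) = cmod (h z) * (cmod (\<phi> w) * (1 / cmod (z - w)))" by (simp add: norm_mult norm_divide)
          also have "\<dots> \<le> cmod (h z) * ((B * indicator (ball 0 (R+1)) w) * (1 / cmod (z - w)))"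
            by (intro mult_left_mono mult_right_mono \<phi>le) auto
          finally have "ennreal (norm (?f z w)) \<le> ennreal (cmod (h z) * ((B * indicator (ball 0 (R+1)) w) * (1 / cmod (z - w))))" by (rule ennreal_leI)
          also have "\<dots> = (ennreal (cmod (h z)) * ennreal B) * (ennreal (1 / cmod (z - w)) * indicator (ball 0 (R+1)) w)"
          proof (cases "w \<in> ball 0 (R+1)")
            case True
            show ?thesis unfolding indicator_simps(1)[OF True] mult_1_right
              by (rule ennreal_mult3) (use B(1) in auto)
          qed (simp add: indicator_def)
          finally show "ennreal (norm (?f z w)) \<le> (ennreal (cmod (h z)) * ennreal B) * (ennreal (1 / cmod (z - w)) * indicator (ball 0 (R+1)) w)" .
        qed
        also have "\<dots> = (ennreal (cmod (h z)) * ennreal B) * (\<integral>\<^sup>+w. (ennreal (1 / cmod (z - w)) * indicator (ball 0 (R+1)) w) \<partial>lborel)"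
          by (rule nn_integral_cmult) measurable
        also have "\<dots> \<le> (ennreal (cmod (h z)) * ennreal B) * ennreal (kernel_bound (R+1))"
          by (intro mult_left_mono nn_kernel_one) auto
        finally show "(\<integral>\<^sup>+w. ennreal (norm (?f z w)) \<partial>lborel) \<le> ennreal (cmod (h z)) * ennreal (B * kernel_bound (R+1))"
          using B(1) by (simp add: ennreal_mult mult.assoc)
      qed
      also have "\<dots> = (\<integral>\<^sup>+z. ennreal (cmod (h z)) \<partial>lborel) * ennreal (B * kernel_bound (R+1))"
        by (rule nn_integral_multc) measurable
      also have "\<dots> < \<infinity>" using h by (simp add: integrable_iff_bounded ennreal_mult_less_top)
      finally show "(\<integral>\<^sup>+x. ennreal (norm (case_prod ?f x)) \<partial>(lborel \<Otimes>\<^sub>M lborel)) < \<infinity>" .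
    qed measurable
    have "(\<integral>z. h z * ?C z \<partial>lborel) = (\<integral>z. \<integral>w. ?f z w \<partial>lborel \<partial>lborel)"
    proof (rule Bochner_Integration.integral_cong[OF refl])
      fix z
      have "?C z = (\<integral>w. 1 / (z - w) * \<phi> w \<partial>lborel)"
        by (rule conv_commute[OF cauchy_kernel_locint c\<phi>])
      also have "\<dots> = (\<integral>w. \<phi> w * (1 / (z - w)) \<partial>lborel)" by (simp only: mult.commute)
      finally show "h z * ?C z = (\<integral>w. ?f z w \<partial>lborel)" by (simp only: integral_mult_right_zero)
    qed
    also have "\<dots> = (\<integral>w. \<integral>z. ?f z w \<partial>lborel \<partial>lborel)"
      by (rule lborel_pair.Fubini_integral[OF int2, symmetric])
    also have "\<dots> = (\<integral>w. - (cau h w * \<phi> w) \<partial>lborel)"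
    proof (rule Bochner_Integration.integral_cong[OF refl])
      fix w
      \<comment> \<open>The Cauchy kernel is odd, so exchanging the roles of z and w changes the
        sign.\<close>
      have "?f z w = - \<phi> w * (h z * (1 / (w - z)))" for z
      proof -
        have "1 / (z - w) = - (1 / (w - z))" using minus_divide_right[of 1 "w - z"] by simp
        then show ?thesis by (simp only:) simp
      qed
      then have "(\<integral>z. ?f z w \<partial>lborel) = - \<phi> w * cau h w" by (simp only: integral_mult_right_zero cau_def)
      then show "(\<integral>z. ?f z w \<partial>lborel) = - (cau h w * \<phi> w)" by simp
    qed
    finally have e3: "(\<integral>z. h z * ?C z \<partial>lborel) = - (\<integral>w. cau h w * \<phi> w \<partial>lborel)" by simp
    show "(\<integral>z. (of_real pomp * (q z * \<kappa> z) - cau h z) * \<phi> z \<partial>lborel) = 0"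
      unfolding left_diff_distrib
      using e2 e3 j2 locint_mult_test[OF lcau \<phi>] by simp
  qed
  then show "AE z in lborel. z \<in> \<Omega> \<longrightarrow> of_real pomp * (q z * \<kappa> z) = cau h z" by simp
qed

section \<open>Continuity of weak solutions\<close>

text \<open>The discs may be uncountably many; the Lindelof property selects countably many with the
  same union, and null sets are closed under countable unions.\<close>

lemma AE_open_local:
  fixes \<Omega> :: "complex set"
  assumes "\<And>z. z \<in> \<Omega> \<Longrightarrow> \<exists>r>0. AE w in lborel. w \<in> ball z r \<longrightarrow> P w"
  shows "AE w in lborel. w \<in> \<Omega> \<longrightarrow> P w"
proof -
  obtain r where r: "\<And>z. z \<in> \<Omega> \<Longrightarrow> r z > 0" "\<And>z. z \<in> \<Omega> \<Longrightarrow> AE w in lborel. w \<in> ball z (r z) \<longrightarrow> P w"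
    using assms by metis
  let ?F = "(\<lambda>z. ball z (r z)) ` \<Omega>"
  obtain F' where F': "F' \<subseteq> ?F" "countable F'" "\<Union>F' = \<Union>?F"
    using Lindelof[of ?F] by auto
  have "AE w in lborel. \<forall>B\<in>F'. w \<in> B \<longrightarrow> P w"
  proof (subst AE_ball_countable[OF F'(2)], intro ballI)
    fix B assume "B \<in> F'"
    then obtain z where "z \<in> \<Omega>" "B = ball z (r z)" using F'(1) by auto
    then show "AE w in lborel. w \<in> B \<longrightarrow> P w" using r(2) by simp
  qed
  then show ?thesis
  proof (rule eventually_mono, intro impI)
    fix w assume w: "\<forall>B\<in>F'. w \<in> B \<longrightarrow> P w" "w \<in> \<Omega>"
    then have "w \<in> \<Union>?F" using r(1)[of w] by (auto intro!: bexI[of _ w])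
    then show "P w" using w F'(3) by auto
  qed
qed

lemma AE_cont_zero:
  fixes f :: "complex \<Rightarrow> complex"
  assumes "open S" "continuous_on S f" "AE z in lborel. z \<in> S \<longrightarrow> f z = 0" "z \<in> S"
  shows "f z = 0"
proof (rule ccontr)
  assume ne: "f z \<noteq> 0"
  have "open (S \<inter> f -` (- {0}))"
    using assms(2,1) by (rule continuous_open_preimage) auto
  then obtain e where e: "e > 0" "ball z e \<subseteq> S \<inter> f -` (- {0})"
    using ne assms(4) by (metis ComplI IntI open_contains_ball singletonD vimageI)
  have "AE w::complex in lborel. w \<notin> ball z e"
    using assms(3) by (rule eventually_mono) (use e(2) in auto)
  then have "ball z e \<in> null_sets lborel" by (subst AE_iff_null_sets) auto
  then have "negligible (ball z e)" by (simp add: negligible_iff_null_sets null_sets_completionI)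
  then show False using open_not_negligible[of "ball z e"] e(1) by simp
qed

lemma AE_cont_eq:
  fixes f g :: "complex \<Rightarrow> complex"
  assumes "open S" "continuous_on S f" "continuous_on S g" "AE z in lborel. z \<in> S \<longrightarrow> f z = g z" "z \<in> S"
  shows "f z = g z"
  using AE_cont_zero[OF assms(1) continuous_on_diff[OF assms(2,3)] _ assms(5)] assms(4) by simp

text \<open>Local representatives agree on overlaps, because continuous functions that are equal
  almost everywhere on an open set are equal on it. Hence the value at w may be taken from the disc
  centred at w itself.\<close>

lemma continuous_rep_patch:
  fixes q :: "complex \<Rightarrow> complex"
  assumes "\<And>z. z \<in> \<Omega> \<Longrightarrow> \<exists>r>0. \<exists>Q. continuous_on (ball z r) Q \<and> (AE w in lborel. w \<in> ball z r \<longrightarrow> Q w = q w)"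
  shows "\<exists>Q. continuous_on \<Omega> Q \<and> (AE w in lborel. w \<in> \<Omega> \<longrightarrow> Q w = q w)"
proof -
  obtain r Q where r: "\<And>z. z \<in> \<Omega> \<Longrightarrow> r z > 0" "\<And>z. z \<in> \<Omega> \<Longrightarrow> continuous_on (ball z (r z)) (Q z)"
    "\<And>z. z \<in> \<Omega> \<Longrightarrow> AE w in lborel. w \<in> ball z (r z) \<longrightarrow> Q z w = q w"
    using assms by metis
  have eq: "Q w w = Q z w" if "z \<in> \<Omega>" "w \<in> \<Omega>" "w \<in> ball z (r z)" for z w
  proof (rule AE_cont_eq[of "ball w (r w) \<inter> ball z (r z)" "Q w" "Q z"])
    show "continuous_on (ball w (r w) \<inter> ball z (r z)) (Q w)" "continuous_on (ball w (r w) \<inter> ball z (r z)) (Q z)"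
      using r(2) that continuous_on_subset by blast+
    show "AE x in lborel. x \<in> ball w (r w) \<inter> ball z (r z) \<longrightarrow> Q w x = Q z x"
      using r(3)[OF that(1)] r(3)[OF that(2)] by eventually_elim auto
  qed (use that r(1) in auto)
  show ?thesis
  proof (intro exI[of _ "\<lambda>w. Q w w"] conjI)
    show "continuous_on \<Omega> (\<lambda>w. Q w w)"
      unfolding continuous_on_def
    proof
      fix z assume z: "z \<in> \<Omega>"
      have "(Q z \<longlongrightarrow> Q z z) (at z)"
        using r(2)[OF z] r(1)[OF z] by (metis centre_in_ball continuous_on_eq_continuous_at isContD open_ball)
      then have "(Q z \<longlongrightarrow> Q z z) (at z within \<Omega>)" by (rule tendsto_within_subset) simp
      moreover have "\<forall>\<^sub>F w in at z within \<Omega>. Q z w = Q w w"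
        using eventually_at_ball'[OF r(1)[OF z], of z \<Omega>] eventually_at_in_open'[of "ball z (r z)" z]
        by (auto simp: eventually_at_filter elim!: eventually_mono intro: eq[OF z, symmetric])
      ultimately show "((\<lambda>w. Q w w) \<longlongrightarrow> Q z z) (at z within \<Omega>)"
        by (rule Lim_transform_eventually)
    qed
    show "AE w in lborel. w \<in> \<Omega> \<longrightarrow> Q w w = q w"
    proof -
      have "AE w in lborel. w \<in> \<Omega> \<longrightarrow> (w \<in> \<Omega> \<longrightarrow> Q w w = q w)"
      proof (rule AE_open_local)
        fix z assume z: "z \<in> \<Omega>"
        have "AE w in lborel. w \<in> ball z (r z) \<longrightarrow> w \<in> \<Omega> \<longrightarrow> Q w w = q w"
          using r(3)[OF z] by (rule eventually_mono) (use eq[OF z] in auto)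
        then show "\<exists>r>0. AE w in lborel. w \<in> ball z r \<longrightarrow> w \<in> \<Omega> \<longrightarrow> Q w w = q w" using r(1)[OF z] by blast
      qed
      then show ?thesis by simp
    qed
  qed
qed

lemma wdz_mono: "wdz \<Omega> q g \<Longrightarrow> S \<subseteq> \<Omega> \<Longrightarrow> wdz S q g"
  unfolding wdz_def using locint_mono test_fun_mono by blast

text \<open>With \<kappa> = 1 on the smaller disc, q is there a multiple of the Cauchy transform of
  a bounded function supported in the larger disc, and such a transform is continuous by
  \<open>cau_continuous\<close>.\<close>

lemma wdz_continuous_local:
  assumes "open \<Omega>" and q: "wdz \<Omega> q g" and z: "cball z r \<subseteq> \<Omega>" "r > 0"
    and b: "AE w in lborel. w \<in> ball z r \<longrightarrow> cmod (q w) \<le> B \<and> cmod (g w) \<le> B"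
  shows "\<exists>Q. continuous_on (ball z (r/2)) Q \<and> (AE w in lborel. w \<in> ball z (r/2) \<longrightarrow> Q w = q w)"
proof -
  have sub: "ball z r \<subseteq> \<Omega>" using z(1) ball_subset_cball by blast
  have w: "wdz (ball z r) q g" by (rule wdz_mono[OF q sub])
  have "cball z (r/2) \<subseteq> ball z r" using z(2) by auto
  then obtain \<kappa> where \<kappa>: "\<kappa> \<in> test_fun (ball z r)" "\<And>w. w \<in> cball z (r/2) \<Longrightarrow> \<kappa> w = 1" "\<And>w. cmod (\<kappa> w) \<le> 1"
    using cutoff[of "cball z (r/2)" "ball z r"] by auto
  define h where "h w = g w * \<kappa> w + q w * dz \<kappa> w" for w
  have h: "integrable lborel h" "AE w in lborel. w \<in> ball z r \<longrightarrow> of_real pomp * (q w * \<kappa> w) = cau h w"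
    using cauchy_rep[OF open_ball w \<kappa>(1)] unfolding h_def[abs_def] by auto
  have d\<kappa>: "dz \<kappa> \<in> test_fun (ball z r)" by (rule test_fun_dz[OF \<kappa>(1)])
  obtain R where R: "R > 0" "\<And>w. cmod w > R \<Longrightarrow> dz \<kappa> w = 0" using test_fun_bdd_support[OF d\<kappa>] by metis
  obtain D where D: "D > 0" "\<And>w. cmod (dz \<kappa> w) \<le> D"
    using continuous_bdd_support_bounded[OF smooth_continuous[OF test_fun_smooth[OF d\<kappa>]] R(2)] by metis
  define B1 where "B1 = \<bar>B\<bar> + \<bar>B\<bar> * D"
  have B1: "B1 \<ge> 0" using D by (simp add: B1_def)
  have "AE w in lborel. cmod (h w) \<le> B1 * indicator (ball 0 (cmod z + r)) w"
    using b
  proof (rule eventually_mono)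
    fix w assume bw: "w \<in> ball z r \<longrightarrow> cmod (q w) \<le> B \<and> cmod (g w) \<le> B"
    show "cmod (h w) \<le> B1 * indicator (ball 0 (cmod z + r)) w"
    proof (cases "w \<in> ball z r")
      case True
      then have "cmod w < cmod z + r" using norm_triangle_ineq2[of w z] by (simp add: dist_norm norm_minus_commute)
      moreover have "cmod (h w) \<le> cmod (g w) * cmod (\<kappa> w) + cmod (q w) * cmod (dz \<kappa> w)"
        unfolding h_def by (intro order_trans[OF norm_triangle_ineq]) (simp add: norm_mult)
      moreover have "\<dots> \<le> \<bar>B\<bar> * 1 + \<bar>B\<bar> * D"
        using bw True \<kappa>(3)[of w] D by (intro add_mono mult_mono) auto
      ultimately show ?thesis by (simp add: B1_def)
    next
      case False
      then show ?thesis using test_fun_zero[OF \<kappa>(1) False] test_fun_zero[OF d\<kappa> False] B1 by (simp add: h_def)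
    qed
  qed
  then have c: "continuous_on UNIV (cau h)" using h(1) B1 by (intro cau_continuous[of h B1]) auto
  show ?thesis
  proof (intro exI[of _ "\<lambda>w. cau h w / of_real pomp"] conjI)
    show "continuous_on (ball z (r/2)) (\<lambda>w. cau h w / of_real pomp)"
      using c pomp_pos by (intro continuous_intros) (auto intro: continuous_on_subset)
    show "AE w in lborel. w \<in> ball z (r/2) \<longrightarrow> cau h w / of_real pomp = q w"
      using h(2)
    proof (rule eventually_mono, intro impI)
      fix w assume w: "w \<in> ball z r \<longrightarrow> of_real pomp * (q w * \<kappa> w) = cau h w" "w \<in> ball z (r/2)"
      then have "w \<in> ball z r" "\<kappa> w = 1" using z(2) \<kappa>(2)[of w] by auto
      then have "of_real pomp * q w = cau h w" using w by simp
      then show "cau h w / of_real pomp = q w" using pomp_pos by (simp add: field_simps)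
    qed
  qed
qed

lemma wdz_bounded_continuous:
  assumes "open \<Omega>" "wdz \<Omega> q g" "\<And>z. cmod (q z) \<le> B" "\<And>z. cmod (g z) \<le> B"
  shows "\<exists>Q. continuous_on \<Omega> Q \<and> (AE w in lborel. w \<in> \<Omega> \<longrightarrow> Q w = q w)"
proof (rule continuous_rep_patch)
  fix z assume "z \<in> \<Omega>"
  then obtain r where r: "r > 0" "cball z r \<subseteq> \<Omega>" using assms(1) open_contains_cball by blast
  show "\<exists>r>0. \<exists>Q. continuous_on (ball z r) Q \<and> (AE w in lborel. w \<in> ball z r \<longrightarrow> Q w = q w)"
    using wdz_continuous_local[OF assms(1,2) r(2,1), of B] assms(3,4) r(1) by (intro exI[of _ "r/2"]) auto
qed

text \<open>Three applications of the kernel \<open>1/\<bar>z\<bar>\<close> map \<open>L\<^sup>1\<close> to \<open>L\<^sup>\<infinity>\<close>.\<close>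

lemma triple_kernel_bound:
  fixes M1 M2 M3 M4 :: "complex \<Rightarrow> ennreal" and C :: real
  assumes [measurable]: "M2 \<in> borel_measurable borel" "M3 \<in> borel_measurable borel" "M4 \<in> borel_measurable borel"
    and supp: "\<And>w. w \<notin> ball 0 R \<Longrightarrow> M2 w = 0" "\<And>w. w \<notin> ball 0 R \<Longrightarrow> M3 w = 0"
    and le: "AE z in lborel. M1 z \<le> ennreal C * (\<integral>\<^sup>+w. M2 w * ennreal (1 / cmod (z - w)) \<partial>lborel)"
      "AE z in lborel. M2 z \<le> ennreal C * (\<integral>\<^sup>+w. M3 w * ennreal (1 / cmod (z - w)) \<partial>lborel)"
      "AE z in lborel. M3 z \<le> ennreal C * (\<integral>\<^sup>+w. M4 w * ennreal (1 / cmod (z - w)) \<partial>lborel)"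
    and fin: "(\<integral>\<^sup>+w. M4 w \<partial>lborel) < \<infinity>"
  shows "\<exists>N::real. AE z in lborel. M1 z \<le> ennreal N"
proof -
  let ?S = "sing_bound R"
  let ?k = "\<lambda>z w. ennreal (1 / cmod (z - w))"
  let ?I = "\<lambda>w. indicator (ball 0 R) w :: ennreal"
  define N where "N = ennreal C * (ennreal C * (ennreal (4 * ?S) * (ennreal C * ((\<integral>\<^sup>+w. M4 w \<partial>lborel) * ennreal (2 * ?S)))))"
  \<comment> \<open>Inserting the bound for M2 and integrating in w first composes two poles of
    order 1 into one of order 1/2 at z. Inserting the bound for M3 composes this with a further pole
    of order 1, and the result is bounded by \<open>nn_kernel_half_one\<close>. The supports confine
    both inner integrals to one disc.\<close>
  have T2: "(\<integral>\<^sup>+w. M2 w * ?k z w \<partial>lborel) \<le> ennreal C * (ennreal (4 * ?S) * (ennreal C * ((\<integral>\<^sup>+w. M4 w \<partial>lborel) * ennreal (2 * ?S))))" for z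
  proof -
    have "(\<integral>\<^sup>+w. M2 w * ?k z w \<partial>lborel) \<le> (\<integral>\<^sup>+w. \<integral>\<^sup>+v. ennreal C * (M3 v * (?k z w * ?k w v * ?I w)) \<partial>lborel \<partial>lborel)"
    proof (rule nn_integral_mono_AE, use le(2) in eventually_elim)
      fix w assume a: "M2 w \<le> ennreal C * (\<integral>\<^sup>+v. M3 v * ?k w v \<partial>lborel)"
      show "M2 w * ?k z w \<le> (\<integral>\<^sup>+v. ennreal C * (M3 v * (?k z w * ?k w v * ?I w)) \<partial>lborel)"
      proof (cases "w \<in> ball 0 R")
        case True
        have "(\<integral>\<^sup>+v. ennreal C * (M3 v * (?k z w * ?k w v * ?I w)) \<partial>lborel) = (\<integral>\<^sup>+v. (ennreal C * ?k z w) * (M3 v * ?k w v) \<partial>lborel)"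
          using True by (intro nn_integral_cong) (simp add: mult_ac)
        also have "\<dots> = (ennreal C * ?k z w) * (\<integral>\<^sup>+v. M3 v * ?k w v \<partial>lborel)" by (rule nn_integral_cmult) measurable
        finally show ?thesis using mult_right_mono[OF a, of "?k z w"] by (simp add: mult_ac)
      qed (use supp in auto)
    qed
    also have "\<dots> = (\<integral>\<^sup>+v. \<integral>\<^sup>+w. ennreal C * (M3 v * (?k z w * ?k w v * ?I w)) \<partial>lborel \<partial>lborel)"
      by (rule lborel_pair.Fubini') measurable
    also have "\<dots> \<le> (\<integral>\<^sup>+v. ennreal C * (M3 v * ennreal (4 * ?S / sqrt (cmod (z - v)))) \<partial>lborel)"
    proof (rule nn_integral_mono_AE, use AE_lborel_singleton[of z] in eventually_elim)
      fix v assume v: "v \<noteq> z"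
      have "(\<integral>\<^sup>+w. ennreal C * (M3 v * (?k z w * ?k w v * ?I w)) \<partial>lborel) = (\<integral>\<^sup>+w. (ennreal C * M3 v) * (ennreal (1 / (cmod (z - w) * cmod (v - w))) * ?I w) \<partial>lborel)"
        by (intro nn_integral_cong) (simp add: mult.assoc norm_minus_commute[of _ v] flip: ennreal_mult')
      also have "\<dots> = (ennreal C * M3 v) * (\<integral>\<^sup>+w. (ennreal (1 / (cmod (z - w) * cmod (v - w))) * ?I w) \<partial>lborel)"
        by (rule nn_integral_cmult) measurable
      also have "\<dots> \<le> (ennreal C * M3 v) * ennreal (4 * ?S / sqrt (cmod (z - v)))"
        using v by (intro mult_left_mono nn_kernel_one_one) auto
      finally show "(\<integral>\<^sup>+w. ennreal C * (M3 v * (?k z w * ?k w v * ?I w)) \<partial>lborel) \<le> ennreal C * (M3 v * ennreal (4 * ?S / sqrt (cmod (z - v))))"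
        by (simp add: mult.assoc)
    qed
    also have "\<dots> = ennreal C * (\<integral>\<^sup>+v. M3 v * ennreal (4 * ?S / sqrt (cmod (z - v))) \<partial>lborel)"
      by (rule nn_integral_cmult) measurable
    also have "(\<integral>\<^sup>+v. M3 v * ennreal (4 * ?S / sqrt (cmod (z - v))) \<partial>lborel)
       \<le> (\<integral>\<^sup>+v. \<integral>\<^sup>+x. (ennreal (4 * ?S) * ennreal C) * (M4 x * (ennreal (1 / (sqrt (cmod (z - v)) * cmod (x - v))) * ?I v)) \<partial>lborel \<partial>lborel)"
    proof (rule nn_integral_mono_AE, use le(3) in eventually_elim)
      fix v assume a: "M3 v \<le> ennreal C * (\<integral>\<^sup>+x. M4 x * ?k v x \<partial>lborel)"
      show "M3 v * ennreal (4 * ?S / sqrt (cmod (z - v))) \<le> (\<integral>\<^sup>+x. (ennreal (4 * ?S) * ennreal C) * (M4 x * (ennreal (1 / (sqrt (cmod (z - v)) * cmod (x - v))) * ?I v)) \<partial>lborel)"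
      proof (cases "v \<in> ball 0 R")
        case True
        have s: "ennreal (4 * ?S / sqrt (cmod (z - v))) = ennreal (4 * ?S) * ennreal (1 / sqrt (cmod (z - v)))"
          by (simp flip: ennreal_mult)
        have k: "ennreal (1 / (sqrt (cmod (z - v)) * cmod (x - v))) = ennreal (1 / sqrt (cmod (z - v))) * ?k v x" for x
          by (simp add: norm_minus_commute[of v] flip: ennreal_mult)
        have "(\<integral>\<^sup>+x. (ennreal (4 * ?S) * ennreal C) * (M4 x * (ennreal (1 / (sqrt (cmod (z - v)) * cmod (x - v))) * ?I v)) \<partial>lborel)
           = (\<integral>\<^sup>+x. (ennreal (4 * ?S) * ennreal C * ennreal (1 / sqrt (cmod (z - v)))) * (M4 x * ?k v x) \<partial>lborel)"
          unfolding k using True by (intro nn_integral_cong) (simp add: mult_ac)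
        also have "\<dots> = (ennreal (4 * ?S) * ennreal C * ennreal (1 / sqrt (cmod (z - v)))) * (\<integral>\<^sup>+x. M4 x * ?k v x \<partial>lborel)"
          by (rule nn_integral_cmult) measurable
        finally show ?thesis using mult_right_mono[OF a, of "ennreal (4 * ?S / sqrt (cmod (z - v)))"] unfolding s by (simp add: mult_ac)
      qed (use supp in auto)
    qed
    also have "\<dots> = (\<integral>\<^sup>+x. \<integral>\<^sup>+v. (ennreal (4 * ?S) * ennreal C) * (M4 x * (ennreal (1 / (sqrt (cmod (z - v)) * cmod (x - v))) * ?I v)) \<partial>lborel \<partial>lborel)"
      by (rule lborel_pair.Fubini') measurable
    also have "\<dots> \<le> (\<integral>\<^sup>+x. (ennreal (4 * ?S) * ennreal C) * (M4 x * ennreal (2 * ?S)) \<partial>lborel)"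
    proof (rule nn_integral_mono)
      fix x
      have "(\<integral>\<^sup>+v. (ennreal (4 * ?S) * ennreal C) * (M4 x * (ennreal (1 / (sqrt (cmod (z - v)) * cmod (x - v))) * ?I v)) \<partial>lborel)
        = (\<integral>\<^sup>+v. (ennreal (4 * ?S) * ennreal C * M4 x) * (ennreal (1 / (sqrt (cmod (z - v)) * cmod (x - v))) * ?I v) \<partial>lborel)"
        by (simp add: mult.assoc)
      also have "\<dots> = (ennreal (4 * ?S) * ennreal C * M4 x) * (\<integral>\<^sup>+v. (ennreal (1 / (sqrt (cmod (z - v)) * cmod (x - v))) * ?I v) \<partial>lborel)"
        by (rule nn_integral_cmult) measurable
      also have "\<dots> \<le> (ennreal (4 * ?S) * ennreal C * M4 x) * ennreal (2 * ?S)"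
        by (intro mult_left_mono nn_kernel_half_one) auto
      finally show "(\<integral>\<^sup>+v. (ennreal (4 * ?S) * ennreal C) * (M4 x * (ennreal (1 / (sqrt (cmod (z - v)) * cmod (x - v))) * ?I v)) \<partial>lborel)
        \<le> (ennreal (4 * ?S) * ennreal C) * (M4 x * ennreal (2 * ?S))" by (simp add: mult.assoc)
    qed
    also have "\<dots> = (ennreal (4 * ?S) * ennreal C) * ((\<integral>\<^sup>+x. M4 x \<partial>lborel) * ennreal (2 * ?S))"
      by (subst nn_integral_cmult, measurable, subst nn_integral_multc) measurable
    finally show ?thesis by (simp add: mult_left_mono mult.assoc)
  qed
  have "N < \<infinity>" using fin by (simp add: N_def ennreal_mult_less_top)
  then obtain n where n: "N = ennreal n" by (metis ennreal_enn2real infinity_ennreal_def)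
  have "AE z in lborel. M1 z \<le> N"
    using le(1)
  proof (rule eventually_mono)
    fix z assume "M1 z \<le> ennreal C * (\<integral>\<^sup>+w. M2 w * ?k z w \<partial>lborel)"
    also have "\<dots> \<le> N" unfolding N_def by (intro mult_left_mono T2) auto
    finally show "M1 z \<le> N" .
  qed
  then show ?thesis using n by blast
qed

text \<open>One gain of regularity. On the disc where the cut-off is 1, q is the Cauchy transform of
  h up to \<open>pomp\<close>, and |h| is at most (A + D) m on the larger disc, D being a bound for
  the derivative of the cut-off. The common majorant m lets a coupled system be iterated as if it
  were a single equation.\<close>

lemma wdz_step:
  assumes "open \<Omega>" and q: "wdz \<Omega> q g" and z: "cball z r \<subseteq> \<Omega>" "0 < s" "s < r"
    and m: "\<And>w. w \<in> \<Omega> \<Longrightarrow> cmod (q w) \<le> m w" "\<And>w. w \<in> \<Omega> \<Longrightarrow> cmod (g w) \<le> A * m w" "\<And>w. m w \<ge> 0" "A \<ge> 0"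
    and mm: "m \<in> borel_measurable borel"
  shows "\<exists>C\<ge>0. AE w in lborel. ennreal (cmod (q w)) * indicator (ball z s) w \<le>
    ennreal C * (\<integral>\<^sup>+v. (ennreal (m v) * indicator (ball z r) v) * ennreal (1 / cmod (w - v)) \<partial>lborel)"
proof -
  note [measurable] = mm
  have sub: "ball z r \<subseteq> \<Omega>" using z(1) ball_subset_cball by blast
  have w: "wdz (ball z r) q g" by (rule wdz_mono[OF q sub])
  have "cball z s \<subseteq> ball z r" using z by auto
  then obtain \<kappa> where \<kappa>: "\<kappa> \<in> test_fun (ball z r)" "\<And>w. w \<in> cball z s \<Longrightarrow> \<kappa> w = 1" "\<And>w. cmod (\<kappa> w) \<le> 1"
    using cutoff[of "cball z s" "ball z r"] by auto
  define h where "h w = g w * \<kappa> w + q w * dz \<kappa> w" for w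
  have h: "integrable lborel h" "AE w in lborel. w \<in> ball z r \<longrightarrow> of_real pomp * (q w * \<kappa> w) = cau h w"
    using cauchy_rep[OF open_ball w \<kappa>(1)] unfolding h_def[abs_def] by auto
  have hm [measurable]: "h \<in> borel_measurable borel" using h(1) by auto
  have d\<kappa>: "dz \<kappa> \<in> test_fun (ball z r)" by (rule test_fun_dz[OF \<kappa>(1)])
  obtain R where R: "R > 0" "\<And>w. cmod w > R \<Longrightarrow> dz \<kappa> w = 0" using test_fun_bdd_support[OF d\<kappa>] by metis
  obtain D where D: "D > 0" "\<And>w. cmod (dz \<kappa> w) \<le> D"
    using continuous_bdd_support_bounded[OF smooth_continuous[OF test_fun_smooth[OF d\<kappa>]] R(2)] by metis
  have hle: "ennreal (cmod (h w)) \<le> ennreal (A + D) * (ennreal (m w) * indicator (ball z r) w)" for w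
  proof (cases "w \<in> ball z r")
    case True
    have "cmod (h w) \<le> cmod (g w) * cmod (\<kappa> w) + cmod (q w) * cmod (dz \<kappa> w)"
      unfolding h_def by (intro order_trans[OF norm_triangle_ineq]) (simp add: norm_mult)
    also have "\<dots> \<le> (A * m w) * 1 + m w * D"
      using True sub m \<kappa>(3)[of w] D by (intro add_mono mult_mono) auto
    also have "\<dots> = (A + D) * m w" by (simp add: algebra_simps)
    finally have "ennreal (cmod (h w)) \<le> ennreal ((A + D) * m w)" by (rule ennreal_leI)
    also have "\<dots> = ennreal (A + D) * ennreal (m w)" using m D by (intro ennreal_mult) auto
    finally show ?thesis using True by simp
  next
    case False
    then show ?thesis using test_fun_zero[OF \<kappa>(1) False] test_fun_zero[OF d\<kappa> False] by (simp add: h_def)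
  qed
  let ?T = "\<lambda>w. (\<integral>\<^sup>+v. (ennreal (m v) * indicator (ball z r) v) * ennreal (1 / cmod (w - v)) \<partial>lborel)"
  have cle: "ennreal (cmod (cau h w)) \<le> ennreal (A + D) * ?T w" for w
  proof -
    have "ennreal (cmod (cau h w)) \<le> (\<integral>\<^sup>+v. ennreal (cmod (h v)) * ennreal (1 / cmod (w - v)) \<partial>lborel)"
      by (rule nn_cau_le) measurable
    also have "\<dots> \<le> (\<integral>\<^sup>+v. (ennreal (A + D) * (ennreal (m v) * indicator (ball z r) v)) * ennreal (1 / cmod (w - v)) \<partial>lborel)"
      by (intro nn_integral_mono mult_right_mono hle) auto
    also have "\<dots> = (\<integral>\<^sup>+v. ennreal (A + D) * ((ennreal (m v) * indicator (ball z r) v) * ennreal (1 / cmod (w - v))) \<partial>lborel)"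
      by (simp add: mult.assoc)
    also have "\<dots> = ennreal (A + D) * ?T w" by (rule nn_integral_cmult) measurable
    finally show ?thesis .
  qed
  show ?thesis
  proof (intro exI[of _ "(A + D) / pomp"] conjI)
    show "(A + D) / pomp \<ge> 0" using m D pomp_pos by simp
    show "AE w in lborel. ennreal (cmod (q w)) * indicator (ball z s) w \<le> ennreal ((A + D) / pomp) * ?T w"
      using h(2)
    proof (rule eventually_mono)
      fix w assume a: "w \<in> ball z r \<longrightarrow> of_real pomp * (q w * \<kappa> w) = cau h w"
      show "ennreal (cmod (q w)) * indicator (ball z s) w \<le> ennreal ((A + D) / pomp) * ?T w"
      proof (cases "w \<in> ball z s")
        case True
        then have "w \<in> ball z r" "\<kappa> w = 1" using z \<kappa>(2)[of w] by auto
        then have "of_real pomp * q w = cau h w" using a by simp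
        then have "q w = cau h w * of_real (1 / pomp)" using pomp_pos by (simp add: field_simps)
        then have eq: "cmod (q w) = (1 / pomp) * cmod (cau h w)" using pomp_pos by (simp add: norm_mult norm_divide)
        have "ennreal (cmod (q w)) = ennreal (1 / pomp) * ennreal (cmod (cau h w))"
          unfolding eq by (rule ennreal_mult) (use pomp_pos in auto)
        also have "\<dots> \<le> ennreal (1 / pomp) * (ennreal (A + D) * ?T w)" by (intro mult_left_mono cle) auto
        also have "\<dots> = ennreal ((A + D) / pomp) * ?T w"
        proof -
          have "ennreal (1 / pomp * (A + D)) = ennreal (1 / pomp) * ennreal (A + D)"
            by (rule ennreal_mult) (use pomp_pos m D in auto)
          moreover have "1 / pomp * (A + D) = (A + D) / pomp" by simp
          ultimately show ?thesis by (simp only: mult.assoc)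
        qed
        finally show ?thesis using True by simp
      qed simp
    qed
  qed
qed

text \<open>The two equations are coupled only through the bound on g1 and g2, so m = |q1| + |q2|
  satisfies a scalar inequality with kernel 1/|z|. Three steps of it turn local integrability of m
  into a local bound, after which each equation separately has bounded data.\<close>

lemma wdz_pair_continuous:
  assumes "open \<Omega>" and q: "wdz \<Omega> q1 g1" "wdz \<Omega> q2 g2" and A: "A \<ge> 0"
    and g: "\<And>w. w \<in> \<Omega> \<Longrightarrow> cmod (g1 w) \<le> A * (cmod (q1 w) + cmod (q2 w))"
      "\<And>w. w \<in> \<Omega> \<Longrightarrow> cmod (g2 w) \<le> A * (cmod (q1 w) + cmod (q2 w))"
  shows "\<exists>Q1 Q2. continuous_on \<Omega> Q1 \<and> continuous_on \<Omega> Q2 \<and>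
    (AE w in lborel. w \<in> \<Omega> \<longrightarrow> Q1 w = q1 w) \<and> (AE w in lborel. w \<in> \<Omega> \<longrightarrow> Q2 w = q2 w)"
proof -
  define m where "m w = cmod (q1 w) + cmod (q2 w)" for w
  have l: "locint \<Omega> q1" "locint \<Omega> q2" using q by (auto simp: wdz_def)
  have [measurable]: "q1 \<in> borel_measurable borel" "q2 \<in> borel_measurable borel" using l locint_measurable by auto
  have mm [measurable]: "m \<in> borel_measurable borel" unfolding m_def by measurable
  have bdd: "\<exists>r>0. cball z r \<subseteq> \<Omega> \<and> (\<exists>B. AE w in lborel. w \<in> ball z r \<longrightarrow> m w \<le> B)" if z: "z \<in> \<Omega>" for z
  proof -
    obtain r where r: "r > 0" "cball z r \<subseteq> \<Omega>" using assms(1) z open_contains_cball by blast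
    have step: "\<exists>C\<ge>0. AE w in lborel. ennreal (m w) * indicator (ball z s) w \<le>
      ennreal C * (\<integral>\<^sup>+v. (ennreal (m v) * indicator (ball z t) v) * ennreal (1 / cmod (w - v)) \<partial>lborel)"
      if st: "0 < s" "s < t" "t \<le> r" for s t
    proof -
      have sub: "cball z t \<subseteq> \<Omega>" using r st by auto
      obtain C1 where C1: "C1 \<ge> 0" "AE w in lborel. ennreal (cmod (q1 w)) * indicator (ball z s) w \<le>
        ennreal C1 * (\<integral>\<^sup>+v. (ennreal (m v) * indicator (ball z t) v) * ennreal (1 / cmod (w - v)) \<partial>lborel)"
        using wdz_step[OF assms(1) q(1) sub st(1,2), of m A] g A mm by (auto simp: m_def)
      obtain C2 where C2: "C2 \<ge> 0" "AE w in lborel. ennreal (cmod (q2 w)) * indicator (ball z s) w \<le>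
        ennreal C2 * (\<integral>\<^sup>+v. (ennreal (m v) * indicator (ball z t) v) * ennreal (1 / cmod (w - v)) \<partial>lborel)"
        using wdz_step[OF assms(1) q(2) sub st(1,2), of m A] g A mm by (auto simp: m_def)
      show ?thesis
      proof (intro exI[of _ "C1 + C2"] conjI)
        show "AE w in lborel. ennreal (m w) * indicator (ball z s) w \<le>
          ennreal (C1 + C2) * (\<integral>\<^sup>+v. (ennreal (m v) * indicator (ball z t) v) * ennreal (1 / cmod (w - v)) \<partial>lborel)"
          using C1(2) C2(2)
        proof eventually_elim
          case (elim w)
          from add_mono[OF elim] show ?case
            using C1(1) C2(1) by (simp add: m_def distrib_right)
        qed
      qed (use C1 C2 in simp)
    qed
    \<comment> \<open>Each step shrinks the disc, so three steps use the four radii r, 3r/4, r/2,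
      r/4.\<close>
    obtain C1 where C1: "C1 \<ge> 0" "AE w in lborel. ennreal (m w) * indicator (ball z (r/4)) w \<le>
      ennreal C1 * (\<integral>\<^sup>+v. (ennreal (m v) * indicator (ball z (r/2)) v) * ennreal (1 / cmod (w - v)) \<partial>lborel)"
      using step[of "r/4" "r/2"] r by auto
    obtain C2 where C2: "C2 \<ge> 0" "AE w in lborel. ennreal (m w) * indicator (ball z (r/2)) w \<le>
      ennreal C2 * (\<integral>\<^sup>+v. (ennreal (m v) * indicator (ball z (3*r/4)) v) * ennreal (1 / cmod (w - v)) \<partial>lborel)"
      using step[of "r/2" "3*r/4"] r by auto
    obtain C3 where C3: "C3 \<ge> 0" "AE w in lborel. ennreal (m w) * indicator (ball z (3*r/4)) w \<le>
      ennreal C3 * (\<integral>\<^sup>+v. (ennreal (m v) * indicator (ball z r) v) * ennreal (1 / cmod (w - v)) \<partial>lborel)"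
      using step[of "3*r/4" r] r by auto
    define C where "C = max C1 (max C2 C3)"
    have Cle: "ennreal C1 \<le> ennreal C" "ennreal C2 \<le> ennreal C" "ennreal C3 \<le> ennreal C"
      by (auto simp: C_def intro!: ennreal_leI)
    have out: "ennreal (m w) * indicator (ball z t) w = 0" if "w \<notin> ball 0 (cmod z + r)" "t \<le> r" for w t
    proof -
      have "w \<notin> ball z t" using that norm_triangle_ineq2[of w z] by (auto simp: dist_norm norm_minus_commute)
      then show ?thesis by simp
    qed
    have "integrable lborel (\<lambda>w. cmod (indicator (cball z r) w * q1 w) + cmod (indicator (cball z r) w * q2 w))"
      using locint_integrable[OF l(1) _ r(2)] locint_integrable[OF l(2) _ r(2)] by auto
    then have "(\<integral>\<^sup>+w. ennreal (norm (cmod (indicator (cball z r) w * q1 w) + cmod (indicator (cball z r) w * q2 w))) \<partial>lborel) < \<infinity>"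
      by (simp add: integrable_iff_bounded)
    moreover have "(\<integral>\<^sup>+w. ennreal (m w) * indicator (ball z r) w \<partial>lborel) \<le> (\<integral>\<^sup>+w. ennreal (norm (cmod (indicator (cball z r) w * q1 w) + cmod (indicator (cball z r) w * q2 w))) \<partial>lborel)"
      by (intro nn_integral_mono) (auto simp: m_def indicator_def)
    ultimately have fin: "(\<integral>\<^sup>+w. ennreal (m w) * indicator (ball z r) w \<partial>lborel) < \<infinity>" by (rule le_less_trans[rotated])
    have "\<exists>N. AE w in lborel. ennreal (m w) * indicator (ball z (r/4)) w \<le> ennreal N"
    proof (rule triple_kernel_bound[OF _ _ _ out out _ _ _ fin])
      show "AE w in lborel. ennreal (m w) * indicator (ball z (r/4)) w \<le>
        ennreal C * (\<integral>\<^sup>+v. (ennreal (m v) * indicator (ball z (r/2)) v) * ennreal (1 / cmod (w - v)) \<partial>lborel)"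
        using C1(2) by (rule eventually_mono) (erule order_trans, intro mult_right_mono Cle, simp)
      show "AE w in lborel. ennreal (m w) * indicator (ball z (r/2)) w \<le>
        ennreal C * (\<integral>\<^sup>+v. (ennreal (m v) * indicator (ball z (3*r/4)) v) * ennreal (1 / cmod (w - v)) \<partial>lborel)"
        using C2(2) by (rule eventually_mono) (erule order_trans, intro mult_right_mono Cle, simp)
      show "AE w in lborel. ennreal (m w) * indicator (ball z (3*r/4)) w \<le>
        ennreal C * (\<integral>\<^sup>+v. (ennreal (m v) * indicator (ball z r) v) * ennreal (1 / cmod (w - v)) \<partial>lborel)"
        using C3(2) by (rule eventually_mono) (erule order_trans, intro mult_right_mono Cle, simp)
    qed (use r in auto)
    then obtain N where N: "AE w in lborel. ennreal (m w) * indicator (ball z (r/4)) w \<le> ennreal N" by blast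
    have "AE w in lborel. w \<in> ball z (r/4) \<longrightarrow> m w \<le> \<bar>N\<bar>"
      using N
    proof (rule eventually_mono, intro impI)
      fix w assume "ennreal (m w) * indicator (ball z (r/4)) w \<le> ennreal N" "w \<in> ball z (r/4)"
      then have "ennreal (m w) \<le> ennreal N" by simp
      also have "\<dots> \<le> ennreal \<bar>N\<bar>" by (intro ennreal_leI) simp
      finally show "m w \<le> \<bar>N\<bar>" by simp
    qed
    moreover have "cball z (r/4) \<subseteq> \<Omega>" using r by auto
    ultimately show ?thesis using r(1) by (intro exI[of _ "r/4"]) auto
  qed
  have cont: "\<exists>Q. continuous_on \<Omega> Q \<and> (AE w in lborel. w \<in> \<Omega> \<longrightarrow> Q w = q w)"
    if "wdz \<Omega> q g" "\<And>w. w \<in> \<Omega> \<Longrightarrow> cmod (q w) \<le> m w" "\<And>w. w \<in> \<Omega> \<Longrightarrow> cmod (g w) \<le> A * m w" for q g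
  proof (rule continuous_rep_patch)
    fix z assume "z \<in> \<Omega>"
    then obtain r B where r: "r > 0" "cball z r \<subseteq> \<Omega>" "AE w in lborel. w \<in> ball z r \<longrightarrow> m w \<le> B"
      using bdd by blast
    \<comment> \<open>Once m is bounded by B, the unknown is bounded by B and the right-hand side by
      A B.\<close>
    have "AE w in lborel. w \<in> ball z r \<longrightarrow> cmod (q w) \<le> max B (A * B) \<and> cmod (g w) \<le> max B (A * B)"
      using r(3)
    proof (rule eventually_mono, intro impI)
      fix w assume w: "w \<in> ball z r \<longrightarrow> m w \<le> B" "w \<in> ball z r"
      then have "w \<in> \<Omega>" "m w \<le> B" using r(2) ball_subset_cball by blast+
      moreover have "A * m w \<le> A * B" using A \<open>m w \<le> B\<close> by (rule mult_left_mono[rotated])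
      ultimately show "cmod (q w) \<le> max B (A * B) \<and> cmod (g w) \<le> max B (A * B)" using that(2,3)[of w] by auto
    qed
    then show "\<exists>r>0. \<exists>Q. continuous_on (ball z r) Q \<and> (AE w in lborel. w \<in> ball z r \<longrightarrow> Q w = q w)"
      using wdz_continuous_local[OF assms(1) that(1) r(2,1)] r(1) by (intro exI[of _ "r/2"]) auto
  qed
  show ?thesis using cont[OF q(1)] cont[OF q(2)] g by (auto simp: m_def)
qed

section \<open>Potentials of continuous fields\<close>

lemma mol_uniform:
  assumes K': "compact K'" and f: "integrable lborel (\<lambda>w. indicator K' w * f w)" "continuous_on K' f"
    and d: "d > 0" "\<And>z. z \<in> K \<Longrightarrow> cball z d \<subseteq> K'" and "\<epsilon> > 0"
  shows "\<exists>\<delta>>0. \<forall>e. 0 < e \<and> e \<le> \<delta> \<longrightarrow> (\<forall>z\<in>K. cmod (mol e (\<lambda>w. indicator K' w * f w) z - f z) \<le> \<epsilon>)"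
proof -
  have "uniformly_continuous_on K' f" using f(2) K' by (rule compact_uniformly_continuous)
  then obtain \<delta> where \<delta>: "\<delta> > 0" "\<And>z w. z \<in> K' \<Longrightarrow> w \<in> K' \<Longrightarrow> dist w z < \<delta> \<Longrightarrow> dist (f w) (f z) < \<epsilon>"
    using \<open>\<epsilon> > 0\<close> unfolding uniformly_continuous_on_def by metis
  show ?thesis
  proof (intro exI[of _ "min d \<delta>"] conjI allI impI ballI)
    fix e z assume e: "0 < e \<and> e \<le> min d \<delta>" and z: "z \<in> K"
    show "cmod (mol e (\<lambda>w. indicator K' w * f w) z - f z) \<le> \<epsilon>"
    proof (rule mol_diff_le[OF integrable_imp_locint[OF f(1)]])
      fix w assume w: "cmod w < e"
      then have "z - w \<in> cball z d" "dist (z - w) z < \<delta>" "z \<in> cball z d" using e d(1) by (auto simp: dist_norm)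
      moreover from this have "z - w \<in> K'" "z \<in> K'" using d(2)[OF z] by blast+
      ultimately show "cmod (indicator K' (z - w) * f (z - w) - f z) \<le> \<epsilon>"
        using \<delta>(2)[of z "z - w"] by (simp add: dist_norm)
    qed (use e in simp)
  qed (use d \<delta> in auto)
qed

lemma has_derivative_sequence_pd:
  fixes F :: "nat \<Rightarrow> complex \<Rightarrow> complex"
  assumes S: "open S" "convex S" "x0 \<in> S"
    and D: "\<And>n z. z \<in> S \<Longrightarrow> (F n has_derivative (\<lambda>h. of_real (Re h) * A n z + of_real (Im h) * B n z)) (at z)"
    and A: "\<And>\<epsilon>. \<epsilon> > 0 \<Longrightarrow> \<forall>\<^sub>F n in sequentially. \<forall>z\<in>S. cmod (A n z - P z) \<le> \<epsilon>"
    and B: "\<And>\<epsilon>. \<epsilon> > 0 \<Longrightarrow> \<forall>\<^sub>F n in sequentially. \<forall>z\<in>S. cmod (B n z - Q z) \<le> \<epsilon>"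
    and lim: "(\<lambda>n. F n x0) \<longlonglongrightarrow> l"
  shows "\<exists>g. \<forall>z\<in>S. (\<lambda>n. F n z) \<longlonglongrightarrow> g z \<and> (g has_derivative (\<lambda>h. of_real (Re h) * P z + of_real (Im h) * Q z)) (at z)"
proof -
  have "\<exists>g. \<forall>z\<in>S. (\<lambda>n. F n z) \<longlonglongrightarrow> g z \<and> (g has_derivative (\<lambda>h. of_real (Re h) * P z + of_real (Im h) * Q z)) (at z within S)"
  proof (rule has_derivative_sequence[where f = F and l = l and ?x0.0 = x0 and S = S
        and f' = "\<lambda>n z h. of_real (Re h) * A n z + of_real (Im h) * B n z"
        and g' = "\<lambda>z h. of_real (Re h) * P z + of_real (Im h) * Q z"])
    show "(F n has_derivative (\<lambda>h. of_real (Re h) * A n z + of_real (Im h) * B n z)) (at z within S)" if "z \<in> S" for n z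
      using D[OF that] by (rule has_derivative_at_withinI)
    fix e :: real assume "e > 0"
    then have "e/2 > 0" by simp
    from A[OF this] B[OF this]
    show "\<forall>\<^sub>F n in sequentially. \<forall>z\<in>S. \<forall>h. norm (of_real (Re h) * A n z + of_real (Im h) * B n z - (of_real (Re h) * P z + of_real (Im h) * Q z)) \<le> e * norm h"
    proof eventually_elim
      case (elim n)
      show ?case
      proof (intro ballI allI)
        fix z h assume z: "z \<in> S"
        have "of_real (Re h) * A n z + of_real (Im h) * B n z - (of_real (Re h) * P z + of_real (Im h) * Q z)
          = of_real (Re h) * (A n z - P z) + of_real (Im h) * (B n z - Q z)" by (simp add: algebra_simps)
        also have "cmod \<dots> \<le> \<bar>Re h\<bar> * cmod (A n z - P z) + \<bar>Im h\<bar> * cmod (B n z - Q z)"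
          by (intro norm_triangle_le) (simp add: norm_mult)
        also have "\<dots> \<le> cmod h * (e/2) + cmod h * (e/2)"
          using elim z by (intro add_mono mult_mono abs_Re_le_cmod abs_Im_le_cmod) auto
        finally show "norm (of_real (Re h) * A n z + of_real (Im h) * B n z - (of_real (Re h) * P z + of_real (Im h) * Q z)) \<le> e * norm h"
          by (simp add: algebra_simps)
      qed
    qed
  qed (use S lim in auto)
  then show ?thesis using at_within_open[OF _ S(1)] by metis
qed

text \<open>The mollifications of U have gradients converging locally uniformly to (P, Q). Together
  with convergence at a single point of a disc this forces convergence to a differentiable function
  with gradient (P, Q), which equals U almost everywhere; the local limits are then patched.\<close>

lemma C1_rep:
  assumes "open \<Omega>" and w: "wd 1 \<Omega> U P" "wd \<i> \<Omega> U Q" and c: "continuous_on \<Omega> P" "continuous_on \<Omega> Q"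
  shows "\<exists>V. (\<forall>z\<in>\<Omega>. (V has_derivative (\<lambda>h. of_real (Re h) * P z + of_real (Im h) * Q z)) (at z)) \<and>
    (AE z in lborel. z \<in> \<Omega> \<longrightarrow> V z = U z)"
proof -
  have local: "\<exists>r>0. \<exists>V. ball z0 r \<subseteq> \<Omega> \<and> (\<forall>z\<in>ball z0 r. (V has_derivative (\<lambda>h. of_real (Re h) * P z + of_real (Im h) * Q z)) (at z)) \<and>
    (AE z in lborel. z \<in> ball z0 r \<longrightarrow> V z = U z)" if z0: "z0 \<in> \<Omega>" for z0
  proof -
    obtain r where r: "r > 0" "cball z0 r \<subseteq> \<Omega>" using assms(1) z0 open_contains_cball by blast
    define K' where "K' = cball z0 r"
    define S where "S = ball z0 (r/2)"
    have K': "compact K'" "K' \<subseteq> \<Omega>" using r by (auto simp: K'_def)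
    have sub: "cball z (r/2) \<subseteq> K'" if "z \<in> S" for z
    proof
      fix w assume "w \<in> cball z (r/2)"
      then have "dist z0 w \<le> dist z0 z + dist z w" "dist z w \<le> r/2" "dist z0 z < r/2"
        using that dist_triangle[of z0 w z] by (auto simp: S_def)
      then show "w \<in> K'" by (simp add: K'_def)
    qed
    have int: "integrable lborel (\<lambda>w. indicator K' w * g w)" if "locint \<Omega> g" for g by (rule locint_integrable[OF that K'])
    note l = wdD(1)[OF w(1)] wdD(2)[OF w(1)] wdD(2)[OF w(2)]
    obtain s where s: "strict_mono s" "AE z in lborel. (\<lambda>n. mol (1 / real (Suc (s n))) (\<lambda>w. indicator K' w * U w) z) \<longlonglongrightarrow> indicator K' z * U z"
      using mol_AE_subseq[of "{\<lambda>w. indicator K' w * U w}"] int[OF l(1)] by auto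
    obtain N where N: "inverse (real (Suc N)) < r/2" using reals_Archimedean[of "r/2"] r(1) by auto
    define e where "e n = 1 / real (Suc (s (n + N)))" for n
    have epos: "e n > 0" for n by (simp add: e_def)
    have ele: "e n \<le> 1 / real (Suc n)" "e n \<le> r/2" for n
    proof -
      have "n + N \<le> s (n + N)" by (rule strict_mono_imp_increasing[OF s(1)])
      then show "e n \<le> 1 / real (Suc n)" unfolding e_def by (intro divide_left_mono) auto
      have "e n \<le> 1 / real (Suc N)" using \<open>n + N \<le> s (n + N)\<close> unfolding e_def by (intro divide_left_mono) auto
      then show "e n \<le> r/2" using N by (simp add: inverse_eq_divide)
    qed
    let ?F = "\<lambda>n. mol (e n) (\<lambda>w. indicator K' w * U w)"
    have lim: "AE z in lborel. z \<in> S \<longrightarrow> (\<lambda>n. ?F n z) \<longlonglongrightarrow> U z"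
      using s(2)
    proof (rule eventually_mono, intro impI)
      fix z assume a: "(\<lambda>n. mol (1 / real (Suc (s n))) (\<lambda>w. indicator K' w * U w) z) \<longlonglongrightarrow> indicator K' z * U z" "z \<in> S"
      then have "z \<in> K'" using r by (auto simp: S_def K'_def)
      then show "(\<lambda>n. ?F n z) \<longlonglongrightarrow> U z" using LIMSEQ_ignore_initial_segment[OF a(1), of N] by (simp add: e_def)
    qed
    \<comment> \<open>Convergence holds almost everywhere along the subsequence, and the disc is not
      a null set.\<close>
    have "\<exists>x0\<in>S. (\<lambda>n. ?F n x0) \<longlonglongrightarrow> U x0"
    proof (rule ccontr)
      assume "\<not> ?thesis"
      then have "AE z in lborel. z \<in> S \<longrightarrow> (\<lambda>z. 1) z = (0::complex)" using lim by (auto elim!: eventually_mono)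
      from AE_cont_zero[OF _ continuous_on_const this, of z0] show False using r by (simp add: S_def)
    qed
    then obtain x0 where x0: "x0 \<in> S" "(\<lambda>n. ?F n x0) \<longlonglongrightarrow> U x0" by blast
    have unif: "\<forall>\<^sub>F n in sequentially. \<forall>z\<in>S. cmod (mol (e n) (\<lambda>w. indicator K' w * g w) z - g z) \<le> \<epsilon>"
      if g: "continuous_on \<Omega> g" "locint \<Omega> g" "\<epsilon> > 0" for g \<epsilon>
    proof -
      have "\<exists>\<delta>>0. \<forall>e. 0 < e \<and> e \<le> \<delta> \<longrightarrow> (\<forall>z\<in>S. cmod (mol e (\<lambda>w. indicator K' w * g w) z - g z) \<le> \<epsilon>)"
        by (rule mol_uniform[OF K'(1) int[OF g(2)] continuous_on_subset[OF g(1) K'(2)] half_gt_zero[OF r(1)] sub g(3)])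
      then obtain \<delta> where \<delta>: "\<delta> > 0" "\<And>e z. 0 < e \<Longrightarrow> e \<le> \<delta> \<Longrightarrow> z \<in> S \<Longrightarrow> cmod (mol e (\<lambda>w. indicator K' w * g w) z - g z) \<le> \<epsilon>" by blast
      obtain M where M: "inverse (real (Suc M)) < \<delta>" using reals_Archimedean[OF \<delta>(1)] by blast
      have "e n \<le> \<delta>" if "n \<ge> M" for n
      proof -
        have "1 / real (Suc n) \<le> 1 / real (Suc M)" using that by (intro divide_left_mono) auto
        then show ?thesis using M ele(1)[of n] by (simp add: inverse_eq_divide)
      qed
      then show ?thesis using \<delta>(2) epos unfolding eventually_sequentially by blast
    qed
    have "\<exists>g. \<forall>z\<in>S. (\<lambda>n. ?F n z) \<longlonglongrightarrow> g z \<and> (g has_derivative (\<lambda>h. of_real (Re h) * P z + of_real (Im h) * Q z)) (at z)"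
    proof (rule has_derivative_sequence_pd[where F = ?F and S = S and ?x0.0 = x0 and l = "U x0" and P = P and Q = Q
        and A = "\<lambda>n. mol (e n) (\<lambda>w. indicator K' w * P w)" and B = "\<lambda>n. mol (e n) (\<lambda>w. indicator K' w * Q w)"])
      show "x0 \<in> S" "(\<lambda>n. ?F n x0) \<longlonglongrightarrow> U x0" by (rule x0)+
      show "\<forall>\<^sub>F n in sequentially. \<forall>z\<in>S. cmod (mol (e n) (\<lambda>w. indicator K' w * P w) z - P z) \<le> \<epsilon>" if "\<epsilon> > 0" for \<epsilon>
        by (rule unif[OF c(1) l(2) that])
      show "\<forall>\<^sub>F n in sequentially. \<forall>z\<in>S. cmod (mol (e n) (\<lambda>w. indicator K' w * Q w) z - Q z) \<le> \<epsilon>" if "\<epsilon> > 0" for \<epsilon>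
        by (rule unif[OF c(2) l(3) that])
    next
      fix n z assume z: "z \<in> S"
      have sm: "smooth (?F n)" by (rule smooth_mol[OF integrable_imp_locint[OF int[OF l(1)]] epos])
      have sub': "cball z (e n) \<subseteq> K'" using sub[OF z] ele(2)[of n] by auto
      show "(?F n has_derivative (\<lambda>h. of_real (Re h) * mol (e n) (\<lambda>w. indicator K' w * P w) z + of_real (Im h) * mol (e n) (\<lambda>w. indicator K' w * Q w) z)) (at z)"
      proof -
        have "pd h (?F n) z = of_real (Re h) * mol (e n) (\<lambda>w. indicator K' w * P w) z + of_real (Im h) * mol (e n) (\<lambda>w. indicator K' w * Q w) z" for h
          by (rule trans[OF pd_expand[OF smooth_differentiable[OF sm]]])
             (simp only: pd_mol_cut[OF w(1) K' epos sub'] pd_mol_cut[OF w(2) K' epos sub'])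
        then show ?thesis using has_derivative_pd[OF smooth_differentiable[OF sm], of z] by (simp only:)
      qed
    qed (auto simp: S_def)
    then obtain g where g: "\<And>z. z \<in> S \<Longrightarrow> (\<lambda>n. ?F n z) \<longlonglongrightarrow> g z"
      "\<And>z. z \<in> S \<Longrightarrow> (g has_derivative (\<lambda>h. of_real (Re h) * P z + of_real (Im h) * Q z)) (at z)" by blast
    have "AE z in lborel. z \<in> S \<longrightarrow> g z = U z"
      using lim by (rule eventually_mono) (use g(1) LIMSEQ_unique in blast)
    moreover have "S \<subseteq> \<Omega>" using K' r by (auto simp: S_def K'_def)
    ultimately show ?thesis using g(2) half_gt_zero[OF r(1)] unfolding S_def by blast
  qed
  have "\<exists>V. continuous_on \<Omega> V \<and> (AE w in lborel. w \<in> \<Omega> \<longrightarrow> V w = U w)"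
  proof (rule continuous_rep_patch)
    fix z assume "z \<in> \<Omega>"
    from local[OF this] obtain r V where r: "r > 0" "\<forall>z\<in>ball z r. (V has_derivative (\<lambda>h. of_real (Re h) * P z + of_real (Im h) * Q z)) (at z)"
      "AE w in lborel. w \<in> ball z r \<longrightarrow> V w = U w" by blast
    have "continuous_on (ball z r) V"
      using r(2) by (intro continuous_at_imp_continuous_on) (auto dest: has_derivative_continuous)
    then show "\<exists>r>0. \<exists>Q. continuous_on (ball z r) Q \<and> (AE w in lborel. w \<in> ball z r \<longrightarrow> Q w = U w)" using r by blast
  qed
  then obtain V where V: "continuous_on \<Omega> V" "AE w in lborel. w \<in> \<Omega> \<longrightarrow> V w = U w" by blast
  have "(V has_derivative (\<lambda>h. of_real (Re h) * P z + of_real (Im h) * Q z)) (at z)" if z: "z \<in> \<Omega>" for z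
  proof -
    from local[OF z] obtain r V' where r: "r > 0" "ball z r \<subseteq> \<Omega>" "\<forall>z\<in>ball z r. (V' has_derivative (\<lambda>h. of_real (Re h) * P z + of_real (Im h) * Q z)) (at z)"
      "AE w in lborel. w \<in> ball z r \<longrightarrow> V' w = U w" by blast
    have c': "continuous_on (ball z r) V'"
      using r(3) by (intro continuous_at_imp_continuous_on) (auto dest: has_derivative_continuous)
    have eq: "V' w = V w" if "w \<in> ball z r" for w
    proof (rule AE_cont_eq[OF open_ball c' continuous_on_subset[OF V(1) r(2)] _ that])
      show "AE w in lborel. w \<in> ball z r \<longrightarrow> V' w = V w"
        using r(4) V(2) by eventually_elim (use r(2) in auto)
    qed
    have "(V' has_derivative (\<lambda>h. of_real (Re h) * P z + of_real (Im h) * Q z)) (at z)" using r(1,3) by simp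
    then show ?thesis
      by (rule has_derivative_transform_within_open[of _ _ z UNIV "ball z r"]) (use r(1) eq in auto)
  qed
  then show ?thesis using V(2) by blast
qed

lemma wd_zero_const:
  assumes "open \<Omega>" "connected \<Omega>" and w: "wd 1 \<Omega> U (\<lambda>z. 0)" "wd \<i> \<Omega> U (\<lambda>z. 0)"
  shows "\<exists>c. AE z in lborel. z \<in> \<Omega> \<longrightarrow> U z = c"
proof (cases "\<Omega> = {}")
  case False
  then obtain z0 where z0: "z0 \<in> \<Omega>" by blast
  obtain V where V: "\<And>z. z \<in> \<Omega> \<Longrightarrow> (V has_derivative (\<lambda>h. 0)) (at z)" "AE z in lborel. z \<in> \<Omega> \<longrightarrow> V z = U z"
    using C1_rep[OF assms(1) w] by auto
  have "V z = V z0" if "z \<in> \<Omega>" for z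
    using has_derivative_zero_unique_connected[OF assms(1,2) V(1) that z0] by blast
  then show ?thesis using V(2) by (intro exI[of _ "V z0"]) (auto elim!: eventually_mono)
qed simp

section \<open>The integral of P dx + Q dy along the segment from 0 to z\<close>

definition ray_potential :: "(complex \<Rightarrow> complex) \<Rightarrow> (complex \<Rightarrow> complex) \<Rightarrow> complex \<Rightarrow> complex"
  where "ray_potential P Q z = integral {0..1} (\<lambda>t::real. of_real (Re z) * P (of_real t * z) + of_real (Im z) * Q (of_real t * z))"

text \<open>The derivative of t p(tz) in t is p(tz) + t times the derivative of p in direction z.
  Closedness exchanges the y-derivative of p for the x-derivative of q, which turns this into the
  x-derivative of the integrand of the ray potential; likewise for q.\<close>

lemma smooth_ray_integrals:
  assumes p: "smooth p" and q: "smooth q"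
    and closed: "\<And>t. t \<in> {0..1} \<Longrightarrow> pd \<i> p (of_real t * z) = pd 1 q (of_real t * z)"
  shows "((\<lambda>t. p (of_real t * z) + of_real t * (of_real (Re z) * pd 1 p (of_real t * z) + of_real (Im z) * pd 1 q (of_real t * z))) has_integral p z) {0..1}"
    "((\<lambda>t. q (of_real t * z) + of_real t * (of_real (Re z) * pd \<i> p (of_real t * z) + of_real (Im z) * pd \<i> q (of_real t * z))) has_integral q z) {0..1}"
proof -
  have D: "((\<lambda>t. of_real t * g (of_real t * z)) has_vector_derivative (g (of_real t * z) + of_real t * pd z g (of_real t * z))) (at t within {0..1})"
    if "smooth g" for g and t :: real
  proof -
    have "((\<lambda>t. of_real t * z) has_derivative (\<lambda>s. of_real s * z)) (at t)" by (auto intro!: derivative_eq_intros)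
    from diff_chain_at[OF this has_derivative_pd[OF smooth_differentiable[OF that]]]
    have "((\<lambda>t. g (of_real t * z)) has_derivative (\<lambda>s. pd (of_real s * z) g (of_real t * z))) (at t)" by (simp add: o_def)
    moreover have "pd (of_real s * z) g (of_real t * z) = s *\<^sub>R pd z g (of_real t * z)" for s
      using pd_scale[OF smooth_differentiable[OF that]] by (simp add: scaleR_conv_of_real)
    ultimately have 1: "((\<lambda>t. g (of_real t * z)) has_vector_derivative pd z g (of_real t * z)) (at t)"
      by (simp add: has_vector_derivative_def)
    have 2: "((\<lambda>t. complex_of_real t) has_vector_derivative 1) (at t)"
    proof -
      have "(of_real has_derivative complex_of_real) (at t)"
        by (rule bounded_linear_imp_has_derivative[OF bounded_linear_of_real])
      moreover have "complex_of_real = (\<lambda>x. x *\<^sub>R 1)" by (auto simp: fun_eq_iff scaleR_conv_of_real)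
      ultimately show ?thesis by (simp add: has_vector_derivative_def)
    qed
    have "((\<lambda>t. of_real t * g (of_real t * z)) has_vector_derivative (of_real t * pd z g (of_real t * z) + 1 * g (of_real t * z))) (at t)"
      by (rule has_vector_derivative_mult[OF 2 1])
    then show ?thesis by (simp add: add.commute has_vector_derivative_at_within)
  qed
  have I: "((\<lambda>t. g (of_real t * z) + of_real t * pd z g (of_real t * z)) has_integral g z) {0..1}" if "smooth g" for g
    using fundamental_theorem_of_calculus[of 0 1 "\<lambda>t. of_real t * g (of_real t * z)" "\<lambda>t. g (of_real t * z) + of_real t * pd z g (of_real t * z)"] D[OF that] by simp
  show "((\<lambda>t. p (of_real t * z) + of_real t * (of_real (Re z) * pd 1 p (of_real t * z) + of_real (Im z) * pd 1 q (of_real t * z))) has_integral p z) {0..1}"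
    by (rule has_integral_eq[OF _ I[OF p]]) (simp add: closed[symmetric] pd_expand[OF smooth_differentiable[OF p], of z])
  show "((\<lambda>t. q (of_real t * z) + of_real t * (of_real (Re z) * pd \<i> p (of_real t * z) + of_real (Im z) * pd \<i> q (of_real t * z))) has_integral q z) {0..1}"
    by (rule has_integral_eq[OF _ I[OF q]]) (simp add: closed pd_expand[OF smooth_differentiable[OF q], of z])
qed

text \<open>Differentiation under the integral sign, followed by
  \<open>smooth_ray_integrals\<close>. Closedness is assumed only on the segment from 0 to z,
  because mollified fields are closed only near that segment; S merely provides the convex
  neighbourhood for the Leibniz rule.\<close>

lemma smooth_ray_potential:
  assumes p: "smooth p" and q: "smooth q" and S: "open S" "convex S" "z \<in> S"
    and closed: "\<And>t. t \<in> {0..1} \<Longrightarrow> pd \<i> p (of_real t * z) = pd 1 q (of_real t * z)"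
  shows "(ray_potential p q has_derivative (\<lambda>h. of_real (Re h) * p z + of_real (Im h) * q z)) (at z)"
proof -
  \<comment> \<open>The Leibniz rule asks for the derivative of the integrand as a continuous family
    of bounded linear maps, so real and imaginary part are packaged as such.\<close>
  define re where "re = Blinfun (\<lambda>h. complex_of_real (Re h))"
  define im where "im = Blinfun (\<lambda>h. complex_of_real (Im h))"
  have re: "blinfun_apply re h = of_real (Re h)" for h
    unfolding re_def by (subst bounded_linear_Blinfun_apply) (auto intro: bounded_linear_compose[OF bounded_linear_of_real] bounded_linear_Re)
  have im: "blinfun_apply im h = of_real (Im h)" for h
    unfolding im_def by (subst bounded_linear_Blinfun_apply) (auto intro: bounded_linear_compose[OF bounded_linear_of_real] bounded_linear_Im)
  define a where "a w t = p (of_real t * w) + of_real t * (of_real (Re w) * pd 1 p (of_real t * w) + of_real (Im w) * pd 1 q (of_real t * w))" for w and t :: real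
  define b where "b w t = q (of_real t * w) + of_real t * (of_real (Re w) * pd \<i> p (of_real t * w) + of_real (Im w) * pd \<i> q (of_real t * w))" for w and t :: real
  define fx where "fx w t = (blinfun_mult_right (a w t) o\<^sub>L re) + (blinfun_mult_right (b w t) o\<^sub>L im)" for w and t :: real
  have fx: "blinfun_apply (fx w t) h = of_real (Re h) * a w t + of_real (Im h) * b w t" for w t h
    by (simp add: fx_def blinfun.add_left re im mult.commute)
  have cs: "continuous_on X g" if "smooth g" for g X by (rule smooth_continuous[OF that])
  have cc: "continuous_on X (\<lambda>x. g (of_real (snd x) * fst x))" if "smooth g" for g and X :: "(complex \<times> real) set"
    by (rule continuous_on_compose2[OF cs[OF that, of UNIV]]) (auto intro!: continuous_intros)
  have "(ray_potential p q has_derivative blinfun_apply (integral (cbox 0 1) (fx z))) (at z within S)"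
    unfolding ray_potential_def[abs_def] cbox_interval[symmetric]
  proof (rule leibniz_rule[OF _ _ _ S(3,2)])
    fix w and t :: real assume "w \<in> S"
    have D: "((\<lambda>w. g (of_real t * w)) has_derivative (\<lambda>h. of_real t * (of_real (Re h) * pd 1 g (of_real t * w) + of_real (Im h) * pd \<i> g (of_real t * w)))) (at w)"
      if "smooth g" for g
    proof -
      have "pd (of_real t * h) g (of_real t * w) = of_real t * (of_real (Re h) * pd 1 g (of_real t * w) + of_real (Im h) * pd \<i> g (of_real t * w))" for h
        unfolding pd_scale[OF smooth_differentiable[OF that]] using pd_expand[OF smooth_differentiable[OF that], of h] by simp
      then show ?thesis using has_derivative_compose_affine[of g 0 t w] smooth_differentiable[OF that] by simp
    qed
    have R: "((\<lambda>w. complex_of_real (Re w)) has_derivative (\<lambda>h. of_real (Re h))) (at w)"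
      "((\<lambda>w. complex_of_real (Im w)) has_derivative (\<lambda>h. of_real (Im h))) (at w)"
      by (auto intro!: derivative_eq_intros)
    have "((\<lambda>w. of_real (Re w) * p (of_real t * w) + of_real (Im w) * q (of_real t * w)) has_derivative blinfun_apply (fx w t)) (at w)"
      by (rule has_derivative_eq_rhs[OF has_derivative_add[OF has_derivative_mult[OF R(1) D[OF p]] has_derivative_mult[OF R(2) D[OF q]]]])
         (auto simp: fun_eq_iff fx a_def b_def algebra_simps)
    then show "((\<lambda>w. of_real (Re w) * p (of_real t * w) + of_real (Im w) * q (of_real t * w)) has_derivative blinfun_apply (fx w t)) (at w within S)"
      by (rule has_derivative_at_withinI)
  next
    fix w
    show "(\<lambda>t. of_real (Re w) * p (of_real t * w) + of_real (Im w) * q (of_real t * w)) integrable_on cbox 0 1"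
      by (intro integrable_continuous continuous_intros continuous_on_compose2[OF cs[OF p, of UNIV]] continuous_on_compose2[OF cs[OF q, of UNIV]]) auto
  next
    show "continuous_on (S \<times> cbox 0 1) (\<lambda>(x, t). fx x t)"
      unfolding fx_def a_def b_def case_prod_beta
      by (intro continuous_intros cc p q smooth_pd bounded_linear.continuous_on[OF bounded_linear_blinfun_mult_right])
  qed
  moreover have "blinfun_apply (integral (cbox 0 1) (fx z)) = (\<lambda>h. of_real (Re h) * p z + of_real (Im h) * q z)"
  proof
    fix h
    have "continuous_on (cbox 0 1) (fx z)"
      unfolding fx_def a_def b_def
      by (intro continuous_intros continuous_on_compose2[OF cs[OF smooth_pd[OF p], of UNIV]] continuous_on_compose2[OF cs[OF smooth_pd[OF q], of UNIV]]
          continuous_on_compose2[OF cs[OF p, of UNIV]] continuous_on_compose2[OF cs[OF q, of UNIV]] bounded_linear.continuous_on[OF bounded_linear_blinfun_mult_right]) auto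
    then have "fx z integrable_on cbox 0 1" by (rule integrable_continuous)
    from integral_linear[OF this blinfun.bounded_linear_left, of h]
    have "blinfun_apply (integral (cbox 0 1) (fx z)) h = integral (cbox 0 1) (\<lambda>t. of_real (Re h) * a z t + of_real (Im h) * b z t)"
      by (simp add: o_def fx)
    also have "\<dots> = of_real (Re h) * p z + of_real (Im h) * q z"
      unfolding cbox_interval a_def b_def
      by (intro integral_unique has_integral_add has_integral_mult_right smooth_ray_integrals[OF p q closed])
    finally show "blinfun_apply (integral (cbox 0 1) (fx z)) h = of_real (Re h) * p z + of_real (Im h) * q z" .
  qed
  ultimately show ?thesis using at_within_open[OF S(3,1)] by simp
qed

text \<open>P and Q are only continuous and closed only weakly, so the smooth case is applied to
  their mollifications near the segment to z0. The ray potentials converge pointwise and their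
  gradients uniformly on a disc around z0, so the limit has gradient (P, Q).\<close>

lemma star_poincare:
  assumes "open \<Omega>" and star: "star_shaped0 \<Omega>" and c: "continuous_on \<Omega> P" "continuous_on \<Omega> Q"
    and l: "locint \<Omega> P" "locint \<Omega> Q"
    and closed: "\<And>\<phi>. \<phi> \<in> test_fun \<Omega> \<Longrightarrow> (\<integral>z. P z * pd \<i> \<phi> z \<partial>lborel) = (\<integral>z. Q z * pd 1 \<phi> z \<partial>lborel)"
    and z0: "z0 \<in> \<Omega>"
  shows "(ray_potential P Q has_derivative (\<lambda>h. of_real (Re h) * P z0 + of_real (Im h) * Q z0)) (at z0)"
proof -
  define K0 where "K0 = (\<lambda>t. complex_of_real t * z0) ` {0..1}"
  have K0: "compact K0" "K0 \<subseteq> \<Omega>"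
    unfolding K0_def using star z0
    by (auto simp: star_shaped0_def intro!: compact_continuous_image continuous_intros)
  \<comment> \<open>K1 contains every segment from 0 to a point within distance d of z0, although
    \<Omega> need not be star-shaped with respect to other centres; K' below adds the margin for
    mollification.\<close>
  obtain d K1 where d: "d > 0" "compact K1" "K1 \<subseteq> \<Omega>" "\<And>z. z \<in> K0 \<Longrightarrow> cball z d \<subseteq> K1"
    using compact_nbhd[OF K0(1) assms(1) K0(2)] by metis
  obtain d' K' where d': "d' > 0" "compact K'" "K' \<subseteq> \<Omega>" "\<And>z. z \<in> K1 \<Longrightarrow> cball z d' \<subseteq> K'"
    using compact_nbhd[OF d(2) assms(1) d(3)] by metis
  define S where "S = ball z0 d"
  have tz: "of_real t * z \<in> K1" if "z \<in> S" "t \<in> {0..1}" for t z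
  proof -
    have "dist (of_real t * z0) (of_real t * z) = t * dist z0 z"
      using that(2) by (simp add: dist_norm right_diff_distrib[symmetric] norm_mult)
    also have "\<dots> \<le> 1 * dist z0 z" using that(2) by (intro mult_right_mono) auto
    also have "\<dots> < d" using that(1) by (simp add: S_def)
    finally have "of_real t * z \<in> cball (of_real t * z0) d" by simp
    then show ?thesis using d(4)[of "of_real t * z0"] that(2) unfolding K0_def by blast
  qed
  have SK: "z \<in> K1" if "z \<in> S" for z using tz[OF that, of 1] by simp
  let ?c = "\<lambda>g w. indicator K' w * g w :: complex"
  have int: "integrable lborel (?c g)" if "locint \<Omega> g" for g by (rule locint_integrable[OF that d'(2,3)])
  define e where "e n = min d' (1 / real (Suc n))" for n
  have epos: "e n > 0" "e n \<le> d'" "e n \<le> 1 / real (Suc n)" for n using d'(1) by (auto simp: e_def)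
  have sm: "smooth (mol (e n) (?c g))" if "locint \<Omega> g" for g n by (rule smooth_mol[OF integrable_imp_locint[OF int[OF that]] epos(1)])
  have unif: "\<forall>\<^sub>F n in sequentially. \<forall>z\<in>K1. cmod (mol (e n) (?c g) z - g z) \<le> \<epsilon>"
    if g: "continuous_on \<Omega> g" "locint \<Omega> g" "\<epsilon> > 0" for g \<epsilon>
  proof -
    have "\<exists>\<delta>>0. \<forall>e. 0 < e \<and> e \<le> \<delta> \<longrightarrow> (\<forall>z\<in>K1. cmod (mol e (\<lambda>w. indicator K' w * g w) z - g z) \<le> \<epsilon>)"
      by (rule mol_uniform[OF d'(2) int[OF g(2)] continuous_on_subset[OF g(1) d'(3)] d'(1,4) g(3)])
    then obtain \<delta> where \<delta>: "\<delta> > 0" "\<And>e z. 0 < e \<Longrightarrow> e \<le> \<delta> \<Longrightarrow> z \<in> K1 \<Longrightarrow> cmod (mol e (?c g) z - g z) \<le> \<epsilon>" by blast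
    obtain M where M: "inverse (real (Suc M)) < \<delta>" using reals_Archimedean[OF \<delta>(1)] by blast
    have "e n \<le> \<delta>" if "n \<ge> M" for n
    proof -
      have "1 / real (Suc n) \<le> 1 / real (Suc M)" using that by (intro divide_left_mono) auto
      then show ?thesis using M epos(3)[of n] by (simp add: inverse_eq_divide)
    qed
    then show ?thesis using \<delta>(2) epos(1) unfolding eventually_sequentially by blast
  qed
  \<comment> \<open>Both derivatives are pairings with derivatives of the same reflected mollifier,
    so this is the weak closedness tested with that mollifier.\<close>
  have closed_mol: "pd \<i> (mol (e n) (?c P)) z = pd 1 (mol (e n) (?c Q)) z" if "z \<in> K1" for n z
  proof -
    have sub: "cball z (e n) \<subseteq> K'" using d'(4)[OF that] epos(2)[of n] by auto
    have "(\<lambda>w. of_real (mollifier (e n) (z - w))) \<in> test_fun \<Omega>"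
      by (rule mollifier_reflect_test[OF epos(1) order_trans[OF sub d'(3)]])
    from closed[OF this] show ?thesis
      by (simp only: pd_mol_test[OF l(1) d'(2,3) epos(1) sub] pd_mol_test[OF l(2) d'(2,3) epos(1) sub])
  qed
  let ?V = "\<lambda>n. ray_potential (mol (e n) (?c P)) (mol (e n) (?c Q))"
  have lim: "(\<lambda>n. ?V n z) \<longlonglongrightarrow> ray_potential P Q z" if z: "z \<in> S" for z
    unfolding LIMSEQ_iff
  proof (intro allI impI)
    fix r :: real assume r: "r > 0"
    \<comment> \<open>The two components contribute at most |z| \<epsilon> each, and 2 |z|
      \<epsilon> <= r/2.\<close>
    define \<epsilon> where "\<epsilon> = r / (4 * (cmod z + 1))"
    have \<epsilon>: "\<epsilon> > 0" using r by (simp add: \<epsilon>_def add_nonneg_pos)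
    have "\<forall>\<^sub>F n in sequentially. norm (?V n z - ray_potential P Q z) < r"
      using unif[OF c(1) l(1) \<epsilon>] unif[OF c(2) l(2) \<epsilon>]
    proof eventually_elim
      case (elim n)
      have cont: "continuous_on {0..1} (\<lambda>t. g (of_real t * z))" if "continuous_on K1 g" for g :: "complex \<Rightarrow> complex"
        by (rule continuous_on_compose2[OF that]) (auto intro!: continuous_intros tz[OF z])
      have cP: "continuous_on {0..1} (\<lambda>t. P (of_real t * z))" "continuous_on {0..1} (\<lambda>t. Q (of_real t * z))"
        by (auto intro!: cont continuous_on_subset[OF _ d(3)] c)
      have cm: "continuous_on {0..1} (\<lambda>t. mol (e n) (?c P) (of_real t * z))" "continuous_on {0..1} (\<lambda>t. mol (e n) (?c Q) (of_real t * z))"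
        by (auto intro!: cont smooth_continuous sm l)
      have "?V n z - ray_potential P Q z = integral {0..1} (\<lambda>t::real. of_real (Re z) * mol (e n) (?c P) (of_real t * z) + of_real (Im z) * mol (e n) (?c Q) (of_real t * z)
         - (of_real (Re z) * P (of_real t * z) + of_real (Im z) * Q (of_real t * z)))"
        unfolding ray_potential_def
        by (intro Henstock_Kurzweil_Integration.integral_diff[symmetric] integrable_continuous_real continuous_intros cP cm)
      also have "norm \<dots> \<le> 2 * cmod z * \<epsilon> * (1 - 0)"
      proof (rule integral_bound)
        show "continuous_on {0..1} (\<lambda>t::real. of_real (Re z) * mol (e n) (?c P) (of_real t * z) + of_real (Im z) * mol (e n) (?c Q) (of_real t * z)
         - (of_real (Re z) * P (of_real t * z) + of_real (Im z) * Q (of_real t * z)))"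
          by (intro continuous_intros cP cm)
        fix t :: real assume t: "t \<in> {0..1}"
        let ?w = "of_real t * z"
        have "of_real (Re z) * mol (e n) (?c P) ?w + of_real (Im z) * mol (e n) (?c Q) ?w - (of_real (Re z) * P ?w + of_real (Im z) * Q ?w)
          = of_real (Re z) * (mol (e n) (?c P) ?w - P ?w) + of_real (Im z) * (mol (e n) (?c Q) ?w - Q ?w)" by (simp add: algebra_simps)
        also have "cmod \<dots> \<le> \<bar>Re z\<bar> * cmod (mol (e n) (?c P) ?w - P ?w) + \<bar>Im z\<bar> * cmod (mol (e n) (?c Q) ?w - Q ?w)"
          by (intro norm_triangle_le) (simp add: norm_mult)
        also have "\<dots> \<le> cmod z * \<epsilon> + cmod z * \<epsilon>"
          using elim tz[OF z t] by (intro add_mono mult_mono abs_Re_le_cmod abs_Im_le_cmod) auto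
        finally show "norm (of_real (Re z) * mol (e n) (?c P) ?w + of_real (Im z) * mol (e n) (?c Q) ?w - (of_real (Re z) * P ?w + of_real (Im z) * Q ?w)) \<le> 2 * cmod z * \<epsilon>"
          by (simp add: mult_ac)
      qed simp
      also have "\<dots> < r"
      proof -
        have "2 * cmod z * \<epsilon> \<le> 2 * (cmod z + 1) * \<epsilon>" using \<epsilon> by (intro mult_right_mono) auto
        also have "\<dots> = r / 2"
        proof -
          have "cmod z + 1 \<noteq> 0" by (smt (verit) norm_ge_zero)
          then show ?thesis by (simp add: \<epsilon>_def field_simps)
        qed
        finally show ?thesis using r by simp
      qed
      finally show ?case .
    qed
    then show "\<exists>N. \<forall>n\<ge>N. norm (?V n z - ray_potential P Q z) < r" by (simp add: eventually_sequentially)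
  qed
  have z0S: "z0 \<in> S" using d(1) by (simp add: S_def)
  have "\<exists>g. \<forall>z\<in>S. (\<lambda>n. ?V n z) \<longlonglongrightarrow> g z \<and> (g has_derivative (\<lambda>h. of_real (Re h) * P z + of_real (Im h) * Q z)) (at z)"
  proof (rule has_derivative_sequence_pd[where F = ?V and S = S and ?x0.0 = z0 and l = "ray_potential P Q z0" and P = P and Q = Q
        and A = "\<lambda>n. mol (e n) (?c P)" and B = "\<lambda>n. mol (e n) (?c Q)"])
    show "z0 \<in> S" "(\<lambda>n. ?V n z0) \<longlonglongrightarrow> ray_potential P Q z0" by (rule z0S lim[OF z0S])+
    show "(?V n has_derivative (\<lambda>h. of_real (Re h) * mol (e n) (?c P) z + of_real (Im h) * mol (e n) (?c Q) z)) (at z)" if "z \<in> S" for n z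
      by (rule smooth_ray_potential[OF sm[OF l(1)] sm[OF l(2)] _ _ that]) (use closed_mol tz[OF that] in \<open>auto simp: S_def\<close>)
    show "\<forall>\<^sub>F n in sequentially. \<forall>z\<in>S. cmod (mol (e n) (?c P) z - P z) \<le> \<epsilon>" if "\<epsilon> > 0" for \<epsilon>
      using unif[OF c(1) l(1) that] by (rule eventually_mono) (use SK in auto)
    show "\<forall>\<^sub>F n in sequentially. \<forall>z\<in>S. cmod (mol (e n) (?c Q) z - Q z) \<le> \<epsilon>" if "\<epsilon> > 0" for \<epsilon>
      using unif[OF c(2) l(2) that] by (rule eventually_mono) (use SK in auto)
  qed (auto simp: S_def)
  then obtain g where g: "\<And>z. z \<in> S \<Longrightarrow> (\<lambda>n. ?V n z) \<longlonglongrightarrow> g z"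
    "\<And>z. z \<in> S \<Longrightarrow> (g has_derivative (\<lambda>h. of_real (Re h) * P z + of_real (Im h) * Q z)) (at z)" by blast
  have eq: "g z = ray_potential P Q z" if "z \<in> S" for z using g(1)[OF that] lim[OF that] by (rule LIMSEQ_unique)
  show ?thesis
    by (rule has_derivative_transform_within_open[OF g(2)[OF z0S], of S]) (use z0S eq in \<open>auto simp: S_def\<close>)
qed

section \<open>Power integrability of ray potentials\<close>

lemma powr_ge_tangent:
  fixes x m q :: real
  assumes "m > 0" "x \<ge> 0" "q \<ge> 1"
  shows "m powr q + q * m powr (q - 1) * (x - m) \<le> x powr q"
proof (cases "x = 0")
  case True
  have "m powr (q - 1) * m = m powr q" using assms by (simp add: powr_diff)
  then have "m powr q + q * m powr (q - 1) * (x - m) = m powr q * (1 - q)"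
    using True by (simp add: algebra_simps)
  also have "\<dots> \<le> 0" using assms by (simp add: mult_nonneg_nonpos)
  finally show ?thesis using True by simp
next
  case False
  have "x powr q - m powr q \<ge> (q * m powr (q - 1)) * (x - m)"
  proof (rule convex_on_imp_above_tangent[OF powr_convex[OF assms(3)]])
    show "((\<lambda>x. x powr q) has_field_derivative q * m powr (q - 1)) (at m within {0<..})"
      using assms(1) by (auto intro!: has_field_derivative_at_within has_real_derivative_powr)
  qed (use assms False in \<open>auto simp: interior_open\<close>)
  then show ?thesis by simp
qed

text \<open>Jensen's inequality on the unit interval: the tangent of the power function at the mean
  m is integrated, and its linear term has integral 0.\<close>

lemma integral_powr_le:
  fixes f :: "real \<Rightarrow> real" and q :: real
  assumes c: "continuous_on {0..1} f" and f: "\<And>t. t \<in> {0..1} \<Longrightarrow> f t \<ge> 0" and q: "q \<ge> 1"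
  shows "(integral {0..1} f) powr q \<le> integral {0..1} (\<lambda>t. f t powr q)"
proof -
  define m where "m = integral {0..1} f"
  have i: "f integrable_on {0..1}" by (rule integrable_continuous_real[OF c])
  have cq: "continuous_on {0..1} (\<lambda>t. f t powr q)" using c q by (intro continuous_on_powr' continuous_intros) (use f in auto)
  have iq: "(\<lambda>t. f t powr q) integrable_on {0..1}" by (rule integrable_continuous_real[OF cq])
  have "m \<ge> 0" unfolding m_def using i f by (rule Henstock_Kurzweil_Integration.integral_nonneg)
  show ?thesis
  proof (cases "m = 0")
    case True
    then show ?thesis using Henstock_Kurzweil_Integration.integral_nonneg[OF iq] by (simp add: m_def)
  next
    case False
    then have m: "m > 0" using \<open>m \<ge> 0\<close> by simp
    have h: "((\<lambda>t. m powr q + q * m powr (q - 1) * (f t - m)) has_integral (m powr q * (1 - 0) + q * m powr (q - 1) * (m - m * (1 - 0)))) {0..1}"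
    proof -
      have "((\<lambda>t. c) has_integral (c * (1 - 0))) {0..1::real}" for c :: real
        using has_integral_const_real[of c 0 1] by (simp add: mult.commute)
      then show ?thesis
        by (intro has_integral_add has_integral_mult_right has_integral_diff integrable_integral[OF i, folded m_def])
    qed
    have "m powr q \<le> integral {0..1} (\<lambda>t. f t powr q)"
      using has_integral_le[OF h integrable_integral[OF iq]] powr_ge_tangent[OF m f q] by simp
    then show ?thesis by (simp add: m_def)
  qed
qed

lemma nn_integral_scale:
  fixes f :: "complex \<Rightarrow> ennreal"
  assumes "c > 0" and [measurable]: "f \<in> borel_measurable borel"
  shows "(\<integral>\<^sup>+w. f w \<partial>lborel) = ennreal (c\<^sup>2) * (\<integral>\<^sup>+w. f (c *\<^sub>R w) \<partial>lborel)"
proof -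
  have eq: "(lborel :: complex measure) = density (distr lborel borel (\<lambda>x. 0 + c *\<^sub>R x)) (\<lambda>_. ennreal (c\<^sup>2))"
    using lborel_affine[of c "0::complex"] assms(1) by simp
  have "(\<integral>\<^sup>+w. f w \<partial>lborel) = (\<integral>\<^sup>+w. ennreal (c\<^sup>2) * f w \<partial>distr lborel borel (\<lambda>x. 0 + c *\<^sub>R x))"
    by (subst eq, subst nn_integral_density) auto
  also have "\<dots> = (\<integral>\<^sup>+w. ennreal (c\<^sup>2) * f (c *\<^sub>R w) \<partial>lborel)"
    by (subst nn_integral_distr) auto
  also have "\<dots> = ennreal (c\<^sup>2) * (\<integral>\<^sup>+w. f (c *\<^sub>R w) \<partial>lborel)"
    by (rule nn_integral_cmult) measurable
  finally show ?thesis .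
qed

lemma powr_add_le:
  fixes a b q :: real assumes "a \<ge> 0" "b \<ge> 0" "q \<ge> 0"
  shows "(a + b) powr q \<le> 2 powr q * (a powr q + b powr q)"
proof -
  have "(a + b) powr q \<le> (2 * max a b) powr q" using assms by (intro powr_mono2) auto
  also have "\<dots> = 2 powr q * (max a b) powr q" using assms by (simp add: powr_mult)
  also have "(max a b) powr q \<le> a powr q + b powr q" by (simp add: max_def)
  finally show ?thesis by (simp add: mult_left_mono)
qed

text \<open>Near the origin the field is bounded; away from it the substitution \<open>w = t z\<close> costs only a
  bounded factor \<open>1/t\<^sup>2\<close>. So star-shapedness with respect to a single point suffices.\<close>

lemma ray_potential_Lp:
  assumes "open \<Omega>" "bounded \<Omega>" and star: "star_shaped0 \<Omega>" and q: "q \<ge> 1"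
    and c: "continuous_on \<Omega> P" "continuous_on \<Omega> Q"
    and [measurable]: "P \<in> borel_measurable borel" "Q \<in> borel_measurable borel"
    and iP: "integrable lborel (\<lambda>z. cmod (P z) powr q)" and iQ: "integrable lborel (\<lambda>z. cmod (Q z) powr q)"
    and V: "V \<in> borel_measurable borel" "\<And>z. z \<in> \<Omega> \<Longrightarrow> V z = ray_potential P Q z" "\<And>z. z \<notin> \<Omega> \<Longrightarrow> V z = 0"
  shows "integrable lborel (\<lambda>z. cmod (V z) powr q)"
proof -
  note [measurable] = V(1)
  have Om [measurable]: "\<Omega> \<in> sets borel" using assms(1) by simp
  obtain R where R: "R > 0" "\<Omega> \<subseteq> ball 0 R" using bounded_subset_ballD[OF assms(2)] by blast
  have "0 \<in> \<Omega>" using star by (simp add: star_shaped0_def)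
  then obtain r0 where r0: "r0 > 0" "cball 0 r0 \<subseteq> \<Omega>" using assms(1) open_contains_cball by blast
  define N where "N w = cmod (P w) + cmod (Q w)" for w
  have N0: "N w \<ge> 0" for w by (simp add: N_def)
  have [measurable]: "N \<in> borel_measurable borel" unfolding N_def[abs_def] by measurable
  have cN: "continuous_on \<Omega> N" unfolding N_def by (intro continuous_intros c)
  have iN: "(\<integral>\<^sup>+w. ennreal (N w powr q) \<partial>lborel) < \<infinity>"
  proof -
    have "integrable lborel (\<lambda>w. 2 powr q * (cmod (P w) powr q + cmod (Q w) powr q))" using iP iQ by auto
    then have "integrable lborel (\<lambda>w. N w powr q)"
      by (rule Bochner_Integration.integrable_bound) (use q powr_add_le[of "cmod (P w)" "cmod (Q w)" q for w] in \<open>auto simp: N_def\<close>)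
    then show ?thesis by (simp add: integrable_iff_bounded)
  qed
  have "compact (N ` cball 0 r0)" by (intro compact_continuous_image continuous_on_subset[OF cN r0(2)]) auto
  then obtain B where B: "B > 0" "\<And>w. w \<in> cball 0 r0 \<Longrightarrow> N w \<le> B"
    using compact_imp_bounded[THEN bounded_pos[THEN iffD1]] by (metis abs_le_D1 image_eqI real_norm_def)
  have tz: "of_real t * z \<in> \<Omega>" if "z \<in> \<Omega>" "t \<in> {0..1}" for t z
    using star that by (auto simp: star_shaped0_def)
  \<comment> \<open>Both coordinates of z are at most R, and Jensen's inequality moves the power
    inside the integral over t. The indicator of \<Omega> stays in the integrand so that Tonelli can
    exchange t and z.\<close>
  have pt: "ennreal (cmod (V z) powr q) \<le> (\<integral>\<^sup>+t. ennreal (R powr q) * (ennreal (N (of_real t * z) powr q) * indicator {0..1} t * indicator \<Omega> z) \<partial>lborel)" for z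
  proof (cases "z \<in> \<Omega>")
    case False
    then show ?thesis using V(3) q by simp
  next
    case True
    have cont: "continuous_on {0..1} (\<lambda>t. g (of_real t * z))" if "continuous_on \<Omega> g" for g :: "complex \<Rightarrow> 'c::topological_space"
      by (rule continuous_on_compose2[OF that]) (auto intro!: continuous_intros tz[OF True])
    have "cmod (V z) \<le> integral {0..1} (\<lambda>t. R * N (of_real t * z))"
      unfolding V(2)[OF True] ray_potential_def
    proof (rule integral_norm_bound_integral)
      show "(\<lambda>t. of_real (Re z) * P (of_real t * z) + of_real (Im z) * Q (of_real t * z)) integrable_on {0..1}"
        by (intro integrable_continuous_real continuous_intros cont c)
      show "(\<lambda>t. R * N (of_real t * z)) integrable_on {0..1}"
        by (intro integrable_continuous_real continuous_intros cont cN)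
      fix t :: real
      have "cmod z \<le> R" using True R by auto
      then have "\<bar>Re z\<bar> \<le> R" "\<bar>Im z\<bar> \<le> R" using abs_Re_le_cmod[of z] abs_Im_le_cmod[of z] by linarith+
      then have "\<bar>Re z\<bar> * cmod (P (of_real t * z)) + \<bar>Im z\<bar> * cmod (Q (of_real t * z)) \<le> R * N (of_real t * z)"
        unfolding N_def distrib_left by (intro add_mono mult_right_mono) auto
      then show "norm (of_real (Re z) * P (of_real t * z) + of_real (Im z) * Q (of_real t * z)) \<le> R * N (of_real t * z)"
        by (intro order_trans[OF norm_triangle_ineq]) (simp add: norm_mult)
    qed
    also have "\<dots> = R * integral {0..1} (\<lambda>t. N (of_real t * z))" by simp
    finally have "cmod (V z) powr q \<le> (R * integral {0..1} (\<lambda>t. N (of_real t * z))) powr q"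
      using q by (intro powr_mono2) auto
    also have "\<dots> = R powr q * (integral {0..1} (\<lambda>t. N (of_real t * z))) powr q"
      using R(1) by (simp add: powr_mult Henstock_Kurzweil_Integration.integral_nonneg integrable_continuous_real cont cN N0)
    also have "\<dots> \<le> R powr q * integral {0..1} (\<lambda>t. N (of_real t * z) powr q)"
      by (intro mult_left_mono integral_powr_le cont cN N0 q) auto
    finally have le: "ennreal (cmod (V z) powr q) \<le> ennreal (R powr q * integral {0..1} (\<lambda>t. N (of_real t * z) powr q))" by (rule ennreal_leI)
    have cq: "continuous_on {0..1} (\<lambda>t. N (of_real t * z) powr q)"
      using cont[OF cN] q by (intro continuous_on_powr' continuous_intros) (use N0 in auto)
    have "((\<lambda>t. N (of_real t * z) powr q) has_integral integral {0..1} (\<lambda>t. N (of_real t * z) powr q)) {0..1}"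
      by (intro integrable_integral integrable_continuous_real cq)
    then have hi: "((\<lambda>t. if t \<in> {0..1} then N (of_real t * z) powr q else 0) has_integral integral {0..1} (\<lambda>t. N (of_real t * z) powr q)) UNIV"
      by (subst has_integral_restrict_UNIV)
    have "(\<integral>\<^sup>+t. ennreal (if t \<in> {0..1} then N (of_real t * z) powr q else 0) \<partial>lborel) = ennreal (integral {0..1} (\<lambda>t. N (of_real t * z) powr q))"
      by (rule nn_integral_has_integral_lborel[OF _ _ hi]) auto
    moreover have "ennreal (if t \<in> {0..1} then N (of_real t * z) powr q else 0) = ennreal (N (of_real t * z) powr q) * indicator {0..1} t * indicator \<Omega> z" for t
      using True by (simp add: indicator_def)
    ultimately have e: "(\<integral>\<^sup>+t. ennreal (N (of_real t * z) powr q) * indicator {0..1} t * indicator \<Omega> z \<partial>lborel) = ennreal (integral {0..1} (\<lambda>t. N (of_real t * z) powr q))" by simp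
    have "(\<integral>\<^sup>+t. ennreal (R powr q) * (ennreal (N (of_real t * z) powr q) * indicator {0..1} t * indicator \<Omega> z) \<partial>lborel)
       = ennreal (R powr q) * ennreal (integral {0..1} (\<lambda>t. N (of_real t * z) powr q))"
      unfolding e[symmetric] by (rule nn_integral_cmult) measurable
    also have "\<dots> = ennreal (R powr q * integral {0..1} (\<lambda>t. N (of_real t * z) powr q))"
      by (rule ennreal_mult'[symmetric]) simp
    finally show ?thesis using le by simp
  qed
  \<comment> \<open>The threshold between the two regimes: for t <= \<delta> and |z| < R the point
    tz lies in the disc of radius r0 about 0, a compact part of \<Omega> on which N is bounded by
    B.\<close>
  define \<delta> where "\<delta> = r0 / R"
  have \<delta>: "\<delta> > 0" using r0 R by (simp add: \<delta>_def)
  define C where "C = ennreal (B powr q) * emeasure lborel (ball (0::complex) R) + ennreal (1 / \<delta>\<^sup>2) * (\<integral>\<^sup>+w. ennreal (N w powr q) \<partial>lborel)"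
  have Cfin: "C < \<infinity>" unfolding C_def
    using iN emeasure_bounded_finite[of "ball (0::complex) R"] by (simp add: ennreal_add_less_top ennreal_mult_less_top)
  have inner: "(\<integral>\<^sup>+z. ennreal (R powr q) * (ennreal (N (of_real t * z) powr q) * indicator {0..1} t * indicator \<Omega> z) \<partial>lborel) \<le> ennreal (R powr q) * C * indicator {0..1} t" for t :: real
  proof (cases "t \<in> {0..1}")
    case False then show ?thesis by simp
  next
    case True
    have "(\<integral>\<^sup>+z. ennreal (N (of_real t * z) powr q) * indicator \<Omega> z \<partial>lborel) \<le> C"
    proof (cases "t \<le> \<delta>")
      case t: True
      have "(\<integral>\<^sup>+z. ennreal (N (of_real t * z) powr q) * indicator \<Omega> z \<partial>lborel) \<le> (\<integral>\<^sup>+z. ennreal (B powr q) * indicator (ball 0 R) (z::complex) \<partial>lborel)"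
      proof (rule nn_integral_mono)
        fix z :: complex
        show "ennreal (N (of_real t * z) powr q) * indicator \<Omega> z \<le> ennreal (B powr q) * indicator (ball 0 R) z"
        proof (cases "z \<in> \<Omega>")
          case z: True
          then have "cmod z < R" using R by auto
          then have "cmod (of_real t * z) \<le> \<delta> * R" unfolding norm_mult using True t R by (intro mult_mono) auto
          then have "of_real t * z \<in> cball 0 r0" using R by (simp add: \<delta>_def)
          from B(2)[OF this] have "N (of_real t * z) powr q \<le> B powr q" using q N0 by (intro powr_mono2) auto
          then show ?thesis using z \<open>cmod z < R\<close> by (simp add: ennreal_leI)
        qed simp
      qed
      also have "\<dots> = ennreal (B powr q) * emeasure lborel (ball (0::complex) R)" by (rule nn_integral_cmult_indicator) simp
      also have "\<dots> \<le> C" by (simp add: C_def)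
      finally show ?thesis .
    next
      case t: False
      have "(\<integral>\<^sup>+z. ennreal (N (of_real t * z) powr q) * indicator \<Omega> z \<partial>lborel) \<le> (\<integral>\<^sup>+z. ennreal (N (t *\<^sub>R z) powr q) \<partial>lborel)"
        by (intro nn_integral_mono) (simp add: scaleR_conv_of_real indicator_def)
      also have "\<dots> = ennreal (1 / t\<^sup>2) * (ennreal (t\<^sup>2) * (\<integral>\<^sup>+z. ennreal (N (t *\<^sub>R z) powr q) \<partial>lborel))"
        using t \<delta> by (simp add: mult.assoc[symmetric] flip: ennreal_mult)
      also have "ennreal (t\<^sup>2) * (\<integral>\<^sup>+z. ennreal (N (t *\<^sub>R z) powr q) \<partial>lborel) = (\<integral>\<^sup>+w. ennreal (N w powr q) \<partial>lborel)"
        by (rule nn_integral_scale[symmetric]) (use t \<delta> in auto)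
      also have "ennreal (1 / t\<^sup>2) * (\<integral>\<^sup>+w. ennreal (N w powr q) \<partial>lborel) \<le> ennreal (1 / \<delta>\<^sup>2) * (\<integral>\<^sup>+w. ennreal (N w powr q) \<partial>lborel)"
        using t \<delta> by (intro mult_right_mono ennreal_leI frac_le power_mono) auto
      also have "\<dots> \<le> C" by (simp add: C_def)
      finally show ?thesis .
    qed
    then have "ennreal (R powr q) * (\<integral>\<^sup>+z. ennreal (N (of_real t * z) powr q) * indicator \<Omega> z \<partial>lborel) \<le> ennreal (R powr q) * C" by (rule mult_left_mono) simp
    moreover have "(\<integral>\<^sup>+z. ennreal (R powr q) * (ennreal (N (of_real t * z) powr q) * indicator {0..1} t * indicator \<Omega> z) \<partial>lborel)
       = ennreal (R powr q) * (\<integral>\<^sup>+z. ennreal (N (of_real t * z) powr q) * indicator \<Omega> z \<partial>lborel)"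
      using True by (subst nn_integral_cmult[symmetric]) auto
    ultimately show ?thesis using True by simp
  qed
  show ?thesis
  proof (rule integrableI_bounded)
    have "(\<integral>\<^sup>+z. ennreal (norm (cmod (V z) powr q)) \<partial>lborel) \<le>
       (\<integral>\<^sup>+z. \<integral>\<^sup>+t. ennreal (R powr q) * (ennreal (N (of_real t * z) powr q) * indicator {0..1} t * indicator \<Omega> z) \<partial>lborel \<partial>lborel)"
      by (intro nn_integral_mono) (use pt in simp)
    also have "\<dots> = (\<integral>\<^sup>+t. \<integral>\<^sup>+z. ennreal (R powr q) * (ennreal (N (of_real t * z) powr q) * indicator {0..1} t * indicator \<Omega> z) \<partial>lborel \<partial>lborel)"
      by (rule lborel_pair.Fubini') measurable
    also have "\<dots> \<le> (\<integral>\<^sup>+t. ennreal (R powr q) * C * indicator {0..1::real} t \<partial>lborel)"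
      by (rule nn_integral_mono) (rule inner)
    also have "\<dots> = ennreal (R powr q) * C * emeasure lborel {0..1::real}" by (rule nn_integral_cmult_indicator) simp
    also have "\<dots> < \<infinity>" using Cfin by (simp add: ennreal_mult_less_top)
    finally show "(\<integral>\<^sup>+z. ennreal (norm (cmod (V z) powr q)) \<partial>lborel) < \<infinity>" .
  qed measurable
qed

section \<open>The conductivity equation\<close>

text \<open>The weak gradient is curl-free: both sides are minus the integral of U against the mixed
  second derivative of \<psi>, whose order does not matter for a smooth function.\<close>

lemma wd_mixed:
  assumes U: "wd 1 \<Omega> U Ux" "wd \<i> \<Omega> U Uy" and \<psi>: "\<psi> \<in> test_fun \<Omega>"
  shows "(\<integral>z. Ux z * pd \<i> \<psi> z \<partial>lborel) = (\<integral>z. Uy z * pd 1 \<psi> z \<partial>lborel)"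
proof -
  obtain R where R: "R > 0" "\<And>z. cmod z > R \<Longrightarrow> \<psi> z = 0" using test_fun_bdd_support[OF \<psi>] by metis
  have "pd 1 (pd \<i> \<psi>) = pd \<i> (pd 1 \<psi>)" by (rule pd_commute[OF test_fun_smooth[OF \<psi>] R(2)])
  then show ?thesis
    using wdD(3)[OF U(1) test_fun_pd[OF \<psi>, of \<i>]] wdD(3)[OF U(2) test_fun_pd[OF \<psi>, of 1]] by simp
qed

text \<open>Testing \<open>div (\<sigma> \<nabla>U) = 0\<close> with \<open>\<tau>\<psi>\<close>, \<open>\<tau> = 1/\<sigma>\<close>, turns the equation into
  \<open>\<Delta>U = \<sigma> \<nabla>\<tau> \<cdot> \<nabla>U\<close>, whose right-hand side involves no second derivatives. Both \<open>U\<^sub>x - i U\<^sub>y\<close> and the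
  conjugate of \<open>U\<^sub>x + i U\<^sub>y\<close> then solve an inhomogeneous Cauchy--Riemann equation.\<close>

lemma sol_gradient_continuous:
  assumes "open \<Omega>"
    and \<sigma>: "\<sigma> \<in> borel_measurable borel" "\<And>z. cmod (\<sigma> z) \<le> B"
    and \<tau>: "wd 1 \<Omega> \<tau> \<tau>x" "wd \<i> \<Omega> \<tau> \<tau>y" "\<And>z. cmod (\<tau> z) \<le> B" "\<And>z. cmod (\<tau>x z) \<le> B" "\<And>z. cmod (\<tau>y z) \<le> B"
    and inv: "\<And>z. z \<in> \<Omega> \<Longrightarrow> \<sigma> z * \<tau> z = 1"
    and U: "wd 1 \<Omega> U Ux" "wd \<i> \<Omega> U Uy"
    and sol: "\<And>\<phi>. \<phi> \<in> test_fun \<Omega> \<Longrightarrow> (\<integral>z. \<sigma> z * (Ux z * pd 1 \<phi> z + Uy z * pd \<i> \<phi> z) \<partial>lborel) = 0"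
  shows "\<exists>P Q. continuous_on \<Omega> P \<and> continuous_on \<Omega> Q \<and>
    (AE z in lborel. z \<in> \<Omega> \<longrightarrow> P z = Ux z) \<and> (AE z in lborel. z \<in> \<Omega> \<longrightarrow> Q z = Uy z)"
proof -
  have B: "B \<ge> 0" using \<sigma>(2) norm_ge_zero order_trans by blast
  note lU = wdD(2)[OF U(1)] wdD(2)[OF U(2)]
  note [measurable] = \<sigma>(1) locint_measurable[OF wdD(1)[OF \<tau>(1)]] locint_measurable[OF wdD(2)[OF \<tau>(1)]] locint_measurable[OF wdD(2)[OF \<tau>(2)]]
    locint_measurable[OF lU(1)] locint_measurable[OF lU(2)]
  define g where "g z = \<sigma> z * \<tau>x z * Ux z + \<sigma> z * \<tau>y z * Uy z" for z
  have st: "cmod (\<sigma> z * \<tau>x z) \<le> B * B" "cmod (\<sigma> z * \<tau>y z) \<le> B * B" for z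
    unfolding norm_mult using \<sigma> \<tau> B by (auto intro!: mult_mono)
  have lg: "locint \<Omega> g" unfolding g_def[abs_def]
    by (intro locint_add locint_mult_bdd[OF lU(1) _ st(1)] locint_mult_bdd[OF lU(2) _ st(2)]) measurable
  have lsU: "locint \<Omega> (\<lambda>z. \<sigma> z * Ux z)" "locint \<Omega> (\<lambda>z. \<sigma> z * Uy z)"
    by (intro locint_mult_bdd[OF lU(1) \<sigma>] locint_mult_bdd[OF lU(2) \<sigma>])+
  have sum4: "a + c = - g" if "a + b + c + d = 0" "b + d = g" for a b c d g :: complex
    using that by (metis add.assoc add.commute eq_neg_iff_add_eq_0)
  \<comment> \<open>\<tau> \<psi> is not smooth, so the equation is tested with F n \<psi>, where F
    n approximates \<tau> with bounded derivatives. In the limit \<sigma> \<tau> = 1 removes the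
    coefficient from the principal terms, and the terms with derivatives of \<tau> form g.\<close>
  have key: "(\<integral>z. Ux z * pd 1 \<psi> z \<partial>lborel) + (\<integral>z. Uy z * pd \<i> \<psi> z \<partial>lborel) = - (\<integral>z. g z * \<psi> z \<partial>lborel)"
    if \<psi>: "\<psi> \<in> test_fun \<Omega>" for \<psi>
  proof -
    obtain K where K: "smooth \<psi>" "compact K" "K \<subseteq> \<Omega>" "\<And>z. z \<notin> K \<Longrightarrow> \<psi> z = 0"
      using test_funD[OF \<psi>] by blast
    have pK: "pd e \<psi> z = 0" if "z \<notin> K" for e z
      by (rule pd_closed_support[OF compact_imp_closed[OF K(2)] K(4) that])
    obtain F :: "nat \<Rightarrow> complex \<Rightarrow> complex" where F: "\<And>n. smooth (F n)" "\<And>n z. cmod (F n z) \<le> B"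
      "\<And>n z. z \<in> K \<Longrightarrow> cmod (pd 1 (F n) z) \<le> B" "\<And>n z. z \<in> K \<Longrightarrow> cmod (pd \<i> (F n) z) \<le> B"
      "AE z in lborel. z \<in> K \<longrightarrow> (\<lambda>n. F n z) \<longlonglongrightarrow> \<tau> z"
      "AE z in lborel. z \<in> K \<longrightarrow> (\<lambda>n. pd 1 (F n) z) \<longlonglongrightarrow> \<tau>x z"
      "AE z in lborel. z \<in> K \<longrightarrow> (\<lambda>n. pd \<i> (F n) z) \<longlonglongrightarrow> \<tau>y z"
    proof (rule wd_approx[OF assms(1) K(2,3) \<tau>], goal_cases)
      case (1 F) show ?case by (rule 1(1)[OF 1(2-8)])
    qed
    have int: "integrable lborel (\<lambda>z. \<sigma> z * Ux z * \<phi> z)" "integrable lborel (\<lambda>z. \<sigma> z * Uy z * \<phi> z)" if "\<phi> \<in> test_fun \<Omega>" for \<phi>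
      using locint_mult_test[OF lsU(1) that] locint_mult_test[OF lsU(2) that] by auto
    let ?a1 = "\<lambda>z. \<sigma> z * Ux z * pd 1 \<psi> z" and ?a2 = "\<lambda>z. \<sigma> z * Uy z * pd \<i> \<psi> z"
    let ?b1 = "\<lambda>z. \<sigma> z * Ux z * \<psi> z" and ?b2 = "\<lambda>z. \<sigma> z * Uy z * \<psi> z"
    have eq: "(\<integral>z. ?a1 z * F n z \<partial>lborel) + (\<integral>z. ?b1 z * pd 1 (F n) z \<partial>lborel) + (\<integral>z. ?a2 z * F n z \<partial>lborel) + (\<integral>z. ?b2 z * pd \<i> (F n) z \<partial>lborel) = 0" for n
    proof -
      have p: "pd e (\<lambda>z. F n z * \<psi> z) z = F n z * pd e \<psi> z + pd e (F n) z * \<psi> z" for e z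
        by (rule pd_mult) (auto intro: smooth_differentiable F K)
      have "(\<integral>z. ?a1 z * F n z + ?b1 z * pd 1 (F n) z + ?a2 z * F n z + ?b2 z * pd \<i> (F n) z \<partial>lborel) = 0"
        using sol[OF test_fun_mult[OF \<psi> F(1)], of n] unfolding p by (simp add: algebra_simps)
      moreover have "integrable lborel (\<lambda>z. ?a1 z * F n z)" "integrable lborel (\<lambda>z. ?a2 z * F n z)"
        "integrable lborel (\<lambda>z. ?b1 z * pd 1 (F n) z)" "integrable lborel (\<lambda>z. ?b2 z * pd \<i> (F n) z)"
        using int[OF test_fun_mult2[OF test_fun_pd[OF \<psi>] F(1)]] int[OF test_fun_mult2[OF \<psi> smooth_pd[OF F(1)]]]
        by (auto simp: mult.assoc)
      ultimately show ?thesis by simp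
    qed
    have z: "?a1 z = 0" "?a2 z = 0" "?b1 z = 0" "?b2 z = 0" if "z \<notin> K" for z
      using K(4)[OF that] pK[OF that] by auto
    have "(\<lambda>n. (\<integral>z. ?a1 z * F n z \<partial>lborel) + (\<integral>z. ?b1 z * pd 1 (F n) z \<partial>lborel) + (\<integral>z. ?a2 z * F n z \<partial>lborel) + (\<integral>z. ?b2 z * pd \<i> (F n) z \<partial>lborel)) \<longlonglongrightarrow>
      (\<integral>z. ?a1 z * \<tau> z \<partial>lborel) + (\<integral>z. ?b1 z * \<tau>x z \<partial>lborel) + (\<integral>z. ?a2 z * \<tau> z \<partial>lborel) + (\<integral>z. ?b2 z * \<tau>y z \<partial>lborel)"
      by (intro tendsto_add integral_lim_bdd[OF int(1)[OF test_fun_pd[OF \<psi>]] z(1) smooth_borel[OF F(1)] _ F(2) F(5)]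
          integral_lim_bdd[OF int(2)[OF test_fun_pd[OF \<psi>]] z(2) smooth_borel[OF F(1)] _ F(2) F(5)]
          integral_lim_bdd[OF int(1)[OF \<psi>] z(3) smooth_borel[OF smooth_pd[OF F(1)]] _ F(3) F(6)]
          integral_lim_bdd[OF int(2)[OF \<psi>] z(4) smooth_borel[OF smooth_pd[OF F(1)]] _ F(4) F(7)]) measurable
    then have "(\<integral>z. ?a1 z * \<tau> z \<partial>lborel) + (\<integral>z. ?b1 z * \<tau>x z \<partial>lborel) + (\<integral>z. ?a2 z * \<tau> z \<partial>lborel) + (\<integral>z. ?b2 z * \<tau>y z \<partial>lborel) = 0"
      unfolding eq by (simp add: LIMSEQ_const_iff)
    then have S: "(\<integral>z. ?a1 z * \<tau> z \<partial>lborel) + (\<integral>z. ?b1 z * \<tau>x z \<partial>lborel) + (\<integral>z. ?a2 z * \<tau> z \<partial>lborel) + (\<integral>z. ?b2 z * \<tau>y z \<partial>lborel) = 0" .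
    have a: "?a1 z * \<tau> z = Ux z * pd 1 \<psi> z" "?a2 z * \<tau> z = Uy z * pd \<i> \<psi> z" for z
    proof -
      have "a * b * c * d = b * c" if "a * d = 1" for a b c d :: complex
        using that by (metis mult.assoc mult.commute mult_1)
      then show "?a1 z * \<tau> z = Ux z * pd 1 \<psi> z" "?a2 z * \<tau> z = Uy z * pd \<i> \<psi> z"
        using inv[of z] pK[of z] K(3) by (cases "z \<in> K"; auto)+
    qed
    have b: "(\<integral>z. ?b1 z * \<tau>x z \<partial>lborel) + (\<integral>z. ?b2 z * \<tau>y z \<partial>lborel) = (\<integral>z. g z * \<psi> z \<partial>lborel)"
    proof -
      have "integrable lborel (\<lambda>z. (\<sigma> z * \<tau>x z * Ux z) * \<psi> z)" "integrable lborel (\<lambda>z. (\<sigma> z * \<tau>y z * Uy z) * \<psi> z)"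
        by (intro locint_mult_test[OF locint_mult_bdd[OF lU(1) _ st(1)] \<psi>] locint_mult_test[OF locint_mult_bdd[OF lU(2) _ st(2)] \<psi>]; measurable)+
      then have "(\<integral>z. (\<sigma> z * \<tau>x z * Ux z) * \<psi> z \<partial>lborel) + (\<integral>z. (\<sigma> z * \<tau>y z * Uy z) * \<psi> z \<partial>lborel) = (\<integral>z. g z * \<psi> z \<partial>lborel)"
        unfolding g_def distrib_right by simp
      then show ?thesis by (simp add: mult_ac)
    qed
    show ?thesis by (rule sum4[OF S[unfolded a] b])
  qed
  \<comment> \<open>Formally \<open>dz\<close> of q1 is the Laplacian of U plus i times the curl of
    its gradient. The curl vanishes by \<open>wd_mixed\<close>, and \<open>key\<close> identifies
    the Laplacian with g.\<close>
  define q1 where "q1 z = Ux z - \<i> * Uy z" for z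
  define q2 where "q2 z = cnj (Ux z + \<i> * Uy z)" for z
  have int: "integrable lborel (\<lambda>z. Ux z * \<phi> z)" "integrable lborel (\<lambda>z. Uy z * \<phi> z)" if "\<phi> \<in> test_fun \<Omega>" for \<phi>
    using locint_mult_test[OF lU(1) that] locint_mult_test[OF lU(2) that] by auto
  have w1: "wdz \<Omega> q1 g" unfolding wdz_def
  proof (intro conjI ballI lg)
    show "locint \<Omega> q1" unfolding q1_def[abs_def] by (intro locint_diff locint_cmult lU)
    fix \<psi> assume \<psi>: "\<psi> \<in> test_fun \<Omega>"
    note i = int[OF test_fun_pd[OF \<psi>]]
    have "(\<integral>z. q1 z * dz \<psi> z \<partial>lborel) = (\<integral>z. (Ux z * pd 1 \<psi> z + Uy z * pd \<i> \<psi> z) + \<i> * (Ux z * pd \<i> \<psi> z - Uy z * pd 1 \<psi> z) \<partial>lborel)"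
      by (intro Bochner_Integration.integral_cong refl) (simp add: q1_def dz_def algebra_simps)
    also have "\<dots> = ((\<integral>z. Ux z * pd 1 \<psi> z \<partial>lborel) + (\<integral>z. Uy z * pd \<i> \<psi> z \<partial>lborel)) + \<i> * ((\<integral>z. Ux z * pd \<i> \<psi> z \<partial>lborel) - (\<integral>z. Uy z * pd 1 \<psi> z \<partial>lborel))"
      using i by simp
    finally show "(\<integral>z. q1 z * dz \<psi> z \<partial>lborel) = - (\<integral>z. g z * \<psi> z \<partial>lborel)" using key[OF \<psi>] wd_mixed[OF U \<psi>] by simp
  qed
  have cnj_loc: "locint \<Omega> (\<lambda>z. cnj (h z))" if "locint \<Omega> h" for h
    unfolding locint_def
  proof (intro conjI allI impI)
    have [measurable]: "cnj \<in> borel_measurable borel" by (intro borel_measurable_continuous_onI continuous_on_cnj continuous_on_id)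
    show "(\<lambda>z. cnj (h z)) \<in> borel_measurable borel" using locint_measurable[OF that] by measurable
    fix K assume "compact K" "K \<subseteq> \<Omega>"
    from integrable_cnj[OF locint_integrable[OF that this]]
    have "integrable lborel (\<lambda>z. cnj (indicator K z * h z))" .
    moreover have "cnj (indicator K z * h z) = indicator K z * cnj (h z)" for z by (simp add: indicator_def)
    ultimately show "integrable lborel (\<lambda>z. indicator K z * cnj (h z))" by (simp only:)
  qed
  \<comment> \<open>The combination U_x + i U_y belongs to the conjugate operator. Conjugating it,
    and the test function with it, brings it under the same operator \<open>dz\<close>, at the price
    of the conjugate of g.\<close>
  have w2: "wdz \<Omega> q2 (\<lambda>z. cnj (g z))" unfolding wdz_def
  proof (intro conjI ballI cnj_loc lg)
    show "locint \<Omega> q2" unfolding q2_def[abs_def] by (intro cnj_loc locint_add locint_cmult lU)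
    fix \<psi> assume \<psi>: "\<psi> \<in> test_fun \<Omega>"
    define \<theta> where "\<theta> z = cnj (\<psi> z)" for z
    have \<theta>: "\<theta> \<in> test_fun \<Omega>" unfolding \<theta>_def[abs_def] by (rule test_fun_cnj[OF \<psi>])
    have p\<theta>: "pd e \<theta> z = cnj (pd e \<psi> z)" for e z
      unfolding \<theta>_def by (rule pd_cnj[OF smooth_differentiable[OF test_fun_smooth[OF \<psi>]]])
    note i = int[OF test_fun_pd[OF \<theta>]]
    have "(\<integral>z. q2 z * dz \<psi> z \<partial>lborel) = (\<integral>z. cnj ((Ux z * pd 1 \<theta> z + Uy z * pd \<i> \<theta> z) - \<i> * (Ux z * pd \<i> \<theta> z - Uy z * pd 1 \<theta> z)) \<partial>lborel)"
      by (intro Bochner_Integration.integral_cong refl) (simp add: q2_def dz_def p\<theta> algebra_simps)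
    also have "\<dots> = cnj (\<integral>z. (Ux z * pd 1 \<theta> z + Uy z * pd \<i> \<theta> z) - \<i> * (Ux z * pd \<i> \<theta> z - Uy z * pd 1 \<theta> z) \<partial>lborel)"
      by (rule Bochner_Integration.integral_cnj)
    also have "(\<integral>z. (Ux z * pd 1 \<theta> z + Uy z * pd \<i> \<theta> z) - \<i> * (Ux z * pd \<i> \<theta> z - Uy z * pd 1 \<theta> z) \<partial>lborel)
      = ((\<integral>z. Ux z * pd 1 \<theta> z \<partial>lborel) + (\<integral>z. Uy z * pd \<i> \<theta> z \<partial>lborel)) - \<i> * ((\<integral>z. Ux z * pd \<i> \<theta> z \<partial>lborel) - (\<integral>z. Uy z * pd 1 \<theta> z \<partial>lborel))"
      using i by simp
    also have "\<dots> = - (\<integral>z. g z * \<theta> z \<partial>lborel)" using key[OF \<theta>] wd_mixed[OF U \<theta>] by simp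
    also have "cnj \<dots> = - (\<integral>z. cnj (g z * \<theta> z) \<partial>lborel)" by (simp only: Bochner_Integration.integral_cnj complex_cnj_minus)
    finally show "(\<integral>z. q2 z * dz \<psi> z \<partial>lborel) = - (\<integral>z. cnj (g z) * \<psi> z \<partial>lborel)" by (simp add: \<theta>_def)
  qed
  have Uq: "Ux z = (q1 z + cnj (q2 z)) / 2" "Uy z = (cnj (q2 z) - q1 z) / (2 * \<i>)" for z
    by (simp_all add: q1_def q2_def)
  \<comment> \<open>The pair determines the gradient linearly, and each component is at most half
    the sum of the moduli; the coefficients \<sigma> times derivatives of \<tau> are at most B^2.
    This is the coupling bound required by \<open>wdz_pair_continuous\<close>.\<close>
  have gle: "cmod (g z) \<le> B * B * (cmod (q1 z) + cmod (q2 z))" for z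
  proof -
    have "cmod (q1 z + cnj (q2 z)) \<le> cmod (q1 z) + cmod (q2 z)" "cmod (cnj (q2 z) - q1 z) \<le> cmod (q1 z) + cmod (q2 z)"
      using norm_triangle_ineq[of "q1 z" "cnj (q2 z)"] norm_triangle_ineq4[of "cnj (q2 z)" "q1 z"] by simp_all
    then have U2: "cmod (Ux z) \<le> (cmod (q1 z) + cmod (q2 z)) / 2" "cmod (Uy z) \<le> (cmod (q1 z) + cmod (q2 z)) / 2"
      unfolding Uq by (simp_all add: norm_divide norm_mult)
    have "cmod (g z) \<le> cmod (\<sigma> z * \<tau>x z) * cmod (Ux z) + cmod (\<sigma> z * \<tau>y z) * cmod (Uy z)"
      unfolding g_def by (intro order_trans[OF norm_triangle_ineq]) (simp add: norm_mult)
    also have "\<dots> \<le> B * B * ((cmod (q1 z) + cmod (q2 z)) / 2) + B * B * ((cmod (q1 z) + cmod (q2 z)) / 2)"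
      by (intro add_mono mult_mono st U2) (use B in auto)
    finally show ?thesis by simp
  qed
  obtain Q1 Q2 where Q: "continuous_on \<Omega> Q1" "continuous_on \<Omega> Q2"
    "AE w in lborel. w \<in> \<Omega> \<longrightarrow> Q1 w = q1 w" "AE w in lborel. w \<in> \<Omega> \<longrightarrow> Q2 w = q2 w"
    using wdz_pair_continuous[OF assms(1) w1 w2, of "B * B"] gle B by auto
  show ?thesis
  proof (intro exI conjI)
    show "continuous_on \<Omega> (\<lambda>z. (Q1 z + cnj (Q2 z)) / 2)" "continuous_on \<Omega> (\<lambda>z. (cnj (Q2 z) - Q1 z) / (2 * \<i>))"
      by (intro continuous_intros Q; simp)+
    show "AE z in lborel. z \<in> \<Omega> \<longrightarrow> (Q1 z + cnj (Q2 z)) / 2 = Ux z"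
      using Q(3,4) by eventually_elim (simp add: Uq)
    show "AE z in lborel. z \<in> \<Omega> \<longrightarrow> (cnj (Q2 z) - Q1 z) / (2 * \<i>) = Uy z"
      using Q(3,4) by eventually_elim (simp add: Uq)
  qed
qed

lemma cont_AE_le:
  fixes g :: "complex \<Rightarrow> real"
  assumes "open S" "continuous_on S g" "AE z in lborel. z \<in> S \<longrightarrow> g z \<le> C" "z \<in> S"
  shows "g z \<le> C"
proof -
  have "complex_of_real (max 0 (g z - C)) = 0"
  proof (rule AE_cont_zero[OF assms(1) _ _ assms(4)])
    show "continuous_on S (\<lambda>z. complex_of_real (max 0 (g z - C)))" by (intro continuous_intros assms(2))
    show "AE z in lborel. z \<in> S \<longrightarrow> complex_of_real (max 0 (g z - C)) = 0"
      using assms(3) by (rule eventually_mono) auto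
  qed
  then show ?thesis by (simp add: max_def split: if_splits)
qed

section \<open>Borel representatives vanishing off the domain\<close>

definition rep :: "complex set \<Rightarrow> (complex \<Rightarrow> complex) \<Rightarrow> (complex \<Rightarrow> complex) \<Rightarrow> bool"
  where "rep \<Omega> G g \<longleftrightarrow> g \<in> borel_measurable borel \<and> (\<forall>z. z \<notin> \<Omega> \<longrightarrow> g z = 0) \<and>
    G \<in> borel_measurable (lebesgue_on \<Omega>) \<and> (AE z in lborel. z \<in> \<Omega> \<longrightarrow> g z = G z)"

lemma AE_lebesgue_on_open:
  fixes \<Omega> :: "complex set"
  assumes "open \<Omega>"
  shows "(AE z in lebesgue_on \<Omega>. P z) \<longleftrightarrow> (AE z in lborel. z \<in> \<Omega> \<longrightarrow> P z)"
  using assms by (subst AE_restrict_space_iff) (auto simp: AE_completion_iff)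

lemma repD:
  assumes "rep \<Omega> G g"
  shows "g \<in> borel_measurable borel" "z \<notin> \<Omega> \<Longrightarrow> g z = 0" "G \<in> borel_measurable (lebesgue_on \<Omega>)"
    "AE z in lborel. z \<in> \<Omega> \<longrightarrow> g z = G z"
  using assms by (auto simp: rep_def)

text \<open>Every Lebesgue measurable real function agrees almost everywhere with a Borel one; this
  is applied to real and imaginary parts after extension by 0.\<close>

lemma rep_ex:
  assumes "open \<Omega>" "G \<in> borel_measurable (lebesgue_on \<Omega>)" shows "\<exists>g. rep \<Omega> G g"
proof -
  have Om: "\<Omega> \<in> sets borel" using assms(1) by simp
  have m: "(\<lambda>z. indicator \<Omega> z *\<^sub>R G z) \<in> borel_measurable lebesgue"
    using assms by (subst (asm) borel_measurable_restrict_space_iff) auto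
  have "(\<lambda>z. Re (indicator \<Omega> z *\<^sub>R G z)) \<in> borel_measurable (completion lborel)" "(\<lambda>z. Im (indicator \<Omega> z *\<^sub>R G z)) \<in> borel_measurable (completion lborel)"
    using m by measurable
  from this[THEN completion_ex_borel_measurable_real]
  obtain a b where a: "a \<in> borel_measurable lborel" "AE z in lborel. Re (indicator \<Omega> z *\<^sub>R G z) = a z"
    and b: "b \<in> borel_measurable lborel" "AE z in lborel. Im (indicator \<Omega> z *\<^sub>R G z) = b z" by blast
  note [measurable] = a(1)[simplified] b(1)[simplified] Om
  show ?thesis
  proof (intro exI[of _ "\<lambda>z. indicator \<Omega> z * (of_real (a z) + \<i> * of_real (b z))"], unfold rep_def, intro conjI allI impI assms(2))
    show "(\<lambda>z. indicator \<Omega> z * (of_real (a z) + \<i> * of_real (b z))) \<in> borel_measurable borel" by measurable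
    show "AE z in lborel. z \<in> \<Omega> \<longrightarrow> indicator \<Omega> z * (of_real (a z) + \<i> * of_real (b z)) = G z"
      using a(2) b(2) by eventually_elim (auto simp: complex_eq_iff)
  qed auto
qed

lemma rep_integral:
  assumes "open \<Omega>" and r: "rep \<Omega> G g"
  shows "(\<integral>z. G z \<partial>lebesgue_on \<Omega>) = (\<integral>z. g z \<partial>lborel)" "integrable (lebesgue_on \<Omega>) G \<longleftrightarrow> integrable lborel g"
proof -
  note d = repD[OF r]
  have Om: "\<Omega> \<inter> space lebesgue \<in> sets lebesgue" using assms(1) by auto
  have m: "(\<lambda>z. indicator \<Omega> z *\<^sub>R G z) \<in> borel_measurable lebesgue"
    using d(3) Om by (subst (asm) borel_measurable_restrict_space_iff) auto
  have gm: "g \<in> borel_measurable lebesgue" using d(1) by (intro measurable_completion) simp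
  have "AE z in lborel. indicator \<Omega> z *\<^sub>R G z = g z"
    using d(4) by eventually_elim (use d(2) in \<open>auto simp: indicator_def\<close>)
  then have ae: "AE z in lebesgue. indicator \<Omega> z *\<^sub>R G z = g z" by (rule AE_completion)
  have "(\<integral>z. G z \<partial>lebesgue_on \<Omega>) = (\<integral>z. indicator \<Omega> z *\<^sub>R G z \<partial>lebesgue)" by (rule integral_restrict_space[OF Om])
  also have "\<dots> = (\<integral>z. g z \<partial>lebesgue)" by (rule integral_cong_AE[OF m gm ae])
  also have "\<dots> = (\<integral>z. g z \<partial>lborel)" using d(1) by (intro integral_completion) simp
  finally show "(\<integral>z. G z \<partial>lebesgue_on \<Omega>) = (\<integral>z. g z \<partial>lborel)" .
  have "integrable (lebesgue_on \<Omega>) G \<longleftrightarrow> integrable lebesgue (\<lambda>z. indicator \<Omega> z *\<^sub>R G z)" by (rule integrable_restrict_space[OF Om])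
  also have "\<dots> \<longleftrightarrow> integrable lebesgue g" by (rule integrable_cong_AE[OF m gm ae])
  also have "\<dots> \<longleftrightarrow> integrable lborel g" using d(1) by (intro integrable_completion) simp
  finally show "integrable (lebesgue_on \<Omega>) G \<longleftrightarrow> integrable lborel g" .
qed

lemma rep_L1loc:
  assumes "open \<Omega>" and r: "rep \<Omega> G g"
  shows "G \<in> L1loc \<Omega> \<longleftrightarrow> locint \<Omega> g"
proof -
  note d = repD[OF r]
  have eq: "integrable (lebesgue_on K) G \<longleftrightarrow> integrable lborel (\<lambda>z. indicator K z * g z)" if K: "compact K" "K \<subseteq> \<Omega>" for K
  proof -
    have Kb: "K \<in> sets borel" using K by (simp add: compact_imp_closed borel_closed)
    have KL: "K \<inter> space lebesgue \<in> sets lebesgue" using Kb by auto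
    have Om: "\<Omega> \<inter> space lebesgue \<in> sets lebesgue" using assms(1) by auto
    have "(\<lambda>z. indicator \<Omega> z *\<^sub>R G z) \<in> borel_measurable lebesgue"
      using d(3) Om by (subst (asm) borel_measurable_restrict_space_iff) auto
    moreover have ik: "(\<lambda>z. indicator K z :: real) \<in> borel_measurable lebesgue" using KL by auto
    ultimately have "(\<lambda>z. indicator K z *\<^sub>R (indicator \<Omega> z *\<^sub>R G z)) \<in> borel_measurable lebesgue"
      by (intro borel_measurable_scaleR[OF ik])
    moreover have "indicator K z *\<^sub>R (indicator \<Omega> z *\<^sub>R G z) = indicator K z *\<^sub>R G z" for z
      using K(2) by (auto simp: indicator_def)
    ultimately have m: "(\<lambda>z. indicator K z *\<^sub>R G z) \<in> borel_measurable lebesgue" by (simp only:)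
    have gb: "(\<lambda>z. indicator K z * g z) \<in> borel_measurable borel" using d(1) Kb by simp
    then have gm: "(\<lambda>z. indicator K z * g z) \<in> borel_measurable lebesgue" by (intro measurable_completion) simp
    have "AE z in lborel. indicator K z *\<^sub>R G z = indicator K z * g z"
      using d(4) by eventually_elim (use K(2) in \<open>auto simp: indicator_def\<close>)
    then have ae: "AE z in lebesgue. indicator K z *\<^sub>R G z = indicator K z * g z" by (rule AE_completion)
    have "integrable (lebesgue_on K) G \<longleftrightarrow> integrable lebesgue (\<lambda>z. indicator K z *\<^sub>R G z)" by (rule integrable_restrict_space[OF KL])
    also have "\<dots> \<longleftrightarrow> integrable lebesgue (\<lambda>z. indicator K z * g z)" by (rule integrable_cong_AE[OF m gm ae])
    also have "\<dots> \<longleftrightarrow> integrable lborel (\<lambda>z. indicator K z * g z)" using gb by (intro integrable_completion) simp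
    finally show ?thesis .
  qed
  show ?thesis using eq d(1,3) by (auto simp: L1loc_def locint_def)
qed

lemma rep_mult:
  assumes "rep \<Omega> G g" "rep \<Omega> H h" shows "rep \<Omega> (\<lambda>z. G z * H z) (\<lambda>z. g z * h z)"
  unfolding rep_def
proof (intro conjI allI impI)
  note d = repD[OF assms(1)] repD[OF assms(2)]
  show "AE z in lborel. z \<in> \<Omega> \<longrightarrow> g z * h z = G z * H z"
    using d(4,8) by eventually_elim auto
qed (use repD[OF assms(1)] repD[OF assms(2)] in auto)

lemma rep_add:
  assumes "rep \<Omega> G g" "rep \<Omega> H h" shows "rep \<Omega> (\<lambda>z. G z + H z) (\<lambda>z. g z + h z)"
  unfolding rep_def
proof (intro conjI allI impI)
  note d = repD[OF assms(1)] repD[OF assms(2)]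
  show "AE z in lborel. z \<in> \<Omega> \<longrightarrow> g z + h z = G z + H z"
    using d(4,8) by eventually_elim auto
qed (use repD[OF assms(1)] repD[OF assms(2)] in auto)

lemma rep_diff:
  assumes "rep \<Omega> G g" "rep \<Omega> H h" shows "rep \<Omega> (\<lambda>z. G z - H z) (\<lambda>z. g z - h z)"
  unfolding rep_def
proof (intro conjI allI impI)
  note d = repD[OF assms(1)] repD[OF assms(2)]
  show "AE z in lborel. z \<in> \<Omega> \<longrightarrow> g z - h z = G z - H z"
    using d(4,8) by eventually_elim auto
qed (use repD[OF assms(1)] repD[OF assms(2)] in auto)

lemma rep_cmult:
  assumes "rep \<Omega> G g" shows "rep \<Omega> (\<lambda>z. c * G z) (\<lambda>z. c * g z)"
  unfolding rep_def
proof (intro conjI allI impI)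
  show "AE z in lborel. z \<in> \<Omega> \<longrightarrow> c * g z = c * G z"
    using repD(4)[OF assms] by eventually_elim auto
qed (use repD[OF assms] in auto)

text \<open>The reciprocal of a function vanishing off \<Omega> again vanishes there, by the
  convention for division by 0, so the class of representatives is closed under reciprocals.\<close>

lemma rep_inverse:
  assumes "rep \<Omega> G g" shows "rep \<Omega> (\<lambda>z. 1 / G z) (\<lambda>z. 1 / g z)"
  unfolding rep_def
proof (intro conjI allI impI)
  show "AE z in lborel. z \<in> \<Omega> \<longrightarrow> 1 / g z = 1 / G z"
    using repD(4)[OF assms] by eventually_elim auto
qed (use repD[OF assms] in auto)

lemma rep_cong:
  assumes "rep \<Omega> G g" "g' \<in> borel_measurable borel" "\<And>z. z \<notin> \<Omega> \<Longrightarrow> g' z = 0" "AE z in lborel. z \<in> \<Omega> \<longrightarrow> g' z = g z"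
  shows "rep \<Omega> G g'"
  unfolding rep_def
proof (intro conjI allI impI)
  show "AE z in lborel. z \<in> \<Omega> \<longrightarrow> g' z = G z"
    using repD(4)[OF assms(1)] assms(4) by eventually_elim auto
qed (use repD[OF assms(1)] assms in auto)

lemma rep_mult_test:
  assumes "rep \<Omega> G g" "\<phi> \<in> test_fun \<Omega>" shows "rep \<Omega> (\<lambda>z. G z * \<phi> z) (\<lambda>z. g z * \<phi> z)"
  unfolding rep_def
proof (intro conjI allI impI)
  have b: "\<phi> \<in> borel_measurable borel" by (rule smooth_borel[OF test_fun_smooth[OF assms(2)]])
  then have "\<phi> \<in> borel_measurable lebesgue" by (intro measurable_completion) simp
  then have "\<phi> \<in> borel_measurable (lebesgue_on \<Omega>)" by (rule measurable_restrict_space1)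
  then show "(\<lambda>z. G z * \<phi> z) \<in> borel_measurable (lebesgue_on \<Omega>)" using repD(3)[OF assms(1)] by simp
  show "(\<lambda>z. g z * \<phi> z) \<in> borel_measurable borel" using repD(1)[OF assms(1)] b by simp
  show "AE z in lborel. z \<in> \<Omega> \<longrightarrow> g z * \<phi> z = G z * \<phi> z"
    using repD(4)[OF assms(1)] by eventually_elim auto
qed (use repD(2)[OF assms(1)] in auto)

lemma rep_continuous:
  assumes "open \<Omega>" "continuous_on \<Omega> G"
  shows "rep \<Omega> G (\<lambda>z. if z \<in> \<Omega> then G z else 0)"
  unfolding rep_def
proof (intro conjI allI impI)
  show b: "(\<lambda>z. if z \<in> \<Omega> then G z else 0) \<in> borel_measurable borel" by (rule continuous_on_open_borel[OF assms])
  have "(\<lambda>z. indicator \<Omega> z *\<^sub>R G z) = (\<lambda>z. if z \<in> \<Omega> then G z else 0)" by (auto simp: indicator_def)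
  then have "(\<lambda>z. indicator \<Omega> z *\<^sub>R G z) \<in> borel_measurable lebesgue" using b by (intro measurable_completion) simp
  then show "G \<in> borel_measurable (lebesgue_on \<Omega>)"
    using assms(1) by (subst borel_measurable_restrict_space_iff) auto
qed auto

lemma rep_weak_pd:
  assumes "open \<Omega>" "rep \<Omega> G g" "rep \<Omega> H h"
  shows "weak_pd (pd e) \<Omega> G H \<longleftrightarrow> wd e \<Omega> g h"
proof -
  have "(\<integral>z. G z * pd e \<phi> z \<partial>lebesgue_on \<Omega>) = (\<integral>z. g z * pd e \<phi> z \<partial>lborel)"
    "(\<integral>z. H z * \<phi> z \<partial>lebesgue_on \<Omega>) = (\<integral>z. h z * \<phi> z \<partial>lborel)" if "\<phi> \<in> test_fun \<Omega>" for \<phi>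
    using rep_integral(1)[OF assms(1) rep_mult_test[OF assms(2) test_fun_pd[OF that]]]
      rep_integral(1)[OF assms(1) rep_mult_test[OF assms(3) that]] by auto
  then show ?thesis unfolding weak_pd_def wd_def
    using rep_L1loc[OF assms(1,2)] rep_L1loc[OF assms(1,3)] by simp
qed

lemma rep_Lp:
  assumes "open \<Omega>" "rep \<Omega> G g" "1 < p" "p < \<infinity>"
  shows "G \<in> Lp p \<Omega> \<longleftrightarrow> integrable lborel (\<lambda>z. cmod (g z) powr enn2real p)"
proof -
  note d = repD[OF assms(2)]
  have q: "enn2real p > 0" using assms(3,4) by (metis enn2real_positive_iff infinity_ennreal_def less_trans zero_less_one)
  have "rep \<Omega> (\<lambda>z. of_real (cmod (G z) powr enn2real p)) (\<lambda>z. of_real (cmod (g z) powr enn2real p))"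
    unfolding rep_def
  proof (intro conjI allI impI)
    show "AE z in lborel. z \<in> \<Omega> \<longrightarrow> complex_of_real (cmod (g z) powr enn2real p) = of_real (cmod (G z) powr enn2real p)"
      using d(4) by eventually_elim auto
  qed (use d q in auto)
  from rep_integral(2)[OF assms(1) this]
  have "integrable (lebesgue_on \<Omega>) (\<lambda>z. cmod (G z) powr enn2real p) \<longleftrightarrow> integrable lborel (\<lambda>z. cmod (g z) powr enn2real p)"
    by (simp add: complex_of_real_integrable_eq)
  then show ?thesis using d(3) assms(4) by (auto simp: Lp_def)
qed

text \<open>Resetting the representative to 0 where it exceeds the essential bound changes only a
  null set and yields a bound at every point, the form in which the product rules and approximations
  take their hypotheses.\<close>

lemma rep_Linf_bdd:
  assumes "open \<Omega>" "G \<in> Lp \<infinity> \<Omega>"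
  shows "\<exists>g B. rep \<Omega> G g \<and> B \<ge> 0 \<and> (\<forall>z. cmod (g z) \<le> B)"
proof -
  have m: "G \<in> borel_measurable (lebesgue_on \<Omega>)" and "\<exists>C. AE z in lebesgue_on \<Omega>. cmod (G z) \<le> C"
    using assms(2) by (auto simp: Lp_def)
  then obtain C where C: "AE z in lborel. z \<in> \<Omega> \<longrightarrow> cmod (G z) \<le> C"
    unfolding AE_lebesgue_on_open[OF assms(1)] by blast
  obtain g where g: "rep \<Omega> G g" using rep_ex[OF assms(1) m] by blast
  note d = repD[OF g]
  note [measurable] = d(1)
  have "rep \<Omega> G (\<lambda>z. if cmod (g z) \<le> \<bar>C\<bar> then g z else 0)"
  proof (rule rep_cong[OF g])
    show "AE z in lborel. z \<in> \<Omega> \<longrightarrow> (if cmod (g z) \<le> \<bar>C\<bar> then g z else 0) = g z"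
      using d(4) C by eventually_elim auto
  qed (use d(2) in auto)
  then show ?thesis by (intro exI[of _ "\<lambda>z. if cmod (g z) \<le> \<bar>C\<bar> then g z else 0"] exI[of _ "\<bar>C\<bar>"]) auto
qed

lemma Lq_mult_bdd:
  assumes "integrable lborel (\<lambda>z. cmod (g z) powr q)" "g \<in> borel_measurable borel" "b \<in> borel_measurable borel" "q \<ge> 0"
    "\<And>z. cmod (b z) \<le> B"
  shows "integrable lborel (\<lambda>z::complex. cmod (b z * g z :: complex) powr q)"
proof (rule Bochner_Integration.integrable_bound)
  show "integrable lborel (\<lambda>z. B powr q * cmod (g z) powr q)" using assms(1) by simp
  have "B \<ge> 0" using assms(5) norm_ge_zero order_trans by blast
  have "cmod (b z * g z) powr q \<le> B powr q * cmod (g z) powr q" for z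
  proof -
    have "cmod (b z * g z) powr q \<le> (B * cmod (g z)) powr q"
      unfolding norm_mult using assms by (intro powr_mono2 mult_right_mono) auto
    then show ?thesis using \<open>B \<ge> 0\<close> by (simp add: powr_mult)
  qed
  then show "AE z in lborel. norm (cmod (b z * g z) powr q) \<le> norm (B powr q * cmod (g z) powr q)" by simp
qed (use assms in measurable)

lemma Lq_add:
  fixes g h :: "complex \<Rightarrow> complex"
  assumes "integrable lborel (\<lambda>z. cmod (g z) powr q)" "integrable lborel (\<lambda>z. cmod (h z) powr q)"
    "g \<in> borel_measurable borel" "h \<in> borel_measurable borel" "q \<ge> 0"
  shows "integrable lborel (\<lambda>z. cmod (g z + h z) powr q)"
proof (rule Bochner_Integration.integrable_bound)
  show "integrable lborel (\<lambda>z. 2 powr q * (cmod (g z) powr q + cmod (h z) powr q))" using assms by simp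
  have "cmod (g z + h z) powr q \<le> 2 powr q * (cmod (g z) powr q + cmod (h z) powr q)" for z
    using assms(5) by (intro order_trans[OF powr_mono2[OF _ _ norm_triangle_ineq] powr_add_le]) auto
  then show "AE z in lborel. norm (cmod (g z + h z) powr q) \<le> norm (2 powr q * (cmod (g z) powr q + cmod (h z) powr q))" by simp
qed (use assms in measurable)

lemma Lq_cong:
  fixes g h :: "complex \<Rightarrow> complex"
  assumes "integrable lborel (\<lambda>z. cmod (g z) powr q)" "g \<in> borel_measurable borel" "h \<in> borel_measurable borel"
    "\<And>z. z \<notin> \<Omega> \<Longrightarrow> g z = 0" "\<And>z. z \<notin> \<Omega> \<Longrightarrow> h z = 0" "AE z in lborel. z \<in> \<Omega> \<longrightarrow> g z = h z"
  shows "integrable lborel (\<lambda>z. cmod (h z) powr q)"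
proof (rule integrable_cong_AE_imp[OF assms(1)])
  show "AE z in lborel. cmod (g z) powr q = cmod (h z) powr q"
    using assms(6) by eventually_elim (use assms(4,5) in auto)
qed (use assms in measurable)

lemma rep_self:
  assumes "h \<in> borel_measurable borel" "\<And>z. z \<notin> \<Omega> \<Longrightarrow> h z = 0"
  shows "rep \<Omega> h h"
  unfolding rep_def
proof (intro conjI allI impI)
  have "h \<in> borel_measurable lebesgue" using assms by (intro measurable_completion) simp
  then show "h \<in> borel_measurable (lebesgue_on \<Omega>)" by (rule measurable_restrict_space1)
qed (use assms in auto)

lemma W1I:
  assumes "open \<Omega>" and r: "rep \<Omega> G g" and p: "1 < p" "p < \<infinity>"
    and w: "wd 1 \<Omega> g gx" "wd \<i> \<Omega> g gy" and z: "\<And>z. z \<notin> \<Omega> \<Longrightarrow> gx z = 0" "\<And>z. z \<notin> \<Omega> \<Longrightarrow> gy z = 0"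
    and L: "integrable lborel (\<lambda>z. cmod (g z) powr enn2real p)" "integrable lborel (\<lambda>z. cmod (gx z) powr enn2real p)" "integrable lborel (\<lambda>z. cmod (gy z) powr enn2real p)"
  shows "G \<in> W1 p \<Omega>"
proof -
  have rx: "rep \<Omega> gx gx" "rep \<Omega> gy gy"
    using rep_self locint_measurable[OF wdD(2)[OF w(1)]] locint_measurable[OF wdD(2)[OF w(2)]] z by auto
  show ?thesis unfolding W1_def
    using rep_Lp[OF assms(1) r p] rep_Lp[OF assms(1) rx(1) p] rep_Lp[OF assms(1) rx(2) p] L
      rep_weak_pd[OF assms(1) r rx(1), of 1] rep_weak_pd[OF assms(1) r rx(2), of \<i>] w
    by (auto simp: pdx_eq_pd pdy_eq_pd)
qed

text \<open>By uniqueness of weak derivatives, whichever function the choice operator picks has the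
  same Borel representative. This gives access to \<open>wdx\<close> and \<open>wdy\<close>.\<close>

lemma rep_some_weak_pd:
  assumes "open \<Omega>" and g: "rep \<Omega> G g" and w: "wd e \<Omega> g ge" "weak_pd (pd e) \<Omega> G he" and r: "rep \<Omega> he ge"
  shows "rep \<Omega> (SOME h. weak_pd (pd e) \<Omega> G h) ge"
proof -
  define s where "s = (SOME h. weak_pd (pd e) \<Omega> G h)"
  have s: "weak_pd (pd e) \<Omega> G s" unfolding s_def using w(2) by (rule someI[where P = "weak_pd (pd e) \<Omega> G"])
  then have "s \<in> borel_measurable (lebesgue_on \<Omega>)" by (simp add: weak_pd_def L1loc_def)
  then obtain k where k: "rep \<Omega> s k" using rep_ex[OF assms(1)] by blast
  have "wd e \<Omega> g k" using rep_weak_pd[OF assms(1) g k] s by simp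
  from rep_cong[OF k repD(1)[OF r] repD(2)[OF r] wd_unique[OF assms(1) w(1) this]] show ?thesis
    unfolding s_def .
qed

lemma W1_Linf_rep:
  assumes "open \<Omega>" "G \<in> W1 \<infinity> \<Omega>"
  shows "\<exists>g gx gy B. rep \<Omega> G g \<and> rep \<Omega> (wdx \<Omega> G) gx \<and> rep \<Omega> (wdy \<Omega> G) gy \<and> wd 1 \<Omega> g gx \<and> wd \<i> \<Omega> g gy \<and>
    (\<forall>z. cmod (g z) \<le> B \<and> cmod (gx z) \<le> B \<and> cmod (gy z) \<le> B)"
proof -
  obtain hx hy where h: "G \<in> Lp \<infinity> \<Omega>" "hx \<in> Lp \<infinity> \<Omega>" "weak_pd (pd 1) \<Omega> G hx" "hy \<in> Lp \<infinity> \<Omega>" "weak_pd (pd \<i>) \<Omega> G hy"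
    using assms(2) by (auto simp: W1_def pdx_eq_pd pdy_eq_pd)
  obtain g B0 where g: "rep \<Omega> G g" "\<And>z. cmod (g z) \<le> B0" using rep_Linf_bdd[OF assms(1) h(1)] by blast
  obtain gx B1 where gx: "rep \<Omega> hx gx" "\<And>z. cmod (gx z) \<le> B1" using rep_Linf_bdd[OF assms(1) h(2)] by blast
  obtain gy B2 where gy: "rep \<Omega> hy gy" "\<And>z. cmod (gy z) \<le> B2" using rep_Linf_bdd[OF assms(1) h(4)] by blast
  have w: "wd 1 \<Omega> g gx" "wd \<i> \<Omega> g gy"
    using rep_weak_pd[OF assms(1) g(1) gx(1)] rep_weak_pd[OF assms(1) g(1) gy(1)] h by auto
  note s = rep_some_weak_pd[OF assms(1) g(1)]
  show ?thesis
    using g(1) s[OF w(1) h(3) gx(1)] s[OF w(2) h(5) gy(1)] w g(2) gx(2) gy(2)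
    unfolding wdx_def wdy_def pdx_eq_pd pdy_eq_pd
    by (intro exI[of _ g] exI[of _ gx] exI[of _ gy] exI[of _ "max B0 (max B1 B2)"])
       (auto simp: le_max_iff_disj)
qed

lemma W1_Lp_rep:
  assumes "open \<Omega>" "G \<in> W1 p \<Omega>" and p: "1 < p" "p < \<infinity>" and g: "rep \<Omega> G g"
  shows "\<exists>gx gy. rep \<Omega> (wdx \<Omega> G) gx \<and> rep \<Omega> (wdy \<Omega> G) gy \<and> wd 1 \<Omega> g gx \<and> wd \<i> \<Omega> g gy \<and>
    integrable lborel (\<lambda>z. cmod (g z) powr enn2real p) \<and> integrable lborel (\<lambda>z. cmod (gx z) powr enn2real p) \<and>
    integrable lborel (\<lambda>z. cmod (gy z) powr enn2real p)"
proof -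
  obtain hx hy where h: "G \<in> Lp p \<Omega>" "hx \<in> Lp p \<Omega>" "weak_pd (pd 1) \<Omega> G hx" "hy \<in> Lp p \<Omega>" "weak_pd (pd \<i>) \<Omega> G hy"
    using assms(2) by (auto simp: W1_def pdx_eq_pd pdy_eq_pd)
  have hm: "hx \<in> borel_measurable (lebesgue_on \<Omega>)" "hy \<in> borel_measurable (lebesgue_on \<Omega>)" using h(2,4) by (auto simp: Lp_def)
  obtain gx where gx: "rep \<Omega> hx gx" using rep_ex[OF assms(1) hm(1)] by blast
  obtain gy where gy: "rep \<Omega> hy gy" using rep_ex[OF assms(1) hm(2)] by blast
  have w: "wd 1 \<Omega> g gx" "wd \<i> \<Omega> g gy"
    using rep_weak_pd[OF assms(1) g gx] rep_weak_pd[OF assms(1) g gy] h by auto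
  note s = rep_some_weak_pd[OF assms(1) g(1)]
  show ?thesis
    using s[OF w(1) h(3) gx(1)] s[OF w(2) h(5) gy(1)] w
      rep_Lp[OF assms(1) g p] rep_Lp[OF assms(1) gx p] rep_Lp[OF assms(1) gy p] h
    unfolding wdx_def wdy_def pdx_eq_pd pdy_eq_pd by blast
qed

section \<open>Weak solutions of the Vekua equation\<close>

lemma rep_cong_fun:
  assumes "rep \<Omega> G g" "\<And>z. z \<in> \<Omega> \<Longrightarrow> G' z = G z"
  shows "rep \<Omega> G' g"
  unfolding rep_def
proof (intro conjI allI impI)
  have "G' \<in> borel_measurable (lebesgue_on \<Omega>) \<longleftrightarrow> G \<in> borel_measurable (lebesgue_on \<Omega>)"
    by (rule measurable_cong) (use assms(2) in auto)
  then show "G' \<in> borel_measurable (lebesgue_on \<Omega>)" using repD(3)[OF assms(1)] by blast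
  show "AE z in lborel. z \<in> \<Omega> \<longrightarrow> g z = G' z"
    using repD(4)[OF assms(1)] by (rule eventually_mono) (use assms(2) in auto)
qed (use repD[OF assms(1)] in auto)

lemma integral_mult_test_zero:
  assumes "AE z in lborel. z \<in> \<Omega> \<longrightarrow> E z = 0" "E \<in> borel_measurable borel" "\<phi> \<in> test_fun \<Omega>"
  shows "(\<integral>z. E z * \<phi> z \<partial>lborel) = 0"
proof -
  have [measurable]: "\<phi> \<in> borel_measurable borel" by (rule smooth_borel[OF test_fun_smooth[OF assms(3)]])
  have "(\<integral>z. E z * \<phi> z \<partial>lborel) = (\<integral>z. 0 \<partial>(lborel :: complex measure))"
  proof (rule integral_cong_AE)
    show "AE z in lborel. E z * \<phi> z = 0"
      using assms(1) by (rule eventually_mono) (use test_fun_zero[OF assms(3)] in auto)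
  qed (use assms(2) in measurable)
  then show ?thesis by simp
qed

lemma wd_diff:
  assumes "wd e \<Omega> g g'" "wd e \<Omega> h h'"
  shows "wd e \<Omega> (\<lambda>z. g z - h z) (\<lambda>z. g' z - h' z)"
  unfolding wd_def
proof (intro conjI ballI locint_diff wdD(1)[OF assms(1)] wdD(2)[OF assms(1)] wdD(1)[OF assms(2)] wdD(2)[OF assms(2)])
  fix \<phi> assume \<phi>: "\<phi> \<in> test_fun \<Omega>"
  show "(\<integral>z. (g z - h z) * pd e \<phi> z \<partial>lborel) = - (\<integral>z. (g' z - h' z) * \<phi> z \<partial>lborel)"
    using wdD(3)[OF assms(1) \<phi>] wdD(3)[OF assms(2) \<phi>]
      locint_mult_test[OF wdD(1)[OF assms(1)] test_fun_pd[OF \<phi>]] locint_mult_test[OF wdD(1)[OF assms(2)] test_fun_pd[OF \<phi>]]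
      locint_mult_test[OF wdD(2)[OF assms(1)] \<phi>] locint_mult_test[OF wdD(2)[OF assms(2)] \<phi>]
    by (simp add: left_diff_distrib)
qed

lemma C1_wd_patch:
  assumes "open \<Omega>" "Ck_on (Suc 0) \<Omega> g" "e \<in> {1, \<i>}"
  shows "wd e \<Omega> (\<lambda>z. if z \<in> \<Omega> then g z else 0) (\<lambda>z. if z \<in> \<Omega> then pd e g z else 0)"
proof -
  have c: "continuous_on \<Omega> g" "continuous_on \<Omega> (pd e g)"
    using Ck_on_imp_continuous[OF assms(2)] assms(2,3) unfolding Ck_Suc by auto
  have l: "locint \<Omega> (\<lambda>z. if z \<in> \<Omega> then h z else 0)" if "continuous_on \<Omega> h" for h :: "complex \<Rightarrow> complex"
    by (rule locint_continuous[OF _ continuous_on_open_borel[OF assms(1) that]])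
       (use that in \<open>simp cong: continuous_on_cong_simp\<close>)
  show ?thesis unfolding wd_def
  proof (intro conjI ballI l c)
    fix \<phi> assume \<phi>: "\<phi> \<in> test_fun \<Omega>"
    have "(\<integral>z. (if z \<in> \<Omega> then g z else 0) * pd e \<phi> z \<partial>lborel) = (\<integral>z. g z * pd e \<phi> z \<partial>lborel)"
      by (intro Bochner_Integration.integral_cong refl) (use test_fun_zero[OF test_fun_pd[OF \<phi>]] in auto)
    also have "\<dots> = - (\<integral>z. pd e g z * \<phi> z \<partial>lborel)" by (rule C1_by_parts[OF assms(1,2) \<phi> assms(3)])
    also have "(\<integral>z. pd e g z * \<phi> z \<partial>lborel) = (\<integral>z. (if z \<in> \<Omega> then pd e g z else 0) * \<phi> z \<partial>lborel)"
      by (intro Bochner_Integration.integral_cong refl) (use test_fun_zero[OF \<phi>] in auto)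
    finally show "(\<integral>z. (if z \<in> \<Omega> then g z else 0) * pd e \<phi> z \<partial>lborel) = - (\<integral>z. (if z \<in> \<Omega> then pd e g z else 0) * \<phi> z \<partial>lborel)" .
  qed
qed

lemma Ck_on_1I:
  assumes "\<And>z. z \<in> \<Omega> \<Longrightarrow> (V has_derivative (\<lambda>h. of_real (Re h) * P z + of_real (Im h) * Q z)) (at z)"
    "continuous_on \<Omega> P" "continuous_on \<Omega> Q"
  shows "Ck_on (Suc 0) \<Omega> V" "z \<in> \<Omega> \<Longrightarrow> pd 1 V z = P z" "z \<in> \<Omega> \<Longrightarrow> pd \<i> V z = Q z"
proof -
  have p: "pd 1 V z = P z" "pd \<i> V z = Q z" if "z \<in> \<Omega>" for z
    using pd_eqI[OF assms(1)[OF that], of 1] pd_eqI[OF assms(1)[OF that], of \<i>] by auto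
  then show "z \<in> \<Omega> \<Longrightarrow> pd 1 V z = P z" "z \<in> \<Omega> \<Longrightarrow> pd \<i> V z = Q z" by auto
  have "continuous_on \<Omega> (pd 1 V)" "continuous_on \<Omega> (pd \<i> V)"
    using assms(2,3) p by (auto cong: continuous_on_cong)
  moreover have "\<forall>z\<in>\<Omega>. V differentiable (at z)" using assms(1) differentiable_def by blast
  ultimately show "Ck_on (Suc 0) \<Omega> V" unfolding Ck_Suc by simp
qed

text \<open>Expanding a bicomplex pairing gives two scalar identities, each mixing both components
  of the test function. Purely scalar test functions decouple them, so that E1 and E2 vanish by the
  fundamental lemma. The factor 2 compensates the 1/2 in \<open>dbar\<close>.\<close>

lemma weak_dbar_iff:
  assumes "open \<Omega>" and r: "rep \<Omega> u ub" "rep \<Omega> v vb" "rep \<Omega> (\<lambda>z. Sc (V z)) S" "rep \<Omega> (\<lambda>z. Vec (V z)) N"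
    and wu: "wd 1 \<Omega> ub ux" "wd \<i> \<Omega> ub uy" and wv: "wd 1 \<Omega> vb vx" "wd \<i> \<Omega> vb vy"
    and l: "locint \<Omega> S" "locint \<Omega> N" and L: "u \<in> Lp p \<Omega>" "v \<in> Lp p \<Omega>"
  shows "weak_dbar p \<Omega> (\<lambda>z. bc (u z) + \<j> * bc (v z)) V \<longleftrightarrow>
    (AE z in lborel. z \<in> \<Omega> \<longrightarrow> ux z - vy z = 2 * S z \<and> uy z + vx z = 2 * N z)"
proof -
  define E1 where "E1 z = ux z - vy z - 2 * S z" for z
  define E2 where "E2 z = uy z + vx z - 2 * N z" for z
  note lw = wdD(2)[OF wu(1)] wdD(2)[OF wu(2)] wdD(2)[OF wv(1)] wdD(2)[OF wv(2)]
  have lE: "locint \<Omega> E1" "locint \<Omega> E2"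
    unfolding E1_def[abs_def] E2_def[abs_def] by (intro locint_diff locint_add locint_cmult lw l)+
  let ?W = "\<lambda>z. bc (u z) + \<j> * bc (v z)"
  \<comment> \<open>The weak derivatives of u and v remove all derivatives from the components of
    \<phi>, after which the terms collect into the two residuals E1 and E2 of the scalar
    system.\<close>
  have pair: "bc_integral \<Omega> (\<lambda>z. ?W z * dbar \<phi> z) = - bc_integral \<Omega> (\<lambda>z. V z * \<phi> z) \<longleftrightarrow>
      (\<integral>z. E1 z * Sc (\<phi> z) \<partial>lborel) = (\<integral>z. E2 z * Vec (\<phi> z) \<partial>lborel) \<and>
      (\<integral>z. E1 z * Vec (\<phi> z) \<partial>lborel) = - (\<integral>z. E2 z * Sc (\<phi> z) \<partial>lborel)"
    if \<phi>: "\<phi> \<in> bc_valued (test_fun \<Omega>)" for \<phi>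
  proof -
    define a where "a z = Sc (\<phi> z)" for z
    define b where "b z = Vec (\<phi> z)" for z
    have ab: "a \<in> test_fun \<Omega>" "b \<in> test_fun \<Omega>" using \<phi> by (auto simp: bc_valued_def a_def[abs_def] b_def[abs_def])
    note pab = test_fun_pd[OF ab(1)] test_fun_pd[OF ab(2)]
    have s1: "Sc (?W z * dbar \<phi> z) = (1/2) * ((u z * pd 1 a z - u z * pd \<i> b z) - (v z * pd 1 b z + v z * pd \<i> a z))"
      "Vec (?W z * dbar \<phi> z) = (1/2) * ((u z * pd 1 b z + u z * pd \<i> a z) + (v z * pd 1 a z - v z * pd \<i> b z))" for z
      by (simp_all add: dbar_def pdx_eq_pd pdy_eq_pd a_def[abs_def] b_def[abs_def] algebra_simps)
    have s2: "Sc (V z * \<phi> z) = Sc (V z) * a z - Vec (V z) * b z" "Vec (V z * \<phi> z) = Sc (V z) * b z + Vec (V z) * a z" for z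
      by (simp_all add: a_def b_def)
    have i1: "(\<integral>z. Sc (?W z * dbar \<phi> z) \<partial>lebesgue_on \<Omega>) = (\<integral>z. (1/2) * ((ub z * pd 1 a z - ub z * pd \<i> b z) - (vb z * pd 1 b z + vb z * pd \<i> a z)) \<partial>lborel)"
      unfolding s1 by (intro rep_integral(1)[OF assms(1)] rep_cmult rep_diff rep_add rep_mult_test r pab)
    have i2: "(\<integral>z. Vec (?W z * dbar \<phi> z) \<partial>lebesgue_on \<Omega>) = (\<integral>z. (1/2) * ((ub z * pd 1 b z + ub z * pd \<i> a z) + (vb z * pd 1 a z - vb z * pd \<i> b z)) \<partial>lborel)"
      unfolding s1 by (intro rep_integral(1)[OF assms(1)] rep_cmult rep_diff rep_add rep_mult_test r pab)
    have i3: "(\<integral>z. Sc (V z * \<phi> z) \<partial>lebesgue_on \<Omega>) = (\<integral>z. S z * a z - N z * b z \<partial>lborel)"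
      unfolding s2 by (intro rep_integral(1)[OF assms(1)] rep_diff rep_mult_test r ab)
    have i4: "(\<integral>z. Vec (V z * \<phi> z) \<partial>lebesgue_on \<Omega>) = (\<integral>z. S z * b z + N z * a z \<partial>lborel)"
      unfolding s2 by (intro rep_integral(1)[OF assms(1)] rep_add rep_mult_test r ab)
    note m = locint_mult_test[OF wdD(1)[OF wu(1)]] locint_mult_test[OF wdD(1)[OF wv(1)]]
    define I where "I h k = (\<integral>z. h z * k z \<partial>lborel)" for h k :: "complex \<Rightarrow> complex"
    have t: "integrable lborel (\<lambda>z. h z * k z)" if "locint \<Omega> h" "k = a \<or> k = b" for h k
      using locint_mult_test[OF that(1)] that(2) ab by auto
    have j1: "(\<integral>z. (1/2) * ((ub z * pd 1 a z - ub z * pd \<i> b z) - (vb z * pd 1 b z + vb z * pd \<i> a z)) \<partial>lborel)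
        = (1/2) * ((- I ux a + I uy b) - (- I vx b - I vy a))"
      unfolding I_def using m pab wdD(3)[OF wu(1)] wdD(3)[OF wu(2)] wdD(3)[OF wv(1)] wdD(3)[OF wv(2)] ab by simp
    have j2: "(\<integral>z. (1/2) * ((ub z * pd 1 b z + ub z * pd \<i> a z) + (vb z * pd 1 a z - vb z * pd \<i> b z)) \<partial>lborel)
        = (1/2) * ((- I ux b - I uy a) + (- I vx a + I vy b))"
      unfolding I_def using m pab wdD(3)[OF wu(1)] wdD(3)[OF wu(2)] wdD(3)[OF wv(1)] wdD(3)[OF wv(2)] ab by simp
    have j3: "(\<integral>z. S z * a z - N z * b z \<partial>lborel) = I S a - I N b" "(\<integral>z. S z * b z + N z * a z \<partial>lborel) = I S b + I N a"
      unfolding I_def using t l by simp_all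
    have e1: "(\<integral>z. E1 z * k z \<partial>lborel) = I ux k - I vy k - 2 * I S k" "(\<integral>z. E2 z * k z \<partial>lborel) = I uy k + I vx k - 2 * I N k"
      if "k = a \<or> k = b" for k
    proof -
      note tt = t[OF lw(1) that] t[OF lw(2) that] t[OF lw(3) that] t[OF lw(4) that] t[OF l(1) that] t[OF l(2) that]
      have "(\<integral>z. E1 z * k z \<partial>lborel) = (\<integral>z. ux z * k z - vy z * k z - 2 * (S z * k z) \<partial>lborel)"
        "(\<integral>z. E2 z * k z \<partial>lborel) = (\<integral>z. uy z * k z + vx z * k z - 2 * (N z * k z) \<partial>lborel)"
        by (simp_all add: E1_def E2_def algebra_simps)
      then show "(\<integral>z. E1 z * k z \<partial>lborel) = I ux k - I vy k - 2 * I S k" "(\<integral>z. E2 z * k z \<partial>lborel) = I uy k + I vx k - 2 * I N k"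
        unfolding I_def using tt by simp_all
    qed
    have half: "(1/2) * x = - y \<longleftrightarrow> x + 2 * y = 0" for x y :: complex
      by (auto simp: field_simps eq_neg_iff_add_eq_0)
    have "bc_integral \<Omega> (\<lambda>z. ?W z * dbar \<phi> z) = - bc_integral \<Omega> (\<lambda>z. V z * \<phi> z) \<longleftrightarrow>
        (1/2) * ((- I ux a + I uy b) - (- I vx b - I vy a)) = - (I S a - I N b) \<and>
        (1/2) * ((- I ux b - I uy a) + (- I vx a + I vy b)) = - (I S b + I N a)"
      unfolding bc_integral_def i1 i2 i3 i4 j1 j2 j3 bicomplex_eq_iff by simp
    also have "\<dots> \<longleftrightarrow> (\<integral>z. E1 z * a z \<partial>lborel) = (\<integral>z. E2 z * b z \<partial>lborel) \<and> (\<integral>z. E1 z * b z \<partial>lborel) = - (\<integral>z. E2 z * a z \<partial>lborel)"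
    proof -
      have "(- ua + ub') - (- vb' - va) + 2 * (sa - nb) = 0 \<longleftrightarrow> ua - va - 2 * sa = ub' + vb' - 2 * nb"
        for ua ub' va vb' sa nb :: complex
      proof -
        have "(- ua + ub') - (- vb' - va) + 2 * (sa - nb) = (ub' + vb' - 2 * nb) - (ua - va - 2 * sa)" by (simp add: algebra_simps)
        then show ?thesis by (simp only: right_minus_eq) (rule eq_commute)
      qed
      moreover have "(- ub' - ua) + (- va + vb') + 2 * (sb + na) = 0 \<longleftrightarrow> ub' - vb' - 2 * sb = - (ua + va - 2 * na)"
        for ua ub' va vb' sb na :: complex
      proof -
        have "(- ub' - ua) + (- va + vb') + 2 * (sb + na) = - (ua + va - 2 * na) - (ub' - vb' - 2 * sb)" by (simp add: algebra_simps)
        then show ?thesis by (simp only: right_minus_eq) (rule eq_commute)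
      qed
      ultimately show ?thesis
        unfolding half e1(1)[of a, simplified] e1(1)[of b, simplified] e1(2)[of a, simplified] e1(2)[of b, simplified] by blast
    qed
    finally show ?thesis by (simp add: a_def b_def)
  qed
  have "V \<in> bc_valued (L1loc \<Omega>)"
    using rep_L1loc[OF assms(1) r(3)] rep_L1loc[OF assms(1) r(4)] l by (simp add: bc_valued_def)
  moreover have "?W \<in> bc_valued (Lp p \<Omega>)" using L by (simp add: bc_valued_def)
  ultimately have "weak_dbar p \<Omega> ?W V \<longleftrightarrow> (\<forall>\<phi>\<in>bc_valued (test_fun \<Omega>).
      (\<integral>z. E1 z * Sc (\<phi> z) \<partial>lborel) = (\<integral>z. E2 z * Vec (\<phi> z) \<partial>lborel) \<and>
      (\<integral>z. E1 z * Vec (\<phi> z) \<partial>lborel) = - (\<integral>z. E2 z * Sc (\<phi> z) \<partial>lborel))"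
    unfolding weak_dbar_def using pair by auto
  also have "\<dots> \<longleftrightarrow> (AE z in lborel. z \<in> \<Omega> \<longrightarrow> E1 z = 0) \<and> (AE z in lborel. z \<in> \<Omega> \<longrightarrow> E2 z = 0)"
  proof (intro iffI conjI ballI; (elim conjE)?)
    assume A: "\<forall>\<phi>\<in>bc_valued (test_fun \<Omega>). (\<integral>z. E1 z * Sc (\<phi> z) \<partial>lborel) = (\<integral>z. E2 z * Vec (\<phi> z) \<partial>lborel) \<and>
      (\<integral>z. E1 z * Vec (\<phi> z) \<partial>lborel) = - (\<integral>z. E2 z * Sc (\<phi> z) \<partial>lborel)"
    have "(\<integral>z. E1 z * a z \<partial>lborel) = 0 \<and> (\<integral>z. E2 z * a z \<partial>lborel) = 0" if "a \<in> test_fun \<Omega>" for a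
    proof -
      \<comment> \<open>With vanishing vector part one identity contains only E1 and the other only
        E2.\<close>
      have "(\<lambda>z. bc (a z)) \<in> bc_valued (test_fun \<Omega>)" using that by (simp add: bc_valued_def test_fun_def del: Ck_on.simps)
      from A[rule_format, OF this] show ?thesis by simp
    qed
    then show "AE z in lborel. z \<in> \<Omega> \<longrightarrow> E1 z = 0" "AE z in lborel. z \<in> \<Omega> \<longrightarrow> E2 z = 0"
      using fundamental_lemma[OF assms(1) lE(1)] fundamental_lemma[OF assms(1) lE(2)] by auto
  next
    fix \<phi> assume A: "AE z in lborel. z \<in> \<Omega> \<longrightarrow> E1 z = 0" "AE z in lborel. z \<in> \<Omega> \<longrightarrow> E2 z = 0" and "\<phi> \<in> bc_valued (test_fun \<Omega>)"
    then have "(\<lambda>z. Sc (\<phi> z)) \<in> test_fun \<Omega>" "(\<lambda>z. Vec (\<phi> z)) \<in> test_fun \<Omega>" by (auto simp: bc_valued_def)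
    then show "(\<integral>z. E1 z * Sc (\<phi> z) \<partial>lborel) = (\<integral>z. E2 z * Vec (\<phi> z) \<partial>lborel)"
      "(\<integral>z. E1 z * Vec (\<phi> z) \<partial>lborel) = - (\<integral>z. E2 z * Sc (\<phi> z) \<partial>lborel)"
      using integral_mult_test_zero[OF A(1) locint_measurable[OF lE(1)]] integral_mult_test_zero[OF A(2) locint_measurable[OF lE(2)]] by auto
  qed
  also have "\<dots> \<longleftrightarrow> (AE z in lborel. z \<in> \<Omega> \<longrightarrow> ux z - vy z = 2 * S z \<and> uy z + vx z = 2 * N z)"
    unfolding E1_def E2_def eq_iff_diff_eq_0[symmetric] by (auto simp flip: AE_conj_iff elim: eventually_mono)
  finally show ?thesis .
qed

section \<open>The conjugate function\<close>

text \<open>A bounded function with bounded weak derivatives solves an inhomogeneous Cauchy-Riemann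
  equation with bounded data, hence has a continuous version. Continuity then turns the essential
  bounds on f and 1/f into bounds at every point. Collecting them in one B >= 1 lets powers of B be
  compared later.\<close>

lemma W1_Linf_continuous_rep:
  assumes "open \<Omega>" "f \<in> W1 \<infinity> \<Omega>" "\<forall>z\<in>\<Omega>. f z \<noteq> 0" "(\<lambda>z. 1 / f z) \<in> Lp \<infinity> \<Omega>"
  shows "\<exists>F fx fy B. rep \<Omega> f F \<and> rep \<Omega> (wdx \<Omega> f) fx \<and> rep \<Omega> (wdy \<Omega> f) fy \<and> wd 1 \<Omega> F fx \<and> wd \<i> \<Omega> F fy \<and>
    B \<ge> 1 \<and> (\<forall>z. cmod (F z) \<le> B \<and> cmod (fx z) \<le> B \<and> cmod (fy z) \<le> B \<and> cmod (1 / F z) \<le> B) \<and>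
    continuous_on \<Omega> F \<and> (\<forall>z\<in>\<Omega>. F z \<noteq> 0 \<and> F z = Ck_rep 0 \<Omega> f z)"
proof -
  obtain g gx gy B0 where g: "rep \<Omega> f g" and gxy: "rep \<Omega> (wdx \<Omega> f) gx" "rep \<Omega> (wdy \<Omega> f) gy"
    and w: "wd 1 \<Omega> g gx" "wd \<i> \<Omega> g gy" and b: "\<And>z. cmod (g z) \<le> B0" "\<And>z. cmod (gx z) \<le> B0" "\<And>z. cmod (gy z) \<le> B0"
    using W1_Linf_rep[OF assms(1,2)] by blast
  have "wdz \<Omega> g (\<lambda>z. gx z + \<i> * gy z)" unfolding wdz_def
  proof (intro conjI ballI locint_add locint_cmult wdD(1)[OF w(1)] wdD(2)[OF w(1)] wdD(2)[OF w(2)])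
    fix \<psi> assume \<psi>: "\<psi> \<in> test_fun \<Omega>"
    have "(\<integral>z. g z * dz \<psi> z \<partial>lborel) = (\<integral>z. g z * pd 1 \<psi> z + \<i> * (g z * pd \<i> \<psi> z) \<partial>lborel)"
      by (simp add: dz_def algebra_simps)
    also have "\<dots> = - (\<integral>z. gx z * \<psi> z \<partial>lborel) - \<i> * (\<integral>z. gy z * \<psi> z \<partial>lborel)"
      using wdD(3)[OF w(1) \<psi>] wdD(3)[OF w(2) \<psi>] locint_mult_test[OF wdD(1)[OF w(1)] test_fun_pd[OF \<psi>]] by simp
    also have "\<dots> = - (\<integral>z. gx z * \<psi> z + \<i> * (gy z * \<psi> z) \<partial>lborel)"
      using locint_mult_test[OF wdD(2)[OF w(1)] \<psi>] locint_mult_test[OF wdD(2)[OF w(2)] \<psi>] by simp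
    finally show "(\<integral>z. g z * dz \<psi> z \<partial>lborel) = - (\<integral>z. (gx z + \<i> * gy z) * \<psi> z \<partial>lborel)"
      by (simp add: distrib_right mult.assoc)
  qed
  moreover have "cmod (gx z + \<i> * gy z) \<le> 2 * B0" for z
    by (rule order_trans[OF norm_triangle_ineq]) (use b(2,3)[of z] in \<open>simp add: norm_mult\<close>)
  moreover have "B0 \<ge> 0" using b(1) norm_ge_zero order_trans by blast
  then have "cmod (g z) \<le> 2 * B0" for z using b(1)[of z] by linarith
  ultimately obtain Q where Q: "continuous_on \<Omega> Q" "AE z in lborel. z \<in> \<Omega> \<longrightarrow> Q z = g z"
    using wdz_bounded_continuous[OF assms(1), of g "\<lambda>z. gx z + \<i> * gy z" "2 * B0"] by blast
  \<comment> \<open>F is built from the very representative that occurs in \<open>I_op\<close>, so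
    that the two can be compared pointwise on rays.\<close>
  define Fc where "Fc = Ck_rep 0 \<Omega> f"
  have "AE z in lborel. z \<in> \<Omega> \<longrightarrow> Q z = f z" using Q(2) repD(4)[OF g] by eventually_elim auto
  then have "\<exists>h. Ck_on 0 \<Omega> h \<and> (AE z in lebesgue_on \<Omega>. h z = f z)"
    using Q(1) AE_lebesgue_on_open[OF assms(1)] by auto
  from someI_ex[OF this] have Fc: "continuous_on \<Omega> Fc" "AE z in lborel. z \<in> \<Omega> \<longrightarrow> Fc z = f z"
    unfolding Fc_def Ck_rep_def AE_lebesgue_on_open[OF assms(1)] by auto
  define F where "F z = (if z \<in> \<Omega> then Fc z else 0)" for z
  have cF: "continuous_on \<Omega> F" using Fc(1) by (simp add: F_def cong: continuous_on_cong_simp)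
  have Fb: "F \<in> borel_measurable borel" unfolding F_def[abs_def] by (rule continuous_on_open_borel[OF assms(1) Fc(1)])
  have Fg: "AE z in lborel. z \<in> \<Omega> \<longrightarrow> F z = g z" using Fc(2) repD(4)[OF g] by eventually_elim (auto simp: F_def)
  have Ff: "AE z in lborel. z \<in> \<Omega> \<longrightarrow> F z = f z" using Fc(2) by eventually_elim (auto simp: F_def)
  have rF: "rep \<Omega> f F" by (rule rep_cong[OF g Fb _ Fg]) (simp add: F_def)
  have gF: "AE z in lborel. z \<in> \<Omega> \<longrightarrow> g z = F z" using Fg by eventually_elim auto
  have wF: "wd 1 \<Omega> F gx" "wd \<i> \<Omega> F gy"
    by (rule wd_cong_AE[OF w(1) gF] wd_cong_AE[OF w(2) gF]; use Fb repD(1)[OF gxy(1)] repD(1)[OF gxy(2)] in simp)+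
  obtain C where "AE z in lborel. z \<in> \<Omega> \<longrightarrow> cmod (1 / f z) \<le> C"
    using assms(4) unfolding Lp_def by (auto simp: AE_lebesgue_on_open[OF assms(1)])
  \<comment> \<open>F may differ from f on a null set, so the pointwise hypothesis that f does not
    vanish says nothing about F there. The bound on 1/f, written without division, is continuous in
    F and extends to all of \<Omega>; it excludes zeros of F.\<close>
  with Ff have "AE z in lborel. z \<in> \<Omega> \<longrightarrow> 1 - \<bar>C\<bar> * cmod (F z) \<le> 0"
  proof eventually_elim
    case (elim z)
    show ?case
    proof
      assume z: "z \<in> \<Omega>"
      then have "f z \<noteq> 0" "cmod (1 / f z) \<le> C" "F z = f z" using assms(3) elim by auto
      then have "1 \<le> C * cmod (F z)" by (simp add: norm_divide field_simps)
      then have "1 \<le> \<bar>C\<bar> * cmod (F z)" by (meson abs_ge_self mult_right_mono norm_ge_zero order_trans)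
      then show "1 - \<bar>C\<bar> * cmod (F z) \<le> 0" by simp
    qed
  qed
  then have lb: "1 - \<bar>C\<bar> * cmod (F z) \<le> 0" if "z \<in> \<Omega>" for z
    by (rule cont_AE_le[OF assms(1) _ _ that, rotated]) (intro continuous_intros cF)
  have FB: "cmod (F z) \<le> B0" for z
  proof (cases "z \<in> \<Omega>")
    case True
    show ?thesis
      by (rule cont_AE_le[OF assms(1) _ _ True]) (intro continuous_intros cF, use Fg b(1) in \<open>auto elim: eventually_mono\<close>)
  qed (use \<open>B0 \<ge> 0\<close> in \<open>simp add: F_def\<close>)
  have nz: "F z \<noteq> 0" if "z \<in> \<Omega>" for z using lb[OF that] by auto
  have ib: "cmod (1 / F z) \<le> \<bar>C\<bar>" for z
  proof (cases "z \<in> \<Omega>")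
    case True
    then show ?thesis using lb[OF True] nz[OF True] by (simp add: norm_divide field_simps)
  qed (simp add: F_def)
  show ?thesis
  proof (rule exI[of _ F], rule exI[of _ gx], rule exI[of _ gy], rule exI[of _ "max 1 (max B0 \<bar>C\<bar>)"], intro conjI allI ballI)
    fix z
    show "cmod (F z) \<le> max 1 (max B0 \<bar>C\<bar>)" "cmod (gx z) \<le> max 1 (max B0 \<bar>C\<bar>)" "cmod (gy z) \<le> max 1 (max B0 \<bar>C\<bar>)" "cmod (1 / F z) \<le> max 1 (max B0 \<bar>C\<bar>)"
      using FB[of z] b[of z] ib[of z] by (simp_all only: le_max_iff_disj simp_thms)
  qed (use rF gxy wF cF nz in \<open>auto simp: F_def Fc_def\<close>)
qed

text \<open>Collects the Borel versions of f and of its weak derivatives, with one pointwise bound B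
  for them and for 1/F. F is tied both to f, through \<open>rep\<close>, and to the continuous
  representative used by \<open>I_op\<close>.\<close>

locale vekua_coefficient =
  fixes \<Omega> :: "complex set" and f F fx fy :: "complex \<Rightarrow> complex" and B :: real and p :: ennreal
  assumes op: "open \<Omega>" and p: "1 < p" "p < \<infinity>"
    and rF: "rep \<Omega> f F" and rfxy: "rep \<Omega> (wdx \<Omega> f) fx" "rep \<Omega> (wdy \<Omega> f) fy"
    and wF: "wd 1 \<Omega> F fx" "wd \<i> \<Omega> F fy" and B1: "B \<ge> 1"
    and bF: "cmod (F z) \<le> B" "cmod (fx z) \<le> B" "cmod (fy z) \<le> B" "cmod (1 / F z) \<le> B"
    and cF: "continuous_on \<Omega> F" and nz: "z \<in> \<Omega> \<Longrightarrow> F z \<noteq> 0" and F_rep: "z \<in> \<Omega> \<Longrightarrow> F z = Ck_rep 0 \<Omega> f z"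
begin

abbreviation q where "q \<equiv> enn2real p"

lemma q1: "q > 1"
proof -
  obtain r where r: "p = ennreal r" "r \<ge> 0" using p(2) by (cases p) auto
  have "ennreal 1 < ennreal r" using p(1) r(1) by simp
  then have "1 < r" by (subst (asm) ennreal_less_iff) auto
  then show ?thesis using r by simp
qed

lemma borelF [measurable]: "F \<in> borel_measurable borel" "fx \<in> borel_measurable borel" "fy \<in> borel_measurable borel"
  using repD(1)[OF rF] repD(1)[OF rfxy(1)] repD(1)[OF rfxy(2)] by auto

lemma F0: "z \<notin> \<Omega> \<Longrightarrow> F z = 0" "z \<notin> \<Omega> \<Longrightarrow> fx z = 0" "z \<notin> \<Omega> \<Longrightarrow> fy z = 0"
  using repD(2)[OF rF] repD(2)[OF rfxy(1)] repD(2)[OF rfxy(2)] by auto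

abbreviation T where "T z \<equiv> 1 / F z"
abbreviation Tx where "Tx z \<equiv> - fx z / (F z)\<^sup>2"
abbreviation Ty where "Ty z \<equiv> - fy z / (F z)\<^sup>2"

lemma wT: "wd 1 \<Omega> T Tx" "wd \<i> \<Omega> T Ty"
proof -
  have c: "1 / B \<le> cmod (F z)" if "z \<in> \<Omega>" for z
    using bF(4)[of z] nz[OF that] B1 by (simp add: norm_divide field_simps)
  have c0: "1 / B > 0" using B1 by simp
  show "wd 1 \<Omega> T Tx" "wd \<i> \<Omega> T Ty"
    using wd_reciprocal[OF op wF bF(1-3) cF c0 c F0(1)] by auto
qed

text \<open>The cube arises from the derivative of 1/F, a product of a derivative of F with two
  factors 1/F; the bound for 1/F itself is weakened to the same power because \<open>wd_mult\<close>
  asks for a single constant.\<close>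

lemma bT: "cmod (T z) \<le> B ^ 3" "cmod (Tx z) \<le> B ^ 3" "cmod (Ty z) \<le> B ^ 3"
proof -
  have "B ^ 1 \<le> B ^ 3" by (rule power_increasing) (use B1 in auto)
  then show "cmod (T z) \<le> B ^ 3" using bF(4)[of z] by simp
  have t: "cmod (k * T z * T z) \<le> B ^ 3" if "cmod k \<le> B" for k
    unfolding norm_mult power3_eq_cube by (intro mult_mono that bF) (use B1 in auto)
  show "cmod (Tx z) \<le> B ^ 3" "cmod (Ty z) \<le> B ^ 3"
    using t[of "- fx z"] t[of "- fy z"] bF(2,3)[of z] by (simp_all add: power2_eq_square)
qed

text \<open>The derivative of W and the derivative of f both carry the factor 1/2, so it cancels
  when components are compared. The right-hand sides are the two components of (f_x +
  \<open>\<j>\<close> f_y)(u - \<open>\<j>\<close> v) divided by f.\<close>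

lemma vekua_iff:
  assumes r: "rep \<Omega> u ub" "rep \<Omega> v vb" and wu: "wd 1 \<Omega> ub ux" "wd \<i> \<Omega> ub uy" and wv: "wd 1 \<Omega> vb vx" "wd \<i> \<Omega> vb vy"
    and L: "u \<in> Lp p \<Omega>" "v \<in> Lp p \<Omega>"
  shows "(\<lambda>z. bc (u z) + \<j> * bc (v z)) \<in> vekua_space f p \<Omega> \<longleftrightarrow>
    (AE z in lborel. z \<in> \<Omega> \<longrightarrow> ux z - vy z = T z * (fx z * ub z + fy z * vb z) \<and> uy z + vx z = T z * (fy z * ub z - fx z * vb z))"
proof -
  let ?V = "\<lambda>z. bc (1 / f z) * sobolev_dbar \<Omega> f z * bcnj (bc (u z) + \<j> * bc (v z))"
  define S where "S z = (1/2) * (T z * (fx z * ub z + fy z * vb z))" for z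
  define N where "N z = (1/2) * (T z * (fy z * ub z - fx z * vb z))" for z
  have s: "Sc (?V z) = (1/2) * (1 / f z * (wdx \<Omega> f z * u z + wdy \<Omega> f z * v z))"
    "Vec (?V z) = (1/2) * (1 / f z * (wdy \<Omega> f z * u z - wdx \<Omega> f z * v z))" for z
    by (simp_all add: sobolev_dbar_def algebra_simps)
  have rS: "rep \<Omega> (\<lambda>z. Sc (?V z)) S" unfolding s S_def[abs_def]
    by (intro rep_cmult rep_mult rep_add rep_inverse rF rfxy r)
  have rN: "rep \<Omega> (\<lambda>z. Vec (?V z)) N" unfolding s N_def[abs_def]
    by (intro rep_cmult rep_mult rep_diff rep_inverse rF rfxy r)
  have TB: "(\<lambda>z. T z) \<in> borel_measurable borel" by measurable
  have l: "locint \<Omega> S" "locint \<Omega> N" unfolding S_def[abs_def] N_def[abs_def]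
    by (intro locint_cmult locint_mult_bdd[OF _ TB bF(4)] locint_add locint_diff
        locint_mult_bdd[OF wdD(1)[OF wu(1)] borelF(2) bF(2)] locint_mult_bdd[OF wdD(1)[OF wu(1)] borelF(3) bF(3)]
        locint_mult_bdd[OF wdD(1)[OF wv(1)] borelF(2) bF(2)] locint_mult_bdd[OF wdD(1)[OF wv(1)] borelF(3) bF(3)])+
  have "(\<lambda>z. bc (u z) + \<j> * bc (v z)) \<in> bc_valued (Lp p \<Omega>)" using L by (simp add: bc_valued_def)
  moreover have h: "2 * S z = T z * (fx z * ub z + fy z * vb z)" "2 * N z = T z * (fy z * ub z - fx z * vb z)" for z
    by (simp_all only: S_def N_def mult.assoc[symmetric]) simp_all
  ultimately show ?thesis
    using weak_dbar_iff[OF op r rS rN wu wv l L] unfolding h by (simp add: vekua_space_def)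
qed

text \<open>Applies \<open>sol_gradient_continuous\<close> with \<sigma> = F^2 and \<tau> = 1/F^2,
  the latter obtained by the product rule for two factors 1/F. It follows that the choice in
  \<open>Ck_rep 1\<close> is made from a nonempty set, so the chosen function has the required
  properties.\<close>

lemma Sol_C1_rep:
  assumes U: "U \<in> Sol (\<lambda>z. (f z)\<^sup>2) p \<Omega>"
  shows "Ck_on (Suc 0) \<Omega> (Ck_rep 1 \<Omega> U)" "AE z in lborel. z \<in> \<Omega> \<longrightarrow> Ck_rep 1 \<Omega> U z = U z"
proof -
  have W: "U \<in> W1 p \<Omega>" using U by (simp add: Sol_def)
  have "U \<in> borel_measurable (lebesgue_on \<Omega>)" using W by (simp add: W1_def Lp_def)
  then obtain Ub where rU: "rep \<Omega> U Ub" using rep_ex[OF op] by blast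
  obtain Ux Uy where rUx: "rep \<Omega> (wdx \<Omega> U) Ux" "rep \<Omega> (wdy \<Omega> U) Uy" and wU: "wd 1 \<Omega> Ub Ux" "wd \<i> \<Omega> Ub Uy"
    using W1_Lp_rep[OF op W p rU] by blast
  have rF2: "rep \<Omega> (\<lambda>z. (f z)\<^sup>2) (\<lambda>z. (F z)\<^sup>2)" unfolding power2_eq_square by (intro rep_mult rF)
  have sol: "(\<integral>z. (F z)\<^sup>2 * (Ux z * pd 1 \<phi> z + Uy z * pd \<i> \<phi> z) \<partial>lborel) = 0" if \<phi>: "\<phi> \<in> test_fun \<Omega>" for \<phi>
  proof -
    have "(\<integral>z. (f z)\<^sup>2 * (wdx \<Omega> U z * pd 1 \<phi> z + wdy \<Omega> U z * pd \<i> \<phi> z) \<partial>lebesgue_on \<Omega>) = (\<integral>z. (F z)\<^sup>2 * (Ux z * pd 1 \<phi> z + Uy z * pd \<i> \<phi> z) \<partial>lborel)"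
      by (intro rep_integral(1)[OF op] rep_mult[OF rF2] rep_add rep_mult_test rUx test_fun_pd \<phi>)
    then show ?thesis using U \<phi> by (simp add: Sol_def pdx_eq_pd pdy_eq_pd)
  qed
  \<comment> \<open>Each derivative of T^2 is a sum of two products, whose factors are bounded by
    B^3 each.\<close>
  define C where "C = 2 * B ^ 6"
  have B6: "B ^ 2 \<le> B ^ 6" "0 \<le> B ^ 6" using B1 by (auto intro: power_increasing)
  have T3: "cmod (a * b) \<le> B ^ 6" if "cmod a \<le> B ^ 3" "cmod b \<le> B ^ 3" for a b :: complex
  proof -
    have "cmod a * cmod b \<le> B ^ 3 * B ^ 3" by (intro mult_mono that) (use B1 in auto)
    then show ?thesis by (simp add: norm_mult power_add[symmetric])
  qed
  have "\<exists>P Q. continuous_on \<Omega> P \<and> continuous_on \<Omega> Q \<and>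
    (AE z in lborel. z \<in> \<Omega> \<longrightarrow> P z = Ux z) \<and> (AE z in lborel. z \<in> \<Omega> \<longrightarrow> Q z = Uy z)"
  proof (rule sol_gradient_continuous[OF op _ _ _ _ _ _ _ _ wU sol, where B = C])
    show "(\<lambda>z. (F z)\<^sup>2) \<in> borel_measurable borel" by measurable
    show "wd 1 \<Omega> (\<lambda>z. T z * T z) (\<lambda>z. Tx z * T z + T z * Tx z)"
      by (rule wd_mult[OF op wT bT wT(1)]) auto
    show "wd \<i> \<Omega> (\<lambda>z. T z * T z) (\<lambda>z. Ty z * T z + T z * Ty z)"
      by (rule wd_mult[OF op wT bT wT(2)]) auto
    fix z
    have "cmod ((F z)\<^sup>2) \<le> B\<^sup>2" unfolding norm_power by (rule power_mono[OF bF(1)]) simp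
    then show "cmod ((F z)\<^sup>2) \<le> C" using B6 unfolding C_def by linarith
    show "cmod (T z * T z) \<le> C" using T3[OF bT(1) bT(1), of z z] B6 unfolding C_def by linarith
    show "cmod (Tx z * T z + T z * Tx z) \<le> C" "cmod (Ty z * T z + T z * Ty z) \<le> C"
      using norm_triangle_ineq[of "Tx z * T z" "T z * Tx z"] norm_triangle_ineq[of "Ty z * T z" "T z * Ty z"]
        T3[OF bT(2) bT(1), of z z] T3[OF bT(1) bT(2), of z z] T3[OF bT(3) bT(1), of z z] T3[OF bT(1) bT(3), of z z]
      unfolding C_def by linarith+
    show "z \<in> \<Omega> \<Longrightarrow> (F z)\<^sup>2 * (T z * T z) = 1" using nz[of z] by (simp add: power2_eq_square)
  qed
  then obtain P Q where PQ: "continuous_on \<Omega> P" "continuous_on \<Omega> Q"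
    "AE z in lborel. z \<in> \<Omega> \<longrightarrow> P z = Ux z" "AE z in lborel. z \<in> \<Omega> \<longrightarrow> Q z = Uy z" by blast
  define P' where "P' z = (if z \<in> \<Omega> then P z else 0)" for z
  define Q' where "Q' z = (if z \<in> \<Omega> then Q z else 0)" for z
  have c: "continuous_on \<Omega> P'" "continuous_on \<Omega> Q'"
    unfolding P'_def[abs_def] Q'_def[abs_def] using PQ(1,2) by (simp_all cong: continuous_on_cong_simp)
  have b: "P' \<in> borel_measurable borel" "Q' \<in> borel_measurable borel"
    unfolding P'_def[abs_def] Q'_def[abs_def] by (intro continuous_on_open_borel op PQ)+
  have "wd 1 \<Omega> Ub P'" "wd \<i> \<Omega> Ub Q'"
  proof -
    have "AE z in lborel. z \<in> \<Omega> \<longrightarrow> Ux z = P' z" "AE z in lborel. z \<in> \<Omega> \<longrightarrow> Uy z = Q' z"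
      using PQ(3,4) by (auto simp: P'_def Q'_def elim: eventually_mono)
    then show "wd 1 \<Omega> Ub P'" "wd \<i> \<Omega> Ub Q'"
      using wd_cong_AE[OF wU(1), of Ub P'] wd_cong_AE[OF wU(2), of Ub Q'] b repD(1)[OF rU] by auto
  qed
  from C1_rep[OF op this c] obtain V where
    V: "\<And>z. z \<in> \<Omega> \<Longrightarrow> (V has_derivative (\<lambda>h. of_real (Re h) * P' z + of_real (Im h) * Q' z)) (at z)"
    "AE z in lborel. z \<in> \<Omega> \<longrightarrow> V z = Ub z" by blast
  have "AE z in lborel. z \<in> \<Omega> \<longrightarrow> V z = U z" using V(2) repD(4)[OF rU] by eventually_elim auto
  then have "\<exists>h. Ck_on 1 \<Omega> h \<and> (AE z in lebesgue_on \<Omega>. h z = U z)"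
    using Ck_on_1I(1)[OF V(1) c] AE_lebesgue_on_open[OF op] unfolding One_nat_def by blast
  from someI_ex[OF this] show "Ck_on (Suc 0) \<Omega> (Ck_rep 1 \<Omega> U)" "AE z in lborel. z \<in> \<Omega> \<longrightarrow> Ck_rep 1 \<Omega> U z = U z"
    unfolding Ck_rep_def AE_lebesgue_on_open[OF op] by (simp_all del: Ck_on.simps)
qed

text \<open>Everything later steps need about the potential V: its gradient is F^2 times the rotated
  gradient of U, and V and that gradient are integrable to the power q. The potential itself comes
  from \<open>star_poincare\<close>, its integrability from \<open>ray_potential_Lp\<close>.\<close>

lemma conjugate_data:
  assumes bd: "bounded \<Omega>" and star: "star_shaped0 \<Omega>" and u: "u \<in> Sol_hat f p \<Omega>"
  shows "\<exists>U px py V. rep \<Omega> (\<lambda>z. u z / f z) U \<and> wd 1 \<Omega> U px \<and> wd \<i> \<Omega> U py \<and>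
    (\<forall>z. z \<notin> \<Omega> \<longrightarrow> px z = 0 \<and> py z = 0) \<and> rep \<Omega> (I_op \<Omega> f u) V \<and>
    wd 1 \<Omega> V (\<lambda>z. - ((F z)\<^sup>2 * py z)) \<and> wd \<i> \<Omega> V (\<lambda>z. (F z)\<^sup>2 * px z) \<and>
    integrable lborel (\<lambda>z. cmod (V z) powr q) \<and>
    integrable lborel (\<lambda>z. cmod ((F z)\<^sup>2 * px z) powr q) \<and> integrable lborel (\<lambda>z. cmod (- ((F z)\<^sup>2 * py z)) powr q)"
proof -
  define U0 where "U0 z = u z / f z" for z
  define Uc where "Uc = Ck_rep 1 \<Omega> U0"
  have S: "U0 \<in> Sol (\<lambda>z. (f z)\<^sup>2) p \<Omega>" using u by (simp add: Sol_hat_def U0_def[abs_def])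
  note Uc = Sol_C1_rep[OF S, folded Uc_def]
  have cp: "continuous_on \<Omega> Uc" "continuous_on \<Omega> (pd 1 Uc)" "continuous_on \<Omega> (pd \<i> Uc)"
    using Ck_on_imp_continuous[OF Uc(1)] Uc(1) unfolding Ck_Suc by auto
  define U where "U z = (if z \<in> \<Omega> then Uc z else 0)" for z
  define px where "px z = (if z \<in> \<Omega> then pd 1 Uc z else 0)" for z
  define py where "py z = (if z \<in> \<Omega> then pd \<i> Uc z else 0)" for z
  have wU: "wd 1 \<Omega> U px" "wd \<i> \<Omega> U py"
    using C1_wd_patch[OF op Uc(1), of 1] C1_wd_patch[OF op Uc(1), of \<i>] unfolding U_def[abs_def] px_def[abs_def] py_def[abs_def] by auto
  have c: "continuous_on \<Omega> px" "continuous_on \<Omega> py"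
    unfolding px_def[abs_def] py_def[abs_def] using cp by (simp_all cong: continuous_on_cong_simp)
  have b [measurable]: "U \<in> borel_measurable borel" "px \<in> borel_measurable borel" "py \<in> borel_measurable borel"
    unfolding U_def[abs_def] px_def[abs_def] py_def[abs_def] by (intro continuous_on_open_borel op cp)+
  have z: "px z = 0" "py z = 0" if "z \<notin> \<Omega>" for z using that by (auto simp: px_def py_def)
  have W: "U0 \<in> W1 p \<Omega>" using S by (simp add: Sol_def)
  have m: "U0 \<in> borel_measurable (lebesgue_on \<Omega>)" using W by (simp add: W1_def Lp_def)
  have rU: "rep \<Omega> U0 U" unfolding rep_def
  proof (intro conjI allI impI b m)
    show "AE z in lborel. z \<in> \<Omega> \<longrightarrow> U z = U0 z" using Uc(2) by eventually_elim (simp add: U_def)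
  qed (simp add: U_def)
  obtain gx gy where g: "rep \<Omega> (wdx \<Omega> U0) gx" "rep \<Omega> (wdy \<Omega> U0) gy" "wd 1 \<Omega> U gx" "wd \<i> \<Omega> U gy"
    "integrable lborel (\<lambda>z. cmod (gx z) powr q)" "integrable lborel (\<lambda>z. cmod (gy z) powr q)"
    using W1_Lp_rep[OF op W p rU] by blast
  have ae: "AE z in lborel. z \<in> \<Omega> \<longrightarrow> gx z = px z" "AE z in lborel. z \<in> \<Omega> \<longrightarrow> gy z = py z"
    using wd_unique[OF op g(3) wU(1)] wd_unique[OF op g(4) wU(2)] .
  have rp: "rep \<Omega> (wdx \<Omega> U0) px" "rep \<Omega> (wdy \<Omega> U0) py"
    by (rule rep_cong[OF g(1) b(2) z(1)] rep_cong[OF g(2) b(3) z(2)]; use ae in \<open>auto elim: eventually_mono\<close>)+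
  have Lp: "integrable lborel (\<lambda>z. cmod (px z) powr q)" "integrable lborel (\<lambda>z. cmod (py z) powr q)"
    using Lq_cong[OF g(5) repD(1)[OF g(1)] b(2) repD(2)[OF g(1)] z(1) ae(1)] Lq_cong[OF g(6) repD(1)[OF g(2)] b(3) repD(2)[OF g(2)] z(2) ae(2)] by auto
  define P where "P z = - ((F z)\<^sup>2 * py z)" for z
  define Q where "Q z = (F z)\<^sup>2 * px z" for z
  have F2: "cmod ((F z)\<^sup>2) \<le> B\<^sup>2" "cmod (- (F z)\<^sup>2) \<le> B\<^sup>2" for z unfolding norm_minus_cancel norm_power by (rule power_mono[OF bF(1)]; simp)+
  have LPQ: "integrable lborel (\<lambda>z. cmod (P z) powr q)" "integrable lborel (\<lambda>z. cmod (Q z) powr q)"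
    using Lq_mult_bdd[OF Lp(2) b(3) _ _ F2(2)] Lq_mult_bdd[OF Lp(1) b(2) _ _ F2(1)] q1 by (simp_all add: P_def Q_def)
  have cPQ: "continuous_on \<Omega> P" "continuous_on \<Omega> Q"
    unfolding P_def[abs_def] Q_def[abs_def] by (intro continuous_intros cF c)+
  have bPQ [measurable]: "P \<in> borel_measurable borel" "Q \<in> borel_measurable borel"
    unfolding P_def[abs_def] Q_def[abs_def] by measurable
  have lPQ: "locint \<Omega> P" "locint \<Omega> Q" by (intro locint_continuous cPQ bPQ)+
  have rF2: "rep \<Omega> (\<lambda>z. (f z)\<^sup>2) (\<lambda>z. (F z)\<^sup>2)" unfolding power2_eq_square by (intro rep_mult rF)
  \<comment> \<open>Weak closedness of the rotated field is the weak conductivity equation for U,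
    term by term.\<close>
  have closed: "(\<integral>z. P z * pd \<i> \<phi> z \<partial>lborel) = (\<integral>z. Q z * pd 1 \<phi> z \<partial>lborel)" if \<phi>: "\<phi> \<in> test_fun \<Omega>" for \<phi>
  proof -
    have "(\<integral>z. (f z)\<^sup>2 * (wdx \<Omega> U0 z * pd 1 \<phi> z + wdy \<Omega> U0 z * pd \<i> \<phi> z) \<partial>lebesgue_on \<Omega>) = (\<integral>z. (F z)\<^sup>2 * (px z * pd 1 \<phi> z + py z * pd \<i> \<phi> z) \<partial>lborel)"
      by (intro rep_integral(1)[OF op] rep_mult[OF rF2] rep_add rep_mult_test rp test_fun_pd \<phi>)
    then have "(\<integral>z. (F z)\<^sup>2 * (px z * pd 1 \<phi> z + py z * pd \<i> \<phi> z) \<partial>lborel) = 0" using S \<phi> by (simp add: Sol_def pdx_eq_pd pdy_eq_pd)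
    also have "(\<integral>z. (F z)\<^sup>2 * (px z * pd 1 \<phi> z + py z * pd \<i> \<phi> z) \<partial>lborel) = (\<integral>z. Q z * pd 1 \<phi> z - P z * pd \<i> \<phi> z \<partial>lborel)"
      by (simp add: P_def Q_def algebra_simps)
    also have "\<dots> = (\<integral>z. Q z * pd 1 \<phi> z \<partial>lborel) - (\<integral>z. P z * pd \<i> \<phi> z \<partial>lborel)"
      using locint_mult_test[OF lPQ(1) test_fun_pd[OF \<phi>]] locint_mult_test[OF lPQ(2) test_fun_pd[OF \<phi>]] by simp
    finally show ?thesis by simp
  qed
  note der = star_poincare[OF op star cPQ lPQ closed]
  note R = Ck_on_1I[OF der cPQ]
  \<comment> \<open>The whole segment lies in \<Omega>, where F and the chosen representatives
    coincide, so the integrands are equal at every point and not only almost everywhere.\<close>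
  have I: "I_op \<Omega> f u z = ray_potential P Q z" if zO: "z \<in> \<Omega>" for z
    unfolding I_op_explicit ray_potential_def
  proof (rule integral_cong)
    fix t :: real assume "t \<in> {0..1}"
    then have "complex_of_real t * z \<in> \<Omega>" using star zO by (auto simp: star_shaped0_def)
    then show "(Ck_rep 0 \<Omega> f (complex_of_real t * z))\<^sup>2 *
       (complex_of_real (Im z) * pdx (Ck_rep 1 \<Omega> (\<lambda>w. u w / f w)) (complex_of_real t * z) -
        complex_of_real (Re z) * pdy (Ck_rep 1 \<Omega> (\<lambda>w. u w / f w)) (complex_of_real t * z)) =
       of_real (Re z) * P (of_real t * z) + of_real (Im z) * Q (of_real t * z)"
      by (simp add: P_def Q_def px_def py_def F_rep pdx_eq_pd pdy_eq_pd Uc_def U0_def[abs_def] algebra_simps)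
  qed
  define V where "V z = (if z \<in> \<Omega> then ray_potential P Q z else 0)" for z
  have cR: "continuous_on \<Omega> (ray_potential P Q)" by (rule Ck_on_imp_continuous[OF R(1)])
  have rV: "rep \<Omega> (I_op \<Omega> f u) V"
    unfolding V_def[abs_def] by (rule rep_cong_fun[OF rep_continuous[OF op cR] I])
  have zPQ: "P z = 0" "Q z = 0" if "z \<notin> \<Omega>" for z using z[OF that] by (simp_all add: P_def Q_def)
  have e: "(\<lambda>z. if z \<in> \<Omega> then pd 1 (ray_potential P Q) z else 0) = P" "(\<lambda>z. if z \<in> \<Omega> then pd \<i> (ray_potential P Q) z else 0) = Q"
    using R(2,3) zPQ by auto
  have wV: "wd 1 \<Omega> V P" "wd \<i> \<Omega> V Q"
    using C1_wd_patch[OF op R(1), of 1] C1_wd_patch[OF op R(1), of \<i>] unfolding V_def[abs_def] e by auto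
  have LV: "integrable lborel (\<lambda>z. cmod (V z) powr q)"
    by (rule ray_potential_Lp[OF op bd star _ cPQ bPQ LPQ repD(1)[OF rV]]) (use q1 in \<open>auto simp: V_def\<close>)
  show ?thesis
    using rU wU z rV wV LV LPQ unfolding U0_def[abs_def] P_def[abs_def] Q_def[abs_def] by blast
qed

text \<open>Dividing the gradient of V by F^2 leaves the rotated gradient of U, which is
  divergence-free because the gradient of U is curl-free.\<close>

lemma conjugate_in_Sol_hat:
  assumes rV: "rep \<Omega> I V" and U: "wd 1 \<Omega> U px" "wd \<i> \<Omega> U py"
    and z: "\<And>z. z \<notin> \<Omega> \<Longrightarrow> px z = 0" "\<And>z. z \<notin> \<Omega> \<Longrightarrow> py z = 0"
    and wV: "wd 1 \<Omega> V (\<lambda>z. - ((F z)\<^sup>2 * py z))" "wd \<i> \<Omega> V (\<lambda>z. (F z)\<^sup>2 * px z)"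
    and L: "integrable lborel (\<lambda>z. cmod (V z) powr q)"
      "integrable lborel (\<lambda>z. cmod ((F z)\<^sup>2 * px z) powr q)" "integrable lborel (\<lambda>z. cmod (- ((F z)\<^sup>2 * py z)) powr q)"
    and f0: "\<forall>z\<in>\<Omega>. f z \<noteq> 0"
  shows "(\<lambda>z. 1 / f z * I z) \<in> Sol_hat (\<lambda>z. 1 / f z) p \<Omega>"
proof -
  have [measurable]: "V \<in> borel_measurable borel" "px \<in> borel_measurable borel" "py \<in> borel_measurable borel"
    using repD(1)[OF rV] locint_measurable[OF wdD(2)[OF U(1)]] locint_measurable[OF wdD(2)[OF U(2)]] by auto
  let ?P = "\<lambda>z. - ((F z)\<^sup>2 * py z)" and ?Q = "\<lambda>z. (F z)\<^sup>2 * px z"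
  have P [measurable]: "?P \<in> borel_measurable borel" "?Q \<in> borel_measurable borel" by measurable
  have q0: "q \<ge> 0" using q1 by simp
  have rv: "rep \<Omega> (\<lambda>z. 1 / f z * I z) (\<lambda>z. T z * V z)" by (intro rep_mult rep_inverse rF rV)
  have wv: "wd 1 \<Omega> (\<lambda>z. T z * V z) (\<lambda>z. Tx z * V z + T z * ?P z)" "wd \<i> \<Omega> (\<lambda>z. T z * V z) (\<lambda>z. Ty z * V z + T z * ?Q z)"
    by (rule wd_mult[OF op wT bT wV(1)] wd_mult[OF op wT bT wV(2)]; simp)+
  have "(\<lambda>z. 1 / f z * I z) \<in> W1 p \<Omega>"
  proof (rule W1I[OF op rv p wv])
    show "integrable lborel (\<lambda>z. cmod (T z * V z) powr q)" by (rule Lq_mult_bdd[OF L(1) _ _ q0 bT(1)]) measurable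
    show "integrable lborel (\<lambda>z. cmod (Tx z * V z + T z * ?P z) powr q)"
      by (rule Lq_add[OF Lq_mult_bdd[OF L(1) _ _ q0 bT(2)] Lq_mult_bdd[OF L(3) _ _ q0 bT(1)] _ _ q0]) measurable
    show "integrable lborel (\<lambda>z. cmod (Ty z * V z + T z * ?Q z) powr q)"
      by (rule Lq_add[OF Lq_mult_bdd[OF L(1) _ _ q0 bT(3)] Lq_mult_bdd[OF L(2) _ _ q0 bT(1)] _ _ q0]) measurable
  qed (auto simp: F0)
  moreover
  \<comment> \<open>This is the quotient that \<open>Sol_hat\<close> forms for the index 1/f; on
    \<Omega> it equals I because f does not vanish there.\<close>
  define H where "H z = 1 / f z * I z / (1 / f z)" for z
  have rH: "rep \<Omega> H V" by (rule rep_cong_fun[OF rV]) (use f0 in \<open>simp add: H_def\<close>)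
  have WH: "H \<in> W1 p \<Omega>" by (rule W1I[OF op rH p wV _ _ L(1,3,2)]) (simp_all add: F0)
  obtain gx gy where g: "rep \<Omega> (wdx \<Omega> H) gx" "rep \<Omega> (wdy \<Omega> H) gy" "wd 1 \<Omega> V gx" "wd \<i> \<Omega> V gy"
    using W1_Lp_rep[OF op WH p rH] by blast
  have rP: "rep \<Omega> (wdx \<Omega> H) ?P"
    by (rule rep_cong[OF g(1) P(1) _ wd_unique[OF op wV(1) g(3)]]) (simp add: F0)
  have rQ: "rep \<Omega> (wdy \<Omega> H) ?Q"
    by (rule rep_cong[OF g(2) P(2) _ wd_unique[OF op wV(2) g(4)]]) (simp add: F0)
  have "(\<integral>z. (1 / f z)\<^sup>2 * (wdx \<Omega> H z * pdx \<phi> z + wdy \<Omega> H z * pdy \<phi> z) \<partial>lebesgue_on \<Omega>) = 0" if \<phi>: "\<phi> \<in> test_fun \<Omega>" for \<phi>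
  proof -
    have "(\<integral>z. (1 / f z * (1 / f z)) * (wdx \<Omega> H z * pd 1 \<phi> z + wdy \<Omega> H z * pd \<i> \<phi> z) \<partial>lebesgue_on \<Omega>) = (\<integral>z. (T z * T z) * (?P z * pd 1 \<phi> z + ?Q z * pd \<i> \<phi> z) \<partial>lborel)"
      by (intro rep_integral(1)[OF op] rep_mult rep_inverse rF rep_add rep_mult_test rP rQ test_fun_pd \<phi>)
    also have "\<dots> = (\<integral>z. px z * pd \<i> \<phi> z - py z * pd 1 \<phi> z \<partial>lborel)"
    proof (intro Bochner_Integration.integral_cong refl)
      fix w show "T w * T w * (?P w * pd 1 \<phi> w + ?Q w * pd \<i> \<phi> w) = px w * pd \<i> \<phi> w - py w * pd 1 \<phi> w"
        using nz[of w] z[of w] by (cases "w \<in> \<Omega>") (simp_all add: field_simps power2_eq_square)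
    qed
    also have "\<dots> = (\<integral>z. px z * pd \<i> \<phi> z \<partial>lborel) - (\<integral>z. py z * pd 1 \<phi> z \<partial>lborel)"
      using locint_mult_test[OF wdD(2)[OF U(1)] test_fun_pd[OF \<phi>]] locint_mult_test[OF wdD(2)[OF U(2)] test_fun_pd[OF \<phi>]] by simp
    also have "\<dots> = 0" using wd_mixed[OF U \<phi>] by simp
    finally show ?thesis by (simp only: pdx_eq_pd pdy_eq_pd power2_eq_square)
  qed
  ultimately show ?thesis using WH by (simp add: Sol_hat_def Sol_def H_def[abs_def])
qed

text \<open>For the second claim, subtracting the Vekua equations of two candidates cancels all
  terms in u. What is left says that F times the gradient of the difference D is minus D times the
  gradient of F, so FD has zero weak gradient.\<close>

lemma conjugate_vekua:
  assumes rU: "rep \<Omega> (\<lambda>z. u z / f z) U" and rV: "rep \<Omega> I V" and U: "wd 1 \<Omega> U px" "wd \<i> \<Omega> U py"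
    and wV: "wd 1 \<Omega> V (\<lambda>z. - ((F z)\<^sup>2 * py z))" "wd \<i> \<Omega> V (\<lambda>z. (F z)\<^sup>2 * px z)"
    and L: "u \<in> Lp p \<Omega>" "(\<lambda>z. 1 / f z * I z) \<in> Lp p \<Omega>"
    and f0: "\<forall>z\<in>\<Omega>. f z \<noteq> 0"
  shows "(\<lambda>z. bc (u z) + \<j> * bc (1 / f z * I z)) \<in> vekua_space f p \<Omega>"
    and "connected \<Omega> \<Longrightarrow> v2 \<in> W1 p \<Omega> \<Longrightarrow> (\<lambda>z. bc (u z) + \<j> * bc (v2 z)) \<in> vekua_space f p \<Omega> \<Longrightarrow>
      \<exists>c. AE z in lebesgue_on \<Omega>. v2 z = 1 / f z * I z + c / f z"
proof -
  have ru: "rep \<Omega> u (\<lambda>z. F z * U z)"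
    by (rule rep_cong_fun[OF rep_mult[OF rF rU]]) (use f0 in simp)
  have wu: "wd 1 \<Omega> (\<lambda>z. F z * U z) (\<lambda>z. fx z * U z + F z * px z)" "wd \<i> \<Omega> (\<lambda>z. F z * U z) (\<lambda>z. fy z * U z + F z * py z)"
    by (rule wd_mult[OF op wF bF(1-3) U(1)] wd_mult[OF op wF bF(1-3) U(2)]; simp)+
  have rv: "rep \<Omega> (\<lambda>z. 1 / f z * I z) (\<lambda>z. T z * V z)" by (intro rep_mult rep_inverse rF rV)
  define vx where "vx z = Tx z * V z + T z * - ((F z)\<^sup>2 * py z)" for z
  define vy where "vy z = Ty z * V z + T z * ((F z)\<^sup>2 * px z)" for z
  have wv: "wd 1 \<Omega> (\<lambda>z. T z * V z) vx" "wd \<i> \<Omega> (\<lambda>z. T z * V z) vy"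
    unfolding vx_def[abs_def] vy_def[abs_def]
    by (rule wd_mult[OF op wT bT wV(1)] wd_mult[OF op wT bT wV(2)]; simp)+
  \<comment> \<open>In the product rules for FU and V/F the terms with the gradient of U cancel,
    since F^2 from the gradient of V meets the factor 1/F; only terms with derivatives of F
    survive.\<close>
  have eq: "fx z * U z + F z * px z - vy z = T z * (fx z * (F z * U z) + fy z * (T z * V z))"
    "fy z * U z + F z * py z + vx z = T z * (fy z * (F z * U z) - fx z * (T z * V z))" if "z \<in> \<Omega>" for z
    using nz[OF that] by (simp_all add: vx_def vy_def field_simps power2_eq_square)
  show "(\<lambda>z. bc (u z) + \<j> * bc (1 / f z * I z)) \<in> vekua_space f p \<Omega>"
    unfolding vekua_iff[OF ru rv wu wv L] using eq by (intro AE_I2) auto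
  assume con: "connected \<Omega>" and W2: "v2 \<in> W1 p \<Omega>" and vek: "(\<lambda>z. bc (u z) + \<j> * bc (v2 z)) \<in> vekua_space f p \<Omega>"
  have L2: "v2 \<in> Lp p \<Omega>" using W2 by (simp add: W1_def)
  then have "v2 \<in> borel_measurable (lebesgue_on \<Omega>)" by (simp add: Lp_def)
  then obtain w where rw: "rep \<Omega> v2 w" using rep_ex[OF op] by blast
  obtain wx wy where ww: "wd 1 \<Omega> w wx" "wd \<i> \<Omega> w wy" using W1_Lp_rep[OF op W2 p rw] by blast
  define D where "D z = w z - T z * V z" for z
  have wD: "wd 1 \<Omega> D (\<lambda>z. wx z - vx z)" "wd \<i> \<Omega> D (\<lambda>z. wy z - vy z)"
    unfolding D_def[abs_def] by (intro wd_diff ww wv)+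
  have FD: "wd 1 \<Omega> (\<lambda>z. F z * D z) (\<lambda>z. fx z * D z + F z * (wx z - vx z))" "wd \<i> \<Omega> (\<lambda>z. F z * D z) (\<lambda>z. fy z * D z + F z * (wy z - vy z))"
    by (rule wd_mult[OF op wF bF(1-3) wD(1)] wd_mult[OF op wF bF(1-3) wD(2)]; simp)+
  have "AE z in lborel. z \<in> \<Omega> \<longrightarrow> fx z * U z + F z * px z - wy z = T z * (fx z * (F z * U z) + fy z * w z) \<and>
      fy z * U z + F z * py z + wx z = T z * (fy z * (F z * U z) - fx z * w z)"
    using vek unfolding vekua_iff[OF ru rw wu ww L(1) L2] .
  note vek = this
  \<comment> \<open>Subtraction of the equations, stated for plain complex numbers: A and X stand
    for the terms in u that both candidates share.\<close>
  have g1: "wy - vy = t * b * (y - w)" if h: "A - vy = t * (X + b * y)" "A - wy = t * (X + b * w)"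
    for A X b t y w vy wy :: complex
  proof -
    have "wy - vy = (A - vy) - (A - wy)" by simp
    also have "\<dots> = t * b * (y - w)" unfolding h by (simp add: algebra_simps)
    finally show ?thesis .
  qed
  have g2: "wx - vx = t * b * (y - w)" if h: "A + vx = t * (X - b * y)" "A + wx = t * (X - b * w)"
    for A X b t y w vx wx :: complex
  proof -
    have "wx - vx = (A + wx) - (A + vx)" by simp
    also have "\<dots> = t * b * (y - w)" unfolding h by (simp add: algebra_simps)
    finally show ?thesis .
  qed
  from vek have "AE z in lborel. z \<in> \<Omega> \<longrightarrow> fx z * D z + F z * (wx z - vx z) = 0 \<and> fy z * D z + F z * (wy z - vy z) = 0"
  proof eventually_elim
    case (elim z)
    show ?case
    proof
      assume z: "z \<in> \<Omega>"
      with elim have e: "fx z * U z + F z * px z - wy z = T z * (fx z * (F z * U z) + fy z * w z)"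
        "fy z * U z + F z * py z + wx z = T z * (fy z * (F z * U z) - fx z * w z)" by auto
      note d = g1[OF eq(1)[OF z] e(1)] g2[OF eq(2)[OF z] e(2)]
      show "fx z * D z + F z * (wx z - vx z) = 0 \<and> fy z * D z + F z * (wy z - vy z) = 0"
        unfolding d D_def using nz[OF z] by (simp add: field_simps)
    qed
  qed
  then have z: "AE z in lborel. z \<in> \<Omega> \<longrightarrow> fx z * D z + F z * (wx z - vx z) = 0" "AE z in lborel. z \<in> \<Omega> \<longrightarrow> fy z * D z + F z * (wy z - vy z) = 0"
    by (auto elim: eventually_mono)
  have "wd 1 \<Omega> (\<lambda>z. F z * D z) (\<lambda>z. 0)" "wd \<i> \<Omega> (\<lambda>z. F z * D z) (\<lambda>z. 0)"
    by (rule wd_cong_AE[OF FD(1) _ z(1)] wd_cong_AE[OF FD(2) _ z(2)]; use locint_measurable[OF wdD(1)[OF FD(1)]] in simp)+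
  from wd_zero_const[OF op con this] obtain c where c: "AE z in lborel. z \<in> \<Omega> \<longrightarrow> F z * D z = c" by blast
  have "AE z in lborel. z \<in> \<Omega> \<longrightarrow> v2 z = 1 / f z * I z + c / f z"
    using c repD(4)[OF rw] repD(4)[OF rV] repD(4)[OF rF]
  proof eventually_elim
    case (elim z)
    show ?case
    proof
      assume z: "z \<in> \<Omega>"
      have "f z * (v2 z - 1 / f z * I z) = c" and nz: "f z \<noteq> 0" using elim z f0 by (auto simp: D_def)
      then have "v2 z - 1 / f z * I z = c / f z" by (metis nonzero_mult_div_cancel_left)
      then show "v2 z = 1 / f z * I z + c / f z" by (metis add.commute diff_add_cancel)
    qed
  qed
  then show "\<exists>c. AE z in lebesgue_on \<Omega>. v2 z = 1 / f z * I z + c / f z"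
    unfolding AE_lebesgue_on_open[OF op] by blast
qed

end

theorem theorem44:
  fixes \<Omega> :: "complex set" and p :: ennreal and f u :: "complex \<Rightarrow> complex"
  assumes "open \<Omega>" and "connected \<Omega>" and "bounded \<Omega>" and "star_shaped0 \<Omega>"
    and "1 < p" and "p < \<infinity>"
    and "f \<in> W1 \<infinity> \<Omega>" and "\<forall>z\<in>\<Omega>. f z \<noteq> 0" and "(\<lambda>z. 1 / f z) \<in> Lp \<infinity> \<Omega>"
    and "u \<in> Sol_hat f p \<Omega>"
  shows "(\<lambda>z. 1 / f z * I_op \<Omega> f u z) \<in> Sol_hat (\<lambda>z. 1 / f z) p \<Omega>
    \<and> (\<lambda>z. bc (u z) + \<j> * bc (1 / f z * I_op \<Omega> f u z)) \<in> vekua_space f p \<Omega> \<inter> bc_valued (W1 p \<Omega>)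
    \<and> (\<forall>v\<^sub>2 \<in> W1 p \<Omega>.
         (\<lambda>z. bc (u z) + \<j> * bc (v\<^sub>2 z)) \<in> vekua_space f p \<Omega> \<inter> bc_valued (W1 p \<Omega>) \<longrightarrow>
         (\<exists>c. AE z in lebesgue_on \<Omega>. v\<^sub>2 z = 1 / f z * I_op \<Omega> f u z + c / f z))"
proof -
  obtain F fx fy B where F: "vekua_coefficient \<Omega> f F fx fy B p"
    using W1_Linf_continuous_rep[OF assms(1,7-9)] assms(1,5,6) unfolding vekua_coefficient_def by blast
  interpret vekua_coefficient \<Omega> f F fx fy B p by (rule F)
  obtain U px py V where U: "rep \<Omega> (\<lambda>z. u z / f z) U" "wd 1 \<Omega> U px" "wd \<i> \<Omega> U py"
    "\<And>z. z \<notin> \<Omega> \<Longrightarrow> px z = 0" "\<And>z. z \<notin> \<Omega> \<Longrightarrow> py z = 0"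
    and V: "rep \<Omega> (I_op \<Omega> f u) V" "wd 1 \<Omega> V (\<lambda>z. - ((F z)\<^sup>2 * py z))" "wd \<i> \<Omega> V (\<lambda>z. (F z)\<^sup>2 * px z)"
      "integrable lborel (\<lambda>z. cmod (V z) powr q)" "integrable lborel (\<lambda>z. cmod ((F z)\<^sup>2 * px z) powr q)"
      "integrable lborel (\<lambda>z. cmod (- ((F z)\<^sup>2 * py z)) powr q)"
    using conjugate_data[OF assms(3,4,10)] by blast
  have v: "(\<lambda>z. 1 / f z * I_op \<Omega> f u z) \<in> Sol_hat (\<lambda>z. 1 / f z) p \<Omega>"
    by (rule conjugate_in_Sol_hat[OF V(1) U(2-5) V(2-6) assms(8)])
  then have vW: "(\<lambda>z. 1 / f z * I_op \<Omega> f u z) \<in> W1 p \<Omega>" by (simp add: Sol_hat_def)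
  have uW: "u \<in> W1 p \<Omega>" using assms(10) by (simp add: Sol_hat_def)
  have L: "u \<in> Lp p \<Omega>" "(\<lambda>z. 1 / f z * I_op \<Omega> f u z) \<in> Lp p \<Omega>" using uW vW by (auto simp: W1_def)
  note vek = conjugate_vekua[OF U(1) V(1) U(2,3) V(2,3) L assms(8)]
  have "(\<lambda>z. bc (u z) + \<j> * bc (1 / f z * I_op \<Omega> f u z)) \<in> bc_valued (W1 p \<Omega>)"
    using uW vW by (simp add: bc_valued_def)
  then show ?thesis using v vek(1) vek(2)[OF assms(2)] by blast
qed

end
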